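(* Let $F$ be a field of characteristic different from two, and let $(V',b')$ be a non-degenerate $F$-bilinear space of dimension four. Then the algebra with anti-automorphism $(\mathscr{L}(V'),\sigma_{b'})$ is decomposable if and only if $(V',b')$ has a decomposable asymmetry and $\det(b')$ is trivial in $F^\times/F^{\times 2}$.
   Context: All vector spaces and algebras are finite-dimensional over $F$. An $F$-bilinear space $(V,b)$ is an $F$-vector space $V$ with an $F$-bilinear form $b:V\times V\to F$ (no symmetry assumed). $\mathscr{L}(V)$ is the $F$-algebra of endomorphisms of $V$. If $b$ is non-degenerate, $\sigma_b$ is the $F$-linear anti-automorphism of $\mathscr{L}(V)$ defined by $b(f(x),y)=b(x,\sigma_b(f)(y))$ for all $x,y\in V$, $f\in\mathscr{L}(V)$. The asymmetry of $b$ is the unique endomorphism $a_b$ of $V$ with $b(x,y)=b(y,a_b(x))$ for all $x,y\in V$. $\det(b)\in F^\times/F^{\times 2}$ is the square class of the determinant of a matrix of $b$. A bilinear space $(V,b)$ is decomposable if $(V,b)\simeq (V_1,\varphi_1)\otimes_F(V_2,\varphi_2)$ for some $F$-bilinear spaces with $\dim_F(V_i)\geq 2$, $i=1,2$. A non-degenerate bilinear space $(V',b')$ has a decomposable asymmetry if there is a decomposable (non-degenerate) $F$-bilinear space $(V,b)$ such that $a_{b'}$ and $a_b$ are conjugate, i.e. $a_{b'}=fa_bf^{-1}$ for some linear isomorphism $f:V\to V'$. A central simple $F$-algebra with $F$-linear anti-automorphism $(A,\sigma)$ is decomposable if there exist central simple $F$-algebras with $F$-linear anti-automorphisms $(A_1,\sigma_1)$,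 $(A_2,\sigma_2)$ with $\deg(A_i)\geq 2$, such that $(A,\sigma)\simeq (A_1,\sigma_1)\otimes_F(A_2,\sigma_2)$ (isomorphism of algebras compatible with the anti-automorphisms). *)

theory Defs
  imports
    "Jordan_Normal_Form.VS_Connect"
    "HOL-Library.Poly_Mapping"
    "HOL-Algebra.QuotRing"
begin

text \<open>
  The base field is a type \<open>'a :: field\<close>, seen as the ring record \<^term>\<open>class_ring\<close>. Vector spaces
  are HOL-Algebra module records over it. Algebras use the same record type, its
  \<open>mult\<close> and \<open>one\<close> fields being the multiplication and the unit; for mere vector spaces these two
  fields are never used.
\<close>


section \<open>Tensor products of vector spaces\<close>

definition free_space :: "'b set \<Rightarrow> ('a :: field, 'b \<Rightarrow>\<^sub>0 'a) module" where
  "free_space S = \<lparr>carrier = {z. Poly_Mapping.keys z \<subseteq> S}, mult = undefined, one = undefined,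
     zero = 0, add = (+), smult = (\<lambda>c. Poly_Mapping.map ((*) c))\<rparr>"

definition quotient_space :: "('a, 'b) module \<Rightarrow> 'b set \<Rightarrow> ('a, 'b set) module" where
  "quotient_space V N = \<lparr>carrier = a_rcosets\<^bsub>V\<^esub> N, mult = undefined, one = undefined,
     zero = N, add = set_add V, smult = (\<lambda>c X. \<Union>x\<in>X. N +>\<^bsub>V\<^esub> (c \<odot>\<^bsub>V\<^esub> x))\<rparr>"

text \<open>
  The usual construction: \<open>V \<otimes> W\<close> is the vector space freely generated by \<open>V \<times> W\<close> modulo the
  relations of bilinearity. Note that \<^term>\<open>Poly_Mapping.single (x, y) c\<close> is \<open>c\<close> times
  the generator \<open>(x, y)\<close>.
\<close>

definition tensor_relations ::
    "('a :: field, 'b) module \<Rightarrow> ('a, 'c) module \<Rightarrow> ('b \<times> 'c \<Rightarrow>\<^sub>0 'a) set" where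
  "tensor_relations V W =
     {Poly_Mapping.single (x \<oplus>\<^bsub>V\<^esub> x', y) 1
        - Poly_Mapping.single (x, y) 1 - Poly_Mapping.single (x', y) 1
      | x x' y. x \<in> carrier V \<and> x' \<in> carrier V \<and> y \<in> carrier W}
   \<union> {Poly_Mapping.single (x, y \<oplus>\<^bsub>W\<^esub> y') 1
        - Poly_Mapping.single (x, y) 1 - Poly_Mapping.single (x, y') 1
      | x y y'. x \<in> carrier V \<and> y \<in> carrier W \<and> y' \<in> carrier W}
   \<union> {Poly_Mapping.single (c \<odot>\<^bsub>V\<^esub> x, y) 1 - Poly_Mapping.single (x, y) c
      | c x y. x \<in> carrier V \<and> y \<in> carrier W}
   \<union> {Poly_Mapping.single (x, c \<odot>\<^bsub>W\<^esub> y) 1 - Poly_Mapping.single (x, y) c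
      | c x y. x \<in> carrier V \<and> y \<in> carrier W}"

definition tensor_kernel ::
    "('a :: field, 'b) module \<Rightarrow> ('a, 'c) module \<Rightarrow> ('b \<times> 'c \<Rightarrow>\<^sub>0 'a) set" where
  "tensor_kernel V W =
     LinearCombinations.module.span class_ring (free_space (carrier V \<times> carrier W))
       (tensor_relations V W)"

definition tensor_space ::
    "('a :: field, 'b) module \<Rightarrow> ('a, 'c) module \<Rightarrow> ('a, ('b \<times> 'c \<Rightarrow>\<^sub>0 'a) set) module" where
  "tensor_space V W = quotient_space (free_space (carrier V \<times> carrier W)) (tensor_kernel V W)"

definition pure_tensor ::
    "('a :: field, 'b) module \<Rightarrow> ('a, 'c) module \<Rightarrow> 'b \<Rightarrow> 'c \<Rightarrow> ('b \<times> 'c \<Rightarrow>\<^sub>0 'a) set" where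
  "pure_tensor V W x y =
     tensor_kernel V W +>\<^bsub>free_space (carrier V \<times> carrier W)\<^esub> Poly_Mapping.single (x, y) 1"

text \<open>
  The linear map \<open>V \<otimes> W \<rightarrow> U\<close> induced by a bilinear map \<open>\<beta>\<close>. It is computed on an arbitrary
  representative; for bilinear \<open>\<beta>\<close> the choice does not matter, and \<open>x \<otimes> y\<close> goes to \<open>\<beta> x y\<close>.
\<close>

definition tensor_lift ::
    "('a :: field, 'b) module \<Rightarrow> ('a, 'c) module \<Rightarrow> ('a, 'd) module \<Rightarrow> ('b \<Rightarrow> 'c \<Rightarrow> 'd)
      \<Rightarrow> ('b \<times> 'c \<Rightarrow>\<^sub>0 'a) set \<Rightarrow> 'd" where
  "tensor_lift V W U \<beta> X =
     (let z = (SOME z. z \<in> X)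
      in \<Oplus>\<^bsub>U\<^esub>p\<in>Poly_Mapping.keys z. Poly_Mapping.lookup z p \<odot>\<^bsub>U\<^esub> \<beta> (fst p) (snd p))"


section \<open>Bilinear spaces\<close>

definition bilinear_form :: "('a :: field, 'b) module \<Rightarrow> ('b \<Rightarrow> 'b \<Rightarrow> 'a) \<Rightarrow> bool" where
  "bilinear_form V b \<longleftrightarrow>
     (\<forall>x\<in>carrier V. \<forall>y\<in>carrier V. \<forall>z\<in>carrier V.
        b (x \<oplus>\<^bsub>V\<^esub> y) z = b x z + b y z \<and> b z (x \<oplus>\<^bsub>V\<^esub> y) = b z x + b z y) \<and>
     (\<forall>c. \<forall>x\<in>carrier V. \<forall>y\<in>carrier V.
        b (c \<odot>\<^bsub>V\<^esub> x) y = c * b x y \<and> b x (c \<odot>\<^bsub>V\<^esub> y) = c * b x y)"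

definition bilinear_space :: "('a :: field, 'b) module \<Rightarrow> ('b \<Rightarrow> 'b \<Rightarrow> 'a) \<Rightarrow> bool" where
  "bilinear_space V b \<longleftrightarrow>
     vectorspace class_ring V \<and> vectorspace.fin_dim class_ring V \<and> bilinear_form V b"

definition nondegenerate :: "('a :: field, 'b) module \<Rightarrow> ('b \<Rightarrow> 'b \<Rightarrow> 'a) \<Rightarrow> bool" where
  "nondegenerate V b \<longleftrightarrow>
     (\<forall>x\<in>carrier V. (\<forall>y\<in>carrier V. b x y = 0) \<longrightarrow> x = \<zero>\<^bsub>V\<^esub>) \<and>
     (\<forall>y\<in>carrier V. (\<forall>x\<in>carrier V. b x y = 0) \<longrightarrow> y = \<zero>\<^bsub>V\<^esub>)"

definition linear_isos :: "('a :: field, 'b) module \<Rightarrow> ('a, 'c) module \<Rightarrow> ('b \<Rightarrow> 'c) set" where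
  "linear_isos V W = {f \<in> LinearCombinations.module_hom class_ring V W.
     bij_betw f (carrier V) (carrier W)}"

definition isometric ::
    "('a :: field, 'b) module \<Rightarrow> ('b \<Rightarrow> 'b \<Rightarrow> 'a) \<Rightarrow> ('a, 'c) module \<Rightarrow> ('c \<Rightarrow> 'c \<Rightarrow> 'a) \<Rightarrow> bool" where
  "isometric V b W \<phi> \<longleftrightarrow>
     (\<exists>f\<in>linear_isos V W. \<forall>x\<in>carrier V. \<forall>y\<in>carrier V. b x y = \<phi> (f x) (f y))"

definition scalar_space :: "('a :: field, 'a) module" where
  "scalar_space = \<lparr>carrier = UNIV, mult = (*), one = 1, zero = 0, add = (+), smult = (*)\<rparr>"

text \<open>The bilinear form with \<open>(\<phi> \<otimes> \<psi>)(x \<otimes> y, x' \<otimes> y') = \<phi>(x, x') \<psi>(y, y')\<close>.\<close>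

definition tensor_form ::
    "('a :: field, 'b) module \<Rightarrow> ('b \<Rightarrow> 'b \<Rightarrow> 'a) \<Rightarrow> ('a, 'c) module \<Rightarrow> ('c \<Rightarrow> 'c \<Rightarrow> 'a)
      \<Rightarrow> ('b \<times> 'c \<Rightarrow>\<^sub>0 'a) set \<Rightarrow> ('b \<times> 'c \<Rightarrow>\<^sub>0 'a) set \<Rightarrow> 'a" where
  "tensor_form V \<phi> W \<psi> X X' =
     tensor_lift V W scalar_space (\<lambda>x y.
       tensor_lift V W scalar_space (\<lambda>x' y'. \<phi> x x' * \<psi> y y') X') X"

text \<open>
  HOL cannot quantify over types inside a formula. Existentially quantified vector
  spaces (and, below, algebras) therefore have their elements in the type \<^typ>\<open>'a vec\<close>, with an
  arbitrary subset as carrier and arbitrary operations. This is no restriction up to isomorphism,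
  since \<^term>\<open>carrier_vec n\<close> is available for every \<open>n\<close> and any structure of dimension \<open>n\<close>
  can be transported to it.
\<close>

definition decomposable_space :: "('a :: field, 'b) module \<Rightarrow> ('b \<Rightarrow> 'b \<Rightarrow> 'a) \<Rightarrow> bool" where
  "decomposable_space V b \<longleftrightarrow>
     (\<exists>(V1 :: ('a, 'a vec) module) \<phi>1 (V2 :: ('a, 'a vec) module) \<phi>2.
        bilinear_space V1 \<phi>1 \<and> bilinear_space V2 \<phi>2 \<and>
        vectorspace.dim class_ring V1 \<ge> 2 \<and> vectorspace.dim class_ring V2 \<ge> 2 \<and>
        isometric V b (tensor_space V1 V2) (tensor_form V1 \<phi>1 V2 \<phi>2))"

text \<open>Endomorphisms are taken to be \<^term>\<open>undefined\<close> off the carrier, so that two of them are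
  equal iff they agree on the carrier.\<close>

definition endo_alg :: "('a :: field, 'b) module \<Rightarrow> ('a, 'b \<Rightarrow> 'b) module" where
  "endo_alg V = \<lparr>carrier = LinearCombinations.module_hom class_ring V V \<inter> extensional (carrier V),
     mult = compose (carrier V),
     one = (\<lambda>x\<in>carrier V. x),
     zero = (\<lambda>x\<in>carrier V. \<zero>\<^bsub>V\<^esub>),
     add = (\<lambda>f g. \<lambda>x\<in>carrier V. f x \<oplus>\<^bsub>V\<^esub> g x),
     smult = (\<lambda>c f. \<lambda>x\<in>carrier V. c \<odot>\<^bsub>V\<^esub> f x)\<rparr>"

definition adjoint_anti ::
    "('a :: field, 'b) module \<Rightarrow> ('b \<Rightarrow> 'b \<Rightarrow> 'a) \<Rightarrow> ('b \<Rightarrow> 'b) \<Rightarrow> ('b \<Rightarrow> 'b)" where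
  "adjoint_anti V b f =
     (THE g. g \<in> carrier (endo_alg V) \<and>
        (\<forall>x\<in>carrier V. \<forall>y\<in>carrier V. b (f x) y = b x (g y)))"

definition asymmetry :: "('a :: field, 'b) module \<Rightarrow> ('b \<Rightarrow> 'b \<Rightarrow> 'a) \<Rightarrow> 'b \<Rightarrow> 'b" where
  "asymmetry V b =
     (THE a. a \<in> carrier (endo_alg V) \<and>
        (\<forall>x\<in>carrier V. \<forall>y\<in>carrier V. b x y = b y (a x)))"

definition has_decomposable_asymmetry ::
    "('a :: field, 'b) module \<Rightarrow> ('b \<Rightarrow> 'b \<Rightarrow> 'a) \<Rightarrow> bool" where
  "has_decomposable_asymmetry V' b' \<longleftrightarrow>
     (\<exists>(V :: ('a, 'a vec) module) b.
        bilinear_space V b \<and> nondegenerate V b \<and> decomposable_space V b \<and>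
        (\<exists>f\<in>linear_isos V V'. \<forall>y\<in>carrier V'.
           asymmetry V' b' y = f (asymmetry V b (inv_into (carrier V) f y))))"

definition gram_matrix :: "('b \<Rightarrow> 'b \<Rightarrow> 'a) \<Rightarrow> 'b list \<Rightarrow> 'a mat" where
  "gram_matrix b vs = mat (length vs) (length vs) (\<lambda>(i, j). b (vs ! i) (vs ! j))"

definition nonzero_squares :: "'a :: field set" where
  "nonzero_squares = {c\<^sup>2 | c. c \<noteq> 0}"

definition square_class_group :: "'a :: field set monoid" where
  "square_class_group = units_of class_ring Mod nonzero_squares"

text \<open>The square class does not depend on the basis \<open>vs\<close>.\<close>

definition det_class :: "('a :: field, 'b) module \<Rightarrow> ('b \<Rightarrow> 'b \<Rightarrow> 'a) \<Rightarrow> 'a set" where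
  "det_class V b =
     (THE C. \<exists>vs. distinct vs \<and> vectorspace.basis class_ring V (set vs) \<and>
        C = nonzero_squares #>\<^bsub>units_of class_ring\<^esub> det (gram_matrix b vs))"


section \<open>Algebras with anti-automorphism\<close>

text \<open>Not the locale \<open>algebra\<close> of HOL-Algebra, which is for commutative algebras.\<close>

definition fin_dim_algebra :: "('a :: field, 'b) module \<Rightarrow> bool" where
  "fin_dim_algebra A \<longleftrightarrow>
     vectorspace class_ring A \<and> vectorspace.fin_dim class_ring A \<and> ring A \<and>
     (\<forall>c. \<forall>x\<in>carrier A. \<forall>y\<in>carrier A.
        (c \<odot>\<^bsub>A\<^esub> x) \<otimes>\<^bsub>A\<^esub> y = c \<odot>\<^bsub>A\<^esub> (x \<otimes>\<^bsub>A\<^esub> y) \<and>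
        x \<otimes>\<^bsub>A\<^esub> (c \<odot>\<^bsub>A\<^esub> y) = c \<odot>\<^bsub>A\<^esub> (x \<otimes>\<^bsub>A\<^esub> y))"

definition central_simple :: "('a :: field, 'b) module \<Rightarrow> bool" where
  "central_simple A \<longleftrightarrow>
     fin_dim_algebra A \<and>
     {z \<in> carrier A. \<forall>x\<in>carrier A. z \<otimes>\<^bsub>A\<^esub> x = x \<otimes>\<^bsub>A\<^esub> z} = {c \<odot>\<^bsub>A\<^esub> \<one>\<^bsub>A\<^esub> | c. True} \<and>
     \<one>\<^bsub>A\<^esub> \<noteq> \<zero>\<^bsub>A\<^esub> \<and>
     (\<forall>I. ideal I A \<longrightarrow> I = {\<zero>\<^bsub>A\<^esub>} \<or> I = carrier A)"

text \<open>The dimension of a central simple algebra is a square, and the degree is its square root.\<close>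

definition alg_degree :: "('a :: field, 'b) module \<Rightarrow> nat" where
  "alg_degree A = (THE n. n\<^sup>2 = vectorspace.dim class_ring A)"

definition anti_automorphism :: "('a :: field, 'b) module \<Rightarrow> ('b \<Rightarrow> 'b) \<Rightarrow> bool" where
  "anti_automorphism A \<sigma> \<longleftrightarrow>
     \<sigma> \<in> linear_isos A A \<and> \<sigma> \<one>\<^bsub>A\<^esub> = \<one>\<^bsub>A\<^esub> \<and>
     (\<forall>x\<in>carrier A. \<forall>y\<in>carrier A. \<sigma> (x \<otimes>\<^bsub>A\<^esub> y) = \<sigma> y \<otimes>\<^bsub>A\<^esub> \<sigma> x)"

definition isomorphic_with_anti ::
    "('a :: field, 'b) module \<Rightarrow> ('b \<Rightarrow> 'b) \<Rightarrow> ('a, 'c) module \<Rightarrow> ('c \<Rightarrow> 'c) \<Rightarrow> bool" where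
  "isomorphic_with_anti A \<sigma> B \<tau> \<longleftrightarrow>
     (\<exists>h. h \<in> ring_iso A B \<and> h \<in> linear_isos A B \<and> (\<forall>x\<in>carrier A. h (\<sigma> x) = \<tau> (h x)))"

text \<open>The tensor product of algebras, with \<open>(a \<otimes> b)(a' \<otimes> b') = aa' \<otimes> bb'\<close>.\<close>

definition tensor_alg ::
    "('a :: field, 'b) module \<Rightarrow> ('a, 'c) module \<Rightarrow> ('a, ('b \<times> 'c \<Rightarrow>\<^sub>0 'a) set) module" where
  "tensor_alg A B = (tensor_space A B)\<lparr>
     mult := (\<lambda>X Y.
       tensor_lift A B (tensor_space A B) (\<lambda>a b.
         tensor_lift A B (tensor_space A B) (\<lambda>a' b'.
           pure_tensor A B (a \<otimes>\<^bsub>A\<^esub> a') (b \<otimes>\<^bsub>B\<^esub> b')) Y) X),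
     one := pure_tensor A B \<one>\<^bsub>A\<^esub> \<one>\<^bsub>B\<^esub>\<rparr>"

definition tensor_map ::
    "('a :: field, 'b) module \<Rightarrow> ('b \<Rightarrow> 'b) \<Rightarrow> ('a, 'c) module \<Rightarrow> ('c \<Rightarrow> 'c)
      \<Rightarrow> ('b \<times> 'c \<Rightarrow>\<^sub>0 'a) set \<Rightarrow> ('b \<times> 'c \<Rightarrow>\<^sub>0 'a) set" where
  "tensor_map A \<sigma> B \<tau> =
     tensor_lift A B (tensor_space A B) (\<lambda>a b. pure_tensor A B (\<sigma> a) (\<tau> b))"

definition decomposable_alg :: "('a :: field, 'b) module \<Rightarrow> ('b \<Rightarrow> 'b) \<Rightarrow> bool" where
  "decomposable_alg A \<sigma> \<longleftrightarrow>
     (\<exists>(A1 :: ('a, 'a vec) module) \<sigma>1 (A2 :: ('a, 'a vec) module) \<sigma>2.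
        central_simple A1 \<and> anti_automorphism A1 \<sigma>1 \<and>
        central_simple A2 \<and> anti_automorphism A2 \<sigma>2 \<and>
        alg_degree A1 \<ge> 2 \<and> alg_degree A2 \<ge> 2 \<and>
        isomorphic_with_anti A \<sigma> (tensor_alg A1 A2) (tensor_map A1 \<sigma>1 A2 \<sigma>2))"

end

theory Submission
  imports Defs
begin

text \<open>
  In coordinates, let \<open>M\<close> be the Gram matrix of \<open>b'\<close>. A decomposition of the adjoint algebra is a pair of
  commuting quaternion subalgebras of \<open>M\<^sub>4(F)\<close> stable under \<open>X \<mapsto> M\<^sup>-\<^sup>1 X\<^sup>T M\<close>. By Skolem--Noether the
  restrictions are \<open>Int(s\<^sub>i)\<close> after the canonical involutions, so \<open>S = M s\<^sub>1 s\<^sub>2\<close> is a form whose adjoint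
  involution is \<open>e \<mapsto> - e\<close> on the four generators. Such an \<open>S\<close> is symmetric: if it were alternating, the
  Pfaffian would make \<open>i\<^sub>1 i\<^sub>2 + j\<^sub>1 j\<^sub>2\<close> quadratic. Writing \<open>s\<^sub>i\<close> as scalar plus pure quaternion
  \<open>w\<^sub>i\<close>, a vector \<open>v\<close> with \<open>v, w\<^sub>2 v, w\<^sub>1 v, w\<^sub>1 w\<^sub>2 v\<close> independent turns \<open>w\<^sub>1, w\<^sub>2\<close> into \<open>x\<^sub>1 \<otimes> 1\<close> and
  \<open>1 \<otimes> x\<^sub>2\<close>, makes the asymmetry that of a tensor product, and shows that \<open>det S\<close> is a square.

  Conversely, a symmetric form with square determinant is similar to a norm form
  \<open>\<langle>1, A, B, AB\<rangle>\<close>, whose skew maps are the pure quaternions acting from the left and from the right. A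
  decomposable asymmetry gives commuting \<open>W\<^sub>1, W\<^sub>2\<close> with scalar squares. If they are skew for \<open>M\<close>, then
  \<open>M (k\<^sub>1 + W\<^sub>1)(k\<^sub>2 + W\<^sub>2)\<close> is symmetric and each \<open>W\<^sub>i\<close> is one of these pure quaternions, which recovers
  \<open>s\<^sub>1, s\<^sub>2\<close>. Otherwise they are first replaced, using Cayley transforms of the asymmetry.
\<close>

section \<open>Tensor products\<close>

text \<open>The obstacle of the converse is that the asymmetry \<open>a\<close> of \<open>M\<close>
  need not determine \<open>W1\<close> and \<open>W2\<close>. When \<open>k1 = k2 = 1\<close>, its
  Cayley transform \<open>(a - 1) / (a + 1)\<close> is \<open>(W1 + W2) / (1 + W1 W2)\<close>, which
  is skew for \<open>M\<close> wherever it exists. With \<open>w1\<close>, \<open>w2\<close> the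
  squares of \<open>W1\<close>, \<open>W2\<close>, it yields both factors if \<open>w1\<close> and
  \<open>w2\<close> differ and \<open>w1 w2\<close> is not 1. If \<open>w1 = w2\<close>, only the
  sum is recovered; if \<open>w1 w2 = 1\<close>, then -1 is an eigenvalue of \<open>a\<close> and
  there is no Cayley transform; if exactly one \<open>ki\<close> is 0, a relation with a sign for
  the other \<open>W\<close> remains, and that \<open>W\<close> may be nilpotent. Each of these
  cases has its own argument.

  The square determinant matters because a form \<open><d0, d1, d2, d3>\<close> turns into a
  multiple of \<open><1, A, B, AB>\<close> by rescaling its last basis vector only if the product of
  the \<open>di\<close> is a square.

  Both sides of the equivalence are expressed by conditions on a Gram matrix alone,
  \<open>biquat_decomposable\<close> and \<open>kron_decomposable\<close>. These are invariant under
  congruence, so that bases can be adapted freely.\<close>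

lemma vs_facts:
  fixes V :: "('a::field, 'b) module"
  assumes "vectorspace class_ring V"
  shows vs_abelian_group: "abelian_group V"
    and vs_module: "Module.module class_ring V"
    and vs_add_closed: "\<And>x y. x \<in> carrier V \<Longrightarrow> y \<in> carrier V \<Longrightarrow> x \<oplus>\<^bsub>V\<^esub> y \<in> carrier V"
    and vs_zero_closed: "\<zero>\<^bsub>V\<^esub> \<in> carrier V"
    and vs_smult_closed: "\<And>c x. x \<in> carrier V \<Longrightarrow> c \<odot>\<^bsub>V\<^esub> x \<in> carrier V"
    and vs_smult_add: "\<And>c x y. x \<in> carrier V \<Longrightarrow> y \<in> carrier V \<Longrightarrow>
      c \<odot>\<^bsub>V\<^esub> (x \<oplus>\<^bsub>V\<^esub> y) = c \<odot>\<^bsub>V\<^esub> x \<oplus>\<^bsub>V\<^esub> c \<odot>\<^bsub>V\<^esub> y"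
    and vs_add_smult: "\<And>c d x. x \<in> carrier V \<Longrightarrow>
      (c + d) \<odot>\<^bsub>V\<^esub> x = c \<odot>\<^bsub>V\<^esub> x \<oplus>\<^bsub>V\<^esub> d \<odot>\<^bsub>V\<^esub> x"
    and vs_smult_smult: "\<And>c d x. x \<in> carrier V \<Longrightarrow> c \<odot>\<^bsub>V\<^esub> (d \<odot>\<^bsub>V\<^esub> x) = (c * d) \<odot>\<^bsub>V\<^esub> x"
    and vs_one_smult: "\<And>x. x \<in> carrier V \<Longrightarrow> 1 \<odot>\<^bsub>V\<^esub> x = x"
    and vs_zero_smult: "\<And>x. x \<in> carrier V \<Longrightarrow> 0 \<odot>\<^bsub>V\<^esub> x = \<zero>\<^bsub>V\<^esub>"
    and vs_smult_zero: "\<And>c. c \<odot>\<^bsub>V\<^esub> \<zero>\<^bsub>V\<^esub> = \<zero>\<^bsub>V\<^esub>"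
proof -
  interpret V: vectorspace class_ring V by fact
  show "abelian_group V" "Module.module class_ring V" by unfold_locales
  show "\<And>x y. x \<in> carrier V \<Longrightarrow> y \<in> carrier V \<Longrightarrow> x \<oplus>\<^bsub>V\<^esub> y \<in> carrier V" by simp
  show "\<zero>\<^bsub>V\<^esub> \<in> carrier V" by simp
  show "\<And>c x. x \<in> carrier V \<Longrightarrow> c \<odot>\<^bsub>V\<^esub> x \<in> carrier V" by simp
  show "\<And>c x y. x \<in> carrier V \<Longrightarrow> y \<in> carrier V \<Longrightarrow>
      c \<odot>\<^bsub>V\<^esub> (x \<oplus>\<^bsub>V\<^esub> y) = c \<odot>\<^bsub>V\<^esub> x \<oplus>\<^bsub>V\<^esub> c \<odot>\<^bsub>V\<^esub> y"
    using V.smult_r_distr by simp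
  show "\<And>c d x. x \<in> carrier V \<Longrightarrow> (c + d) \<odot>\<^bsub>V\<^esub> x = c \<odot>\<^bsub>V\<^esub> x \<oplus>\<^bsub>V\<^esub> d \<odot>\<^bsub>V\<^esub> x"
    using V.smult_l_distr by simp
  show "\<And>c d x. x \<in> carrier V \<Longrightarrow> c \<odot>\<^bsub>V\<^esub> (d \<odot>\<^bsub>V\<^esub> x) = (c * d) \<odot>\<^bsub>V\<^esub> x"
    using V.smult_assoc1 by simp
  show "\<And>x. x \<in> carrier V \<Longrightarrow> 1 \<odot>\<^bsub>V\<^esub> x = x" using V.smult_one by simp
  show "\<And>x. x \<in> carrier V \<Longrightarrow> 0 \<odot>\<^bsub>V\<^esub> x = \<zero>\<^bsub>V\<^esub>" using V.lmult_0 by simp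
  show "\<And>c. c \<odot>\<^bsub>V\<^esub> \<zero>\<^bsub>V\<^esub> = \<zero>\<^bsub>V\<^esub>" using V.rmult_0 by simp
qed

text \<open>The axioms are identities and existence statements, so they pass to any structure onto
  which a vector space maps compatibly with the operations. Quotients and transported structures
  both obtain their vector space laws in this way.\<close>

lemma vectorspace_image:
  fixes V :: "('a::field, 'b) module" and W :: "('a, 'c) module"
  assumes V: "vectorspace class_ring V"
    and surj: "f ` carrier V = carrier W"
    and add: "\<And>x y. x \<in> carrier V \<Longrightarrow> y \<in> carrier V \<Longrightarrow> f (x \<oplus>\<^bsub>V\<^esub> y) = f x \<oplus>\<^bsub>W\<^esub> f y"
    and zero: "f \<zero>\<^bsub>V\<^esub> = \<zero>\<^bsub>W\<^esub>"
    and smult: "\<And>c x. x \<in> carrier V \<Longrightarrow> f (c \<odot>\<^bsub>V\<^esub> x) = c \<odot>\<^bsub>W\<^esub> f x"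
  shows "vectorspace class_ring W"
proof (rule vs_criteria)
  note V' = vs_facts[OF V]
  interpret V: vectorspace class_ring V by fact
  show "field (class_ring :: 'a ring)" by (rule VS_Connect.class_field)
  show "\<zero>\<^bsub>W\<^esub> \<in> carrier W" using surj zero V'(4) by force
  have cl: "f x \<in> carrier W" if "x \<in> carrier V" for x using surj that by auto
  show "\<forall>v w. v \<in> carrier W \<and> w \<in> carrier W \<longrightarrow> v \<oplus>\<^bsub>W\<^esub> w \<in> carrier W"
    by (auto simp: surj[symmetric] add[symmetric])
  show "\<forall>v\<in>carrier W. \<exists>nv\<in>carrier W. v \<oplus>\<^bsub>W\<^esub> nv = \<zero>\<^bsub>W\<^esub>"
  proof
    fix v assume "v \<in> carrier W"
    then obtain x where x: "x \<in> carrier V" "v = f x" using surj by auto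
    show "\<exists>nv\<in>carrier W. v \<oplus>\<^bsub>W\<^esub> nv = \<zero>\<^bsub>W\<^esub>"
      using x cl by (intro bexI[of _ "f (\<ominus>\<^bsub>V\<^esub> x)"]) (simp_all add: add[symmetric] zero[symmetric] V.r_neg)
  qed
  show "\<forall>c v. c \<in> carrier class_ring \<and> v \<in> carrier W \<longrightarrow> c \<odot>\<^bsub>W\<^esub> v \<in> carrier W"
    by (auto simp: surj[symmetric] smult[symmetric] V')
  show "\<forall>v w. v \<in> carrier W \<and> w \<in> carrier W \<longrightarrow> v \<oplus>\<^bsub>W\<^esub> w = w \<oplus>\<^bsub>W\<^esub> v"
    by (auto simp: surj[symmetric] add[symmetric] V.a_comm)
  show "\<forall>v w x. v \<in> carrier W \<and> w \<in> carrier W \<and> x \<in> carrier W \<longrightarrow>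
      v \<oplus>\<^bsub>W\<^esub> w \<oplus>\<^bsub>W\<^esub> x = v \<oplus>\<^bsub>W\<^esub> (w \<oplus>\<^bsub>W\<^esub> x)"
    by (auto simp: surj[symmetric] add[symmetric] V.a_assoc)
  show "\<forall>v\<in>carrier W. v \<oplus>\<^bsub>W\<^esub> \<zero>\<^bsub>W\<^esub> = v"
    by (auto simp: surj[symmetric] add[symmetric] zero[symmetric])
  show "\<forall>v\<in>carrier W. \<one>\<^bsub>class_ring\<^esub> \<odot>\<^bsub>W\<^esub> v = v"
    by (auto simp: surj[symmetric] smult[symmetric] V')
  show "\<forall>c d v. c \<in> carrier class_ring \<and> d \<in> carrier class_ring \<and> v \<in> carrier W \<longrightarrow>
      (c \<otimes>\<^bsub>class_ring\<^esub> d) \<odot>\<^bsub>W\<^esub> v = c \<odot>\<^bsub>W\<^esub> (d \<odot>\<^bsub>W\<^esub> v)"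
    by (auto simp: surj[symmetric] smult[symmetric] V')
  show "\<forall>a b v. a \<in> carrier class_ring \<and> b \<in> carrier class_ring \<and> v \<in> carrier W \<longrightarrow>
      (a \<oplus>\<^bsub>class_ring\<^esub> b) \<odot>\<^bsub>W\<^esub> v = a \<odot>\<^bsub>W\<^esub> v \<oplus>\<^bsub>W\<^esub> b \<odot>\<^bsub>W\<^esub> v"
    by (auto simp: surj[symmetric] smult[symmetric] add[symmetric] V')
  show "\<forall>a v w. a \<in> carrier class_ring \<and> v \<in> carrier W \<and> w \<in> carrier W \<longrightarrow>
      a \<odot>\<^bsub>W\<^esub> (v \<oplus>\<^bsub>W\<^esub> w) = a \<odot>\<^bsub>W\<^esub> v \<oplus>\<^bsub>W\<^esub> a \<odot>\<^bsub>W\<^esub> w"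
    by (auto simp: surj[symmetric] smult[symmetric] add[symmetric] V')
qed

section \<open>Free vector spaces, quotients and the universal property of the tensor
  product\<close>

lemma lookup_map_times [simp]:
  "Poly_Mapping.lookup (Poly_Mapping.map ((*) (c::'a::field)) z) p = c * Poly_Mapping.lookup z p"
  by (cases "Poly_Mapping.lookup z p = 0") (auto simp: Poly_Mapping.map.rep_eq when_def)

lemma free_space_simps [simp]:
  "carrier (free_space S) = {z. Poly_Mapping.keys z \<subseteq> S}"
  "\<zero>\<^bsub>free_space S\<^esub> = 0"
  "z \<oplus>\<^bsub>free_space S\<^esub> z' = z + z'"
  "c \<odot>\<^bsub>free_space S\<^esub> z = Poly_Mapping.map ((*) c) z"
  by (simp_all add: free_space_def)

lemma keys_map_times: "Poly_Mapping.keys (Poly_Mapping.map ((*) (c::'a::field)) z) \<subseteq> Poly_Mapping.keys z"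
  by (auto simp: in_keys_iff)

lemma vectorspace_free_space: "vectorspace class_ring (free_space S :: ('a::field, _) module)"
proof (rule vs_criteria)
  show "\<forall>v w. v \<in> carrier (free_space S) \<and> w \<in> carrier (free_space S) \<longrightarrow>
      v \<oplus>\<^bsub>free_space S\<^esub> w \<in> carrier (free_space S)"
    by (auto dest!: subsetD[OF keys_add])
  show "\<forall>v\<in>carrier (free_space S). \<exists>nv\<in>carrier (free_space S). v \<oplus>\<^bsub>free_space S\<^esub> nv = \<zero>\<^bsub>free_space S\<^esub>"
    by (intro ballI, rule_tac x="- v" in bexI) auto
  show "\<forall>c v. c \<in> carrier class_ring \<and> v \<in> carrier (free_space S) \<longrightarrow>
      c \<odot>\<^bsub>free_space S\<^esub> v \<in> carrier (free_space S)"
    by (auto dest!: subsetD[OF keys_map_times])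
qed (auto simp: VS_Connect.class_field poly_mapping_eq_iff fun_eq_iff lookup_add algebra_simps)

context
  fixes V :: "('a::field, 'b) module" and N :: "'b set"
  assumes V: "vectorspace class_ring V" and N: "submodule class_ring N V"
begin

interpretation vectorspace class_ring V by (rule V)
interpretation N: submodule class_ring N V by (rule N)

lemma submodule_abelian_subgroup: "abelian_subgroup N V"
proof (rule abelian_subgroupI3)
  show "additive_subgroup N V"
  proof (unfold additive_subgroup_def, unfold_locales, goal_cases)
    case (4 x)
    have x: "x \<in> carrier V" using 4 N.subset by auto
    have "((-1::'a) + 1) \<odot>\<^bsub>V\<^esub> x = (-1) \<odot>\<^bsub>V\<^esub> x \<oplus>\<^bsub>V\<^esub> x"
      by (subst vs_facts(7)[OF V x]) (simp add: vs_facts(9)[OF V x])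
    hence "(-1) \<odot>\<^bsub>V\<^esub> x \<oplus>\<^bsub>V\<^esub> x = \<zero>\<^bsub>V\<^esub>" using vs_facts(10)[OF V] x by simp
    hence "\<ominus>\<^bsub>V\<^esub> x = (-1) \<odot>\<^bsub>V\<^esub> x"
      by (rule minus_equality[OF _ x vs_facts(5)[OF V x]])
    moreover have "(-1) \<odot>\<^bsub>V\<^esub> x \<in> N" using N.smult_closed 4 by simp
    ultimately show ?case by (simp add: a_inv_def)
  qed (use N.subset N.m_closed N.zero_closed in auto)
  show "abelian_group V" by unfold_locales
qed

interpretation N: abelian_subgroup N V by (rule submodule_abelian_subgroup)

lemma quotient_space_vectorspace: "vectorspace class_ring (quotient_space V N)"
  and quotient_space_carrier: "carrier (quotient_space V N) = (\<lambda>x. N +>\<^bsub>V\<^esub> x) ` carrier V"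
  and quotient_space_add: "x \<in> carrier V \<Longrightarrow> y \<in> carrier V \<Longrightarrow>
        (N +>\<^bsub>V\<^esub> x) \<oplus>\<^bsub>quotient_space V N\<^esub> (N +>\<^bsub>V\<^esub> y) = N +>\<^bsub>V\<^esub> (x \<oplus>\<^bsub>V\<^esub> y)"
  and quotient_space_smult: "x \<in> carrier V \<Longrightarrow>
        c \<odot>\<^bsub>quotient_space V N\<^esub> (N +>\<^bsub>V\<^esub> x) = N +>\<^bsub>V\<^esub> (c \<odot>\<^bsub>V\<^esub> x)"
  and quotient_space_zero: "\<zero>\<^bsub>quotient_space V N\<^esub> = N +>\<^bsub>V\<^esub> \<zero>\<^bsub>V\<^esub>"
  and quotient_self_mem: "x \<in> carrier V \<Longrightarrow> x \<in> N +>\<^bsub>V\<^esub> x"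
  and quotient_eqI: "x \<in> carrier V \<Longrightarrow> n \<in> N \<Longrightarrow> N +>\<^bsub>V\<^esub> (n \<oplus>\<^bsub>V\<^esub> x) = N +>\<^bsub>V\<^esub> x"
proof -
  show carr: "carrier (quotient_space V N) = (\<lambda>x. N +>\<^bsub>V\<^esub> x) ` carrier V"
    by (auto simp: quotient_space_def A_RCOSETS_def')
  show add: "(N +>\<^bsub>V\<^esub> x) \<oplus>\<^bsub>quotient_space V N\<^esub> (N +>\<^bsub>V\<^esub> y) = N +>\<^bsub>V\<^esub> (x \<oplus>\<^bsub>V\<^esub> y)"
    if "x \<in> carrier V" "y \<in> carrier V" for x y
    using that by (simp add: quotient_space_def N.a_rcos_sum)
  show z: "\<zero>\<^bsub>quotient_space V N\<^esub> = N +>\<^bsub>V\<^esub> \<zero>\<^bsub>V\<^esub>"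
    using a_coset_add_zero N.subset by (simp add: quotient_space_def)
  show self: "x \<in> N +>\<^bsub>V\<^esub> x" if "x \<in> carrier V" for x
    using that N.a_rcos_self by simp
  show eqI: "N +>\<^bsub>V\<^esub> (n \<oplus>\<^bsub>V\<^esub> x) = N +>\<^bsub>V\<^esub> x" if "x \<in> carrier V" "n \<in> N" for x n
  proof (rule sym, rule N.a_repr_independence')
    show "n \<oplus>\<^bsub>V\<^esub> x \<in> N +>\<^bsub>V\<^esub> x" using that by (auto simp: a_r_coset_def')
  qed (use that in auto)
  show sm: "c \<odot>\<^bsub>quotient_space V N\<^esub> (N +>\<^bsub>V\<^esub> x) = N +>\<^bsub>V\<^esub> (c \<odot>\<^bsub>V\<^esub> x)" if x: "x \<in> carrier V" for c x
  proof -
    have "N +>\<^bsub>V\<^esub> (c \<odot>\<^bsub>V\<^esub> y) = N +>\<^bsub>V\<^esub> (c \<odot>\<^bsub>V\<^esub> x)" if y: "y \<in> N +>\<^bsub>V\<^esub> x" for y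
    proof -
      obtain n where n: "n \<in> N" "y = n \<oplus>\<^bsub>V\<^esub> x" using y by (auto simp: a_r_coset_def')
      have "c \<odot>\<^bsub>V\<^esub> n \<in> N" using N.smult_closed n by simp
      moreover have "n \<in> carrier V" using n N.subset by auto
      ultimately show ?thesis using x eqI[of "c \<odot>\<^bsub>V\<^esub> x" "c \<odot>\<^bsub>V\<^esub> n"]
        by (simp add: n vs_facts(5,6)[OF V])
    qed
    hence "(\<Union>y\<in>N +>\<^bsub>V\<^esub> x. N +>\<^bsub>V\<^esub> (c \<odot>\<^bsub>V\<^esub> y)) = N +>\<^bsub>V\<^esub> (c \<odot>\<^bsub>V\<^esub> x)"
      using self[OF x] by (intro SUP_eq_const) blast+
    thus ?thesis by (simp add: quotient_space_def)
  qed
  show "vectorspace class_ring (quotient_space V N)"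
    by (rule vectorspace_image[OF V, of "\<lambda>x. N +>\<^bsub>V\<^esub> x"]) (simp_all add: carr add z sm)
qed

end

lemma linear_vanish_span:
  fixes V :: "('a::field, 'b) module" and U :: "('a, 'c) module"
  assumes V: "vectorspace class_ring V" and U: "vectorspace class_ring U"
    and f: "f \<in> LinearCombinations.module_hom class_ring V U"
    and S: "S \<subseteq> carrier V" "\<And>s. s \<in> S \<Longrightarrow> f s = \<zero>\<^bsub>U\<^esub>"
    and x: "x \<in> LinearCombinations.module.span class_ring V S"
  shows "f x = \<zero>\<^bsub>U\<^esub>"
proof -
  interpret mod_hom class_ring V U f
    by (intro mod_hom.intro mod_hom_axioms.intro vs_module V U f)
  have "M.span S \<subseteq> ker"
    by (rule M.span_is_subset[OF _ ker_is_submodule]) (use S in \<open>auto simp: ker_def\<close>)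
  thus ?thesis using x by (auto simp: ker_def)
qed

definition bilinear_map ::
    "('a :: field, 'b) module \<Rightarrow> ('a, 'c) module \<Rightarrow> ('a, 'd) module \<Rightarrow> ('b \<Rightarrow> 'c \<Rightarrow> 'd) \<Rightarrow> bool" where
  "bilinear_map V W U \<beta> \<longleftrightarrow>
     (\<forall>x\<in>carrier V. \<forall>y\<in>carrier W. \<beta> x y \<in> carrier U \<and>
        (\<forall>x'\<in>carrier V. \<beta> (x \<oplus>\<^bsub>V\<^esub> x') y = \<beta> x y \<oplus>\<^bsub>U\<^esub> \<beta> x' y) \<and>
        (\<forall>y'\<in>carrier W. \<beta> x (y \<oplus>\<^bsub>W\<^esub> y') = \<beta> x y \<oplus>\<^bsub>U\<^esub> \<beta> x y') \<and>
        (\<forall>c. \<beta> (c \<odot>\<^bsub>V\<^esub> x) y = c \<odot>\<^bsub>U\<^esub> \<beta> x y \<and> \<beta> x (c \<odot>\<^bsub>W\<^esub> y) = c \<odot>\<^bsub>U\<^esub> \<beta> x y))"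

lemma bilinear_mapD:
  assumes "bilinear_map V W U \<beta>" "x \<in> carrier V" "y \<in> carrier W"
  shows "\<beta> x y \<in> carrier U"
    and "x' \<in> carrier V \<Longrightarrow> \<beta> (x \<oplus>\<^bsub>V\<^esub> x') y = \<beta> x y \<oplus>\<^bsub>U\<^esub> \<beta> x' y"
    and "y' \<in> carrier W \<Longrightarrow> \<beta> x (y \<oplus>\<^bsub>W\<^esub> y') = \<beta> x y \<oplus>\<^bsub>U\<^esub> \<beta> x y'"
    and "\<beta> (c \<odot>\<^bsub>V\<^esub> x) y = c \<odot>\<^bsub>U\<^esub> \<beta> x y"
    and "\<beta> x (c \<odot>\<^bsub>W\<^esub> y) = c \<odot>\<^bsub>U\<^esub> \<beta> x y"
  using assms by (auto simp: bilinear_map_def)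

text \<open>\<open>tensor_lift\<close> with the representative as an argument. On the free space the
  map is linear without any choice; bilinearity of \<beta> enters when the relations are shown to be
  killed.\<close>

definition free_lift ::
    "('a::field, 'd) module \<Rightarrow> ('b \<Rightarrow> 'c \<Rightarrow> 'd) \<Rightarrow> ('b \<times> 'c \<Rightarrow>\<^sub>0 'a) \<Rightarrow> 'd" where
  "free_lift U \<beta> z =
     (\<Oplus>\<^bsub>U\<^esub>p\<in>Poly_Mapping.keys z. Poly_Mapping.lookup z p \<odot>\<^bsub>U\<^esub> \<beta> (fst p) (snd p))"

lemma module_homI:
  fixes V :: "('a::field, 'b) module" and W :: "('a, 'c) module"
  assumes "\<And>x. x \<in> carrier V \<Longrightarrow> f x \<in> carrier W"
    and "\<And>x y. x \<in> carrier V \<Longrightarrow> y \<in> carrier V \<Longrightarrow> f (x \<oplus>\<^bsub>V\<^esub> y) = f x \<oplus>\<^bsub>W\<^esub> f y"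
    and "\<And>c x. x \<in> carrier V \<Longrightarrow> f (c \<odot>\<^bsub>V\<^esub> x) = c \<odot>\<^bsub>W\<^esub> f x"
  shows "f \<in> LinearCombinations.module_hom class_ring V W"
  using assms by (auto simp: LinearCombinations.module_hom_def)

lemma module_homD:
  fixes V :: "('a::field, 'b) module" and W :: "('a, 'c) module"
  assumes "f \<in> LinearCombinations.module_hom class_ring V W" "x \<in> carrier V"
  shows "f x \<in> carrier W"
    and "y \<in> carrier V \<Longrightarrow> f (x \<oplus>\<^bsub>V\<^esub> y) = f x \<oplus>\<^bsub>W\<^esub> f y"
    and "f (c \<odot>\<^bsub>V\<^esub> x) = c \<odot>\<^bsub>W\<^esub> f x"
  using assms by (auto simp: LinearCombinations.module_hom_def)

lemma module_hom_zero:
  fixes V :: "('a::field, 'b) module" and W :: "('a, 'c) module"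
  assumes "vectorspace class_ring V" "vectorspace class_ring W"
    and "f \<in> LinearCombinations.module_hom class_ring V W"
  shows "f \<zero>\<^bsub>V\<^esub> = \<zero>\<^bsub>W\<^esub>"
  using module_homD(1)[OF assms(3) vs_zero_closed[OF assms(1)]]
    module_homD(3)[OF assms(3) vs_zero_closed[OF assms(1)], of 0]
  by (simp add: vs_facts(10,11)[OF assms(1)] vs_facts(10)[OF assms(2)])

locale tensor_pair =
  fixes V :: "('a :: field, 'b) module" and W :: "('a, 'c) module"
  assumes vsV: "vectorspace class_ring V" and vsW: "vectorspace class_ring W"
begin

abbreviation "Fr \<equiv> free_space (carrier V \<times> carrier W) :: ('a, 'b \<times> 'c \<Rightarrow>\<^sub>0 'a) module"
abbreviation "K \<equiv> tensor_kernel V W"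
abbreviation "T \<equiv> tensor_space V W"
abbreviation "pt \<equiv> pure_tensor V W"

lemmas V = vs_facts[OF vsV]
lemmas W = vs_facts[OF vsW]

lemma keys_subset_iff: "Poly_Mapping.keys z \<subseteq> S \<longleftrightarrow> (\<forall>p. Poly_Mapping.lookup z p \<noteq> 0 \<longrightarrow> p \<in> S)"
  by (auto simp: in_keys_iff)

lemma relations_subset: "tensor_relations V W \<subseteq> carrier Fr"
  by (auto simp: tensor_relations_def keys_subset_iff lookup_minus lookup_single when_def
      V W split: if_splits)

lemma K_submodule: "submodule class_ring K Fr"
  unfolding tensor_kernel_def
  by (rule module.span_is_submodule[OF vs_module[OF vectorspace_free_space] relations_subset])

lemma relations_K: "r \<in> tensor_relations V W \<Longrightarrow> r \<in> K"
  unfolding tensor_kernel_def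
  using module.in_own_span[OF vs_module[OF vectorspace_free_space] relations_subset] by auto

lemmas Q = quotient_space_vectorspace[OF vectorspace_free_space K_submodule, folded tensor_space_def]
  quotient_space_carrier[OF vectorspace_free_space K_submodule, folded tensor_space_def]
  quotient_space_add[OF vectorspace_free_space K_submodule, folded tensor_space_def]
  quotient_space_smult[OF vectorspace_free_space K_submodule, folded tensor_space_def]
  quotient_space_zero[OF vectorspace_free_space K_submodule, folded tensor_space_def]
  quotient_self_mem[OF vectorspace_free_space K_submodule]
  quotient_eqI[OF vectorspace_free_space K_submodule]

lemmas tensor_vs = Q(1)

lemma coset_eqI:
  assumes "z - z' \<in> K" "z' \<in> carrier Fr"
  shows "K +>\<^bsub>Fr\<^esub> z = K +>\<^bsub>Fr\<^esub> z'"
  using Q(7)[OF assms(2,1)] by simp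

lemma single_carrier: "p \<in> carrier V \<times> carrier W \<Longrightarrow> Poly_Mapping.single p c \<in> carrier Fr"
  by (auto simp: keys_subset_iff lookup_single when_def split: if_splits)

lemma pt_closed: "x \<in> carrier V \<Longrightarrow> y \<in> carrier W \<Longrightarrow> pt x y \<in> carrier T"
  unfolding Q(2) pure_tensor_def using single_carrier by blast

lemma smult_pt: "x \<in> carrier V \<Longrightarrow> y \<in> carrier W \<Longrightarrow>
    c \<odot>\<^bsub>T\<^esub> pt x y = K +>\<^bsub>Fr\<^esub> Poly_Mapping.single (x, y) c"
proof -
  assume xy: "x \<in> carrier V" "y \<in> carrier W"
  have "Poly_Mapping.map ((*) c) (Poly_Mapping.single (x, y) 1) = Poly_Mapping.single (x, y) c"
    by (rule poly_mapping_eqI) (simp add: lookup_single when_def)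
  moreover have "Poly_Mapping.single (x, y) 1 \<in> carrier Fr" using xy by (intro single_carrier) auto
  ultimately show ?thesis unfolding pure_tensor_def by (subst Q(4)) simp_all
qed

lemma add_carrier: "z \<in> carrier Fr \<Longrightarrow> z' \<in> carrier Fr \<Longrightarrow> z + z' \<in> carrier Fr"
  using vs_facts(3)[OF vectorspace_free_space] by (metis free_space_simps(3))

lemma pt_bilinear: "bilinear_map V W T pt"
  unfolding bilinear_map_def
proof (intro ballI conjI allI)
  fix x y assume x: "x \<in> carrier V" and y: "y \<in> carrier W"
  show "pt x y \<in> carrier T" using x y by (rule pt_closed)
  have add: "pt x1 y1 = pt x2 y2 \<oplus>\<^bsub>T\<^esub> pt x3 y3"
    if "Poly_Mapping.single (x1, y1) 1 - Poly_Mapping.single (x2, y2) 1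
       - Poly_Mapping.single (x3, y3) 1 \<in> tensor_relations V W"
      "x2 \<in> carrier V" "x3 \<in> carrier V" "y2 \<in> carrier W" "y3 \<in> carrier W" for x1 x2 x3 y1 y2 y3
  proof -
    have c: "Poly_Mapping.single (x2, y2) 1 \<in> carrier Fr" "Poly_Mapping.single (x3, y3) 1 \<in> carrier Fr"
      using that by (auto intro!: single_carrier simp del: free_space_simps(1))
    show ?thesis unfolding pure_tensor_def Q(3)[OF c] free_space_simps(3)
      by (rule coset_eqI[OF _ add_carrier[OF c]])
        (use relations_K[OF that(1)] in \<open>simp add: algebra_simps\<close>)
  qed
  show "pt (x \<oplus>\<^bsub>V\<^esub> x') y = pt x y \<oplus>\<^bsub>T\<^esub> pt x' y" if "x' \<in> carrier V" for x'
    by (rule add) (use x y that in \<open>auto simp: tensor_relations_def\<close>)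
  show "pt x (y \<oplus>\<^bsub>W\<^esub> y') = pt x y \<oplus>\<^bsub>T\<^esub> pt x y'" if "y' \<in> carrier W" for y'
    by (rule add) (use x y that in \<open>auto simp: tensor_relations_def\<close>)
  fix c
  show "pt (c \<odot>\<^bsub>V\<^esub> x) y = c \<odot>\<^bsub>T\<^esub> pt x y"
    unfolding smult_pt[OF x y] unfolding pure_tensor_def
    by (rule coset_eqI[OF relations_K single_carrier]) (use x y in \<open>auto simp: tensor_relations_def\<close>)
  show "pt x (c \<odot>\<^bsub>W\<^esub> y) = c \<odot>\<^bsub>T\<^esub> pt x y"
    unfolding smult_pt[OF x y] unfolding pure_tensor_def
    by (rule coset_eqI[OF relations_K single_carrier]) (use x y in \<open>auto simp: tensor_relations_def\<close>)
qed

text \<open>The induction runs over the support of a representative. The scalar stays in the base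
  case because the free space is additively generated by the elements \<open>single p c\<close>, so
  that sums suffice.\<close>

lemma tensor_induct [consumes 1, case_names pure add]:
  assumes X: "X \<in> carrier T"
    and pure: "\<And>c x y. x \<in> carrier V \<Longrightarrow> y \<in> carrier W \<Longrightarrow> P (c \<odot>\<^bsub>T\<^esub> pt x y)"
    and add: "\<And>X Y. X \<in> carrier T \<Longrightarrow> Y \<in> carrier T \<Longrightarrow> P X \<Longrightarrow> P Y \<Longrightarrow> P (X \<oplus>\<^bsub>T\<^esub> Y)"
  shows "P X"
proof -
  have zero: "P \<zero>\<^bsub>T\<^esub>"
    using pure[OF V(4) W(4), of 0] vs_facts(10)[OF tensor_vs pt_closed[OF V(4) W(4)]] by simp
  have "z \<in> carrier Fr \<longrightarrow> P (K +>\<^bsub>Fr\<^esub> z)" for z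
  proof (induct z rule: update_induct)
    case const thus ?case using zero by (simp add: Q(5))
  next
    case (update f a b)
    show ?case
    proof
      assume c: "Poly_Mapping.update a b f \<in> carrier Fr"
      have eq: "Poly_Mapping.update a b f = f + Poly_Mapping.single a b"
        using update(1) by (intro poly_mapping_eqI)
          (auto simp: lookup_add lookup_single when_def in_keys_iff lookup_update)
      have a: "a \<in> carrier V \<times> carrier W" and f: "f \<in> carrier Fr"
        using c update(1,2) unfolding free_space_simps mem_Collect_eq keys_subset_iff lookup_update in_keys_iff
        by (metis (full_types))+
      note s = single_carrier[OF a, of b]
      have m: "K +>\<^bsub>Fr\<^esub> f \<in> carrier T" "K +>\<^bsub>Fr\<^esub> Poly_Mapping.single a b \<in> carrier T"
        unfolding Q(2) using f s by blast+
      have "P (K +>\<^bsub>Fr\<^esub> Poly_Mapping.single a b)"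
        using pure[of "fst a" "snd a" b] smult_pt[of "fst a" "snd a" b] a by auto
      hence "P ((K +>\<^bsub>Fr\<^esub> f) \<oplus>\<^bsub>T\<^esub> (K +>\<^bsub>Fr\<^esub> Poly_Mapping.single a b))"
        using update(3) f m by (intro add) auto
      thus "P (K +>\<^bsub>Fr\<^esub> Poly_Mapping.update a b f)" unfolding Q(3)[OF f s] eq by simp
    qed
  qed
  thus ?thesis using X unfolding Q(2) by blast
qed

context
  fixes U :: "('a, 'd) module" and \<beta> :: "'b \<Rightarrow> 'c \<Rightarrow> 'd"
  assumes vsU: "vectorspace class_ring U" and \<beta>: "bilinear_map V W U \<beta>"
begin

lemmas U = vs_facts[OF vsU]

text \<open>To compare sums over the supports of \<open>x\<close>, \<open>y\<close> and
  \<open>x + y\<close>, all of them are enlarged to one finite set; the added coefficients are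
  0.\<close>

lemma free_lift_superset:
  assumes "finite A" "Poly_Mapping.keys z \<subseteq> A" "A \<subseteq> carrier V \<times> carrier W"
  shows "free_lift U \<beta> z = (\<Oplus>\<^bsub>U\<^esub>p\<in>A. Poly_Mapping.lookup z p \<odot>\<^bsub>U\<^esub> \<beta> (fst p) (snd p))"
proof -
  interpret U: vectorspace class_ring U by (rule vsU)
  have cl: "\<beta> (fst p) (snd p) \<in> carrier U" if "p \<in> A" for p
    using that assms by (auto intro!: bilinear_mapD(1)[OF \<beta>])
  show ?thesis unfolding free_lift_def
  proof (rule U.add.finprod_mono_neutral_cong_left)
    show "finite A" by fact
    show "Poly_Mapping.keys z \<subseteq> A" by fact
    fix i assume "i \<in> A - Poly_Mapping.keys z"
    thus "Poly_Mapping.lookup z i \<odot>\<^bsub>U\<^esub> \<beta> (fst i) (snd i) = \<zero>\<^bsub>U\<^esub>"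
      using cl U(10) by (simp add: in_keys_iff)
  qed (use cl U(5) in auto)
qed

lemma free_lift_hom: "free_lift U \<beta> \<in> LinearCombinations.module_hom class_ring Fr U"
proof -
  interpret U: vectorspace class_ring U by (rule vsU)
  have cl: "\<beta> (fst p) (snd p) \<in> carrier U" if "p \<in> carrier V \<times> carrier W" for p
    using that by (auto intro!: bilinear_mapD(1)[OF \<beta>])
  show ?thesis
  proof (rule module_homI)
    fix x assume x: "x \<in> carrier Fr"
    thus "free_lift U \<beta> x \<in> carrier U"
      unfolding free_lift_def by (intro U.finsum_closed) (auto intro!: U(5) cl)
    fix y assume y: "y \<in> carrier Fr"
    let ?A = "Poly_Mapping.keys x \<union> Poly_Mapping.keys y"
    have A: "finite ?A" "?A \<subseteq> carrier V \<times> carrier W" using x y by auto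
    have k: "Poly_Mapping.keys (x + y) \<subseteq> ?A" by (rule keys_add)
    show "free_lift U \<beta> (x \<oplus>\<^bsub>Fr\<^esub> y) = free_lift U \<beta> x \<oplus>\<^bsub>U\<^esub> free_lift U \<beta> y"
      unfolding free_space_simps free_lift_superset[OF A(1) k A(2)]
        free_lift_superset[OF A(1) Un_upper1 A(2)] free_lift_superset[OF A(1) Un_upper2 A(2)]
      by (subst U.finsum_addf[symmetric], use A cl U(5) in blast, use A cl U(5) in blast,
          rule U.finsum_cong') (use A(2) in \<open>auto simp: lookup_add U(3,5,7) bilinear_mapD(1)[OF \<beta>] subset_iff\<close>)
  next
    fix c x assume x: "x \<in> carrier Fr"
    let ?A = "Poly_Mapping.keys x"
    have A: "finite ?A" "?A \<subseteq> carrier V \<times> carrier W" using x by auto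
    show "free_lift U \<beta> (c \<odot>\<^bsub>Fr\<^esub> x) = c \<odot>\<^bsub>U\<^esub> free_lift U \<beta> x"
      unfolding free_space_simps free_lift_superset[OF A(1) keys_map_times A(2)]
        free_lift_superset[OF A(1) order_refl A(2)]
      by (subst U.finsum_smult_ldistr, simp, simp, use A cl U(5) in blast,
          rule U.finsum_cong') (use A(2) in \<open>auto simp: U(5,8) bilinear_mapD(1)[OF \<beta>] subset_iff\<close>)
  qed
qed

lemma free_lift_single:
  assumes "x \<in> carrier V" "y \<in> carrier W"
  shows "free_lift U \<beta> (Poly_Mapping.single (x, y) c) = c \<odot>\<^bsub>U\<^esub> \<beta> x y"
proof -
  interpret U: vectorspace class_ring U by (rule vsU)
  show ?thesis using free_lift_superset[of "{(x,y)}" "Poly_Mapping.single (x, y) c"] assms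
      bilinear_mapD(1)[OF \<beta> assms] U(5)
    by (simp add: U.finsum_insert)
qed

lemma free_lift_minus:
  assumes "a \<in> carrier Fr" "b \<in> carrier Fr" "free_lift U \<beta> a = free_lift U \<beta> b"
  shows "free_lift U \<beta> (a - b) = \<zero>\<^bsub>U\<^esub>"
proof -
  interpret U: vectorspace class_ring U by (rule vsU)
  have c: "a - b \<in> carrier Fr" using assms(1,2)
    by (auto simp: in_keys_iff lookup_minus subset_iff; metis diff_0_right)
  have "free_lift U \<beta> (a - b \<oplus>\<^bsub>Fr\<^esub> b) = free_lift U \<beta> (a - b) \<oplus>\<^bsub>U\<^esub> free_lift U \<beta> b"
    by (rule module_homD(2)[OF free_lift_hom c assms(2)])
  hence "free_lift U \<beta> b = free_lift U \<beta> (a - b) \<oplus>\<^bsub>U\<^esub> free_lift U \<beta> b" using assms(3) by simp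
  thus ?thesis using module_homD(1)[OF free_lift_hom] c assms(2)
    by (metis U.add.r_cancel_one' )
qed

lemma free_lift_K: "z \<in> K \<Longrightarrow> free_lift U \<beta> z = \<zero>\<^bsub>U\<^esub>"
  unfolding tensor_kernel_def
proof (rule linear_vanish_span[OF vectorspace_free_space vsU free_lift_hom relations_subset])
  note B = bilinear_mapD[OF \<beta>]
  have s: "free_lift U \<beta> (Poly_Mapping.single (x, y) 1 + Poly_Mapping.single (x', y') 1) = \<beta> x y \<oplus>\<^bsub>U\<^esub> \<beta> x' y'"
    if "x \<in> carrier V" "y \<in> carrier W" "x' \<in> carrier V" "y' \<in> carrier W" for x x' y y'
    using module_homD(2)[OF free_lift_hom single_carrier single_carrier, of "(x,y)" "(x',y')" 1 1] that
    by (simp add: free_lift_single U(9) B(1))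
  fix r assume "r \<in> tensor_relations V W"
  then consider
    (1) x x' y where "x \<in> carrier V" "x' \<in> carrier V" "y \<in> carrier W"
      "r = Poly_Mapping.single (x \<oplus>\<^bsub>V\<^esub> x', y) 1 - (Poly_Mapping.single (x, y) 1 + Poly_Mapping.single (x', y) 1)"
  | (2) x y y' where "x \<in> carrier V" "y \<in> carrier W" "y' \<in> carrier W"
      "r = Poly_Mapping.single (x, y \<oplus>\<^bsub>W\<^esub> y') 1 - (Poly_Mapping.single (x, y) 1 + Poly_Mapping.single (x, y') 1)"
  | (3) c x y where "x \<in> carrier V" "y \<in> carrier W"
      "r = Poly_Mapping.single (c \<odot>\<^bsub>V\<^esub> x, y) 1 - Poly_Mapping.single (x, y) c"
  | (4) c x y where "x \<in> carrier V" "y \<in> carrier W"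
      "r = Poly_Mapping.single (x, c \<odot>\<^bsub>W\<^esub> y) 1 - Poly_Mapping.single (x, y) c"
    unfolding tensor_relations_def diff_diff_eq by blast
  thus "free_lift U \<beta> r = \<zero>\<^bsub>U\<^esub>"
  proof cases
    case 1 show ?thesis unfolding 1(4)
      by (rule free_lift_minus) (use 1 in \<open>auto intro!: single_carrier add_carrier V W simp: s free_lift_single V(3) U(3,9) B simp del: free_space_simps(1)\<close>)
  next
    case 2 show ?thesis unfolding 2(4)
      by (rule free_lift_minus) (use 2 in \<open>auto intro!: single_carrier add_carrier V W simp: s free_lift_single W(3) U(3,9) B simp del: free_space_simps(1)\<close>)
  next
    case 3 show ?thesis unfolding 3(3)
      by (rule free_lift_minus) (use 3 in \<open>auto intro!: single_carrier add_carrier V W simp: s free_lift_single V(5) U(5,9) B simp del: free_space_simps(1)\<close>)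
  next
    case 4 show ?thesis unfolding 4(3)
      by (rule free_lift_minus) (use 4 in \<open>auto intro!: single_carrier add_carrier V W simp: s free_lift_single W(5) U(5,9) B simp del: free_space_simps(1)\<close>)
  qed
qed

text \<open>The representative picked by \<open>SOME\<close> differs from \<open>z\<close> by an
  element of the kernel, where the lift vanishes.\<close>

lemma tensor_lift_coset:
  assumes z: "z \<in> carrier Fr"
  shows "tensor_lift V W U \<beta> (K +>\<^bsub>Fr\<^esub> z) = free_lift U \<beta> z"
proof -
  interpret U: vectorspace class_ring U by (rule vsU)
  let ?z = "SOME z'. z' \<in> K +>\<^bsub>Fr\<^esub> z"
  have "?z \<in> K +>\<^bsub>Fr\<^esub> z" using Q(6)[OF z] by (rule someI)
  then obtain k where k: "k \<in> K" "?z = k + z" by (auto simp: a_r_coset_def')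
  have kc: "k \<in> carrier Fr" using k(1) submodule.subset[OF K_submodule] by blast
  have "free_lift U \<beta> ?z = free_lift U \<beta> k \<oplus>\<^bsub>U\<^esub> free_lift U \<beta> z"
    using module_homD(2)[OF free_lift_hom kc z] k(2) by simp
  also have "\<dots> = free_lift U \<beta> z"
    using free_lift_K[OF k(1)] module_homD(1)[OF free_lift_hom z] by simp
  finally show ?thesis by (simp add: tensor_lift_def free_lift_def Let_def)
qed

lemma tensor_lift_hom: "tensor_lift V W U \<beta> \<in> LinearCombinations.module_hom class_ring T U"
proof (rule module_homI)
  fix X assume "X \<in> carrier T"
  then obtain z where z: "z \<in> carrier Fr" "X = K +>\<^bsub>Fr\<^esub> z" unfolding Q(2) by blast
  show "tensor_lift V W U \<beta> X \<in> carrier U"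
    unfolding z(2) tensor_lift_coset[OF z(1)] by (rule module_homD(1)[OF free_lift_hom z(1)])
  show "tensor_lift V W U \<beta> (c \<odot>\<^bsub>T\<^esub> X) = c \<odot>\<^bsub>U\<^esub> tensor_lift V W U \<beta> X" for c
    unfolding z(2) Q(4)[OF z(1)] tensor_lift_coset[OF z(1)]
      tensor_lift_coset[OF vs_facts(5)[OF vectorspace_free_space z(1)]]
    by (rule module_homD(3)[OF free_lift_hom z(1)])
  fix Y assume "Y \<in> carrier T"
  then obtain y where y: "y \<in> carrier Fr" "Y = K +>\<^bsub>Fr\<^esub> y" unfolding Q(2) by blast
  show "tensor_lift V W U \<beta> (X \<oplus>\<^bsub>T\<^esub> Y) = tensor_lift V W U \<beta> X \<oplus>\<^bsub>U\<^esub> tensor_lift V W U \<beta> Y"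
    unfolding z(2) y(2) Q(3)[OF z(1) y(1)] tensor_lift_coset[OF z(1)] tensor_lift_coset[OF y(1)]
      tensor_lift_coset[OF vs_facts(3)[OF vectorspace_free_space z(1) y(1)]]
    by (rule module_homD(2)[OF free_lift_hom z(1) y(1)])
qed

lemma tensor_lift_pt:
  assumes "x \<in> carrier V" "y \<in> carrier W"
  shows "tensor_lift V W U \<beta> (pt x y) = \<beta> x y"
  unfolding pure_tensor_def using assms
  by (subst tensor_lift_coset[OF single_carrier])
    (auto simp: free_lift_single U(9) bilinear_mapD(1)[OF \<beta>])

end

lemma hom_eqI:
  fixes U :: "('a, 'd) module"
  assumes f: "f \<in> LinearCombinations.module_hom class_ring T U"
    and g: "g \<in> LinearCombinations.module_hom class_ring T U"
    and eq: "\<And>x y. x \<in> carrier V \<Longrightarrow> y \<in> carrier W \<Longrightarrow> f (pt x y) = g (pt x y)"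
    and X: "X \<in> carrier T"
  shows "f X = g X"
  using X by (induct rule: tensor_induct)
    (simp_all add: module_homD[OF f] module_homD[OF g] eq pt_closed)

end

section \<open>Coordinates, Kronecker products of vectors, dimension of the tensor product\<close>

abbreviation coord_space :: "nat \<Rightarrow> ('a::field, 'a vec) module" where
  "coord_space n \<equiv> module_vec TYPE('a) n"

lemma coord_space_simps:
  "carrier (coord_space n) = carrier_vec n"
  "x \<oplus>\<^bsub>coord_space n\<^esub> y = x + y"
  "c \<odot>\<^bsub>coord_space n\<^esub> x = c \<cdot>\<^sub>v x"
  "\<zero>\<^bsub>coord_space n\<^esub> = 0\<^sub>v n"
  by (simp_all add: module_vec_simps)

lemmas coord_space_vs = vec_vs

lemma linear_isosI:
  fixes V :: "('a::field, 'b) module" and W :: "('a, 'c) module"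
  assumes f: "f \<in> LinearCombinations.module_hom class_ring V W"
    and g: "\<And>y. y \<in> carrier W \<Longrightarrow> g y \<in> carrier V"
    and gf: "\<And>x. x \<in> carrier V \<Longrightarrow> g (f x) = x"
    and fg: "\<And>y. y \<in> carrier W \<Longrightarrow> f (g y) = y"
  shows "f \<in> linear_isos V W"
proof -
  have "bij_betw f (carrier V) (carrier W)"
    by (rule bij_betw_byWitness[of _ g]) (use g gf fg module_homD(1)[OF f] in auto)
  thus ?thesis using f by (simp add: linear_isos_def)
qed

lemma linear_isosD:
  fixes V :: "('a::field, 'b) module" and W :: "('a, 'c) module"
  assumes "f \<in> linear_isos V W"
  shows "f \<in> LinearCombinations.module_hom class_ring V W"
    and "bij_betw f (carrier V) (carrier W)"
    and "\<And>x. x \<in> carrier V \<Longrightarrow> f x \<in> carrier W"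
    and "\<And>x y. x \<in> carrier V \<Longrightarrow> y \<in> carrier V \<Longrightarrow> f (x \<oplus>\<^bsub>V\<^esub> y) = f x \<oplus>\<^bsub>W\<^esub> f y"
    and "\<And>c x. x \<in> carrier V \<Longrightarrow> f (c \<odot>\<^bsub>V\<^esub> x) = c \<odot>\<^bsub>W\<^esub> f x"
    and "inj_on f (carrier V)" and "f ` carrier V = carrier W"
proof -
  show f: "f \<in> LinearCombinations.module_hom class_ring V W"
    and b: "bij_betw f (carrier V) (carrier W)"
    using assms by (simp_all add: linear_isos_def)
  show "\<And>x. x \<in> carrier V \<Longrightarrow> f x \<in> carrier W"
     "\<And>x y. x \<in> carrier V \<Longrightarrow> y \<in> carrier V \<Longrightarrow> f (x \<oplus>\<^bsub>V\<^esub> y) = f x \<oplus>\<^bsub>W\<^esub> f y"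
     "\<And>c x. x \<in> carrier V \<Longrightarrow> f (c \<odot>\<^bsub>V\<^esub> x) = c \<odot>\<^bsub>W\<^esub> f x"
    using module_homD[OF f] by auto
  show "inj_on f (carrier V)" "f ` carrier V = carrier W"
    using b by (auto simp: bij_betw_def)
qed

lemma linear_isos_inv_into:
  fixes V :: "('a::field, 'b) module" and W :: "('a, 'c) module"
  assumes V: "vectorspace class_ring V" and f: "f \<in> linear_isos V W"
  shows "inv_into (carrier V) f \<in> linear_isos W V"
proof (rule linear_isosI[of _ _ _ f])
  note F = linear_isosD[OF f]
  let ?g = "inv_into (carrier V) f"
  have g: "?g y \<in> carrier V" "f (?g y) = y" if "y \<in> carrier W" for y
    using that F(7) by (auto intro: inv_into_into f_inv_into_f)
  have gf: "?g (f x) = x" if "x \<in> carrier V" for x using inv_into_f_f[OF F(6) that] .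
  show "?g \<in> LinearCombinations.module_hom class_ring W V"
  proof (rule module_homI)
    fix x y assume xy: "x \<in> carrier W" "y \<in> carrier W"
    have "?g (f (?g x \<oplus>\<^bsub>V\<^esub> ?g y)) = ?g x \<oplus>\<^bsub>V\<^esub> ?g y" using g xy vs_facts(3)[OF V] by (intro gf) auto
    thus "?g (x \<oplus>\<^bsub>W\<^esub> y) = ?g x \<oplus>\<^bsub>V\<^esub> ?g y" using F(4) g xy by simp
  next
    fix c x assume x: "x \<in> carrier W"
    have "?g (f (c \<odot>\<^bsub>V\<^esub> ?g x)) = c \<odot>\<^bsub>V\<^esub> ?g x" using g x vs_facts(5)[OF V] by (intro gf) auto
    thus "?g (c \<odot>\<^bsub>W\<^esub> x) = c \<odot>\<^bsub>V\<^esub> ?g x" using F(5) g x by simp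
  qed (use g in auto)
qed (use linear_isosD[OF f] in \<open>auto intro: f_inv_into_f\<close>)

lemma module_hom_comp:
  fixes V :: "('a::field, 'b) module" and W :: "('a, 'c) module" and U :: "('a, 'd) module"
  assumes f: "f \<in> LinearCombinations.module_hom class_ring V W"
    and g: "g \<in> LinearCombinations.module_hom class_ring W U"
  shows "(\<lambda>x. g (f x)) \<in> LinearCombinations.module_hom class_ring V U"
  by (rule module_homI) (simp_all add: module_homD[OF f] module_homD[OF g])

lemma linear_isos_comp:
  fixes V :: "('a::field, 'b) module" and W :: "('a, 'c) module" and U :: "('a, 'd) module"
  assumes f: "f \<in> linear_isos V W" and g: "g \<in> linear_isos W U"
  shows "(\<lambda>x. g (f x)) \<in> linear_isos V U"
  using module_hom_comp[OF linear_isosD(1)[OF f] linear_isosD(1)[OF g]]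
    bij_betw_trans[OF linear_isosD(2)[OF f] linear_isosD(2)[OF g]]
  by (simp add: linear_isos_def comp_def)

lemma linear_isos_vectorspace:
  fixes V :: "('a::field, 'b) module" and W :: "('a, 'c) module"
  assumes V: "vectorspace class_ring V" and f: "f \<in> linear_isos V W" and z: "f \<zero>\<^bsub>V\<^esub> = \<zero>\<^bsub>W\<^esub>"
  shows "vectorspace class_ring W"
  by (rule vectorspace_image[OF V linear_isosD(7)[OF f]]) (use linear_isosD[OF f] z in auto)

lemma linear_isos_dim:
  fixes V :: "('a::field, 'b) module" and W :: "('a, 'c) module"
  assumes V: "vectorspace class_ring V" and W: "vectorspace class_ring W"
    and f: "f \<in> linear_isos V W" and fd: "vectorspace.fin_dim class_ring V"
  shows "vectorspace.fin_dim class_ring W" "vectorspace.dim class_ring W = vectorspace.dim class_ring V"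
proof -
  interpret linear_map class_ring V W f
    by (intro linear_map.intro mod_hom.intro mod_hom_axioms.intro vs_module V W linear_isosD(1)[OF f])
  show "vectorspace.fin_dim class_ring W" by (rule surj_fin_dim[OF fd linear_isosD(7)[OF f]])
  show "vectorspace.dim class_ring W = vectorspace.dim class_ring V"
    using dim_eq[OF fd linear_isosD(6,7)[OF f]] by simp
qed

definition basis_map :: "('a::field, 'b) module \<Rightarrow> (nat \<Rightarrow> 'b) \<Rightarrow> nat \<Rightarrow> 'a vec \<Rightarrow> 'b" where
  "basis_map V e n x = (\<Oplus>\<^bsub>V\<^esub>i\<in>{..<n}. x $ i \<odot>\<^bsub>V\<^esub> e i)"

lemma basis_map_hom:
  fixes V :: "('a::field, 'b) module"
  assumes V: "vectorspace class_ring V" and e: "\<And>i. i < n \<Longrightarrow> e i \<in> carrier V"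
  shows "basis_map V e n \<in> LinearCombinations.module_hom class_ring (coord_space n) V"
proof -
  interpret V: vectorspace class_ring V by (rule V)
  note F = vs_facts[OF V]
  show ?thesis
  proof (rule module_homI, unfold coord_space_simps basis_map_def)
    fix x y :: "'a vec" and c assume x: "x \<in> carrier_vec n" and y: "y \<in> carrier_vec n"
    show "(\<Oplus>\<^bsub>V\<^esub>i\<in>{..<n}. x $ i \<odot>\<^bsub>V\<^esub> e i) \<in> carrier V"
      using F(5) e by (intro V.finsum_closed) auto
    show "(\<Oplus>\<^bsub>V\<^esub>i\<in>{..<n}. (x + y) $ i \<odot>\<^bsub>V\<^esub> e i) =
       (\<Oplus>\<^bsub>V\<^esub>i\<in>{..<n}. x $ i \<odot>\<^bsub>V\<^esub> e i) \<oplus>\<^bsub>V\<^esub> (\<Oplus>\<^bsub>V\<^esub>i\<in>{..<n}. y $ i \<odot>\<^bsub>V\<^esub> e i)"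
    proof -
      have "(\<Oplus>\<^bsub>V\<^esub>i\<in>{..<n}. (x + y) $ i \<odot>\<^bsub>V\<^esub> e i) =
          (\<Oplus>\<^bsub>V\<^esub>i\<in>{..<n}. x $ i \<odot>\<^bsub>V\<^esub> e i \<oplus>\<^bsub>V\<^esub> y $ i \<odot>\<^bsub>V\<^esub> e i)"
        by (rule V.finsum_cong') (use e x y in \<open>auto simp: F(3,5,7)\<close>)
      also have "\<dots> = (\<Oplus>\<^bsub>V\<^esub>i\<in>{..<n}. x $ i \<odot>\<^bsub>V\<^esub> e i) \<oplus>\<^bsub>V\<^esub> (\<Oplus>\<^bsub>V\<^esub>i\<in>{..<n}. y $ i \<odot>\<^bsub>V\<^esub> e i)"
        by (rule V.finsum_addf) (use F(5) e in auto)
      finally show ?thesis .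
    qed
    show "(\<Oplus>\<^bsub>V\<^esub>i\<in>{..<n}. (c \<cdot>\<^sub>v x) $ i \<odot>\<^bsub>V\<^esub> e i) = c \<odot>\<^bsub>V\<^esub> (\<Oplus>\<^bsub>V\<^esub>i\<in>{..<n}. x $ i \<odot>\<^bsub>V\<^esub> e i)"
    proof -
      have "(\<Oplus>\<^bsub>V\<^esub>i\<in>{..<n}. (c \<cdot>\<^sub>v x) $ i \<odot>\<^bsub>V\<^esub> e i) = (\<Oplus>\<^bsub>V\<^esub>i\<in>{..<n}. c \<odot>\<^bsub>V\<^esub> (x $ i \<odot>\<^bsub>V\<^esub> e i))"
        by (rule V.finsum_cong') (use e x in \<open>auto simp: F(5,8)\<close>)
      also have "\<dots> = c \<odot>\<^bsub>V\<^esub> (\<Oplus>\<^bsub>V\<^esub>i\<in>{..<n}. x $ i \<odot>\<^bsub>V\<^esub> e i)"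
        by (rule V.finsum_smult_ldistr[symmetric]) (use F(5) e in auto)
      finally show ?thesis .
    qed
  qed
qed

lemma basis_map_unit:
  fixes V :: "('a::field, 'b) module"
  assumes V: "vectorspace class_ring V" and e: "\<And>i. i < n \<Longrightarrow> e i \<in> carrier V" and i: "i < n"
  shows "basis_map V e n (unit_vec n i) = e i"
proof -
  interpret V: vectorspace class_ring V by (rule V)
  note F = vs_facts[OF V]
  have "basis_map V e n (unit_vec n i) = (\<Oplus>\<^bsub>V\<^esub>j\<in>{..<n}. if i = j then e j else \<zero>\<^bsub>V\<^esub>)"
    unfolding basis_map_def by (rule V.finsum_cong') (auto simp: F(4,9,10) e i)
  also have "\<dots> = e i" using V.finsum_singleton[of i "{..<n}" e] i e by auto
  finally show ?thesis .
qed

lemma coord_space_hom_eq_basis_map: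
  fixes V :: "('a::field, 'b) module"
  assumes V: "vectorspace class_ring V"
    and f: "f \<in> LinearCombinations.module_hom class_ring (coord_space n) V"
    and x: "x \<in> carrier_vec n"
  shows "f x = basis_map V (\<lambda>i. f (unit_vec n i)) n x"
proof -
  interpret V: vectorspace class_ring V by (rule V)
  interpret C: vec_space "TYPE('a)" n .
  note F = vs_facts[OF V]
  have u: "f (unit_vec n i) \<in> carrier V" if "i < n" for i
    using module_homD(1)[OF f] by (simp add: coord_space_simps)
  \<comment> \<open>Truncating \<open>x\<close> after \<open>k\<close> coordinates turns the sum
    over the basis into an induction on \<open>k\<close>.\<close>
  have "k \<le> n \<Longrightarrow> f (vec n (\<lambda>i. if i < k then x $ i else 0)) =
      (\<Oplus>\<^bsub>V\<^esub>i\<in>{..<k}. x $ i \<odot>\<^bsub>V\<^esub> f (unit_vec n i))" for k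
  proof (induct k)
    case 0
    have "vec n (\<lambda>i. if i < 0 then x $ i else 0) = 0\<^sub>v n" by auto
    thus ?case using module_hom_zero[OF coord_space_vs V f] by (simp add: coord_space_simps)
  next
    case (Suc k)
    have eq: "vec n (\<lambda>i. if i < Suc k then x $ i else 0)
        = vec n (\<lambda>i. if i < k then x $ i else 0) + x $ k \<cdot>\<^sub>v unit_vec n k"
      using Suc(2) by (intro eq_vecI) (auto simp: less_Suc_eq)
    have "f (vec n (\<lambda>i. if i < Suc k then x $ i else 0)) =
      f (vec n (\<lambda>i. if i < k then x $ i else 0)) \<oplus>\<^bsub>V\<^esub> x $ k \<odot>\<^bsub>V\<^esub> f (unit_vec n k)"
      unfolding eq using module_homD(2,3)[OF f, unfolded coord_space_simps] by simp
    also have "\<dots> = x $ k \<odot>\<^bsub>V\<^esub> f (unit_vec n k) \<oplus>\<^bsub>V\<^esub> (\<Oplus>\<^bsub>V\<^esub>i\<in>{..<k}. x $ i \<odot>\<^bsub>V\<^esub> f (unit_vec n i))"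
      using Suc u F(5) by (subst Suc(1)) (auto intro!: V.a_comm V.finsum_closed)
    also have "\<dots> = (\<Oplus>\<^bsub>V\<^esub>i\<in>{..<Suc k}. x $ i \<odot>\<^bsub>V\<^esub> f (unit_vec n i))"
      unfolding lessThan_Suc using Suc(2) u F(5) by (subst V.finsum_insert) auto
    finally show ?case .
  qed
  moreover have "vec n (\<lambda>i. if i < n then x $ i else 0) = x" using x by (intro eq_vecI) auto
  ultimately show ?thesis unfolding basis_map_def by (metis order_refl)
qed

lemma coord_space_hom_eqI:
  fixes V :: "('a::field, 'b) module"
  assumes V: "vectorspace class_ring V"
    and f: "f \<in> LinearCombinations.module_hom class_ring (coord_space n) V"
    and g: "g \<in> LinearCombinations.module_hom class_ring (coord_space n) V"
    and eq: "\<And>i. i < n \<Longrightarrow> f (unit_vec n i) = g (unit_vec n i)"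
    and x: "x \<in> carrier_vec n"
  shows "f x = g x"
proof -
  interpret V: vectorspace class_ring V by (rule V)
  have "basis_map V (\<lambda>i. f (unit_vec n i)) n x = basis_map V (\<lambda>i. g (unit_vec n i)) n x"
    unfolding basis_map_def
    by (rule V.finsum_cong') (auto simp: eq intro!: vs_facts(5)[OF V] module_homD(1)[OF g, unfolded coord_space_simps])
  thus ?thesis using coord_space_hom_eq_basis_map[OF V f x] coord_space_hom_eq_basis_map[OF V g x] by simp
qed

text \<open>The basis criterion provides unique coefficient functions on the set of basis vectors;
  \<open>ind\<close> turns them into coordinates, which is where the absence of repetitions in the
  list is used.\<close>

lemma basis_map_iso:
  fixes V :: "('a::field, 'b) module"
  assumes V: "vectorspace class_ring V" and d: "distinct vs"
    and b: "vectorspace.basis class_ring V (set vs)"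
  shows "basis_map V ((!) vs) (length vs) \<in> linear_isos (coord_space (length vs)) V"
proof -
  interpret V: vectorspace class_ring V by (rule V)
  note F = vs_facts[OF V]
  let ?n = "length vs" let ?f = "basis_map V ((!) vs) ?n"
  have sub: "set vs \<subseteq> carrier V" using b by (simp add: V.basis_def)
  have e: "vs ! i \<in> carrier V" if "i < ?n" for i using sub that by auto
  have crit: "\<exists>!a. a \<in> set vs \<rightarrow>\<^sub>E carrier class_ring \<and> V.lincomb a (set vs) = v" if "v \<in> carrier V" for v
    using V.basis_criterion[OF _ sub] b that by auto
  have lc: "V.lincomb a (set vs) = (\<Oplus>\<^bsub>V\<^esub>i\<in>{..<?n}. a (vs ! i) \<odot>\<^bsub>V\<^esub> vs ! i)" for a
  proof -
    have "set vs = (!) vs ` {..<?n}" by (metis atLeast_upt list.set_map map_nth)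
    thus ?thesis unfolding V.lincomb_def using d e F(5)
      by (subst V.finsum_reindex[symmetric]) (auto simp: inj_on_def nth_eq_iff_index_eq)
  qed
  define ind where "ind v = (THE i. i < ?n \<and> vs ! i = v)" for v
  have ind: "ind (vs ! i) = i" if "i < ?n" for i
    unfolding ind_def using d that by (intro the_equality) (auto simp: nth_eq_iff_index_eq)
  have fx: "?f x = V.lincomb (\<lambda>v\<in>set vs. x $ ind v) (set vs)" for x
    unfolding basis_map_def lc by (rule V.finsum_cong') (auto simp: ind F(5) e)
  have hom: "?f \<in> LinearCombinations.module_hom class_ring (coord_space ?n) V"
    by (rule basis_map_hom[OF V e])
  have "inj_on ?f (carrier_vec ?n)"
  proof (rule inj_onI)
    fix x y assume x: "x \<in> carrier_vec ?n" and y: "y \<in> carrier_vec ?n" and eq: "?f x = ?f y"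
    have m: "?f x \<in> carrier V" using module_homD(1)[OF hom] x by (simp add: coord_space_simps)
    have "(\<lambda>v\<in>set vs. x $ ind v) = (\<lambda>v\<in>set vs. y $ ind v)"
      using crit[OF m] eq unfolding fx by (elim ex1E) (metis (no_types, lifting) UNIV_I partial_object.select_convs(1) restrict_PiE_iff)
    hence "x $ i = y $ i" if "i < ?n" for i using ind[OF that] that by (metis nth_mem restrict_apply)
    thus "x = y" using x y by auto
  qed
  moreover have "?f ` carrier_vec ?n = carrier V"
  proof
    show "?f ` carrier_vec ?n \<subseteq> carrier V"
      using module_homD(1)[OF hom] by (auto simp: coord_space_simps)
    show "carrier V \<subseteq> ?f ` carrier_vec ?n"
    proof
      fix v assume "v \<in> carrier V"
      then obtain a where "V.lincomb a (set vs) = v" using crit by blast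
      hence "?f (vec ?n (\<lambda>i. a (vs ! i))) = v"
        unfolding lc[symmetric] by (auto simp: basis_map_def lc intro!: V.finsum_cong' F(5) e)
      thus "v \<in> ?f ` carrier_vec ?n" by (metis imageI vec_carrier)
    qed
  qed
  ultimately show ?thesis using hom by (simp add: linear_isos_def bij_betw_def coord_space_simps)
qed

lemma ex_coord_iso:
  fixes V :: "('a::field, 'b) module"
  assumes V: "vectorspace class_ring V" and fd: "vectorspace.fin_dim class_ring V"
  shows "\<exists>f. f \<in> linear_isos (coord_space (vectorspace.dim class_ring V)) V"
proof -
  interpret V: vectorspace class_ring V by (rule V)
  obtain B where B: "finite B" "V.basis B" using V.finite_basis_exists[OF fd] by auto
  obtain vs where vs: "set vs = B" "distinct vs" using finite_distinct_list[OF B(1)] by auto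
  have "length vs = V.dim" using V.dim_basis[OF B] vs distinct_card by metis
  thus ?thesis using basis_map_iso[OF V vs(2)] B vs by metis
qed

lemma coord_iso_dim:
  fixes V :: "('a::field, 'b) module"
  assumes V: "vectorspace class_ring V" and f: "f \<in> linear_isos (coord_space n) V"
  shows "vectorspace.fin_dim class_ring V" "vectorspace.dim class_ring V = n"
proof -
  interpret C: vec_space "TYPE('a)" n .
  show "vectorspace.fin_dim class_ring V" "vectorspace.dim class_ring V = n"
    using linear_isos_dim[OF coord_space_vs V f C.fin_dim] C.dim_is_n by simp_all
qed

lemma coord_iso_basis:
  fixes V :: "('a::field, 'b) module"
  assumes V: "vectorspace class_ring V" and f: "f \<in> linear_isos (coord_space n) V"
  shows "distinct (map f (unit_vecs n))" "vectorspace.basis class_ring V (set (map f (unit_vecs n)))"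
proof -
  interpret C: vec_space "TYPE('a)" n .
  interpret linear_map class_ring "coord_space n" V f
    by (intro linear_map.intro mod_hom.intro mod_hom_axioms.intro vs_module V coord_space_vs linear_isosD(1)[OF f])
  note F = linear_isosD[OF f]
  show "vectorspace.basis class_ring V (set (map f (unit_vecs n)))"
    using linear_inj_image_is_basis[OF F(6,7) C.unit_vecs_basis C.fin_dim] by simp
  show "distinct (map f (unit_vecs n))"
    unfolding distinct_map using C.unit_vecs_distinct
    by (auto intro!: inj_on_subset[OF F(6)] simp: coord_space_simps unit_vecs_def)
qed

lemma bilinear_map_hom_left:
  fixes V :: "('a::field, 'b) module" and W :: "('a, 'c) module" and U :: "('a, 'd) module"
  assumes "bilinear_map V W U \<beta>" "y \<in> carrier W"
  shows "(\<lambda>x. \<beta> x y) \<in> LinearCombinations.module_hom class_ring V U"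
  by (rule module_homI) (use bilinear_mapD[OF assms(1) _ assms(2)] in auto)

lemma bilinear_map_hom_right:
  fixes V :: "('a::field, 'b) module" and W :: "('a, 'c) module" and U :: "('a, 'd) module"
  assumes "bilinear_map V W U \<beta>" "x \<in> carrier V"
  shows "(\<lambda>y. \<beta> x y) \<in> LinearCombinations.module_hom class_ring W U"
  by (rule module_homI) (use bilinear_mapD[OF assms(1,2)] in auto)

lemma coord_bilinear_eqI:
  fixes U :: "('a::field, 'd) module"
  assumes U: "vectorspace class_ring U"
    and f: "bilinear_map (coord_space m) (coord_space n) U f"
    and g: "bilinear_map (coord_space m) (coord_space n) U g"
    and eq: "\<And>i j. i < m \<Longrightarrow> j < n \<Longrightarrow> f (unit_vec m i) (unit_vec n j) = g (unit_vec m i) (unit_vec n j)"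
    and x: "x \<in> carrier_vec m" and y: "y \<in> carrier_vec n"
  shows "f x y = g x y"
proof (rule coord_space_hom_eqI[OF U bilinear_map_hom_left[OF f] bilinear_map_hom_left[OF g] _ x])
  fix i assume "i < m"
  show "f (unit_vec m i) y = g (unit_vec m i) y"
    by (rule coord_space_hom_eqI[OF U bilinear_map_hom_right[OF f] bilinear_map_hom_right[OF g] _ y])
      (auto simp: coord_space_simps eq[OF \<open>i < m\<close>])
qed (use y in \<open>auto simp: coord_space_simps\<close>)

lemma bilinear_map_comp_right:
  fixes V :: "('a::field, 'b) module" and W :: "('a, 'c) module" and U :: "('a, 'd) module"
    and U' :: "('a, 'e) module"
  assumes "bilinear_map V W U \<beta>" "h \<in> LinearCombinations.module_hom class_ring U U'"
  shows "bilinear_map V W U' (\<lambda>x y. h (\<beta> x y))"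
  unfolding bilinear_map_def
  using bilinear_mapD[OF assms(1)] module_homD[OF assms(2)] by auto

lemma bilinear_map_comp_left:
  fixes V :: "('a::field, 'b) module" and W :: "('a, 'c) module" and U :: "('a, 'd) module"
    and V' :: "('a, 'e) module" and W' :: "('a, 'f) module"
  assumes \<beta>: "bilinear_map V W U \<beta>"
    and f: "f \<in> LinearCombinations.module_hom class_ring V' V"
    and g: "g \<in> LinearCombinations.module_hom class_ring W' W"
  shows "bilinear_map V' W' U (\<lambda>x y. \<beta> (f x) (g y))"
  unfolding bilinear_map_def
  using bilinear_mapD[OF \<beta>] module_homD[OF f] module_homD[OF g] by auto

text \<open>Row-major order: the index \<open>i * n + j\<close> belongs to the pair
  \<open>(i, j)\<close>, in agreement with \<open>kronL\<close> and \<open>kronR\<close>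
  below.\<close>

definition kron_vec :: "nat \<Rightarrow> nat \<Rightarrow> 'a::field vec \<Rightarrow> 'a vec \<Rightarrow> 'a vec" where
  "kron_vec m n x y = vec (m * n) (\<lambda>k. x $ (k div n) * y $ (k mod n))"

lemma div_mod_less:
  fixes k m n :: nat
  assumes "k < m * n" shows "k div n < m" "k mod n < n"
  using assms by (auto simp: less_mult_imp_div_less) (metis mod_less_divisor mult_0_right not_less0 gr0I)

lemma kron_vec_bilinear:
  "bilinear_map (coord_space m) (coord_space n) (coord_space (m * n)) (kron_vec m n)"
  unfolding bilinear_map_def coord_space_simps kron_vec_def
  by (cases "n = 0") (auto intro!: eq_vecI simp: div_mod_less algebra_simps)

lemma kron_vec_unit:
  assumes i: "i < m" and j: "j < n"
  shows "kron_vec m n (unit_vec m i) (unit_vec n j) = (unit_vec (m * n) (i * n + j) :: 'a::field vec)"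
proof (rule eq_vecI)
  have ij: "i * n + j < m * n"
  proof -
    have "i * n + j < (i + 1) * n" using j by simp
    also have "\<dots> \<le> m * n" using i by (intro mult_right_mono) auto
    finally show ?thesis .
  qed
  fix k assume "k < dim_vec (unit_vec (m * n) (i * n + j) :: 'a vec)"
  hence k: "k < m * n" by simp
  have "(k div n = i \<and> k mod n = j) = (k = i * n + j)" using j by auto
  thus "kron_vec m n (unit_vec m i) (unit_vec n j) $ k = (unit_vec (m * n) (i * n + j) :: 'a vec) $ k"
    using k ij div_mod_less[OF k] i j by (auto simp: kron_vec_def unit_vec_def)
qed (simp add: kron_vec_def)

text \<open>The map \<open>r\<close> sends unit vectors to pure tensors of basis vectors. Its
  inverse \<open>k\<close> comes from the universal property, applied to the Kronecker product of
  coordinate vectors, so the independence of those pure tensors needs no argument of its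
  own.\<close>

lemma (in tensor_pair) tensor_coord_iso:
  assumes \<phi>: "\<phi> \<in> linear_isos (coord_space m) V" and \<psi>: "\<psi> \<in> linear_isos (coord_space n) W"
  obtains \<kappa> where "\<kappa> \<in> linear_isos (coord_space (m * n)) T"
    and "\<And>x y. x \<in> carrier_vec m \<Longrightarrow> y \<in> carrier_vec n \<Longrightarrow> \<kappa> (kron_vec m n x y) = pt (\<phi> x) (\<psi> y)"
proof -
  note P = linear_isosD[OF \<phi>, unfolded coord_space_simps] and S = linear_isosD[OF \<psi>, unfolded coord_space_simps]
  let ?fi = "inv_into (carrier_vec m) \<phi>" and ?si = "inv_into (carrier_vec n) \<psi>"
  note P' = linear_isosD[OF linear_isos_inv_into[OF coord_space_vs \<phi>], unfolded coord_space_simps]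
  note S' = linear_isosD[OF linear_isos_inv_into[OF coord_space_vs \<psi>], unfolded coord_space_simps]
  let ?e = "\<lambda>k. pt (\<phi> (unit_vec m (k div n))) (\<psi> (unit_vec n (k mod n)))"
  define r where "r = basis_map T ?e (m * n)"
  have e: "?e k \<in> carrier T" if "k < m * n" for k
    using that div_mod_less by (intro pt_closed P(3) S(3)) auto
  have r: "r \<in> LinearCombinations.module_hom class_ring (coord_space (m * n)) T"
    unfolding r_def by (rule basis_map_hom[OF tensor_vs e])
  have rk: "r (kron_vec m n x y) = pt (\<phi> x) (\<psi> y)" if "x \<in> carrier_vec m" "y \<in> carrier_vec n" for x y
  proof (rule coord_bilinear_eqI[OF tensor_vs bilinear_map_comp_right[OF kron_vec_bilinear r]
      bilinear_map_comp_left[OF pt_bilinear P(1) S(1)] _ that])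
    fix i j assume ij: "i < m" "j < n"
    have "i * n + j < m * n"
    proof -
      have "i * n + j < (i + 1) * n" using ij by simp
      also have "\<dots> \<le> m * n" using ij by (intro mult_right_mono) auto
      finally show ?thesis .
    qed
    from basis_map_unit[OF tensor_vs e this]
    show "r (kron_vec m n (unit_vec m i) (unit_vec n j)) = pt (\<phi> (unit_vec m i)) (\<psi> (unit_vec n j))"
      unfolding kron_vec_unit[OF ij] r_def using ij by simp
  qed
  define \<beta> where "\<beta> x y = kron_vec m n (?fi x) (?si y)" for x y
  have \<beta>: "bilinear_map V W (coord_space (m * n)) \<beta>"
    unfolding \<beta>_def by (rule bilinear_map_comp_left[OF kron_vec_bilinear P'(1) S'(1)])
  define k where "k = tensor_lift V W (coord_space (m * n)) \<beta>"
  have k: "k \<in> LinearCombinations.module_hom class_ring T (coord_space (m * n))"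
    unfolding k_def by (rule tensor_lift_hom[OF coord_space_vs \<beta>])
  have kp: "k (pt x y) = \<beta> x y" if "x \<in> carrier V" "y \<in> carrier W" for x y
    unfolding k_def by (rule tensor_lift_pt[OF coord_space_vs \<beta> that])
  have "r \<in> linear_isos (coord_space (m * n)) T"
  proof (rule linear_isosI[OF r, of k, unfolded coord_space_simps])
    show "k X \<in> carrier_vec (m * n)" if "X \<in> carrier T" for X
      using module_homD(1)[OF k that] by (simp add: coord_space_simps)
    have id: "(\<lambda>X. X) \<in> LinearCombinations.module_hom class_ring T T" 
      by (rule module_homI) auto
    show "r (k X) = X" if "X \<in> carrier T" for X
    proof (rule hom_eqI[OF module_hom_comp[OF k r] id _ that])
      fix x y assume "x \<in> carrier V" "y \<in> carrier W"
      thus "r (k (pt x y)) = pt x y"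
        using P(7) S(7) P'(3) S'(3) by (simp add: kp \<beta>_def rk f_inv_into_f)
    qed
    have id': "(\<lambda>x. x) \<in> LinearCombinations.module_hom class_ring (coord_space (m * n)) (coord_space (m * n))"
      by (rule module_homI) auto
    show "k (r x) = x" if "x \<in> carrier_vec (m * n)" for x
    proof (rule coord_space_hom_eqI[OF coord_space_vs module_hom_comp[OF r k] id' _ that])
      fix l assume l: "l < m * n"
      note d = div_mod_less[OF l]
      have "r (unit_vec (m * n) l) = ?e l" unfolding r_def by (rule basis_map_unit[OF tensor_vs e l])
      also have "k \<dots> = unit_vec (m * n) l"
        using d inv_into_f_f[OF P(6)] inv_into_f_f[OF S(6)] P(3) S(3)
        by (simp add: kp \<beta>_def kron_vec_unit)
      finally show "k (r (unit_vec (m * n) l)) = unit_vec (m * n) l" .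
    qed
  qed
  thus ?thesis using rk that by blast
qed

lemma (in tensor_pair) tensor_dim:
  assumes "vectorspace.fin_dim class_ring V" "vectorspace.fin_dim class_ring W"
  shows "vectorspace.fin_dim class_ring T"
    and "vectorspace.dim class_ring T = vectorspace.dim class_ring V * vectorspace.dim class_ring W"
proof -
  obtain f g where "f \<in> linear_isos (coord_space (vectorspace.dim class_ring V)) V"
    "g \<in> linear_isos (coord_space (vectorspace.dim class_ring W)) W"
    using ex_coord_iso[OF vsV assms(1)] ex_coord_iso[OF vsW assms(2)] by auto
  then obtain k where "k \<in> linear_isos (coord_space (vectorspace.dim class_ring V * vectorspace.dim class_ring W)) T"
    by (rule tensor_coord_iso)
  from coord_iso_dim[OF tensor_vs this]
  show "vectorspace.fin_dim class_ring T"
    "vectorspace.dim class_ring T = vectorspace.dim class_ring V * vectorspace.dim class_ring W" .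
qed

section \<open>Four by four matrices\<close>

text \<open>A matrix ring as a type, entries in row-major order, so that ring identities in several matrices
  are available to the simplifier without carrier side conditions.\<close>

datatype 'a m4 = M4 'a 'a 'a 'a  'a 'a 'a 'a  'a 'a 'a 'a  'a 'a 'a 'a

fun m4_times :: "'a::ring_1 m4 \<Rightarrow> 'a m4 \<Rightarrow> 'a m4" where
  "m4_times (M4 a b c d e f g h i j k l m n p q) (M4 a' b' c' d' e' f' g' h' i' j' k' l' m' n' p' q') =
   M4 (a*a'+b*e'+c*i'+d*m') (a*b'+b*f'+c*j'+d*n') (a*c'+b*g'+c*k'+d*p') (a*d'+b*h'+c*l'+d*q')
      (e*a'+f*e'+g*i'+h*m') (e*b'+f*f'+g*j'+h*n') (e*c'+f*g'+g*k'+h*p') (e*d'+f*h'+g*l'+h*q')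
      (i*a'+j*e'+k*i'+l*m') (i*b'+j*f'+k*j'+l*n') (i*c'+j*g'+k*k'+l*p') (i*d'+j*h'+k*l'+l*q')
      (m*a'+n*e'+p*i'+q*m') (m*b'+n*f'+p*j'+q*n') (m*c'+n*g'+p*k'+q*p') (m*d'+n*h'+p*l'+q*q')"

fun m4_plus :: "'a::ring_1 m4 \<Rightarrow> 'a m4 \<Rightarrow> 'a m4" where
  "m4_plus (M4 a b c d e f g h i j k l m n p q) (M4 a' b' c' d' e' f' g' h' i' j' k' l' m' n' p' q') =
   M4 (a+a') (b+b') (c+c') (d+d') (e+e') (f+f') (g+g') (h+h')
      (i+i') (j+j') (k+k') (l+l') (m+m') (n+n') (p+p') (q+q')"

fun smul :: "'a::ring_1 \<Rightarrow> 'a m4 \<Rightarrow> 'a m4" (infixr "*s" 75) where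
  "x *s M4 a b c d e f g h i j k l m n p q =
   M4 (x*a) (x*b) (x*c) (x*d) (x*e) (x*f) (x*g) (x*h) (x*i) (x*j) (x*k) (x*l) (x*m) (x*n) (x*p) (x*q)"

fun tr4 :: "'a m4 \<Rightarrow> 'a m4" where
  "tr4 (M4 a b c d e f g h i j k l m n p q) = M4 a e i m b f j n c g k p d h l q"

instantiation m4 :: (comm_ring_1) ring_1
begin
definition "X + Y = m4_plus X Y" for X :: "'a m4"
definition "X * Y = m4_times X Y" for X :: "'a m4"
definition "0 = (M4 0 0 0 0  0 0 0 0  0 0 0 0  0 0 0 0 :: 'a m4)"
definition "1 = (M4 1 0 0 0  0 1 0 0  0 0 1 0  0 0 0 1 :: 'a m4)"
definition "- X = (- 1) *s X" for X :: "'a m4"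
definition "X - Y = m4_plus X ((- 1) *s Y)" for X :: "'a m4"
lemmas m4_defs = plus_m4_def times_m4_def zero_m4_def one_m4_def uminus_m4_def minus_m4_def
instance
proof
  fix X Y Z :: "'a m4"
  show "X + Y + Z = X + (Y + Z)" "X + Y = Y + X"
    by (cases X; cases Y; cases Z; simp add: m4_defs)+
  show "0 + X = X" "- X + X = 0" "1 * X = X" "X * 1 = X" by (cases X; simp add: m4_defs)+
  show "X - Y = X + - Y" by (cases X; cases Y; simp add: m4_defs)
  show "(X + Y) * Z = X * Z + Y * Z" "X * (Y + Z) = X * Y + X * Z"
    by (cases X; cases Y; cases Z; simp add: m4_defs algebra_simps)+
  show "(0::'a m4) \<noteq> 1" by (simp add: m4_defs)
  show "X * Y * Z = X * (Y * Z)"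
    by (cases X; cases Y; cases Z; simp add: m4_defs algebra_simps)
qed
end

lemma M4_simps:
  "M4 a b c d e f g h i j k l m n p q + M4 a' b' c' d' e' f' g' h' i' j' k' l' m' n' p' q' =
   M4 (a+a') (b+b') (c+c') (d+d') (e+e') (f+f') (g+g') (h+h')
      (i+i') (j+j') (k+k') (l+l') (m+m') (n+n') (p+p') (q+q')"
  "M4 a b c d e f g h i j k l m n p q - M4 a' b' c' d' e' f' g' h' i' j' k' l' m' n' p' q' =
   M4 (a-a') (b-b') (c-c') (d-d') (e-e') (f-f') (g-g') (h-h')
      (i-i') (j-j') (k-k') (l-l') (m-m') (n-n') (p-p') (q-q')"
  "- M4 a b c d e f g h i j k l m n p q =
   M4 (-a) (-b) (-c) (-d) (-e) (-f) (-g) (-h) (-i) (-j) (-k) (-l) (-m) (-n) (-p) (-q)"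
  "M4 a b c d e f g h i j k l m n p q * M4 a' b' c' d' e' f' g' h' i' j' k' l' m' n' p' q' =
   M4 (a*a'+b*e'+c*i'+d*m') (a*b'+b*f'+c*j'+d*n') (a*c'+b*g'+c*k'+d*p') (a*d'+b*h'+c*l'+d*q')
      (e*a'+f*e'+g*i'+h*m') (e*b'+f*f'+g*j'+h*n') (e*c'+f*g'+g*k'+h*p') (e*d'+f*h'+g*l'+h*q')
      (i*a'+j*e'+k*i'+l*m') (i*b'+j*f'+k*j'+l*n') (i*c'+j*g'+k*k'+l*p') (i*d'+j*h'+k*l'+l*q')
      (m*a'+n*e'+p*i'+q*m') (m*b'+n*f'+p*j'+q*n') (m*c'+n*g'+p*k'+q*p') (m*d'+n*h'+p*l'+q*q')"
  "(0::'a::comm_ring_1 m4) = M4 0 0 0 0  0 0 0 0  0 0 0 0  0 0 0 0"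
  "(1::'a m4) = M4 1 0 0 0  0 1 0 0  0 0 1 0  0 0 0 1"
  for a :: "'a::comm_ring_1"
  by (simp_all add: m4_defs)

lemma smul_simps [simp]:
  fixes X :: "'a::comm_ring_1 m4"
  shows "(c *s X) * Y = c *s (X * Y)" "X * (c *s Y) = c *s (X * Y)"
    "c *s d *s X = (c * d) *s X" "1 *s X = X" "0 *s X = 0" "c *s 0 = 0"
    "c *s (- X) = - (c *s X)" "(- c) *s X = - (c *s X)"
  by (cases X; cases Y; simp add: M4_simps algebra_simps)+

lemma smul_distrib:
  fixes X :: "'a::comm_ring_1 m4"
  shows "c *s (X + Y) = c *s X + c *s Y" "(c + d) *s X = c *s X + d *s X"
    "c *s (X - Y) = c *s X - c *s Y" "(c - d) *s X = c *s X - d *s X"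
  by (cases X; cases Y; simp add: M4_simps algebra_simps)+

lemma tr4_simps [simp]:
  fixes X :: "'a::comm_ring_1 m4"
  shows "tr4 (X * Y) = tr4 Y * tr4 X" "tr4 (X + Y) = tr4 X + tr4 Y" "tr4 (X - Y) = tr4 X - tr4 Y"
    "tr4 (- X) = - tr4 X" "tr4 (c *s X) = c *s tr4 X" "tr4 (tr4 X) = X" "tr4 1 = (1 :: 'a m4)"
    "tr4 0 = (0 :: 'a m4)"
  by (cases X; cases Y; simp add: M4_simps algebra_simps)+

lemma smul_eq_0_iff [simp]:
  fixes X :: "'a::field m4"
  shows "c *s X = 0 \<longleftrightarrow> c = 0 \<or> X = 0"
  by (cases X) (auto simp: M4_simps)

lemma smul_cancel: 
  fixes X :: "'a::field m4"
  shows "c \<noteq> 0 \<Longrightarrow> c *s X = c *s Y \<longleftrightarrow> X = Y"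
  by (cases X; cases Y) (auto simp: M4_simps)

fun mat_of :: "'a m4 \<Rightarrow> 'a mat" where
  "mat_of (M4 a b c d e f g h i j k l m n p q) =
   mat 4 4 (\<lambda>(x, y). [[a,b,c,d],[e,f,g,h],[i,j,k,l],[m,n,p,q]] ! x ! y)"

definition of_fun4 :: "(nat \<Rightarrow> nat \<Rightarrow> 'a) \<Rightarrow> 'a m4" where
  "of_fun4 f = M4 (f 0 0) (f 0 1) (f 0 2) (f 0 3) (f 1 0) (f 1 1) (f 1 2) (f 1 3)
     (f 2 0) (f 2 1) (f 2 2) (f 2 3) (f 3 0) (f 3 1) (f 3 2) (f 3 3)"

lemma less_4_cases: "i < (4::nat) \<Longrightarrow> i = 0 \<or> i = 1 \<or> i = 2 \<or> i = 3" by auto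

lemma mat_of_carrier [simp]: "mat_of X \<in> carrier_mat 4 4"
  "dim_row (mat_of X) = 4" "dim_col (mat_of X) = 4"
  by (cases X; simp)+

lemma mat_of_of_fun4: "mat_of (of_fun4 f) = mat 4 4 (\<lambda>(i,j). f i j)"
  by (rule eq_matI) (auto simp: of_fun4_def dest!: less_4_cases)

lemma of_fun4_mat_of [simp]: "of_fun4 (\<lambda>i j. mat_of X $$ (i,j)) = X"
  by (cases X) (simp add: of_fun4_def)

lemma mat_of_inj: "mat_of X = mat_of Y \<Longrightarrow> X = Y"
  by (metis of_fun4_mat_of)

lemma mat_of_surj: "A \<in> carrier_mat 4 4 \<Longrightarrow> \<exists>X. mat_of X = A"
  by (rule exI[of _ "of_fun4 (\<lambda>i j. A $$ (i,j))"]) (auto simp: mat_of_of_fun4 intro!: eq_matI)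

lemma sum_less_4: "sum f {0..<4} = f 0 + f 1 + f 2 + f (3::nat)"
proof -
  have "{0..<4} = {0,1,2,3::nat}" by auto
  thus ?thesis by (simp add: add.assoc)
qed

lemma mat_of_mult: "mat_of (X * Y) = mat_of X * mat_of (Y :: 'a::comm_ring_1 m4)"
  by (rule eq_matI; cases X; cases Y)
    (auto simp: M4_simps scalar_prod_def sum_less_4 dest!: less_4_cases)

lemma mat_of_one: "mat_of (1 :: 'a::comm_ring_1 m4) = 1\<^sub>m 4"
  by (rule eq_matI) (auto simp: M4_simps dest!: less_4_cases)

lemma mat_of_transpose: "mat_of (tr4 X) = transpose_mat (mat_of X)"
  by (rule eq_matI; cases X) (auto dest!: less_4_cases)

lemma mat_of_add: "mat_of (X + Y) = mat_of X + mat_of (Y :: 'a::comm_ring_1 m4)"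
  by (rule eq_matI; cases X; cases Y)
    (auto simp: M4_simps dest!: less_4_cases)

lemma mat_of_smul: "mat_of (c *s X) = c \<cdot>\<^sub>m mat_of (X :: 'a::comm_ring_1 m4)"
  by (rule eq_matI; cases X)
    (auto simp: M4_simps dest!: less_4_cases)

definition det4 :: "'a::comm_ring_1 m4 \<Rightarrow> 'a" where
  "det4 X = det (mat_of X)"

lemma det4_mult [simp]: "det4 (X * Y) = det4 X * det4 (Y :: 'a::idom m4)"
  unfolding det4_def mat_of_mult by (rule det_mult) auto

lemma det4_one [simp]: "det4 (1 :: 'a::comm_ring_1 m4) = 1"
  unfolding det4_def mat_of_one by simp

lemma det4_transpose [simp]: "det4 (tr4 X) = det4 (X :: 'a::comm_ring_1 m4)"
  unfolding det4_def mat_of_transpose by (rule det_transpose) auto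

lemma det4_inverse:
  fixes X :: "'a::field m4"
  assumes "det4 X \<noteq> 0"
  obtains Y where "X * Y = 1" "Y * X = 1"
proof -
  obtain B where B: "B \<in> carrier_mat 4 4" "mat_of X * B = 1\<^sub>m 4" "B * mat_of X = 1\<^sub>m 4"
    using det_non_zero_imp_unit[of "mat_of X" 4] assms
    unfolding det4_def Units_def ring_mat_simps by auto
  obtain Y where "mat_of Y = B" using mat_of_surj[OF B(1)] by auto
  hence "X * Y = 1" "Y * X = 1" using B by (auto intro!: mat_of_inj simp: mat_of_mult mat_of_one)
  thus ?thesis by (rule that)
qed

lemma right_inverse4:
  fixes X :: "'a::field m4"
  assumes "X * Y = 1"
  shows "det4 X \<noteq> 0" "Y * X = 1"
proof -
  have "det4 X * det4 Y = 1" using assms det4_mult[of X Y] by simp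
  thus d: "det4 X \<noteq> 0" by auto
  obtain Z where "X * Z = 1" "Z * X = 1" by (rule det4_inverse[OF d])
  thus "Y * X = 1" by (metis assms mult.assoc mult.left_neutral mult.right_neutral)
qed

text \<open>Expansion along the first column in a form that keeps each minor an explicit
  \<open>mat\<close>, so that it can be repeated down to size one.\<close>

lemma det_expand:
  "det (mat (Suc n) (Suc n) f) =
   (\<Sum>i<Suc n. f (i, 0) * ((-1)^i * det (mat n n (\<lambda>(a,b). f (if a < i then a else Suc a, Suc b)))))"
  for f :: "nat \<times> nat \<Rightarrow> 'a::comm_ring_1"
proof -
  have "mat_delete (mat (Suc n) (Suc n) f) i 0 = mat n n (\<lambda>(a,b). f (if a < i then a else Suc a, Suc b))"
    if "i < Suc n" for i
    using that by (intro eq_matI) (auto simp: mat_delete_def)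
  thus ?thesis by (subst laplace_expansion_column[of _ "Suc n" 0]) (auto simp: cofactor_def intro!: sum.cong)
qed

lemma det_mat_1: "det (mat (Suc 0) (Suc 0) f) = f (0, 0)" for f :: "nat \<times> nat \<Rightarrow> 'a::comm_ring_1"
  by (subst det_expand) simp

lemma det_mat_2: "det (mat (Suc (Suc 0)) (Suc (Suc 0)) f) = f (0, 0) * f (1, 1) - f (1, 0) * f (0, 1)"
  for f :: "nat \<times> nat \<Rightarrow> 'a::comm_ring_1"
  by (subst det_expand) (simp add: det_mat_1 lessThan_Suc)

lemma det_mat_3: "det (mat (Suc (Suc (Suc 0))) (Suc (Suc (Suc 0))) f) =
    f (0, 0) * (f (1, 1) * f (2, 2) - f (2, 1) * f (1, 2))
  - f (1, 0) * (f (0, 1) * f (2, 2) - f (2, 1) * f (0, 2))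
  + f (2, 0) * (f (0, 1) * f (1, 2) - f (1, 1) * f (0, 2))"
  for f :: "nat \<times> nat \<Rightarrow> 'a::comm_ring_1"
  by (subst det_expand) (simp add: det_mat_2 lessThan_Suc numeral_2_eq_2 algebra_simps)

lemma det4_M4:
  "det4 (M4 a b c d e f g h i j k l m n p q :: 'a::comm_ring_1 m4) =
    a * (f * (k*q - l*p) - g * (j*q - l*n) + h * (j*p - k*n))
  - b * (e * (k*q - l*p) - g * (i*q - l*m) + h * (i*p - k*m))
  + c * (e * (j*q - l*n) - f * (i*q - l*m) + h * (i*n - j*m))
  - d * (e * (j*p - k*n) - f * (i*p - k*m) + g * (i*n - j*m))"
proof -
  define F where "F = (\<lambda>(x, y). [[a,b,c,d],[e,f,g,h],[i,j,k,l],[m,n,p,q]] ! x ! y)"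
  have F: "F (0,0) = a" "F (0,1) = b" "F (0,2) = c" "F (0,3) = d" "F (1,0) = e" "F (1,1) = f" "F (1,2) = g" "F (1,3) = h"
    "F (2,0) = i" "F (2,1) = j" "F (2,2) = k" "F (2,3) = l" "F (3,0) = m" "F (3,1) = n" "F (3,2) = p" "F (3,3) = q"
    by (simp_all add: F_def)
  have "mat_of (M4 a b c d e f g h i j k l m n p q) =
      mat (Suc (Suc (Suc (Suc 0)))) (Suc (Suc (Suc (Suc 0)))) F"
    by (simp add: F_def numeral_eq_Suc)
  hence "det4 (M4 a b c d e f g h i j k l m n p q) =
      F (0,0) * det (mat 3 3 (\<lambda>(x,y). F (Suc x, Suc y)))
    - F (1,0) * det (mat 3 3 (\<lambda>(x,y). F (if x < 1 then x else Suc x, Suc y)))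
    + F (2,0) * det (mat 3 3 (\<lambda>(x,y). F (if x < 2 then x else Suc x, Suc y)))
    - F (3,0) * det (mat 3 3 (\<lambda>(x,y). F (if x < 3 then x else Suc x, Suc y)))"
    by (simp add: det4_def det_expand[of "Suc (Suc (Suc 0))"] lessThan_Suc numeral_2_eq_2 numeral_3_eq_3)
  also have "\<dots> = a * (f * (k*q - p*l) - j * (g*q - p*h) + n * (g*l - k*h))
     - e * (b * (k*q - p*l) - j * (c*q - p*d) + n * (c*l - k*d))
     + i * (b * (g*q - p*h) - f * (c*q - p*d) + n * (c*h - g*d))
     - m * (b * (g*l - k*h) - f * (c*l - k*d) + j * (c*h - g*d))"
    using F by (simp add: det_mat_3 numeral_2_eq_2 numeral_3_eq_3)
  finally show ?thesis by (simp add: algebra_simps)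
qed

lemma two_cancel:
  fixes X :: "'a::field m4"
  assumes "(2::'a) \<noteq> 0" "X + X = 0"
  shows "X = 0"
proof -
  have "(2::'a) *s X = X + X" using smul_distrib(2)[of 1 1 X] by simp
  thus ?thesis using assms by simp
qed

section \<open>Quaternion generators and the sixteen products of two commuting pairs\<close>

definition quat_gens :: "'a::field \<Rightarrow> 'a \<Rightarrow> 'a m4 \<Rightarrow> 'a m4 \<Rightarrow> bool" where
  "quat_gens \<alpha> \<beta> i j \<longleftrightarrow> \<alpha> \<noteq> 0 \<and> \<beta> \<noteq> 0 \<and> i * i = \<alpha> *s 1 \<and> j * j = \<beta> *s 1 \<and> j * i = - (i * j)"

lemma quat_gensD:
  assumes "quat_gens \<alpha> \<beta> i j"
  shows "\<alpha> \<noteq> 0" "\<beta> \<noteq> 0" "i * i = \<alpha> *s 1" "j * j = \<beta> *s 1" "j * i = - (i * j)"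
    "i * (i * X) = \<alpha> *s X" "j * (j * X) = \<beta> *s X" "j * (i * X) = - (i * (j * X))"
  using assms by (auto simp: quat_gens_def mult.assoc[symmetric])

text \<open>Conjugation by \<open>i\<close> changes the sign of the components at \<open>j\<close>
  and \<open>i * j\<close>, conjugation by \<open>j\<close> that of the component at
  \<open>i\<close>; as 2 is invertible, sums and differences isolate every term. The coefficients
  may be any matrices commuting with \<open>i\<close> and \<open>j\<close>, which allows
  coefficients from a second quaternion algebra.\<close>

lemma quat_indep:
  fixes i j :: "'a::field m4"
  assumes 2: "(2::'a) \<noteq> 0" and Q: "quat_gens \<alpha> \<beta> i j"
    and comm: "\<And>X. X \<in> {X0, X1, X2, X3} \<Longrightarrow> i * X = X * i \<and> j * X = X * j"
    and eq: "X0 + X1 * i + X2 * j + X3 * (i * j) = 0"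
  shows "X0 = 0 \<and> X1 = 0 \<and> X2 = 0 \<and> X3 = 0"
proof -
  note q = quat_gensD[OF Q]
  have aux: "X = 0 \<and> Y = 0" if c: "i * X = X * i" "j * X = X * j" "i * Y = Y * i" "j * Y = Y * j"
    and e: "X + Y * i = 0" for X Y
  proof -
    have "j * (X * Z) = X * (j * Z)" "j * (Y * Z) = Y * (j * Z)" for Z
      using c by (simp_all add: mult.assoc[symmetric])
    hence "j * (X + Y * i) * j = \<beta> *s (X - Y * i)"
      using q c by (simp add: algebra_simps smul_distrib)
    hence "X - Y * i = 0" using e q(2) by simp
    hence "Y * i = X" by simp
    moreover from this have "X + X = 0" using e by simp
    ultimately have X: "X = 0" "Y * i = 0" using two_cancel[OF 2, of X] by (blast, metis two_cancel[OF 2])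
    have "Y * i * i = \<alpha> *s Y" using q by (simp add: mult.assoc)
    thus ?thesis using X q(1) by simp
  qed
  have c: "i * X0 = X0 * i" "j * X0 = X0 * j" "i * X1 = X1 * i" "j * X1 = X1 * j"
    "i * X2 = X2 * i" "j * X2 = X2 * j" "i * X3 = X3 * i" "j * X3 = X3 * j" using comm by auto
  have c': "i * (X0 * Z) = X0 * (i * Z)" "j * (X0 * Z) = X0 * (j * Z)" "i * (X1 * Z) = X1 * (i * Z)" "j * (X1 * Z) = X1 * (j * Z)"
    "i * (X2 * Z) = X2 * (i * Z)" "j * (X2 * Z) = X2 * (j * Z)" "i * (X3 * Z) = X3 * (i * Z)" "j * (X3 * Z) = X3 * (j * Z)" for Z
    using c by (simp_all add: mult.assoc[symmetric])
  have "i * (X0 + X1 * i + X2 * j + X3 * (i * j)) * i = \<alpha> *s (X0 + X1 * i - (X2 + X3 * i) * j)"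
    by (simp add: distrib_left distrib_right left_diff_distrib mult.assoc c' q smul_distrib)
  hence m: "X0 + X1 * i - (X2 + X3 * i) * j = 0" using eq q(1) by simp
  have p: "X0 + X1 * i + (X2 + X3 * i) * j = 0" using eq by (simp add: algebra_simps)
  have "(X0 + X1 * i) + (X0 + X1 * i) = 0"
    using arg_cong2[OF m p, of "(+)"] by (simp add: algebra_simps)
  hence s: "X0 + X1 * i = 0" by (rule two_cancel[OF 2])
  hence "(X2 + X3 * i) * j * j = 0" using p by simp
  hence t: "X2 + X3 * i = 0" using q by (simp add: mult.assoc)
  show ?thesis using aux[OF c(1-4) s] aux[OF c(5-8) t] by simp
qed

definition biquat :: "'a::field \<Rightarrow> 'a \<Rightarrow> 'a m4 \<Rightarrow> 'a m4 \<Rightarrow> 'a \<Rightarrow> 'a \<Rightarrow> 'a m4 \<Rightarrow> 'a m4 \<Rightarrow> bool" where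
  "biquat \<alpha>1 \<beta>1 i1 j1 \<alpha>2 \<beta>2 i2 j2 \<longleftrightarrow> quat_gens \<alpha>1 \<beta>1 i1 j1 \<and> quat_gens \<alpha>2 \<beta>2 i2 j2 \<and>
     i2 * i1 = i1 * i2 \<and> i2 * j1 = j1 * i2 \<and> j2 * i1 = i1 * j2 \<and> j2 * j1 = j1 * j2"

definition quat :: "'a::field m4 \<Rightarrow> 'a m4 \<Rightarrow> 'a \<Rightarrow> 'a \<Rightarrow> 'a \<Rightarrow> 'a \<Rightarrow> 'a m4" where
  "quat i j x0 x1 x2 x3 = x0 *s 1 + x1 *s i + x2 *s j + x3 *s (i * j)"

interpretation m4vs: vector_space "smul :: 'a::field \<Rightarrow> 'a m4 \<Rightarrow> 'a m4"
  by unfold_locales (simp_all add: smul_distrib)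

definition unit4 :: "nat \<Rightarrow> nat \<Rightarrow> 'a::field m4" where
  "unit4 a b = of_fun4 (\<lambda>i j. if i = a \<and> j = b then 1 else 0)"

lemma in_span_unit4:
  "(X :: 'a::field m4) \<in> m4vs.span ((\<lambda>k. unit4 (k div 4) (k mod 4)) ` {..<16})"
proof -
  have m: "unit4 a b \<in> m4vs.span ((\<lambda>k. unit4 (k div 4) (k mod 4)) ` {..<16})" if "a < 4" "b < 4" for a b
    by (rule m4vs.span_base, rule image_eqI[of _ _ "4 * a + b"]) (use that in auto)
  obtain a b c d e f g h i j k l n p q r where X: "X = M4 a b c d e f g h i j k l n p q r" by (cases X)
  have "X = a *s unit4 0 0 + b *s unit4 0 1 + c *s unit4 0 2 + d *s unit4 0 3
    + e *s unit4 1 0 + f *s unit4 1 1 + g *s unit4 1 2 + h *s unit4 1 3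
    + i *s unit4 2 0 + j *s unit4 2 1 + k *s unit4 2 2 + l *s unit4 2 3
    + n *s unit4 3 0 + p *s unit4 3 1 + q *s unit4 3 2 + r *s unit4 3 3"
    unfolding X unit4_def of_fun4_def by (simp add: M4_simps)
  also have "\<dots> \<in> m4vs.span ((\<lambda>k. unit4 (k div 4) (k mod 4)) ` {..<16})"
    by (intro m4vs.span_add m4vs.span_scale m) auto
  finally show ?thesis .
qed

text \<open>A vector outside the span would give an independent set of seventeen elements, whereas
  sixteen matrix units span.\<close>

lemma indep_16_spans:
  fixes g :: "nat \<Rightarrow> 'a::field m4"
  assumes ind: "\<And>c k. (\<Sum>k<16. c k *s g k) = 0 \<Longrightarrow> k < 16 \<Longrightarrow> c k = 0"
  obtains c where "X = (\<Sum>k<16. c k *s g k)"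
proof -
  let ?B = "g ` {..<16}"
  have inj: "inj_on g {..<16}"
  proof (rule inj_onI, rule ccontr)
    fix x y assume xy: "x \<in> {..<16::nat}" "y \<in> {..<16}" "g x = g y" "x \<noteq> y"
    have "(\<Sum>k<16. (if k = x then 1 else if k = y then -1 else 0) *s g k) =
       (\<Sum>k\<in>{x,y}. (if k = x then 1 else if k = y then -1 else 0) *s g k)"
      by (rule sum.mono_neutral_right) (use xy in auto)
    also have "\<dots> = 0" using xy by simp
    finally show False using ind[of "\<lambda>k. if k = x then 1 else if k = y then -1 else 0" x] xy by auto
  qed
  have indep: "m4vs.independent ?B"
  proof (rule m4vs.independent_if_scalars_zero)
    fix f x assume "(\<Sum>x\<in>?B. f x *s x) = 0" "x \<in> ?B"
    thus "f x = 0" using ind[of "f \<circ> g"] by (auto simp: sum.reindex[OF inj])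
  qed simp
  have "X \<in> m4vs.span ?B"
  proof (rule ccontr)
    assume "X \<notin> m4vs.span ?B"
    hence "X \<notin> ?B" using m4vs.span_base[of X ?B] by metis
    moreover from this have "m4vs.independent (insert X ?B)"
      using indep \<open>X \<notin> m4vs.span ?B\<close> m4vs.independent_insertI[of X ?B] by metis
    ultimately have "card (insert X ?B) \<le> card ((\<lambda>k. unit4 (k div 4) (k mod 4) :: 'a m4) ` {..<16})"
      using m4vs.independent_span_bound[of "(\<lambda>k. unit4 (k div 4) (k mod 4) :: 'a m4) ` {..<16}" "insert X ?B"] in_span_unit4 by auto
    also have "\<dots> \<le> 16" using card_image_le[of "{..<16::nat}"] by (metis card_lessThan finite_lessThan)
    also have "card (insert X ?B) = 17" using \<open>X \<notin> ?B\<close> card_image[OF inj] by simp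
    finally show False by simp
  qed
  then obtain u where "X = (\<Sum>v\<in>?B. u v *s v)"
    by (auto simp: m4vs.span_finite)
  thus ?thesis using that[of "u \<circ> g"] by (simp add: sum.reindex[OF inj])
qed

lemma lessThan_16: "{..<16} = {0,1,2,3,4,5,6,7,8,9,10,11,12,13,14,15::nat}"
proof -
  have "{..<16} = set [0..<16]" by (simp add: atLeast0LessThan)
  also have "[0..<16] = [0,1,2,3,4,5,6,7,8,9,10,11,12,13,14,15]" by (simp add: upt_rec)
  finally show ?thesis by simp
qed

lemma sum_16: "sum f {..<16::nat} = f 0 + f 1 + f 2 + f 3 + f 4 + f 5 + f 6 + f 7 + f 8 + f 9
   + f 10 + f 11 + f 12 + f 13 + f 14 + f 15"
  for f :: "nat \<Rightarrow> 'b::comm_monoid_add"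
  by (simp add: eval_nat_numeral add.assoc)

lemma quat_commute:
  assumes "biquat \<alpha>1 \<beta>1 i1 j1 \<alpha>2 \<beta>2 i2 j2"
  shows "i1 * quat i2 j2 x0 x1 x2 x3 = quat i2 j2 x0 x1 x2 x3 * i1"
    "j1 * quat i2 j2 x0 x1 x2 x3 = quat i2 j2 x0 x1 x2 x3 * j1"
    "quat i1 j1 y0 y1 y2 y3 * quat i2 j2 x0 x1 x2 x3 = quat i2 j2 x0 x1 x2 x3 * quat i1 j1 y0 y1 y2 y3"
proof -
  have c: "i2 * i1 = i1 * i2" "i2 * j1 = j1 * i2" "j2 * i1 = i1 * j2" "j2 * j1 = j1 * j2"
    using assms by (auto simp: biquat_def)
  have c': "i2 * (i1 * X) = i1 * (i2 * X)" "i2 * (j1 * X) = j1 * (i2 * X)"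
     "j2 * (i1 * X) = i1 * (j2 * X)" "j2 * (j1 * X) = j1 * (j2 * X)" for X
    using c by (simp_all add: mult.assoc[symmetric])
  show 1: "i1 * quat i2 j2 x0 x1 x2 x3 = quat i2 j2 x0 x1 x2 x3 * i1"
    and 2: "j1 * quat i2 j2 x0 x1 x2 x3 = quat i2 j2 x0 x1 x2 x3 * j1"
    by (simp_all add: quat_def algebra_simps c c')
  define Z where "Z = quat i2 j2 x0 x1 x2 x3"
  have "i1 * j1 * Z = Z * (i1 * j1)" using 1 2 unfolding Z_def[symmetric] by (metis mult.assoc)
  thus "quat i1 j1 y0 y1 y2 y3 * quat i2 j2 x0 x1 x2 x3 = quat i2 j2 x0 x1 x2 x3 * quat i1 j1 y0 y1 y2 y3"
    using 1 2 unfolding Z_def[symmetric] unfolding quat_def by (simp add: distrib_left distrib_right)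
qed

lemma quat_eq_0:
  fixes i j :: "'a::field m4"
  assumes 2: "(2::'a) \<noteq> 0" and Q: "quat_gens \<alpha> \<beta> i j" and "quat i j x0 x1 x2 x3 = 0"
  shows "x0 = 0 \<and> x1 = 0 \<and> x2 = 0 \<and> x3 = 0"
proof -
  have "x0 *s 1 = (0 :: 'a m4) \<and> x1 *s 1 = (0 :: 'a m4) \<and> x2 *s 1 = (0 :: 'a m4) \<and> x3 *s 1 = (0 :: 'a m4)"
    by (rule quat_indep[OF 2 Q]) (use assms(3) in \<open>auto simp: quat_def\<close>)
  thus ?thesis by simp
qed

text \<open>Independence over the first pair with coefficients in the second algebra, followed by
  independence inside the second algebra.\<close>

lemma biquat_indep:
  fixes i1 :: "'a::field m4"
  assumes 2: "(2::'a) \<noteq> 0" and B: "biquat \<alpha>1 \<beta>1 i1 j1 \<alpha>2 \<beta>2 i2 j2"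
    and eq: "quat i2 j2 a0 a1 a2 a3 + quat i2 j2 b0 b1 b2 b3 * i1
       + quat i2 j2 c0 c1 c2 c3 * j1 + quat i2 j2 d0 d1 d2 d3 * (i1 * j1) = 0"
  shows "a0 = 0 \<and> a1 = 0 \<and> a2 = 0 \<and> a3 = 0 \<and> b0 = 0 \<and> b1 = 0 \<and> b2 = 0 \<and> b3 = 0 \<and>
    c0 = 0 \<and> c1 = 0 \<and> c2 = 0 \<and> c3 = 0 \<and> d0 = 0 \<and> d1 = 0 \<and> d2 = 0 \<and> d3 = 0"
proof -
  have Q: "quat_gens \<alpha>1 \<beta>1 i1 j1" "quat_gens \<alpha>2 \<beta>2 i2 j2" using B by (auto simp: biquat_def)
  have "quat i2 j2 a0 a1 a2 a3 = 0 \<and> quat i2 j2 b0 b1 b2 b3 = 0 \<and> quat i2 j2 c0 c1 c2 c3 = 0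
      \<and> quat i2 j2 d0 d1 d2 d3 = 0"
    by (rule quat_indep[OF 2 Q(1) _ eq]) (use quat_commute(1,2)[OF B] in auto)
  thus ?thesis using quat_eq_0[OF 2 Q(2)] by metis
qed

lemma biquat_span:
  fixes i1 :: "'a::field m4"
  assumes 2: "(2::'a) \<noteq> 0" and B: "biquat \<alpha>1 \<beta>1 i1 j1 \<alpha>2 \<beta>2 i2 j2"
  obtains a0 a1 a2 a3 b0 b1 b2 b3 c0 c1 c2 c3 d0 d1 d2 d3 where
    "X = quat i2 j2 a0 a1 a2 a3 + quat i2 j2 b0 b1 b2 b3 * i1
       + quat i2 j2 c0 c1 c2 c3 * j1 + quat i2 j2 d0 d1 d2 d3 * (i1 * j1)"
proof -
  define g where "g k = [1, i2, j2, i2 * j2] ! (k mod 4) * [1, i1, j1, i1 * j1] ! (k div 4)" for k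
  have s: "(\<Sum>k<16. c k *s g k) = quat i2 j2 (c 0) (c 1) (c 2) (c 3) + quat i2 j2 (c 4) (c 5) (c 6) (c 7) * i1
       + quat i2 j2 (c 8) (c 9) (c 10) (c 11) * j1 + quat i2 j2 (c 12) (c 13) (c 14) (c 15) * (i1 * j1)" for c
    unfolding sum_16 by (simp add: g_def quat_def distrib_right add.assoc)
  obtain c where c: "X = (\<Sum>k<16. c k *s g k)"
  proof (rule indep_16_spans[of g X])
    fix c k assume "(\<Sum>k<16. c k *s g k) = 0" and k: "k < (16::nat)"
    from biquat_indep[OF 2 B this(1)[unfolded s]]
    have "\<forall>k\<in>{0,1,2,3,4,5,6,7,8,9,10,11,12,13,14,15}. c k = 0" by simp
    moreover have "k \<in> {0,1,2,3,4,5,6,7,8,9,10,11,12,13,14,15}"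
      using k unfolding lessThan_iff[symmetric] by (simp only: lessThan_16)
    ultimately show "c k = 0" by blast
  qed blast
  show ?thesis by (rule that[OF c[unfolded s]])
qed

text \<open>The products of the generators span all matrices, so \<open>Z\<close> commutes with
  every matrix; commuting with six matrix units already makes it scalar.\<close>

lemma biquat_central:
  fixes i1 :: "'a::field m4"
  assumes 2: "(2::'a) \<noteq> 0" and B: "biquat \<alpha>1 \<beta>1 i1 j1 \<alpha>2 \<beta>2 i2 j2"
    and c: "Z * i1 = i1 * Z" "Z * j1 = j1 * Z" "Z * i2 = i2 * Z" "Z * j2 = j2 * Z"
  obtains z where "Z = z *s 1"
proof -
  have "Z * quat i2 j2 x0 x1 x2 x3 = quat i2 j2 x0 x1 x2 x3 * Z" for x0 x1 x2 x3
  proof -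
    have "Z * (i2 * j2) = i2 * j2 * Z" using c by (metis mult.assoc)
    thus ?thesis using c by (simp add: quat_def distrib_left distrib_right)
  qed
  moreover have "Z * (i1 * j1) = i1 * j1 * Z" using c by (metis mult.assoc)
  ultimately have all: "Z * X = X * Z" for X
    using biquat_span[OF 2 B, of X] c by (smt (verit, best) distrib_left distrib_right mult.assoc)
  obtain a b c d e f g h i j k l n p q r where X: "Z = M4 a b c d e f g h i j k l n p q r" by (cases Z)
  have "Z = a *s 1"
    using all[of "M4 0 1 0 0 0 0 0 0 0 0 0 0 0 0 0 0"] all[of "M4 0 0 1 0 0 0 0 0 0 0 0 0 0 0 0 0"]
      all[of "M4 0 0 0 1 0 0 0 0 0 0 0 0 0 0 0 0"] all[of "M4 0 0 0 0 1 0 0 0 0 0 0 0 0 0 0 0"]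
      all[of "M4 0 0 0 0 0 0 0 0 1 0 0 0 0 0 0 0"] all[of "M4 0 0 0 0 0 0 0 0 0 0 0 0 1 0 0 0"]
    unfolding X by (simp add: M4_simps)
  thus ?thesis by (rule that)
qed

section \<open>Quaternion decompositions and Kronecker asymmetries\<close>

text \<open>\<open>x \<otimes> 1\<close> and \<open>1 \<otimes> x\<close> for a \<open>2 \<times> 2\<close> matrix \<open>x\<close>, the basis vector \<open>e\<^sub>i \<otimes> e\<^sub>j\<close> having index \<open>2i + j\<close>.\<close>

definition kronL :: "'a::field \<Rightarrow> 'a \<Rightarrow> 'a \<Rightarrow> 'a \<Rightarrow> 'a m4" where
  "kronL a b c d = M4 a 0 b 0  0 a 0 b  c 0 d 0  0 c 0 d"

definition kronR :: "'a::field \<Rightarrow> 'a \<Rightarrow> 'a \<Rightarrow> 'a \<Rightarrow> 'a m4" where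
  "kronR a b c d = M4 a b 0 0  c d 0 0  0 0 a b  0 0 c d"

text \<open>The adjoint anti-automorphism of \<open>M\<close> is \<open>Int(s\<^sub>i)\<close> after the canonical involution on two commuting
  quaternion algebras iff that of \<open>M s\<^sub>1 s\<^sub>2\<close> is the canonical involution on both, which is the
  relation below on generators.\<close>

definition biquat_decomposable :: "'a::field m4 \<Rightarrow> bool" where
  "biquat_decomposable M \<longleftrightarrow> (\<exists>\<alpha>1 \<beta>1 i1 j1 \<alpha>2 \<beta>2 i2 j2 x0 x1 x2 x3 y0 y1 y2 y3.
     biquat \<alpha>1 \<beta>1 i1 j1 \<alpha>2 \<beta>2 i2 j2 \<and>
     det4 (quat i1 j1 x0 x1 x2 x3 * quat i2 j2 y0 y1 y2 y3) \<noteq> 0 \<and>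
     (\<forall>e\<in>{i1, j1, i2, j2}. tr4 e * (M * quat i1 j1 x0 x1 x2 x3 * quat i2 j2 y0 y1 y2 y3) =
        - (M * quat i1 j1 x0 x1 x2 x3 * quat i2 j2 y0 y1 y2 y3 * e)))"

text \<open>With \<open>J\<close> the alternating \<open>2 \<times> 2\<close> matrix, every \<open>2 \<times> 2\<close> matrix is \<open>J (k - x)\<close> with \<open>x\<close> traceless, and
  its transpose is \<open>- J (k + x)\<close>. The asymmetry of a tensor product is therefore the quotient of
  \<open>(k\<^sub>1 + W\<^sub>1)(k\<^sub>2 + W\<^sub>2)\<close> by \<open>(k\<^sub>1 - W\<^sub>1)(k\<^sub>2 - W\<^sub>2)\<close>, with \<open>W\<^sub>i\<close> the image of \<open>x\<^sub>i\<close>.\<close>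

definition kron_asymmetry :: "'a::field m4 \<Rightarrow> 'a \<Rightarrow> 'a m4 \<Rightarrow> 'a \<Rightarrow> 'a m4 \<Rightarrow> bool" where
  "kron_asymmetry M k1 W1 k2 W2 \<longleftrightarrow>
     tr4 M * (k1 *s 1 - W1) * (k2 *s 1 - W2) = M * (k1 *s 1 + W1) * (k2 *s 1 + W2)"

definition kron_decomposable :: "'a::field m4 \<Rightarrow> bool" where
  "kron_decomposable M \<longleftrightarrow> (\<exists>P k1 k2 a b c a' b' c'. det4 P \<noteq> 0 \<and>
     k1\<^sup>2 \<noteq> a\<^sup>2 + b * c \<and> k2\<^sup>2 \<noteq> a'\<^sup>2 + b' * c' \<and>
     kron_asymmetry (tr4 P * M * P) k1 (kronL a b c (- a)) k2 (kronR a' b' c' (- a')))"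

lemma alternating4:
  fixes S :: "'a::field m4"
  assumes 2: "(2::'a) \<noteq> 0" and S: "tr4 S = - S"
  obtains a b c d e f where "S = M4 0 a b c (-a) 0 d e (-b) (-d) 0 f (-c) (-e) (-f) 0"
proof -
  obtain a b c d e f g h i j k l n p q r where X: "S = M4 a b c d e f g h i j k l n p q r" by (cases S)
  have z: "x = 0" if "x = - x" for x :: 'a
  proof -
    have "2 * x = 0" using that by (metis add.right_inverse mult_2)
    thus ?thesis using 2 by simp
  qed
  have "S = M4 0 b c d (-b) 0 g h (-c) (-g) 0 l (-d) (-h) (-l) 0"
  proof -
    have e: "a = - a" "e = - b" "i = - c" "n = - d" "f = - f" "j = - g" "p = - h" "k = - k" "q = - l" "r = - r"
      using S[unfolded X tr4.simps M4_simps m4.inject] by blast+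
    show ?thesis unfolding X z[OF e(1)] z[OF e(5)] z[OF e(8)] z[OF e(10)]
      by (simp only: e(2-4,6,7,9))
  qed
  thus ?thesis by (rule that)
qed

text \<open>Alternating pencils have a square characteristic polynomial: the Pfaffian adjoint
  makes \<open>F\<close> satisfy a quadratic equation.\<close>

lemma alternating_pencil_quadratic:
  fixes S F :: "'a::field m4"
  assumes 2: "(2::'a) \<noteq> 0" and S: "tr4 S = - S" and d: "det4 S \<noteq> 0" and Y: "tr4 (S * F) = - (S * F)"
  obtains c p where "F * F = c *s F + p *s 1"
proof -
  obtain a b c d e f where SM: "S = M4 0 a b c (-a) 0 d e (-b) (-d) 0 f (-c) (-e) (-f) 0"
    by (rule alternating4[OF 2 S])
  obtain a' b' c' d' e' f' where YM: "S * F = M4 0 a' b' c' (-a') 0 d' e' (-b') (-d') 0 f' (-c') (-e') (-f') 0"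
    by (rule alternating4[OF 2 Y])
  \<comment> \<open>The Pfaffian adjoints of \<open>S\<close> and \<open>S * F\<close>, with
    Pfaffians \<open>pS\<close> and \<open>pY\<close>. The third identity below is the polarisation
    of \<open>S * hS = pS *s 1\<close>.\<close>
  define hS where "hS = M4 0 (-f) e (-d)  f 0 (-c) b  (-e) c 0 (-a)  d (-b) a 0"
  define hY where "hY = M4 0 (-f') e' (-d')  f' 0 (-c') b'  (-e') c' 0 (-a')  d' (-b') a' 0"
  define pS pY t where "pS = a*f - b*e + c*d" and "pY = a'*f' - b'*e' + c'*d'"
    and "t = a*f' + a'*f - b*e' - b'*e + c*d' + c'*d"
  have 1: "hS * S = pS *s 1" unfolding hS_def SM pS_def by (simp add: M4_simps algebra_simps)
  have 2: "hY * (S * F) = pY *s 1" unfolding hY_def YM pY_def by (simp add: M4_simps algebra_simps)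
  have 3: "S * hY + S * F * hS = t *s 1"
    unfolding YM hS_def hY_def t_def unfolding SM by (simp add: M4_simps algebra_simps)
  obtain Si where Si: "S * Si = 1" "Si * S = 1" by (rule det4_inverse[OF d])
  have pS: "pS \<noteq> 0"
  proof
    assume "pS = 0"
    hence "hS * S * Si = 0" using 1 by simp
    hence "hS = 0" using Si by (simp add: mult.assoc)
    hence "S = 0" unfolding hS_def SM by (simp add: M4_simps)
    thus False using Si by simp
  qed
  have "(S * hY + S * F * hS) * (S * F) = S * (pY *s 1 + pS *s (F * F))"
    by (simp add: distrib_left distrib_right mult.assoc 2)
      (simp add: mult.assoc[symmetric], simp add: mult.assoc, simp add: mult.assoc[symmetric, of hS] 1)
  hence "S * (t *s F) = S * (pY *s 1 + pS *s (F * F))" unfolding 3 by simp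
  hence "Si * (S * (t *s F)) = Si * (S * (pY *s 1 + pS *s (F * F)))" by simp
  hence "t *s F = pY *s 1 + pS *s (F * F)" unfolding mult.assoc[symmetric] Si by simp
  hence "F * F = (1 / pS) *s (t *s F - pY *s 1)" using pS by simp
  thus ?thesis using that[of "t / pS" "- (pY / pS)"] pS by (simp add: smul_distrib)
qed

section \<open>Forms for which the generators of two commuting quaternion algebras are skew\<close>

locale skew_biquat =
  fixes \<alpha>1 \<beta>1 :: "'a::field" and i1 j1 \<alpha>2 \<beta>2 i2 j2 S
  assumes two: "(2::'a) \<noteq> 0" and B: "biquat \<alpha>1 \<beta>1 i1 j1 \<alpha>2 \<beta>2 i2 j2"
    and det_S: "det4 S \<noteq> 0"
    and skew: "tr4 i1 * S = - (S * i1)" "tr4 j1 * S = - (S * j1)"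
      "tr4 i2 * S = - (S * i2)" "tr4 j2 * S = - (S * j2)"
begin

lemma Q1: "quat_gens \<alpha>1 \<beta>1 i1 j1" and Q2: "quat_gens \<alpha>2 \<beta>2 i2 j2"
  and comm: "i2 * i1 = i1 * i2" "i2 * j1 = j1 * i2" "j2 * i1 = i1 * j2" "j2 * j1 = j1 * j2"
  using B by (auto simp: biquat_def)

lemmas q = quat_gensD[OF Q1] quat_gensD[OF Q2]

lemma comm': "i2 * (i1 * X) = i1 * (i2 * X)" "i2 * (j1 * X) = j1 * (i2 * X)"
  "j2 * (i1 * X) = i1 * (j2 * X)" "j2 * (j1 * X) = j1 * (j2 * X)"
  using comm by (simp_all add: mult.assoc[symmetric])

lemma skew': "tr4 i1 * (S * X) = - (S * (i1 * X))" "tr4 j1 * (S * X) = - (S * (j1 * X))"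
  "tr4 i2 * (S * X) = - (S * (i2 * X))" "tr4 j2 * (S * X) = - (S * (j2 * X))"
  using skew by (simp_all add: mult.assoc[symmetric])

text \<open>Transposing the skewness relations shows that \<open>Si * tr4 S\<close> commutes with
  all four generators, so it is a scalar \<open>z\<close>; transposing twice gives
  \<open>z * z = 1\<close>.\<close>

lemma transpose_S: "tr4 S = S \<or> tr4 S = - S"
proof -
  obtain Si where Si: "S * Si = 1" "Si * S = 1" by (rule det4_inverse[OF det_S])
  have c: "Si * tr4 S * e = e * (Si * tr4 S)" if e: "tr4 e * S = - (S * e)" for e
  proof -
    have t: "tr4 S * e = - (tr4 e * tr4 S)" using arg_cong[OF e, of tr4] by (simp add: minus_equation_iff) 
    have "Si * (tr4 e * S) * Si = - (Si * S * e * Si)" using e by (simp add: mult.assoc)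
    hence s: "Si * tr4 e = - (e * Si)" using Si by (simp add: mult.assoc)
    have "Si * tr4 S * e = - (Si * tr4 e * tr4 S)" using t by (simp add: mult.assoc)
    thus ?thesis using s by (simp add: mult.assoc)
  qed
  obtain z where z: "Si * tr4 S = z *s 1"
    by (rule biquat_central[OF two B c[OF skew(1)] c[OF skew(2)] c[OF skew(3)] c[OF skew(4)]])
  have "S * (Si * tr4 S) = z *s S" using z by simp
  hence t: "tr4 S = z *s S" using Si by (simp add: mult.assoc[symmetric])
  have "S = z *s tr4 S" using arg_cong[OF t, of tr4] by simp
  hence "S = (z * z) *s S" using t by (metis smul_simps(3))
  hence "(1 - z * z) *s S = 0" by (metis diff_self smul_distrib(4) smul_simps(4))
  moreover have "S \<noteq> 0" using Si by auto
  ultimately have "1 - z * z = 0" by (metis smul_eq_0_iff)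
  hence "(1 - z) * (1 + z) = 0" by (simp add: algebra_simps)
  hence "z = 1 \<or> z = -1" by (auto simp: eq_neg_iff_add_eq_0 add.commute)
  thus ?thesis using t by auto
qed

lemma S_symmetric: "tr4 S = S"
proof (rule ccontr)
  assume "tr4 S \<noteq> S"
  hence S: "tr4 S = - S" using transpose_S by auto
  \<comment> \<open>A product of two commuting skew elements is self-adjoint, so
    \<open>S * ?F\<close> is alternating along with \<open>S\<close>. The square of
    \<open>?F\<close> contains \<open>2 *s (i2 * j2 * (i1 * j1))\<close>, a basis element that does
    not occur in \<open>c *s ?F + p *s 1\<close>.\<close>
  let ?F = "i1 * i2 + j1 * j2"
  have "tr4 (S * ?F) = - (S * ?F)"
    by (simp add: S distrib_left distrib_right mult.assoc skew skew' comm)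
  then obtain c p where e: "?F * ?F = c *s ?F + p *s 1"
    by (rule alternating_pencil_quadratic[OF two S det_S])
  have "?F * ?F = (\<alpha>1 * \<alpha>2 + \<beta>1 * \<beta>2) *s 1 + 2 *s (i2 * j2 * (i1 * j1))"
  proof -
    have "?F * ?F = \<alpha>1 *s \<alpha>2 *s 1 + \<beta>1 *s \<beta>2 *s 1 + (i1 * i2 * (j1 * j2) + j1 * j2 * (i1 * i2))"
      using q comm comm' by (simp add: distrib_left distrib_right mult.assoc algebra_simps)
    also have "i1 * i2 * (j1 * j2) = i2 * j2 * (i1 * j1)"
      using comm comm' by (simp add: mult.assoc)
    also have "j1 * j2 * (i1 * i2) = i2 * j2 * (i1 * j1)"
      using q comm comm' by (simp add: mult.assoc)
    also have "i2 * j2 * (i1 * j1) + i2 * j2 * (i1 * j1) = 2 *s (i2 * j2 * (i1 * j1))"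
      using smul_distrib(2)[of 1 1 "i2 * j2 * (i1 * j1)"] by simp
    finally show ?thesis by (simp add: smul_distrib)
  qed
  hence "quat i2 j2 (\<alpha>1 * \<alpha>2 + \<beta>1 * \<beta>2 - p) 0 0 0 + quat i2 j2 0 (- c) 0 0 * i1
     + quat i2 j2 0 0 (- c) 0 * j1 + quat i2 j2 0 0 0 2 * (i1 * j1) = 0"
    using e comm by (simp add: quat_def smul_distrib algebra_simps)
  from biquat_indep[OF two B this] show False using two by simp
qed

end

text \<open>A vector is encoded as the first column of a matrix:
  \<open>e00 (tr4 X * (S * Y))\<close> is the value of the form \<open>S\<close> at the first
  columns of \<open>X\<close> and \<open>Y\<close>. Vectors thereby stay inside the ring of
  matrices.\<close>

fun e00 :: "'a m4 \<Rightarrow> 'a" where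
  "e00 (M4 a b c d e f g h i j k l n p q r) = a"

lemma e00_simps [simp]:
  fixes X :: "'a::comm_ring_1 m4"
  shows "e00 (X + Y) = e00 X + e00 Y" "e00 (X - Y) = e00 X - e00 Y" "e00 (- X) = - e00 X"
    "e00 (c *s X) = c * e00 X" "e00 (tr4 X) = e00 X" "e00 (0 :: 'a m4) = 0"
  by (cases X; cases Y; simp add: M4_simps)+

lemma e00_alternating:
  fixes X :: "'a::field m4"
  assumes "(2::'a) \<noteq> 0" "tr4 G = - G"
  shows "e00 (tr4 X * (G * X)) = 0"
proof -
  have "e00 (tr4 X * (G * X)) = e00 (tr4 (tr4 X * (G * X)))" by (metis e00_simps(5))
  also have "\<dots> = - e00 (tr4 X * (G * X))" using assms(2) by (simp add: mult.assoc)
  finally have "2 * e00 (tr4 X * (G * X)) = 0" by (metis add.right_inverse mult_2)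
  thus ?thesis using assms(1) by simp
qed

text \<open>The values at the unit vectors and at sums of two of them determine all entries, since 2
  is invertible.\<close>

lemma symmetric_ex_nonzero_value:
  fixes G :: "'a::field m4"
  assumes 2: "(2::'a) \<noteq> 0" and G: "tr4 G = G" "G \<noteq> 0"
  obtains X where "e00 (tr4 X * (G * X)) \<noteq> 0"
proof -
  obtain a b c d e f g h i j k l n p q r where X: "G = M4 a b c d e f g h i j k l n p q r" by (cases G)
  have s: "e = b" "i = c" "n = d" "j = g" "p = h" "q = l" using G(1)[unfolded X tr4.simps m4.inject] by blast+
  define v where "v x y z t = M4 x 0 0 0 y 0 0 0 z 0 0 0 t 0 0 (0::'a)" for x y z t
  have val: "e00 (tr4 (v x y z t) * (G * v x y z t)) =
      a*x*x + f*y*y + k*z*z + r*t*t + 2*b*x*y + 2*c*x*z + 2*d*x*t + 2*g*y*z + 2*h*y*t + 2*l*z*t" for x y z t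
    unfolding X v_def s by (simp add: M4_simps algebra_simps)
  show ?thesis
  proof (rule ccontr)
    assume "\<not> thesis"
    hence 0: "a*x*x + f*y*y + k*z*z + r*t*t + 2*b*x*y + 2*c*x*z + 2*d*x*t + 2*g*y*z + 2*h*y*t + 2*l*z*t = 0" for x y z t
      using that val by metis
    have "a = 0" "f = 0" "k = 0" "r = 0" using 0[of 1 0 0 0] 0[of 0 1 0 0] 0[of 0 0 1 0] 0[of 0 0 0 1] by simp_all
    moreover from this have "b = 0" "c = 0" "d = 0" "g = 0" "h = 0" "l = 0"
      using 0[of 1 1 0 0] 0[of 1 0 1 0] 0[of 1 0 0 1] 0[of 0 1 1 0] 0[of 0 1 0 1] 0[of 0 0 1 1] 2 by simp_all
    ultimately have "G = 0" unfolding X s by (simp add: M4_simps)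
    thus False using G(2) by simp
  qed
qed

context skew_biquat
begin

lemma pure_skew:
  "tr4 (quat i1 j1 0 u1 u2 u3) * S = - (S * quat i1 j1 0 u1 u2 u3)"
  "tr4 (quat i2 j2 0 u1 u2 u3) * S = - (S * quat i2 j2 0 u1 u2 u3)"
  by (simp_all add: quat_def distrib_right distrib_left mult.assoc skew skew' q)

lemma pure_square:
  "quat i1 j1 0 u1 u2 u3 * quat i1 j1 0 u1 u2 u3 = (u1\<^sup>2 * \<alpha>1 + u2\<^sup>2 * \<beta>1 - u3\<^sup>2 * (\<alpha>1 * \<beta>1)) *s 1"
  "quat i2 j2 0 u1 u2 u3 * quat i2 j2 0 u1 u2 u3 = (u1\<^sup>2 * \<alpha>2 + u2\<^sup>2 * \<beta>2 - u3\<^sup>2 * (\<alpha>2 * \<beta>2)) *s 1"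
  by (simp_all add: quat_def distrib_right distrib_left mult.assoc q smul_distrib power2_eq_square algebra_simps)

text \<open>In the basis of sixteen products, the product of two pure quaternions has only the nine
  coefficients \<open>vl * uk\<close>, and none of them belongs to 1. It is scalar only if all nine
  vanish.\<close>

lemma not_scalar:
  assumes u: "(u1, u2, u3) \<noteq> (0, 0, 0)" and v: "(v1, v2, v3) \<noteq> (0, 0, 0)"
  shows "quat i1 j1 0 u1 u2 u3 * quat i2 j2 0 v1 v2 v3 \<noteq> \<rho> *s 1"
proof
  assume "quat i1 j1 0 u1 u2 u3 * quat i2 j2 0 v1 v2 v3 = \<rho> *s 1"
  hence "quat i2 j2 0 v1 v2 v3 * quat i1 j1 0 u1 u2 u3 - \<rho> *s 1 = 0"
    using quat_commute(3)[OF B] by simp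
  moreover have "quat i2 j2 0 v1 v2 v3 * quat i1 j1 0 u1 u2 u3 - \<rho> *s 1 =
      quat i2 j2 (- \<rho>) 0 0 0 + quat i2 j2 0 (v1 * u1) (v2 * u1) (v3 * u1) * i1
     + quat i2 j2 0 (v1 * u2) (v2 * u2) (v3 * u2) * j1 + quat i2 j2 0 (v1 * u3) (v2 * u3) (v3 * u3) * (i1 * j1)"
    by (simp add: quat_def distrib_left distrib_right mult.assoc smul_distrib algebra_simps)
  ultimately have "v1 * u1 = 0 \<and> v2 * u1 = 0 \<and> v3 * u1 = 0 \<and> v1 * u2 = 0 \<and> v2 * u2 = 0 \<and> v3 * u2 = 0
     \<and> v1 * u3 = 0 \<and> v2 * u3 = 0 \<and> v3 * u3 = 0"
    using biquat_indep[OF two B] by metis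
  thus False using u v by auto
qed

text \<open>The Gram determinant of \<open>X, w\<^sub>2 X, w\<^sub>1 X, w\<^sub>1 w\<^sub>2 X\<close> with respect to \<open>S\<close> is the square of
  \<open>\<delta> c\<^sup>2 - d\<^sup>2\<close>; here \<open>X\<close> stands for its first column.\<close>

lemma ex_cyclic:
  assumes u: "(u1, u2, u3) \<noteq> (0, 0, 0)" and v: "(v1, v2, v3) \<noteq> (0, 0, 0)"
    and w1: "w1 = quat i1 j1 0 u1 u2 u3" and w2: "w2 = quat i2 j2 0 v1 v2 v3"
    and o1: "w1 * w1 = \<omega>1 *s 1" and o2: "w2 * w2 = \<omega>2 *s 1"
  obtains X where "\<omega>1 * \<omega>2 * (e00 (tr4 X * (S * X)))\<^sup>2 \<noteq> (e00 (tr4 X * (S * (w1 * w2 * X))))\<^sup>2"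
proof (rule ccontr)
  assume "\<not> thesis"
  hence eq: "\<omega>1 * \<omega>2 * (e00 (tr4 X * (S * X)))\<^sup>2 = (e00 (tr4 X * (S * (w1 * w2 * X))))\<^sup>2" for X
    using that by blast
  define T where "T = w1 * w2"
  have cm: "w2 * w1 = w1 * w2" unfolding w1 w2 using quat_commute(3)[OF B] by simp
  have sk: "tr4 w1 * S = - (S * w1)" "tr4 w2 * S = - (S * w2)" unfolding w1 w2 by (rule pure_skew)+
  have skT: "tr4 T * S = S * T"
  proof -
    have "tr4 T * S = tr4 w2 * (tr4 w1 * S)" by (simp add: T_def mult.assoc)
    also have "\<dots> = - (tr4 w2 * S * w1)" by (simp add: sk(1) mult.assoc)
    also have "\<dots> = - (- (S * w2) * w1)" by (simp only: sk)
    also have "\<dots> = S * (w2 * w1)" by (simp add: mult.assoc)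
    finally show ?thesis by (simp add: cm T_def)
  qed
  have skT': "tr4 T * (S * X) = S * (T * X)" for X using skT by (simp add: mult.assoc[symmetric])
  have TT: "T * T = (\<omega>1 * \<omega>2) *s 1"
  proof -
    have "T * T = w1 * w1 * (w2 * w2)" unfolding T_def using cm by (metis mult.assoc)
    thus ?thesis by (simp add: o1 o2)
  qed
  have Tns: "T \<noteq> \<rho> *s 1" for \<rho> unfolding T_def w1 w2 by (rule not_scalar[OF u v])
  note Ssym = S_symmetric
  have S0: "S \<noteq> 0" using det_S by (auto simp: M4_simps det4_M4)
  obtain Si where Si: "S * Si = 1" "Si * S = 1" by (rule det4_inverse[OF det_S])
  have val: "\<exists>X. e00 (tr4 X * (S * ((T + r *s 1) * X))) \<noteq> 0" for r
  proof -
    have "T + r *s 1 \<noteq> 0" using Tns[of "- r"] by (simp add: add_eq_0_iff2)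
    hence "S * (T + r *s 1) \<noteq> 0" using Si by (metis mult.assoc mult.left_neutral mult_zero_right)
    moreover have "tr4 (S * (T + r *s 1)) = S * (T + r *s 1)"
      by (simp add: Ssym distrib_left distrib_right skT)
    ultimately show ?thesis by (metis symmetric_ex_nonzero_value[OF two] mult.assoc)
  qed
  obtain X0 where X0: "e00 (tr4 X0 * (S * X0)) \<noteq> 0"
    by (rule symmetric_ex_nonzero_value[OF two Ssym S0])
  \<comment> \<open>If no \<open>X\<close> works, the values at an anisotropic \<open>X0\<close>
    exhibit \<open>\<omega>1 * \<omega>2\<close>, the square of \<open>T\<close>, as the square of
    \<rho>.\<close>
  define \<rho> where "\<rho> = e00 (tr4 X0 * (S * (w1 * w2 * X0))) / e00 (tr4 X0 * (S * X0))"
  have \<rho>: "\<omega>1 * \<omega>2 = \<rho>\<^sup>2"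
    unfolding \<rho>_def power_divide eq[of X0, symmetric] using X0 by simp
  show False
  proof (cases "\<rho> = 0")
    case True
    obtain X where "e00 (tr4 X * (S * (T * X))) \<noteq> 0" using val[of 0] by auto
    thus False using eq[of X] \<rho> True by (simp add: T_def)
  next
    case False
    obtain Y where Y: "e00 (tr4 Y * (S * ((T + \<rho> *s 1) * Y))) \<noteq> 0" using val by blast
    obtain Z where Z: "e00 (tr4 Z * (S * ((T + (- \<rho>) *s 1) * Z))) \<noteq> 0" using val by blast
    \<comment> \<open>\<open>T + \<rho>\<close> and \<open>T - \<rho>\<close> map into the
      eigenspaces of \<open>T\<close> for \<rho> and -\<rho>, which are orthogonal because
      \<open>T\<close> is self-adjoint. The choice of \<open>Y\<close> and \<open>Z\<close> makes
      \<open>Xp\<close> and \<open>Xm\<close> anisotropic; at their sum the two sides of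
      \<open>eq\<close> differ by \<open>4 \<rho>^2 cP cM\<close>, which is not 0.\<close>
    define Xp Xm where "Xp = T * Y + \<rho> *s Y" and "Xm = T * Z - \<rho> *s Z"
    have TTX: "T * (T * X) = \<rho>\<^sup>2 *s X" for X using TT \<rho> by (simp add: mult.assoc[symmetric])
    have Tp: "T * Xp = \<rho> *s Xp" and Tm: "T * Xm = - (\<rho> *s Xm)"
      by (simp_all add: Xp_def Xm_def distrib_left right_diff_distrib TTX smul_distrib power2_eq_square)
    have cr: "e00 (tr4 (T * Y + r *s Y) * (S * (T * Y + r *s Y))) = 2 * r * e00 (tr4 Y * (S * ((T + r *s 1) * Y)))"
      if "r * r = \<rho>\<^sup>2" for r Y
    proof -
      have E: "tr4 (T * Y + r *s Y) * (S * (T * Y + r *s Y)) =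
          \<rho>\<^sup>2 *s (tr4 Y * (S * Y)) + r *s (tr4 Y * (S * (T * Y)))
          + r *s (tr4 Y * (S * (T * Y))) + (r * r) *s (tr4 Y * (S * Y))"
        by (simp add: distrib_left distrib_right mult.assoc skT' TTX smul_distrib add.assoc)
      show ?thesis unfolding E
        by (simp add: distrib_left distrib_right that[symmetric] mult.assoc)
    qed
    have cp: "e00 (tr4 Xp * (S * Xp)) = 2 * \<rho> * e00 (tr4 Y * (S * ((T + \<rho> *s 1) * Y)))"
      unfolding Xp_def by (rule cr) (simp add: power2_eq_square)
    have cm': "e00 (tr4 Xm * (S * Xm)) = 2 * (- \<rho>) * e00 (tr4 Z * (S * ((T + (- \<rho>) *s 1) * Z)))"
      using cr[of "- \<rho>" Z] unfolding Xm_def by (simp add: power2_eq_square)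
    have "\<rho> *s (tr4 Xp * (S * Xm)) = tr4 (T * Xp) * (S * Xm)" by (simp add: Tp)
    also have "\<dots> = tr4 Xp * (S * (T * Xm))" by (simp add: mult.assoc skT')
    also have "\<dots> = - (\<rho> *s (tr4 Xp * (S * Xm)))" by (simp add: Tm)
    finally have "\<rho> *s (tr4 Xp * (S * Xm)) + \<rho> *s (tr4 Xp * (S * Xm)) = 0"
      unfolding eq_neg_iff_add_eq_0 .
    hence "\<rho> *s (tr4 Xp * (S * Xm)) = 0" by (rule two_cancel[OF two])
    hence z: "tr4 Xp * (S * Xm) = 0" using False by simp
    have "tr4 Xm * (S * Xp) = tr4 (tr4 Xp * (S * Xm))" by (simp add: Ssym mult.assoc)
    hence z': "tr4 Xm * (S * Xp) = 0" unfolding z by simp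
    define cP cM where "cP = e00 (tr4 Xp * (S * Xp))" and "cM = e00 (tr4 Xm * (S * Xm))"
    have c: "e00 (tr4 (Xp + Xm) * (S * (Xp + Xm))) = cP + cM"
      by (simp add: distrib_left distrib_right z z' cP_def cM_def)
    have d: "e00 (tr4 (Xp + Xm) * (S * (w1 * w2 * (Xp + Xm)))) = \<rho> * (cP - cM)"
      unfolding T_def[symmetric]
      by (simp add: distrib_left distrib_right Tp Tm z z' cP_def cM_def algebra_simps)
    have "\<rho>\<^sup>2 * (cP + cM)\<^sup>2 = (\<rho> * (cP - cM))\<^sup>2" using eq[of "Xp + Xm"] unfolding c d \<rho> .
    hence "\<rho>\<^sup>2 * (2 * 2 * (cP * cM)) = 0" by (simp add: power2_eq_square algebra_simps)
    hence "cP = 0 \<or> cM = 0" using False two by (metis mult_eq_0_iff power_not_zero)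
    thus False using cp cm' Y Z False two by (auto simp: cP_def cM_def)
  qed
qed

end

text \<open>The base change matrix of four vectors in the encoding of \<open>e00\<close>.\<close>

fun cols4 :: "'a m4 \<Rightarrow> 'a m4 \<Rightarrow> 'a m4 \<Rightarrow> 'a m4 \<Rightarrow> 'a m4" where
  "cols4 (M4 a0 _ _ _ b0 _ _ _ c0 _ _ _ d0 _ _ _) (M4 a1 _ _ _ b1 _ _ _ c1 _ _ _ d1 _ _ _)
     (M4 a2 _ _ _ b2 _ _ _ c2 _ _ _ d2 _ _ _) (M4 a3 _ _ _ b3 _ _ _ c3 _ _ _ d3 _ _ _) =
   M4 a0 a1 a2 a3 b0 b1 b2 b3 c0 c1 c2 c3 d0 d1 d2 d3"

lemma cols4_mult:
  fixes F :: "'a::field m4"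
  shows "F * cols4 U0 U1 U2 U3 = cols4 (F * U0) (F * U1) (F * U2) (F * U3)"
  by (cases F; cases U0; cases U1; cases U2; cases U3) (simp add: M4_simps)

lemma cols4_kron:
  fixes w :: "'a::field"
  shows "cols4 U0 U1 U2 U3 * kronL 0 w 1 0 = cols4 U2 U3 (w *s U0) (w *s U1)"
    "cols4 U0 U1 U2 U3 * kronR 0 w 1 0 = cols4 U1 (w *s U0) U3 (w *s U2)"
  by (cases U0; cases U1; cases U2; cases U3; simp add: M4_simps kronL_def kronR_def mult.commute)+

lemma cols4_gram:
  fixes U0 :: "'a::field m4"
  shows "tr4 (cols4 U0 U1 U2 U3) * cols4 V0 V1 V2 V3 =
    M4 (e00 (tr4 U0 * V0)) (e00 (tr4 U0 * V1)) (e00 (tr4 U0 * V2)) (e00 (tr4 U0 * V3))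
       (e00 (tr4 U1 * V0)) (e00 (tr4 U1 * V1)) (e00 (tr4 U1 * V2)) (e00 (tr4 U1 * V3))
       (e00 (tr4 U2 * V0)) (e00 (tr4 U2 * V1)) (e00 (tr4 U2 * V2)) (e00 (tr4 U2 * V3))
       (e00 (tr4 U3 * V0)) (e00 (tr4 U3 * V1)) (e00 (tr4 U3 * V2)) (e00 (tr4 U3 * V3))"
  by (cases U0; cases U1; cases U2; cases U3; cases V0; cases V1; cases V2; cases V3) (simp add: M4_simps)

lemma det4_kron:
  fixes k :: "'a::field"
  shows "det4 (k *s 1 + kronL a b c (- a)) = (k\<^sup>2 - (a\<^sup>2 + b * c))\<^sup>2"
    "det4 (k *s 1 + kronR a b c (- a)) = (k\<^sup>2 - (a\<^sup>2 + b * c))\<^sup>2"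
  by (simp_all add: M4_simps kronL_def kronR_def det4_M4 power2_eq_square algebra_simps)

lemma kron_smul:
  "e *s kronL a b c d = kronL (e * a) (e * b) (e * c) (e * d)"
  "e *s kronR a b c d = kronR (e * a) (e * b) (e * c) (e * d)"
  by (simp_all add: kronL_def kronR_def)

text \<open>A scalar quaternion has no pure part to give a direction; in that case an arbitrary
  nonzero pure quaternion is taken with coefficient \<open>e = 0\<close>. The construction of a
  cyclic vector requires a nonzero direction.\<close>

lemma quat_pure_part:
  fixes i j :: "'a::field m4"
  obtains e u1 u2 u3 where "quat i j x0 x1 x2 x3 = x0 *s 1 + e *s quat i j 0 u1 u2 u3"
    and "(u1, u2, u3) \<noteq> (0, 0, 0)"
proof (cases "(x1, x2, x3) = (0, 0, 0)")
  case True
  thus ?thesis using that[of 0 1 0 0] by (simp add: quat_def)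
next
  case False
  thus ?thesis using that[of 1 x1 x2 x3] by (simp add: quat_def add.assoc)
qed

text \<open>The vectors \<open>w1^i w2^j X\<close>, placed at index \<open>2 * i + j\<close>, form a
  basis in which left multiplication by \<open>w1\<close> and \<open>w2\<close> is
  \<open>kronL\<close> and \<open>kronR\<close> of a companion matrix. As \<open>s1\<close> and
  \<open>s2\<close> are linear in \<open>w1\<close> and \<open>w2\<close>, the identity
  \<open>tr4 M * (g1 * g2) = S = M * s1 * s2\<close> becomes the Kronecker asymmetry in that basis.
  The Gram matrix of \<open>S\<close> in this basis and the product \<open>s1 * s2\<close> have
  square determinants, hence so has \<open>M\<close>.\<close>

lemma (in skew_biquat) kron_form:
  assumes S: "S = M * quat i1 j1 x0 x1 x2 x3 * quat i2 j2 y0 y1 y2 y3"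
    and ds: "det4 (quat i1 j1 x0 x1 x2 x3 * quat i2 j2 y0 y1 y2 y3) \<noteq> 0"
  shows "kron_decomposable M \<and> (\<exists>d. det4 M = d\<^sup>2)"
proof -
  define s1 s2 where "s1 = quat i1 j1 x0 x1 x2 x3" and "s2 = quat i2 j2 y0 y1 y2 y3"
  obtain e1 u1 u2 u3 where e1: "s1 = x0 *s 1 + e1 *s quat i1 j1 0 u1 u2 u3" and u: "(u1, u2, u3) \<noteq> (0, 0, 0)"
    unfolding s1_def by (rule quat_pure_part)
  obtain e2 v1 v2 v3 where e2: "s2 = y0 *s 1 + e2 *s quat i2 j2 0 v1 v2 v3" and v: "(v1, v2, v3) \<noteq> (0, 0, 0)"
    unfolding s2_def by (rule quat_pure_part)
  define w1 w2 where "w1 = quat i1 j1 0 u1 u2 u3" and "w2 = quat i2 j2 0 v1 v2 v3"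
  obtain \<omega>1 \<omega>2 where o1: "w1 * w1 = \<omega>1 *s 1" and o2: "w2 * w2 = \<omega>2 *s 1"
    unfolding w1_def w2_def using pure_square by blast
  obtain X where X: "\<omega>1 * \<omega>2 * (e00 (tr4 X * (S * X)))\<^sup>2 \<noteq> (e00 (tr4 X * (S * (w1 * w2 * X))))\<^sup>2"
    by (rule ex_cyclic[OF u v w1_def w2_def o1 o2])
  define c d where "c = e00 (tr4 X * (S * X))" and "d = e00 (tr4 X * (S * (w1 * w2 * X)))"
  have cm: "w2 * w1 = w1 * w2" unfolding w1_def w2_def using quat_commute(3)[OF B] by simp
  have cm': "w2 * (w1 * Y) = w1 * (w2 * Y)" for Y using cm by (simp add: mult.assoc[symmetric])
  have o': "w1 * (w1 * Y) = \<omega>1 *s Y" "w2 * (w2 * Y) = \<omega>2 *s Y" for Y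
    using o1 o2 by (simp_all add: mult.assoc[symmetric])
  have sk: "tr4 w1 * S = - (S * w1)" "tr4 w2 * S = - (S * w2)" unfolding w1_def w2_def by (rule pure_skew)+
  have sk': "tr4 w1 * (S * Y) = - (S * (w1 * Y))" "tr4 w2 * (S * Y) = - (S * (w2 * Y))" for Y
    using sk by (simp_all add: mult.assoc[symmetric])
  have alt: "e00 (tr4 X * (S * (w1 * X))) = 0" "e00 (tr4 X * (S * (w2 * X))) = 0"
    using e00_alternating[OF two, of "S * w1" X] e00_alternating[OF two, of "S * w2" X]
    by (simp_all add: S_symmetric sk mult.assoc)
  define P where "P = cols4 X (w2 * X) (w1 * X) (w1 * (w2 * X))"
  have P1: "w1 * P = P * kronL 0 \<omega>1 1 0" and P2: "w2 * P = P * kronR 0 \<omega>2 1 0"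
    unfolding P_def cols4_mult cols4_kron by (simp_all add: o' cm')
  have SP: "S * P = cols4 (S * X) (S * (w2 * X)) (S * (w1 * X)) (S * (w1 * (w2 * X)))"
    unfolding P_def by (rule cols4_mult)
  have gram: "tr4 P * (S * P) = M4 c 0 0 d  0 (- \<omega>2 * c) (- d) 0  0 (- d) (- \<omega>1 * c) 0  d 0 0 (\<omega>1 * \<omega>2 * c)"
    unfolding SP unfolding P_def cols4_gram
    by (simp add: mult.assoc sk' o' cm' alt) (simp add: c_def d_def mult.assoc)
  have detP: "(det4 P)\<^sup>2 * det4 S = (\<omega>1 * \<omega>2 * c\<^sup>2 - d\<^sup>2)\<^sup>2"
    using arg_cong[OF gram, of det4] by (simp add: det4_M4 power2_eq_square algebra_simps)
  have dP: "det4 P \<noteq> 0" using detP X by (auto simp: c_def d_def)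
  define W1 W2 where "W1 = e1 *s kronL 0 \<omega>1 1 0" and "W2 = e2 *s kronR 0 \<omega>2 1 0"
  have W: "W1 = kronL 0 (e1 * \<omega>1) e1 (- 0)" "W2 = kronR 0 (e2 * \<omega>2) e2 (- 0)"
    by (simp_all add: W1_def W2_def kron_smul)
  define t where "t = (x0 *s 1 + W1) * (y0 *s 1 + W2)"
  have sP: "s1 * s2 * P = P * t"
  proof -
    have 2: "s2 * P = P * (y0 *s 1 + W2)"
      unfolding e2 w2_def[symmetric] W2_def by (simp add: distrib_left distrib_right P2)
    have "s1 * P = P * (x0 *s 1 + W1)"
      unfolding e1 w1_def[symmetric] W1_def by (simp add: distrib_left distrib_right P1)
    thus ?thesis by (simp add: t_def mult.assoc 2) (simp add: mult.assoc[symmetric])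
  qed
  \<comment> \<open>The quaternion conjugates of \<open>s1\<close> and \<open>s2\<close>, which are
    their adjoints with respect to \<open>S\<close>.\<close>
  define g1 g2 where "g1 = x0 *s 1 - e1 *s w1" and "g2 = y0 *s 1 - e2 *s w2"
  have gP: "g1 * g2 * P = P * ((x0 *s 1 - W1) * (y0 *s 1 - W2))"
  proof -
    have 2: "g2 * P = P * (y0 *s 1 - W2)"
      unfolding g2_def W2_def by (simp add: right_diff_distrib left_diff_distrib P2)
    have "g1 * P = P * (x0 *s 1 - W1)"
      unfolding g1_def W1_def by (simp add: right_diff_distrib left_diff_distrib P1)
    thus ?thesis by (simp add: mult.assoc 2) (simp add: mult.assoc[symmetric])
  qed
  have dt: "det4 t = ((x0\<^sup>2 - e1 * \<omega>1 * e1) * (y0\<^sup>2 - e2 * \<omega>2 * e2))\<^sup>2"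
    unfolding t_def W det4_mult det4_kron by (simp add: power_mult_distrib)
  have dst: "det4 (s1 * s2) = det4 t"
    using arg_cong[OF sP, of det4] dP by simp
  have sS: "tr4 s1 * S = S * g1" "tr4 s2 * S = S * g2"
    unfolding e1 e2 w1_def[symmetric] w2_def[symmetric] g1_def g2_def
    by (simp_all add: distrib_right right_diff_distrib sk)
  have MS: "tr4 M * (g1 * g2) = S"
  proof -
    have "S = tr4 s2 * tr4 s1 * tr4 M"
      using S_symmetric S by (simp add: s1_def s2_def mult.assoc)
    hence "tr4 (s1 * s2) * (tr4 M * (g1 * g2)) = S * (g1 * g2)" by (simp add: mult.assoc)
    moreover have "tr4 (s1 * s2) * S = S * (g2 * g1)"
    proof -
      have "tr4 (s1 * s2) * S = tr4 s2 * S * g1" by (simp add: mult.assoc sS(1))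
      thus ?thesis unfolding sS by (simp add: mult.assoc)
    qed
    moreover have "g2 * g1 = g1 * g2"
      unfolding g1_def g2_def by (simp add: right_diff_distrib left_diff_distrib cm smul_distrib algebra_simps)
    ultimately have e: "tr4 (s1 * s2) * (tr4 M * (g1 * g2)) = tr4 (s1 * s2) * S" by simp
    have "det4 (tr4 (s1 * s2)) \<noteq> 0" using ds unfolding s1_def[symmetric] s2_def[symmetric] det4_transpose .
    then obtain Z where "Z * tr4 (s1 * s2) = 1" by (rule det4_inverse)
    thus ?thesis using arg_cong[OF e, of "\<lambda>Y. Z * Y"] by (simp add: mult.assoc[symmetric])
  qed
  have "kron_asymmetry (tr4 P * M * P) x0 W1 y0 W2"
  proof -
    have "tr4 (tr4 P * M * P) * (x0 *s 1 - W1) * (y0 *s 1 - W2) = tr4 P * tr4 M * (P * ((x0 *s 1 - W1) * (y0 *s 1 - W2)))"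
      by (simp add: mult.assoc)
    also have "\<dots> = tr4 P * (tr4 M * (g1 * g2)) * P" unfolding gP[symmetric] by (simp add: mult.assoc)
    also have "\<dots> = tr4 P * M * (s1 * s2 * P)" unfolding MS S s1_def s2_def by (simp add: mult.assoc)
    also have "\<dots> = (tr4 P * M * P) * (x0 *s 1 + W1) * (y0 *s 1 + W2)"
      unfolding sP t_def by (simp add: mult.assoc)
    finally show ?thesis by (simp add: kron_asymmetry_def)
  qed
  moreover have nz: "x0\<^sup>2 - e1 * \<omega>1 * e1 \<noteq> 0" "y0\<^sup>2 - e2 * \<omega>2 * e2 \<noteq> 0"
    using ds dst dt unfolding s1_def[symmetric] s2_def[symmetric] by auto
  ultimately have "kron_decomposable M"
    unfolding kron_decomposable_def W using dP
    by (rule_tac exI[of _ P], rule_tac exI[of _ x0], rule_tac exI[of _ y0], rule_tac exI[of _ 0],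
      rule_tac exI[of _ "e1 * \<omega>1"], rule_tac exI[of _ e1], rule_tac exI[of _ 0],
      rule_tac exI[of _ "e2 * \<omega>2"], rule_tac exI[of _ e2]) simp
  moreover have "det4 M = ((\<omega>1 * \<omega>2 * c\<^sup>2 - d\<^sup>2) / (det4 P * ((x0\<^sup>2 - e1 * \<omega>1 * e1) * (y0\<^sup>2 - e2 * \<omega>2 * e2))))\<^sup>2"
  proof -
    have "det4 S = det4 M * det4 t" unfolding S dst[symmetric] s1_def s2_def by (simp add: mult.assoc)
    hence "(det4 P)\<^sup>2 * (det4 M * ((x0\<^sup>2 - e1 * \<omega>1 * e1) * (y0\<^sup>2 - e2 * \<omega>2 * e2))\<^sup>2) = (\<omega>1 * \<omega>2 * c\<^sup>2 - d\<^sup>2)\<^sup>2"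
      using detP dt by simp
    moreover have "m = (r / (p * k))\<^sup>2" if "p\<^sup>2 * (m * k\<^sup>2) = r\<^sup>2" "p \<noteq> 0" "k \<noteq> 0" for m r p k :: 'a
      using that by (simp add: power_divide power_mult_distrib eq_divide_eq mult.left_commute mult.commute)
    ultimately show ?thesis using dP nz by (metis mult_eq_0_iff)
  qed
  ultimately show ?thesis by blast
qed

theorem biquat_imp_kron:
  fixes M :: "'a::field m4"
  assumes 2: "(2::'a) \<noteq> 0" and M: "det4 M \<noteq> 0" and D: "biquat_decomposable M"
  shows "kron_decomposable M \<and> (\<exists>d. det4 M = d\<^sup>2)"
proof -
  obtain \<alpha>1 \<beta>1 i1 j1 \<alpha>2 \<beta>2 i2 j2 x0 x1 x2 x3 y0 y1 y2 y3 where
    B: "biquat \<alpha>1 \<beta>1 i1 j1 \<alpha>2 \<beta>2 i2 j2" and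
    d: "det4 (quat i1 j1 x0 x1 x2 x3 * quat i2 j2 y0 y1 y2 y3) \<noteq> 0" and
    sk: "\<forall>e\<in>{i1, j1, i2, j2}. tr4 e * (M * quat i1 j1 x0 x1 x2 x3 * quat i2 j2 y0 y1 y2 y3) =
        - (M * quat i1 j1 x0 x1 x2 x3 * quat i2 j2 y0 y1 y2 y3 * e)"
    using D unfolding biquat_decomposable_def by blast
  interpret skew_biquat \<alpha>1 \<beta>1 i1 j1 \<alpha>2 \<beta>2 i2 j2 "M * quat i1 j1 x0 x1 x2 x3 * quat i2 j2 y0 y1 y2 y3"
    by unfold_locales (use 2 B M d sk in \<open>simp_all add: mult.assoc\<close>)
  show ?thesis by (rule kron_form[OF refl d])
qed

section \<open>Congruence, diagonalisation and quaternion norm forms\<close>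

lemma quat_conj:
  fixes P :: "'a::field m4"
  assumes "P' * P = 1" "P * P' = 1"
  shows "quat (P * i * P') (P * j * P') x0 x1 x2 x3 = P * quat i j x0 x1 x2 x3 * P'"
proof -
  have "P * i * P' * (P * j * P') = P * i * (P' * P) * j * P'" by (simp add: mult.assoc)
  thus ?thesis by (simp add: quat_def distrib_left distrib_right assms mult.assoc)
qed

lemma biquat_conj:
  fixes P :: "'a::field m4"
  assumes P: "P' * P = 1" "P * P' = 1" and B: "biquat \<alpha>1 \<beta>1 i1 j1 \<alpha>2 \<beta>2 i2 j2"
  shows "biquat \<alpha>1 \<beta>1 (P * i1 * P') (P * j1 * P') \<alpha>2 \<beta>2 (P * i2 * P') (P * j2 * P')"
proof -
  have "P * x * P' * (P * y * P') = P * (x * y) * P'" for x y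
    by (metis P(1) mult.assoc mult.right_neutral)
  thus ?thesis using B P(2) by (auto simp: biquat_def quat_gens_def)
qed

lemma skew_conj:
  fixes P :: "'a::field m4"
  assumes P: "P' * P = 1" "P * P' = 1" and e: "tr4 e * (tr4 P * S * P) = - (tr4 P * S * P * e)"
  shows "tr4 (P * e * P') * S = - (S * (P * e * P'))"
proof -
  have "tr4 P' * tr4 P = 1" using arg_cong[OF P(2), of tr4] by simp
  hence "tr4 (P * e * P') * S = tr4 P' * (tr4 e * (tr4 P * S * P)) * P'"
    by (simp add: mult.assoc P)
  also have "\<dots> = - (tr4 P' * tr4 P * S * (P * e * P'))" unfolding e by (simp add: mult.assoc)
  finally show ?thesis using \<open>tr4 P' * tr4 P = 1\<close> by simp
qed

text \<open>Conjugating the generators and the factors \<open>s1\<close>, \<open>s2\<close> by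
  \<open>P\<close> undoes the congruence of the form.\<close>

lemma biquat_decomposable_congr:
  fixes P :: "'a::field m4"
  assumes P: "det4 P \<noteq> 0" and D: "biquat_decomposable (tr4 P * M * P)"
  shows "biquat_decomposable M"
proof -
  obtain P' where P': "P * P' = 1" "P' * P = 1" by (rule det4_inverse[OF P])
  obtain \<alpha>1 \<beta>1 i1 j1 \<alpha>2 \<beta>2 i2 j2 x0 x1 x2 x3 y0 y1 y2 y3 where
    B: "biquat \<alpha>1 \<beta>1 i1 j1 \<alpha>2 \<beta>2 i2 j2" and
    d: "det4 (quat i1 j1 x0 x1 x2 x3 * quat i2 j2 y0 y1 y2 y3) \<noteq> 0" and
    sk: "\<forall>e\<in>{i1, j1, i2, j2}. tr4 e * (tr4 P * M * P * quat i1 j1 x0 x1 x2 x3 * quat i2 j2 y0 y1 y2 y3) =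
        - (tr4 P * M * P * quat i1 j1 x0 x1 x2 x3 * quat i2 j2 y0 y1 y2 y3 * e)"
    using D unfolding biquat_decomposable_def by blast
  define s1 s2 where "s1 = quat i1 j1 x0 x1 x2 x3" and "s2 = quat i2 j2 y0 y1 y2 y3"
  define T where "T = M * (P * s1 * P') * (P * s2 * P')"
  have PT: "tr4 P * T * P = tr4 P * M * P * s1 * s2"
  proof -
    have "P' * (P * Z) = Z" for Z using P'(2) by (simp add: mult.assoc[symmetric])
    thus ?thesis unfolding T_def by (simp add: mult.assoc P')
  qed
  have "\<forall>e\<in>{i1, j1, i2, j2}. tr4 e * (tr4 P * T * P) = - (tr4 P * T * P * e)"
    unfolding PT using sk unfolding s1_def s2_def .
  hence "\<forall>e\<in>{P * i1 * P', P * j1 * P', P * i2 * P', P * j2 * P'}. tr4 e * T = - (T * e)"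
    using skew_conj[OF P'(2,1)] by blast
  moreover have "det4 (P * s1 * P' * (P * s2 * P')) \<noteq> 0"
    using d P right_inverse4(1)[OF P'(2)] by (simp add: s1_def s2_def)
  ultimately show ?thesis
    unfolding biquat_decomposable_def T_def s1_def s2_def quat_conj[OF P'(2,1), symmetric]
    using biquat_conj[OF P'(2,1) B] by blast
qed

lemma orthogonal_extension:
  fixes S :: "'a::field m4"
  defines "n \<equiv> \<lambda>X Y. e00 (tr4 X * (S * Y))"
  assumes 2: "(2::'a) \<noteq> 0" and S: "tr4 S = S" "det4 S \<noteq> 0"
    and v: "\<And>v. v \<in> {v0, v1, v2} \<Longrightarrow> v = 0 \<or> n v v \<noteq> 0"
    and o: "n v0 v1 = 0" "n v0 v2 = 0" "n v1 v2 = 0"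
  obtains w where "n w w \<noteq> 0" "n v0 w = 0" "n v1 w = 0" "n v2 w = 0"
proof (rule ccontr)
  assume "\<not> thesis"
  hence "\<forall>w. n v0 w = 0 \<longrightarrow> n v1 w = 0 \<longrightarrow> n v2 w = 0 \<longrightarrow> n w w = 0" using that by blast
  hence iso: "n w w = 0" if "n v0 w = 0" "n v1 w = 0" "n v2 w = 0" for w using that by blast
  have lin: "n X (Y + Z) = n X Y + n X Z" "n (Y + Z) X = n Y X + n Z X"
    "n X (Y - Z) = n X Y - n X Z" "n (Y - Z) X = n Y X - n Z X"
    "n X (c *s Y) = c * n X Y" "n (c *s Y) X = c * n Y X" "n X 0 = 0" for X Y Z c
    by (simp_all add: n_def algebra_simps)
  have sym: "n X Y = n Y X" for X Y
  proof -
    have "n X Y = e00 (tr4 (tr4 X * (S * Y)))" unfolding n_def by (simp only: e00_simps)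
    thus ?thesis by (simp add: n_def S mult.assoc)
  qed
  \<comment> \<open>For \<open>v = 0\<close> numerator and denominator vanish and the quotient is 0,
    which keeps \<open>tv\<close> valid.\<close>
  define t where "t v Y = n v Y / n v v" for v Y
  define pr where "pr Y = Y - t v0 Y *s v0 - t v1 Y *s v1 - t v2 Y *s v2" for Y
  have tv: "t v Y * n v v = n v Y" if "v \<in> {v0, v1, v2}" for v Y
    using v[OF that] by (auto simp: t_def sym[of 0] lin)
  have o': "n v1 v0 = 0" "n v2 v0 = 0" "n v2 v1 = 0" using o sym by auto
  have prv: "n v0 (pr Y) = 0" "n v1 (pr Y) = 0" "n v2 (pr Y) = 0" for Y
    by (simp_all add: pr_def lin o o' tv)
  have 0: "n (pr Y) (pr Z) = 0" for Y Z
  proof -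
    have "n (pr Y + pr Z) (pr Y + pr Z) = 0" by (rule iso) (simp_all add: lin prv)
    moreover have "n (pr Y) (pr Y) = 0" "n (pr Z) (pr Z) = 0" by (rule iso; simp add: prv)+
    ultimately have "2 * n (pr Y) (pr Z) = 0" using sym[of "pr Z" "pr Y"] by (simp add: lin)
    thus ?thesis using 2 by simp
  qed
  have 1: "n (pr Y) Z = 0" for Y Z
  proof -
    have "n (pr Y) (pr Z + t v0 Z *s v0 + t v1 Z *s v1 + t v2 Z *s v2) = 0"
      using prv sym by (simp add: lin 0)
    thus ?thesis by (simp add: pr_def)
  qed
  obtain Si where Si: "S * Si = 1" by (rule det4_inverse[OF S(2)])
  have 2: "e00 (tr4 (pr Y) * W) = 0" for Y W
  proof -
    have "n (pr Y) (Si * W) = e00 (tr4 (pr Y) * (S * Si * W))" by (simp add: n_def mult.assoc)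
    thus ?thesis using 1 Si by simp
  qed
  have 3: "x0 = 0 \<and> x4 = 0 \<and> x8 = 0 \<and> x12 = 0"
    if "pr Y = M4 x0 x1 x2 x3 x4 x5 x6 x7 x8 x9 x10 x11 x12 x13 x14 x15"
    for Y x0 x1 x2 x3 x4 x5 x6 x7 x8 x9 x10 x11 x12 x13 x14 x15
    using 2[of Y "M4 1 0 0 0 0 0 0 0 0 0 0 0 0 0 0 0"] 2[of Y "M4 0 0 0 0 1 0 0 0 0 0 0 0 0 0 0 0"]
      2[of Y "M4 0 0 0 0 0 0 0 0 1 0 0 0 0 0 0 0"] 2[of Y "M4 0 0 0 0 0 0 0 0 0 0 0 0 1 0 0 0"]
    unfolding that by (simp add: M4_simps)
  obtain a0 a1 a2 a3 a4 a5 a6 a7 a8 a9 a10 a11 a12 a13 a14 a15 where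
    a: "v0 = M4 a0 a1 a2 a3 a4 a5 a6 a7 a8 a9 a10 a11 a12 a13 a14 a15" by (cases v0)
  obtain b0 b1 b2 b3 b4 b5 b6 b7 b8 b9 b10 b11 b12 b13 b14 b15 where
    b: "v1 = M4 b0 b1 b2 b3 b4 b5 b6 b7 b8 b9 b10 b11 b12 b13 b14 b15" by (cases v1)
  obtain c0 c1 c2 c3 c4 c5 c6 c7 c8 c9 c10 c11 c12 c13 c14 c15 where
    c: "v2 = M4 c0 c1 c2 c3 c4 c5 c6 c7 c8 c9 c10 c11 c12 c13 c14 c15" by (cases v2)
  define u where "u x y z s = M4 x 0 0 0 y 0 0 0 z 0 0 0 s 0 0 (0::'a)" for x y z s
  have 4: "x = t v0 (u x y z s) * a0 + t v1 (u x y z s) * b0 + t v2 (u x y z s) * c0 \<and>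
    y = t v0 (u x y z s) * a4 + t v1 (u x y z s) * b4 + t v2 (u x y z s) * c4 \<and>
    z = t v0 (u x y z s) * a8 + t v1 (u x y z s) * b8 + t v2 (u x y z s) * c8 \<and>
    s = t v0 (u x y z s) * a12 + t v1 (u x y z s) * b12 + t v2 (u x y z s) * c12" for x y z s
  proof -
    have "pr (u x y z s) = u x y z s - t v0 (u x y z s) *s v0 - t v1 (u x y z s) *s v1 - t v2 (u x y z s) *s v2"
      by (simp add: pr_def)
    from 3[OF this[unfolded a[THEN arg_cong, of "\<lambda>v. _ *s v"] b[THEN arg_cong, of "\<lambda>v. _ *s v"]
        c[THEN arg_cong, of "\<lambda>v. _ *s v"] smul.simps, unfolded u_def[of x y z s] M4_simps]]
    show ?thesis unfolding u_def[of x y z s, symmetric] by (simp add: diff_diff_eq)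
  qed
  define V C where "V = M4 a0 b0 c0 0 a4 b4 c4 0 a8 b8 c8 0 a12 b12 c12 0"
    and "C =
       M4 (t v0 (u 1 0 0 0)) (t v0 (u 0 1 0 0)) (t v0 (u 0 0 1 0)) (t v0 (u 0 0 0 1))
          (t v1 (u 1 0 0 0)) (t v1 (u 0 1 0 0)) (t v1 (u 0 0 1 0)) (t v1 (u 0 0 0 1))
          (t v2 (u 1 0 0 0)) (t v2 (u 0 1 0 0)) (t v2 (u 0 0 1 0)) (t v2 (u 0 0 0 1)) 0 0 0 0"
  have "V * C = 1"
    using 4[of 1 0 0 0] 4[of 0 1 0 0] 4[of 0 0 1 0] 4[of 0 0 0 1]
    unfolding V_def C_def M4_simps m4.inject by (simp add: mult.commute)
  moreover have "det4 V = 0" by (simp add: V_def det4_M4)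
  ultimately show False using right_inverse4(1) by blast
qed

lemma symmetric_diagonal:
  fixes S :: "'a::field m4"
  assumes 2: "(2::'a) \<noteq> 0" and S: "tr4 S = S" "det4 S \<noteq> 0"
  obtains P d0 d1 d2 d3 where "det4 P \<noteq> 0" "tr4 P * S * P = M4 d0 0 0 0  0 d1 0 0  0 0 d2 0  0 0 0 d3"
proof -
  note ext = orthogonal_extension[OF 2 S]
  define n where "n = (\<lambda>X Y. e00 (tr4 X * (S * Y)))"
  have sym: "n X Y = n Y X" for X Y
  proof -
    have "n X Y = e00 (tr4 (tr4 X * (S * Y)))" unfolding n_def by (simp only: e00_simps)
    thus ?thesis by (simp add: n_def S mult.assoc)
  qed
  obtain v0 where v0: "n v0 v0 \<noteq> 0" using ext[of 0 0 0] unfolding n_def by auto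
  obtain v1 where v1: "n v1 v1 \<noteq> 0" "n v0 v1 = 0" using ext[of v0 0 0] v0 unfolding n_def by auto
  obtain v2 where v2: "n v2 v2 \<noteq> 0" "n v0 v2 = 0" "n v1 v2 = 0"
    using ext[of v0 v1 0] v0 v1 unfolding n_def by auto
  obtain v3 where v3: "n v3 v3 \<noteq> 0" "n v0 v3 = 0" "n v1 v3 = 0" "n v2 v3 = 0"
    using ext[of v0 v1 v2] v0 v1 v2 unfolding n_def by auto
  define P where "P = cols4 v0 v1 v2 v3"
  have SP: "S * P = cols4 (S * v0) (S * v1) (S * v2) (S * v3)" unfolding P_def by (rule cols4_mult)
  have z: "n v1 v0 = 0" "n v2 v0 = 0" "n v2 v1 = 0" "n v3 v0 = 0" "n v3 v1 = 0" "n v3 v2 = 0"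
    using v1 v2 v3 sym by auto
  have e: "tr4 P * S * P = M4 (n v0 v0) 0 0 0  0 (n v1 v1) 0 0  0 0 (n v2 v2) 0  0 0 0 (n v3 v3)"
    unfolding mult.assoc SP unfolding P_def cols4_gram
    using z v1 v2 v3 unfolding n_def by simp
  hence "det4 (tr4 P * S * P) \<noteq> 0" using v0 v1 v2 v3 by (simp add: det4_M4)
  hence "det4 P \<noteq> 0" by auto
  thus ?thesis using e by (rule that)
qed

text \<open>The norm form \<open>c \<langle>1, A, B, AB\<rangle>\<close> of the quaternion algebra with \<open>i\<^sup>2 = -A\<close>, \<open>j\<^sup>2 = -B\<close>: left and right
  multiplications by pure quaternions are skew, and span all skew maps.\<close>

lemma norm_form_biquat:
  fixes A B c :: "'a::field"
  assumes 2: "(2::'a) \<noteq> 0" and nz: "A \<noteq> 0" "B \<noteq> 0" "c \<noteq> 0"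
    and S: "S = M4 c 0 0 0  0 (c * A) 0 0  0 0 (c * B) 0  0 0 0 (c * A * B)"
    and i1: "i1 = M4 0 (-A) 0 0  1 0 0 0  0 0 0 (-A)  0 0 1 0"
    and j1: "j1 = M4 0 0 (-B) 0  0 0 0 B  1 0 0 0  0 (-1) 0 0"
    and i2: "i2 = M4 0 (-A) 0 0  1 0 0 0  0 0 0 A  0 0 (-1) 0"
    and j2: "j2 = M4 0 0 (-B) 0  0 0 0 (-B)  1 0 0 0  0 1 0 0"
  shows "skew_biquat (-A) (-B) i1 j1 (-A) (-B) i2 j2 S"
    and "tr4 D * S = - (S * D) \<Longrightarrow> \<exists>u1 u2 u3 v1 v2 v3. D = quat i1 j1 0 u1 u2 u3 + quat i2 j2 0 v1 v2 v3"
proof -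
  show "skew_biquat (-A) (-B) i1 j1 (-A) (-B) i2 j2 S"
    by unfold_locales (use 2 nz in \<open>simp_all add: biquat_def quat_gens_def S i1 j1 i2 j2 M4_simps det4_M4\<close>)
  assume D: "tr4 D * S = - (S * D)"
  obtain d0 d1 d2 d3 e0 e1 e2 e3 f0 f1 f2 f3 g0 g1 g2 g3 where
    DM: "D = M4 d0 d1 d2 d3 e0 e1 e2 e3 f0 f1 f2 f3 g0 g1 g2 g3" by (cases D)
  note eqs = D[unfolded DM S M4_simps tr4.simps m4.inject, simplified]
  have z: "x = 0" if "y * x = - (y * x)" "y \<noteq> 0" for x y :: 'a
  proof -
    have "2 * (y * x) = 0" using that(1) by (metis add.right_inverse mult_2)
    thus ?thesis using 2 that(2) by simp
  qed
  have nz': "c * A \<noteq> 0" "c * B \<noteq> 0" "c * A * B \<noteq> 0" using nz by auto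
  have d0: "d0 = 0" by (rule z[OF _ nz(3)], insert eqs nz, simp add: mult.commute mult.left_commute; blast)
  have e1: "e1 = 0" by (rule z[OF _ nz'(1)], insert eqs nz, simp add: mult.commute mult.left_commute; blast)
  have f2: "f2 = 0" by (rule z[OF _ nz'(2)], insert eqs nz, simp add: mult.commute mult.left_commute; blast)
  have g3: "g3 = 0" by (rule z[OF _ nz'(3)], insert eqs nz, simp add: mult.commute mult.left_commute; blast)
  note eqs' = D[unfolded DM S M4_simps tr4.simps m4.inject, simplified mult.commute mult.left_commute mult.assoc, simplified]
  have cancel: "x = - y" if "k * x + k * y = 0" "k \<noteq> 0" for k x y :: 'a
    using that by (simp add: distrib_left[symmetric] eq_neg_iff_add_eq_0)
  have E: "c * d1 = - (A * (c * e0))" "c * d2 = - (B * (c * f0))" "c * d3 = - (A * (B * (c * g0)))"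
    "A * (c * e2) = - (B * (c * f1))" "A * (c * e3) = - (A * (B * (c * g1)))" "B * (c * f3) = - (A * (B * (c * g2)))"
    using eqs' by (blast+)
  have d1: "d1 = - (A * e0)" by (rule cancel[of c]) (use E nz in \<open>simp_all add: mult.left_commute\<close>)
  have d2: "d2 = - (B * f0)" by (rule cancel[of c]) (use E nz in \<open>simp_all add: mult.left_commute\<close>)
  have d3: "d3 = - (A * B * g0)" by (rule cancel[of c]) (use E nz in \<open>simp_all add: mult.left_commute mult.assoc\<close>)
  have e2: "A * e2 = - (B * f1)" by (rule cancel[of c]) (use E nz in \<open>simp_all add: mult.left_commute\<close>)
  have e3: "e3 = - (B * g1)" by (rule cancel[of "A * c"]) (use E nz in \<open>simp_all add: mult.left_commute mult.assoc\<close>)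
  have f3: "f3 = - (A * g2)" by (rule cancel[of "B * c"]) (use E nz in \<open>simp_all add: mult.left_commute mult.assoc\<close>)
  have h: "x / 2 + x / 2 = x" for x :: 'a using 2 by (simp add: field_simps)
  have h': "(x + y) / 2 + (x - y) / 2 = x" "(x + y) / 2 - (x - y) / 2 = y" for x y :: 'a
    using h[of x] h[of y] by (simp_all add: add_divide_distrib diff_divide_distrib algebra_simps)
  \<comment> \<open>The remaining free entries come in pairs, which up to the factor
    \<open>A\<close> are the sum and the difference of a coefficient from the first algebra and one
    from the second; halving recovers both.\<close>
  define x1 y1 x2 y2 x3 y3 where "x1 = (e0 + g2) / 2" and "y1 = (e0 - g2) / 2"
    and "x2 = (f0 - g1) / 2" and "y2 = (f0 + g1) / 2"
    and "x3 = (f1 / A + g0) / 2" and "y3 = (f1 / A - g0) / 2"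
  have sub: "e0 = x1 + y1" "g2 = x1 - y1" "f0 = y2 + x2" "g1 = y2 - x2" "g0 = x3 - y3" "f1 = A * (x3 + y3)"
    using nz unfolding x1_def y1_def x2_def y2_def x3_def y3_def h' by simp_all
  have e2': "e2 = - (B * (x3 + y3))"
    by (rule cancel[OF _ nz(1)], unfold e2 sub(6)) (simp add: mult.left_commute)
  have "D = quat i1 j1 0 x1 x2 x3 + quat i2 j2 0 y1 y2 y3"
    unfolding DM quat_def i1 j1 i2 j2 d0 e1 f2 g3 d1 d2 d3 e2' e3 f3 sub by (simp add: M4_simps algebra_simps)
  thus "\<exists>u1 u2 u3 v1 v2 v3. D = quat i1 j1 0 u1 u2 u3 + quat i2 j2 0 v1 v2 v3" by blast
qed

text \<open>After diagonalisation the fourth basis vector is rescaled by \<open>t\<close> with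
  \<open>d3 * t^2 = d1 * d2 / d0\<close>, a choice made possible by the square determinant. The form
  is now \<open>d0 <1, A, B, A B>\<close>, and the generators belonging to this norm form are
  conjugated back.\<close>

lemma symmetric_biquat:
  fixes S :: "'a::field m4"
  assumes 2: "(2::'a) \<noteq> 0" and S: "tr4 S = S" "det4 S = \<delta>\<^sup>2" "\<delta> \<noteq> 0"
  obtains \<alpha>1 \<beta>1 i1 j1 \<alpha>2 \<beta>2 i2 j2 where "skew_biquat \<alpha>1 \<beta>1 i1 j1 \<alpha>2 \<beta>2 i2 j2 S"
    and "\<forall>D. tr4 D * S = - (S * D) \<longrightarrow>
      (\<exists>u1 u2 u3 v1 v2 v3. D = quat i1 j1 0 u1 u2 u3 + quat i2 j2 0 v1 v2 v3)"
proof -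
  have "det4 S \<noteq> 0" using S by simp
  then obtain P d0 d1 d2 d3 where P: "det4 P \<noteq> 0" and
    D: "tr4 P * S * P = M4 d0 0 0 0  0 d1 0 0  0 0 d2 0  0 0 0 d3"
    by (rule symmetric_diagonal[OF 2 S(1)])
  have dd: "d0 * d1 * d2 * d3 = (\<delta> * det4 P)\<^sup>2"
    using arg_cong[OF D, of det4] S(2) by (simp add: det4_M4 power2_eq_square algebra_simps)
  have "d0 * d1 * d2 * d3 \<noteq> 0" unfolding dd using S(3) P by simp
  hence nz: "d0 \<noteq> 0" "d1 \<noteq> 0" "d2 \<noteq> 0" "d3 \<noteq> 0" by auto
  define t where "t = \<delta> * det4 P / (d0 * d3)"
  have t: "d3 * (t * t) = d1 * d2 / d0"
  proof -
    have "d3 * (t * t) = (\<delta> * det4 P)\<^sup>2 / (d0 * d0 * d3)"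
      using nz by (simp add: t_def power2_eq_square mult.assoc)
    thus ?thesis unfolding dd[symmetric] using nz by simp
  qed
  have tnz: "t \<noteq> 0" using S(3) P nz by (simp add: t_def)
  define R where "R = P * M4 1 0 0 0  0 1 0 0  0 0 1 0  0 0 0 t"
  define A B where "A = d1 / d0" and "B = d2 / d0"
  have nz': "A \<noteq> 0" "B \<noteq> 0" using nz by (simp_all add: A_def B_def)
  have R: "det4 R \<noteq> 0" using P tnz by (simp add: R_def det4_M4)
  have RS: "tr4 R * S * R = M4 d0 0 0 0  0 (d0 * A) 0 0  0 0 (d0 * B) 0  0 0 0 (d0 * A * B)"
  proof -
    have "tr4 R * S * R = M4 1 0 0 0  0 1 0 0  0 0 1 0  0 0 0 t * (tr4 P * S * P) * M4 1 0 0 0  0 1 0 0  0 0 1 0  0 0 0 t"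
      by (simp add: R_def mult.assoc)
    thus ?thesis unfolding D using t nz by (simp add: M4_simps A_def B_def mult.commute mult.left_commute)
  qed
  obtain R' where R': "R * R' = 1" "R' * R = 1" by (rule det4_inverse[OF R])
  define i1 j1 i2 j2 where "i1 = M4 0 (-A) 0 0  1 0 0 0  0 0 0 (-A)  0 0 1 0"
    and "j1 = M4 0 0 (-B) 0  0 0 0 B  1 0 0 0  0 (-1) 0 0"
    and "i2 = M4 0 (-A) 0 0  1 0 0 0  0 0 0 A  0 0 (-1) 0"
    and "j2 = M4 0 0 (-B) 0  0 0 0 (-B)  1 0 0 0  0 1 0 0"
  note N = norm_form_biquat[OF 2 nz' nz(1) RS i1_def j1_def i2_def j2_def]
  interpret N: skew_biquat "-A" "-B" i1 j1 "-A" "-B" i2 j2 "tr4 R * S * R" by (rule N(1))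
  show ?thesis
  proof (rule that)
    show "skew_biquat (-A) (-B) (R * i1 * R') (R * j1 * R') (-A) (-B) (R * i2 * R') (R * j2 * R') S"
      by unfold_locales
        (use 2 S biquat_conj[OF R'(2,1) N.B] skew_conj[OF R'(2,1) N.skew(1)] skew_conj[OF R'(2,1) N.skew(2)]
          skew_conj[OF R'(2,1) N.skew(3)] skew_conj[OF R'(2,1) N.skew(4)] in simp_all)
    show "\<forall>D. tr4 D * S = - (S * D) \<longrightarrow> (\<exists>u1 u2 u3 v1 v2 v3.
      D = quat (R * i1 * R') (R * j1 * R') 0 u1 u2 u3 + quat (R * i2 * R') (R * j2 * R') 0 v1 v2 v3)"
    proof (intro allI impI)
    fix D assume D: "tr4 D * S = - (S * D)"
    have "tr4 (R' * D * R) * (tr4 R * S * R) = - (tr4 R * S * R * (R' * D * R))"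
    proof -
      have "tr4 R' * tr4 R = 1" using arg_cong[OF R'(1), of tr4] by simp
      hence "tr4 R' * (tr4 R * Z) = Z" "R * (R' * Z) = Z" for Z using R' by (simp_all add: mult.assoc[symmetric])
      thus ?thesis using D by (simp add: mult.assoc) (simp add: mult.assoc[symmetric])
    qed
    then obtain u1 u2 u3 v1 v2 v3 where e: "R' * D * R = quat i1 j1 0 u1 u2 u3 + quat i2 j2 0 v1 v2 v3"
      using N(2) by blast
    have "D = R * (R' * D * R) * R'"
      using R' by (simp add: mult.assoc) (simp add: mult.assoc[symmetric] R')
    hence "D = quat (R * i1 * R') (R * j1 * R') 0 u1 u2 u3 + quat (R * i2 * R') (R * j2 * R') 0 v1 v2 v3"
      unfolding e quat_conj[OF R'(2,1)] by (simp add: distrib_left distrib_right)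
    thus "\<exists>u1 u2 u3 v1 v2 v3. D = quat (R * i1 * R') (R * j1 * R') 0 u1 u2 u3 + quat (R * i2 * R') (R * j2 * R') 0 v1 v2 v3"
      by blast
    qed
  qed
qed

context skew_biquat
begin

text \<open>The two components commute and have scalar squares, so the square of their sum is scalar
  only if their product is; for nonzero components this contradicts
  \<open>not_scalar\<close>.\<close>

lemma square_scalar_pure:
  assumes W: "W = quat i1 j1 0 u1 u2 u3 + quat i2 j2 0 v1 v2 v3" and sq: "W * W = \<omega> *s 1"
  shows "(u1, u2, u3) = (0, 0, 0) \<or> (v1, v2, v3) = (0, 0, 0)"
proof (rule ccontr)
  assume "\<not> ?thesis"
  hence n: "(u1, u2, u3) \<noteq> (0, 0, 0)" "(v1, v2, v3) \<noteq> (0, 0, 0)" by auto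
  define p q where "p = quat i1 j1 0 u1 u2 u3" and "q = quat i2 j2 0 v1 v2 v3"
  obtain x y where "p * p = x *s 1" "q * q = y *s 1" unfolding p_def q_def using pure_square by blast
  moreover have "q * p = p * q" unfolding p_def q_def using quat_commute(3)[OF B] by simp
  ultimately have "p * q + p * q = (\<omega> - x - y) *s 1"
    using sq unfolding W p_def[symmetric] q_def[symmetric] by (simp add: algebra_simps smul_distrib)
  hence "(1/2) *s (p * q + p * q) = ((\<omega> - x - y) / 2) *s 1" by simp
  moreover have "(1/2) *s (p * q + p * q) = p * q"
    using smul_distrib(2)[of "1/2" "1/2" "p * q"] two by (simp add: smul_distrib)
  ultimately show False using not_scalar[OF n] unfolding p_def q_def by simp
qed

lemma quat_mult_closed:
  "\<exists>z0 z1 z2 z3. quat i1 j1 x0 x1 x2 x3 * quat i1 j1 y0 y1 y2 y3 = quat i1 j1 z0 z1 z2 z3"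
  "\<exists>z0 z1 z2 z3. quat i2 j2 x0 x1 x2 x3 * quat i2 j2 y0 y1 y2 y3 = quat i2 j2 z0 z1 z2 z3"
proof -
  have "quat i j x0 x1 x2 x3 * quat i j y0 y1 y2 y3 = quat i j
      (x0*y0 + \<alpha>*x1*y1 + \<beta>*x2*y2 - \<alpha>*\<beta>*x3*y3)
      (x0*y1 + x1*y0 - \<beta>*x2*y3 + \<beta>*x3*y2) (x0*y2 + x2*y0 + \<alpha>*x1*y3 - \<alpha>*x3*y1)
      (x0*y3 + x3*y0 + x1*y2 - x2*y1)" if "quat_gens \<alpha> \<beta> i j" for i j \<alpha> \<beta>
    using quat_gensD[OF that]
    by (simp add: quat_def distrib_left distrib_right mult.assoc smul_distrib) (simp add: algebra_simps smul_distrib)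
  from this[OF Q1] this[OF Q2]
  show "\<exists>z0 z1 z2 z3. quat i1 j1 x0 x1 x2 x3 * quat i1 j1 y0 y1 y2 y3 = quat i1 j1 z0 z1 z2 z3"
    "\<exists>z0 z1 z2 z3. quat i2 j2 x0 x1 x2 x3 * quat i2 j2 y0 y1 y2 y3 = quat i2 j2 z0 z1 z2 z3" by blast+
qed

lemma biquat_decomposableI:
  assumes "S = M * quat i1 j1 x0 x1 x2 x3 * quat i2 j2 y0 y1 y2 y3"
  shows "biquat_decomposable M"
proof -
  have "det4 M * det4 (quat i1 j1 x0 x1 x2 x3 * quat i2 j2 y0 y1 y2 y3) \<noteq> 0"
    using det_S unfolding assms by (simp add: mult.assoc)
  hence "det4 (quat i1 j1 x0 x1 x2 x3 * quat i2 j2 y0 y1 y2 y3) \<noteq> 0" by simp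
  moreover have "\<forall>e\<in>{i1, j1, i2, j2}. tr4 e * (M * quat i1 j1 x0 x1 x2 x3 * quat i2 j2 y0 y1 y2 y3) =
        - (M * quat i1 j1 x0 x1 x2 x3 * quat i2 j2 y0 y1 y2 y3 * e)"
    using skew unfolding assms by auto
  ultimately show ?thesis unfolding biquat_decomposable_def using B by blast
qed

end

text \<open>\<open>S = M (p\<^sub>1 + W\<^sub>1)(p\<^sub>2 + W\<^sub>2)\<close> is symmetric of square determinant. As \<open>W\<^sub>i\<close> is skew with scalar square, it
  lies in one of the two quaternion factors attached to \<open>S\<close>.\<close>

lemma biquat_decomposable_of_skew:
  fixes M :: "'a::field m4"
  assumes 2: "(2::'a) \<noteq> 0" and M: "det4 M = m\<^sup>2" "m \<noteq> 0"
    and k: "kron_asymmetry M p1 W1 p2 W2" and c: "W2 * W1 = W1 * W2"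
    and sk: "tr4 W1 * M = - (M * W1)" "tr4 W2 * M = - (M * W2)"
    and sq: "W1 * W1 = \<omega>1 *s 1" "W2 * W2 = \<omega>2 *s 1"
    and d: "det4 ((p1 *s 1 + W1) * (p2 *s 1 + W2)) = \<delta>\<^sup>2" "\<delta> \<noteq> 0"
  shows "biquat_decomposable M"
proof -
  define S where "S = M * (p1 *s 1 + W1) * (p2 *s 1 + W2)"
  have "tr4 S = S"
  proof -
    have "tr4 S = (p2 *s 1 + tr4 W2) * ((p1 *s 1 + tr4 W1) * tr4 M)" by (simp add: S_def mult.assoc)
    also have "(p1 *s 1 + tr4 W1) * tr4 M = tr4 M * (p1 *s 1 - W1)"
      using arg_cong[OF sk(1), of tr4] by (simp add: algebra_simps)
    also have "(p2 *s 1 + tr4 W2) * (tr4 M * (p1 *s 1 - W1)) = tr4 M * (p2 *s 1 - W2) * (p1 *s 1 - W1)"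
    proof -
      have "(p2 *s 1 + tr4 W2) * tr4 M = tr4 M * (p2 *s 1 - W2)"
        using arg_cong[OF sk(2), of tr4] by (simp add: algebra_simps)
      thus ?thesis by (simp add: mult.assoc[symmetric])
    qed
    also have "\<dots> = tr4 M * (p1 *s 1 - W1) * (p2 *s 1 - W2)"
      using c by (simp add: algebra_simps)
    also have "\<dots> = S" using k by (simp add: kron_asymmetry_def S_def)
    finally show ?thesis .
  qed
  moreover have "det4 S = (m * \<delta>)\<^sup>2" using M d by (simp add: S_def mult.assoc power_mult_distrib)
  moreover have "m * \<delta> \<noteq> 0" using M d by simp
  ultimately obtain \<alpha>1 \<beta>1 i1 j1 \<alpha>2 \<beta>2 i2 j2 where SB: "skew_biquat \<alpha>1 \<beta>1 i1 j1 \<alpha>2 \<beta>2 i2 j2 S"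
    and span: "\<forall>D. tr4 D * S = - (S * D) \<longrightarrow>
      (\<exists>u1 u2 u3 v1 v2 v3. D = quat i1 j1 0 u1 u2 u3 + quat i2 j2 0 v1 v2 v3)"
    by (rule symmetric_biquat[OF 2])
  interpret skew_biquat \<alpha>1 \<beta>1 i1 j1 \<alpha>2 \<beta>2 i2 j2 S by (rule SB)
  have t: "tr4 W1 * S = - (S * W1)" "tr4 W2 * S = - (S * W2)"
  proof -
    have "(p1 *s 1 + W1) * (p2 *s 1 + W2) * W1 = W1 * ((p1 *s 1 + W1) * (p2 *s 1 + W2))"
      "(p1 *s 1 + W1) * (p2 *s 1 + W2) * W2 = W2 * ((p1 *s 1 + W1) * (p2 *s 1 + W2))"
      by (simp_all add: distrib_left distrib_right mult.assoc c)
        (simp_all add: mult.assoc[symmetric] c)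
    moreover have "tr4 W * (M * Z) = - (M * (W * Z))" if "tr4 W * M = - (M * W)" for W Z
      using that by (simp add: mult.assoc[symmetric])
    ultimately show "tr4 W1 * S = - (S * W1)" "tr4 W2 * S = - (S * W2)"
      using sk unfolding S_def mult.assoc[of M] by (simp_all add: mult.assoc)
  qed
  have in1: "(\<exists>u1 u2 u3. p *s 1 + W = quat i1 j1 p u1 u2 u3) \<or> (\<exists>u1 u2 u3. p *s 1 + W = quat i2 j2 p u1 u2 u3)"
    if W: "tr4 W * S = - (S * W)" "W * W = \<omega> *s 1" for W \<omega> p
  proof -
    obtain u1 u2 u3 v1 v2 v3 where e: "W = quat i1 j1 0 u1 u2 u3 + quat i2 j2 0 v1 v2 v3"
      using span W(1) by blast
    from square_scalar_pure[OF e W(2)] show ?thesis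
    proof
      assume "(u1, u2, u3) = (0, 0, 0)"
      hence "p *s 1 + W = quat i2 j2 p v1 v2 v3" unfolding e by (simp add: quat_def add.assoc)
      thus ?thesis by blast
    next
      assume "(v1, v2, v3) = (0, 0, 0)"
      hence "p *s 1 + W = quat i1 j1 p u1 u2 u3" unfolding e by (simp add: quat_def add.assoc)
      thus ?thesis by blast
    qed
  qed
  have S': "S = M * (p2 *s 1 + W2) * (p1 *s 1 + W1)"
    using c unfolding S_def by (simp add: algebra_simps)
  have one: "quat i1 j1 1 0 0 0 = 1" "quat i2 j2 1 0 0 0 = 1" by (simp_all add: quat_def)
  \<comment> \<open>If \<open>W1\<close> and \<open>W2\<close> lie in the same quaternion factor,
    the product of \<open>p1 + W1\<close> and \<open>p2 + W2\<close> is a single quaternion there,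
    and 1 is taken in the other factor.\<close>
  from in1[OF t(1) sq(1), of p1] in1[OF t(2) sq(2), of p2] show ?thesis
  proof (elim disjE exE, goal_cases)
    case (1 u1 u2 u3 v1 v2 v3)
    obtain z0 z1 z2 z3 where "(p1 *s 1 + W1) * (p2 *s 1 + W2) = quat i1 j1 z0 z1 z2 z3"
      unfolding 1 using quat_mult_closed(1) by blast
    hence "S = M * quat i1 j1 z0 z1 z2 z3 * quat i2 j2 1 0 0 0" by (simp add: S_def one mult.assoc)
    thus ?thesis by (rule biquat_decomposableI)
  next
    case (2 u1 u2 u3 v1 v2 v3)
    show ?thesis by (rule biquat_decomposableI[OF S_def[unfolded 2]])
  next
    case (3 u1 u2 u3 v1 v2 v3)
    show ?thesis by (rule biquat_decomposableI[OF S'[unfolded 3]])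
  next
    case (4 u1 u2 u3 v1 v2 v3)
    obtain z0 z1 z2 z3 where "(p1 *s 1 + W1) * (p2 *s 1 + W2) = quat i2 j2 z0 z1 z2 z3"
      unfolding 4 using quat_mult_closed(2) by blast
    hence "S = M * quat i1 j1 1 0 0 0 * quat i2 j2 z0 z1 z2 z3" by (simp add: S_def one mult.assoc)
    thus ?thesis by (rule biquat_decomposableI)
  qed
qed

section \<open>Cayley transforms and the cases of the converse\<close>

lemma cayley_skew:
  fixes M :: "'a::field m4"
  assumes 2: "(2::'a) \<noteq> 0" and c: "c \<noteq> 0" and e: "\<epsilon> * \<epsilon> = 1"
    and eq: "tr4 M * (c *s 1 - W) = \<epsilon> *s (M * (c *s 1 + W))"
  shows "tr4 W * M = - (M * W)"
proof -
  have "tr4 (tr4 M * (c *s 1 - W)) = tr4 (\<epsilon> *s (M * (c *s 1 + W)))" unfolding eq ..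
  hence t: "(c *s 1 - tr4 W) * M = \<epsilon> *s ((c *s 1 + tr4 W) * tr4 M)" by simp
  \<comment> \<open>Inserting the transposed relation and then the relation itself removes
    \<open>tr4 M\<close>, as \<open>\<epsilon> * \<epsilon> = 1\<close>. Expanding the result leaves
    \<open>2 c\<close> times the skewness of \<open>W\<close>.\<close>
  have "(c *s 1 - tr4 W) * M * (c *s 1 - W) = \<epsilon> *s ((c *s 1 + tr4 W) * (tr4 M * (c *s 1 - W)))"
    unfolding t by (simp add: mult.assoc)
  also have "\<dots> = (c *s 1 + tr4 W) * (M * (c *s 1 + W))" unfolding eq using e by simp
  finally have h: "(c *s 1 - tr4 W) * M * (c *s 1 - W) = (c *s 1 + tr4 W) * (M * (c *s 1 + W))" .
  define X where "X = c *s (M * W) + c *s (tr4 W * M)"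
  have "(c *s 1 + tr4 W) * (M * (c *s 1 + W)) - (c *s 1 - tr4 W) * M * (c *s 1 - W) = X + X"
    by (simp add: X_def algebra_simps smul_distrib)
  hence "X + X = 0" unfolding h by simp
  hence "X = 0" by (rule two_cancel[OF 2])
  moreover have "X = c *s (M * W + tr4 W * M)" by (simp add: X_def smul_distrib)
  ultimately have "c *s (M * W + tr4 W * M) = 0" by simp
  hence "M * W + tr4 W * M = 0" using c by simp
  thus ?thesis by (simp add: eq_neg_iff_add_eq_0 add.commute)
qed

lemma kron_facts:
  fixes a :: "'a::field"
  shows "kronL a b c (- a) * kronL a b c (- a) = (a\<^sup>2 + b * c) *s 1"
    "kronR a b c (- a) * kronR a b c (- a) = (a\<^sup>2 + b * c) *s 1"
    "kronR a' b' c' d' * kronL a b c d = kronL a b c d * kronR a' b' c' d'"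
    "kronL 0 0 0 0 = (0 :: 'a m4)" "kronR 0 0 0 0 = (0 :: 'a m4)"
  by (simp_all add: kronL_def kronR_def M4_simps power2_eq_square algebra_simps)

lemma kron_asymmetry_congr:
  fixes M :: "'a::field m4"
  assumes "kron_asymmetry M k1 W1 k2 W2" "W1 * P = P * V1" "W2 * P = P * V2"
  shows "kron_asymmetry (tr4 P * M * P) k1 V1 k2 V2"
proof -
  have 1: "P * (k1 *s 1 - V1) = (k1 *s 1 - W1) * P" "P * (k1 *s 1 + V1) = (k1 *s 1 + W1) * P"
    "P * (k2 *s 1 - V2) = (k2 *s 1 - W2) * P" "P * (k2 *s 1 + V2) = (k2 *s 1 + W2) * P"
    using assms(2,3) by (simp_all add: algebra_simps)
  have "tr4 (tr4 P * M * P) * (k1 *s 1 - V1) * (k2 *s 1 - V2) = tr4 P * tr4 M * ((P * (k1 *s 1 - V1)) * (k2 *s 1 - V2))"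
    by (simp add: mult.assoc)
  also have "\<dots> = tr4 P * tr4 M * ((k1 *s 1 - W1) * (P * (k2 *s 1 - V2)))" unfolding 1(1) by (simp add: mult.assoc)
  also have "\<dots> = tr4 P * (tr4 M * (k1 *s 1 - W1) * (k2 *s 1 - W2)) * P" unfolding 1(3) by (simp add: mult.assoc)
  also have "\<dots> = tr4 P * (M * (k1 *s 1 + W1) * (k2 *s 1 + W2)) * P"
    using assms(1) unfolding kron_asymmetry_def by simp
  also have "\<dots> = tr4 P * M * ((k1 *s 1 + W1) * (P * (k2 *s 1 + V2)))" unfolding 1(4) by (simp add: mult.assoc)
  also have "\<dots> = tr4 P * M * ((k1 *s 1 + W1) * P * (k2 *s 1 + V2))" by (simp add: mult.assoc)
  also have "\<dots> = (tr4 P * M * P) * (k1 *s 1 + V1) * (k2 *s 1 + V2)" unfolding 1(2)[symmetric] by (simp add: mult.assoc)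
  finally show ?thesis by (simp add: kron_asymmetry_def)
qed

text \<open>Here \<open>W1 = W2 = 0\<close> and both constants are 1, so that the symmetric form
  \<open>S\<close> is \<open>M\<close> itself.\<close>

lemma biquat_of_symmetric:
  fixes M :: "'a::field m4"
  assumes 2: "(2::'a) \<noteq> 0" and M: "det4 M = m\<^sup>2" "m \<noteq> 0" and S: "tr4 M = M"
  shows "biquat_decomposable M"
  by (rule biquat_decomposable_of_skew[OF 2 M, of 1 0 1 0 0 0 1])
    (simp_all add: kron_asymmetry_def S)

text \<open>A base change splits \<open>M\<close> into two alternating planes with entries
  \<open>a\<close> and \<open>g\<close>, where \<open>a g\<close> is the Pfaffian. Every traceless
  map of such a plane is skew, in particular the diagonal one. With \<open>W1 = Z\<close> and
  constant 0, the form \<open>N * Z\<close> is symmetric.\<close>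

lemma biquat_of_alternating_aux:
  fixes M :: "'a::field m4"
  assumes 2: "(2::'a) \<noteq> 0" and M: "M = M4 0 a b c (-a) 0 d e (-b) (-d) 0 f (-c) (-e) (-f) 0"
    and nz: "det4 M \<noteq> 0" "a \<noteq> 0"
  shows "biquat_decomposable M"
proof -
  define P where "P = M4 1 0 (d/a) (e/a)  0 1 (-b/a) (-c/a)  0 0 1 0  0 0 0 1"
  define g where "g = (a*f - b*e + c*d) / a"
  have dP: "det4 P = 1" by (simp add: P_def det4_M4)
  define N where "N = tr4 P * M * P"
  have N: "N = M4 0 a 0 0 (-a) 0 0 0  0 0 0 g  0 0 (-g) 0"
    unfolding N_def M P_def g_def using nz(2) by (simp add: M4_simps field_simps)
  have "det4 N = (a * g)\<^sup>2" unfolding N by (simp add: det4_M4 power2_eq_square)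
  moreover have "det4 N \<noteq> 0" using nz dP by (simp add: N_def)
  ultimately have d: "det4 N = (a * g)\<^sup>2" "a * g \<noteq> 0" by auto
  define Z where "Z = M4 1 0 0 0 0 (-1) 0 0 0 0 1 0 0 0 0 (-1 :: 'a)"
  have "biquat_decomposable N"
    by (rule biquat_decomposable_of_skew[OF 2 d, of 0 Z 1 0 1 0 1])
      (simp_all add: kron_asymmetry_def N Z_def M4_simps det4_M4)
  thus ?thesis unfolding N_def by (rule biquat_decomposable_congr[rotated]) (simp add: dP)
qed

lemma biquat_of_alternating:
  fixes M :: "'a::field m4"
  assumes 2: "(2::'a) \<noteq> 0" and nz: "det4 M \<noteq> 0" and A: "tr4 M = - M"
  shows "biquat_decomposable M"
proof -
  obtain a b c d e f where M: "M = M4 0 a b c (-a) 0 d e (-b) (-d) 0 f (-c) (-e) (-f) 0"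
    by (rule alternating4[OF 2 A])
  have *: "biquat_decomposable M" if "det4 P \<noteq> 0" "tr4 P * M * P = M4 0 a' b' c' (-a') 0 d' e' (-b') (-d') 0 f' (-c') (-e') (-f') 0"
    "a' \<noteq> 0" for P a' b' c' d' e' f'
  proof (rule biquat_decomposable_congr[OF that(1)], rule biquat_of_alternating_aux[OF 2 that(2) _ that(3)])
    show "det4 (tr4 P * M * P) \<noteq> 0" using that(1) nz by simp
  qed
  \<comment> \<open>Swapping the second basis vector with the third or the fourth moves a nonzero
    entry of the first row to the place of \<open>a\<close>.\<close>
  consider "a \<noteq> 0" | "b \<noteq> 0" | "c \<noteq> 0" | "a = 0" "b = 0" "c = 0" by blast
  thus ?thesis
  proof cases
    case 1 thus ?thesis by (rule biquat_of_alternating_aux[OF 2 M nz])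
  next
    case 2
    show ?thesis by (rule *[of "M4 1 0 0 0 0 0 1 0 0 1 0 0 0 0 0 1" b a c "-d" f e])
      (use 2 in \<open>simp_all add: det4_M4 M M4_simps\<close>)
  next
    case 3
    show ?thesis by (rule *[of "M4 1 0 0 0 0 0 0 1 0 0 1 0 0 1 0 0" c b a "-f" "-e" "-d"])
      (use 3 in \<open>simp_all add: det4_M4 M M4_simps\<close>)
  next
    case 4
    hence "det4 M = 0" unfolding M by (simp add: det4_M4)
    thus ?thesis using nz by simp
  qed
qed

text \<open>\<open>W\<close> is skew but singular, so a second skew map is required. The relations
  force \<open>M = N \<otimes> J + A \<otimes> E\<close>, where \<open>N\<close> is symmetric with
  rows \<open>(b, d)\<close> and \<open>(d, n)\<close>, \<open>J\<close> is the alternating matrix,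
  \<open>E\<close> the first diagonal matrix unit, and the symmetric part of \<open>A\<close> is
  \<open>- N / k\<close>. The traceless \<open>z\<close> with rows \<open>(d, n)\<close> and
  \<open>(- b, - d)\<close> makes \<open>N z\<close> alternating, and any traceless map is skew for
  the alternating part of \<open>A\<close>; hence \<open>Z = z \<otimes> 1\<close> is skew for
  \<open>M\<close>. Its square \<open>d^2 - b n\<close> is nonzero because
  \<open>det4 M = (b n - d^2)^2\<close>.\<close>

lemma biquat_of_nilpotent:
  fixes M :: "'a::field m4"
  assumes 2: "(2::'a) \<noteq> 0" and M: "det4 M = m\<^sup>2" "m \<noteq> 0" and k: "k \<noteq> 0"
    and W: "W = kronR 0 0 1 0" and eq: "tr4 M * (k *s 1 - W) = - (M * (k *s 1 + W))"
  shows "biquat_decomposable M"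
proof -
  obtain a b c d e f g h i j l n p q r s where X: "M = M4 a b c d e f g h i j l n p q r s" by (cases M)
  have sk: "tr4 W * M = - (M * W)" by (rule cayley_skew[OF 2 k, of "-1"]) (use eq in simp_all)
  note E1 = sk[unfolded X W kronR_def tr4.simps M4_simps m4.inject]
  have e: "f = 0" "h = 0" "q = 0" "s = 0" "e = - b" "g = - d" "p = - j" "r = - n"
    using E1 by (simp_all add: eq_neg_iff_add_eq_0 add.commute)
  note E2 = eq[unfolded X W kronR_def tr4.simps M4_simps smul.simps m4.inject]
  have F: "b + a * (k * 2) = e" "d + (c * k + i * k) = p" "k * p = - (d * k)" "n + k * (l * 2) = r"
    by (insert E2, simp (no_asm_use) add: algebra_simps, elim conjE, assumption)+
  have "k * (p + d) = 0" using F(3) by (simp add: algebra_simps)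
  hence j: "j = d" using k e(7) by simp
  note e = e[unfolded j]
  have D: "k * (2 * a) = - (2 * b)" "k * (c + i) = - (2 * d)" "k * (2 * l) = - (2 * n)"
  proof -
    have "k * (2 * a) + 2 * b = 0" "k * (c + i) + 2 * d = 0" "k * (2 * l) + 2 * n = 0"
      using F(1,2,4) unfolding e by (simp_all add: algebra_simps)
    thus "k * (2 * a) = - (2 * b)" "k * (c + i) = - (2 * d)" "k * (2 * l) = - (2 * n)"
      by (simp_all only: eq_neg_iff_add_eq_0)
  qed
  define Z where "Z = kronL d n (- b) (- d)"
  have Zs: "tr4 Z * M = - (M * Z)"
  proof -
    have "k * (2 * a * d) = k * (b * (c + i))" "k * (2 * a * n) = k * (2 * b * l)" "k * (n * (c + i)) = k * (2 * d * l)"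
    proof -
      have "k * (2 * a * d) = (k * (2 * a)) * d" "k * (b * (c + i)) = b * (k * (c + i))"
        "k * (2 * a * n) = (k * (2 * a)) * n" "k * (2 * b * l) = b * (k * (2 * l))"
        "k * (n * (c + i)) = n * (k * (c + i))" "k * (2 * d * l) = d * (k * (2 * l))"
        by (simp_all only: mult_ac)
      thus "k * (2 * a * d) = k * (b * (c + i))" "k * (2 * a * n) = k * (2 * b * l)" "k * (n * (c + i)) = k * (2 * d * l)"
        unfolding D by simp_all
    qed
    hence "2 * a * d = b * (c + i)" "2 * a * n = 2 * b * l" "n * (c + i) = 2 * d * l"
      using k mult_left_cancel by blast+
    moreover from this(2) have "a * n = b * l" using 2 by simp
    ultimately show ?thesis unfolding X e j Z_def kronL_def by (simp add: M4_simps algebra_simps)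
  qed
  have dM: "det4 M = (b * n - d * d)\<^sup>2"
    unfolding X e j by (simp add: det4_M4 power2_eq_square algebra_simps)
  hence nz: "d\<^sup>2 - b * n \<noteq> 0" using M by (auto simp: power2_eq_square)
  have c: "W * Z = Z * W" unfolding W Z_def by (rule kron_facts)
  show ?thesis
  proof (rule biquat_decomposable_of_skew[OF 2 M _ c Zs sk])
    have "tr4 M * (0 *s 1 - Z) * (k *s 1 - W) = - (tr4 M * (k *s 1 - W) * Z)"
      using c by (simp add: algebra_simps)
    also have "\<dots> = M * (0 *s 1 + Z) * (k *s 1 + W)" unfolding eq using c by (simp add: algebra_simps)
    finally show "kron_asymmetry M 0 Z k W" by (simp add: kron_asymmetry_def)
    show "Z * Z = (d\<^sup>2 - b * n) *s 1" using kron_facts(1)[of d n "- b"] by (simp add: Z_def mult.commute)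
    show "W * W = 0 *s 1" using kron_facts(2)[of 0 0 1] by (simp add: W)
    have "det4 (0 *s 1 + Z) = (d\<^sup>2 - b * n)\<^sup>2"
      using det4_kron(1)[of 0 d n "- b"] by (simp add: Z_def mult.commute power2_commute[of "b * n"])
    moreover have "det4 (k *s 1 + W) = (k\<^sup>2)\<^sup>2" using det4_kron(2)[of k 0 0 1] by (simp add: W)
    ultimately show "det4 ((0 *s 1 + Z) * (k *s 1 + W)) = ((d\<^sup>2 - b * n) * k\<^sup>2)\<^sup>2"
      by (simp add: power_mult_distrib)
    show "(d\<^sup>2 - b * n) * k\<^sup>2 \<noteq> 0" using nz k by simp
  qed
qed

text \<open>\<open>D2\<close> is \<open>D1\<close> on the first two coordinates and
  \<open>- D1\<close> on the last two. As \<open>w\<close> is neither 0 nor 1, the relation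
  annihilates the off-diagonal blocks of \<open>M\<close> and makes its second block alternating. On
  the first block it says that the block of \<open>D1\<close> is skew, except for
  \<open>w = -1\<close>, where it says only that this block of \<open>M\<close> is
  symmetric.\<close>

lemma biquat_of_blocks:
  fixes M :: "'a::field m4"
  assumes 2: "(2::'a) \<noteq> 0" and M: "det4 M = m\<^sup>2" "m \<noteq> 0" and w: "w \<noteq> 0" "w \<noteq> 1"
    and D1: "D1 = M4 0 w 0 0  1 0 0 0  0 0 0 w  0 0 1 0"
    and D2: "D2 = M4 0 w 0 0  1 0 0 0  0 0 0 (-w)  0 0 (-1) 0"
    and eq: "kron_asymmetry M 1 D1 w D2"
  shows "biquat_decomposable M"
proof -
  obtain a b c d e f g h i j l n p q r s where X: "M = M4 a b c d e f g h i j l n p q r s" by (cases M)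
  note E = eq[unfolded kron_asymmetry_def X D1 D2 tr4.simps M4_simps smul.simps m4.inject]
  have C: "b + (e + (b * w + e * w)) = 0 \<and>
      e * (w * 2) = a * (w * 2) + (b * (w * 2) + a * (w * (w * 2))) \<and>
      d + p = d * w + p * w \<and>
      c * w + i * w = c * (w * w) + i * (w * w) \<and>
      b * (w * 2) = f * 2 + (e * (w * 2) + f * (w * 2)) \<and>
      b * w + (e * w + (b * (w * w) + e * (w * w))) = 0 \<and>
      h + q = h * w + q * w \<and>
      g * w + j * w = g * (w * w) + j * (w * w) \<and>
      c * (w * 2) = g + (j + (g * w + (j * w + i * (w * 2)))) \<and>
      g * (w * 2) = c * w + (i * w + (c * (w * w) + (i * (w * w) + j * (w * 2)))) \<and>
      n + r = n * w + r * w \<and>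
      (l = 0 \<or> w = 0 \<or> (2::'a) = 0 \<or> w = 1) \<and>
      d * (w * 2) = h + (q + (h * w + (q * w + p * (w * 2)))) \<and>
      h * (w * 2) = d * w + (p * w + (d * (w * w) + (p * (w * w) + q * (w * 2)))) \<and>
      (s = 0 \<or> (2::'a) = 0 \<or> w = 1) \<and>
      n * w + r * w = n * (w * w) + r * (w * w)"
    by (insert E, simp (no_asm_use) add: algebra_simps, assumption?)
  have R: "b + (e + (b * w + e * w)) = 0"
    "e * (w * 2) = a * (w * 2) + (b * (w * 2) + a * (w * (w * 2)))"
    "d + p = d * w + p * w" "c * w + i * w = c * (w * w) + i * (w * w)"
    "b * (w * 2) = f * 2 + (e * (w * 2) + f * (w * 2))"
    "h + q = h * w + q * w" "g * w + j * w = g * (w * w) + j * (w * w)"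
    "c * (w * 2) = g + (j + (g * w + (j * w + i * (w * 2))))"
    "g * (w * 2) = c * w + (i * w + (c * (w * w) + (i * (w * w) + j * (w * 2))))"
    "n + r = n * w + r * w" "l = 0 \<or> w = 0 \<or> (2::'a) = 0 \<or> w = 1"
    "d * (w * 2) = h + (q + (h * w + (q * w + p * (w * 2))))"
    "h * (w * 2) = d * w + (p * w + (d * (w * w) + (p * (w * w) + q * (w * 2))))"
    "s = 0 \<or> (2::'a) = 0 \<or> w = 1"
    by (insert C, elim conjE, assumption)+
  have Ea: "(b + e) * (1 + w) = 0" using R(1) by (simp add: algebra_simps)
  have Eb: "2 * w * (e - b) = 2 * w * ((1 + w) * a)"
    using arg_cong[OF R(2), of "\<lambda>x. x - b * (w * 2)"] by (simp add: algebra_simps)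
  have Ec: "2 * (w * (b - e)) = 2 * ((1 + w) * f)"
    using arg_cong[OF R(5), of "\<lambda>x. x - e * (w * 2)"] by (simp add: algebra_simps)
  have w1: "1 - w \<noteq> 0" using w by simp
  have f: "x + y = 0" if "x + y = x * w + y * w" for x y
  proof -
    have "(x + y) * (1 - w) = (x + y) - (x * w + y * w)" by (simp add: algebra_simps)
    hence "(x + y) * (1 - w) = 0" unfolding that[symmetric] by simp
    thus ?thesis using w1 by simp
  qed
  have f': "x + y = 0" if "x * w + y * w = x * (w * w) + y * (w * w)" for x y
  proof -
    have "w * ((x + y) * (1 - w)) = (x * w + y * w) - (x * (w * w) + y * (w * w))" by (simp add: algebra_simps)
    hence "w * ((x + y) * (1 - w)) = 0" unfolding that by simp
    thus ?thesis using w(1) w1 by simp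
  qed
  note s0 = f[OF R(3)] f'[OF R(4)] f[OF R(6)] f'[OF R(7)] f[OF R(10)]
  have ls: "l = 0" "s = 0" using R(11,14) w 2 by blast+
  have d0: "c = i" "g = j" "d = p" "h = q"
  proof -
    have "g + (j + (g * w + (j * w + t))) = (g + j) * (1 + w) + t"
      "h + (q + (h * w + (q * w + t))) = (h + q) * (1 + w) + t"
      "c * w + (i * w + (c * (w * w) + (i * (w * w) + t))) = (c + i) * (w * (1 + w)) + t"
      "d * w + (p * w + (d * (w * w) + (p * (w * w) + t))) = (d + p) * (w * (1 + w)) + t" for t
      by (simp_all add: algebra_simps)
    hence "c * (w * 2) = i * (w * 2)" "g * (w * 2) = j * (w * 2)" "d * (w * 2) = p * (w * 2)" "h * (w * 2) = q * (w * 2)"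
      using R(8,9,12,13) unfolding s0(1-4) by simp_all
    thus "c = i" "g = j" "d = p" "h = q" using w 2 by simp_all
  qed
  have z: "x = 0" if "x + x = 0" for x :: 'a
    using that 2 by (metis mult_2 mult_eq_0_iff)
  have off: "c = 0" "d = 0" "g = 0" "h = 0" "i = 0" "j = 0" "p = 0" "q = 0"
    using s0(1-4) d0 z by (metis)+
  have alt: "l = 0" "s = 0" "r = - n" using s0(5) ls by (simp_all add: eq_neg_iff_add_eq_0 add.commute)
  have top: "(b + e) * (1 + w) = 0" "e - b = (1 + w) * a" "w * (b - e) = (1 + w) * f"
    using Ea Eb Ec w 2 by simp_all
  have N: "M = M4 a b 0 0 e f 0 0 0 0 0 n 0 0 (-n) 0" unfolding X off alt by simp
  have dM: "det4 M = (a * f - b * e) * n\<^sup>2" unfolding N by (simp add: det4_M4 power2_eq_square algebra_simps)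
  hence nz: "n \<noteq> 0" using M by auto
  show ?thesis
  proof (cases "w = - 1")
    case False
    hence e: "e = - b" using top(1) by (simp add: eq_neg_iff_add_eq_0 add.commute)
    have "(1 + w) * f = - (w * (e - b))" unfolding top(3)[symmetric] by (simp add: algebra_simps)
    also have "\<dots> = (1 + w) * (- (a * w))" unfolding top(2) by (simp add: algebra_simps)
    finally have "(1 + w) * f = (1 + w) * (- (a * w))" .
    moreover have "1 + w \<noteq> 0" using False by (metis add.commute eq_neg_iff_add_eq_0)
    ultimately have f: "f = - (a * w)" using mult_left_cancel by blast
    have det: "det4 ((1 *s 1 + D1) * (w *s 1 + D2)) = ((1 - w) * (w * w - w))\<^sup>2"
      unfolding det4_mult by (simp add: D1 D2 M4_simps det4_M4 power2_eq_square algebra_simps)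
    have "w * w \<noteq> w" using w by simp
    hence nz': "(1 - w) * (w * w - w) \<noteq> 0" using w by simp
    show ?thesis
      by (rule biquat_decomposable_of_skew[OF 2 M eq _ _ _ _ _ det nz', of w w])
        (simp_all add: N e f D1 D2 M4_simps)
  next
    case True
    hence e: "e = b" using top(2) by simp
    define \<delta> where "\<delta> = m / n"
    have dd: "a * f - b * b = \<delta> * \<delta>" using dM M(1) nz by (simp add: \<delta>_def e field_simps power2_eq_square)
    have \<delta>: "\<delta> \<noteq> 0" using M nz by (simp add: \<delta>_def)
    define x y v where "x = b / \<delta>" and "y = f / \<delta>" and "v = a / \<delta>"
    have abf: "a = \<delta> * v" "b = \<delta> * x" "f = \<delta> * y" using \<delta> by (simp_all add: x_def y_def v_def)
    have "\<delta> * \<delta> * (v * y - x * x) = \<delta> * \<delta> * 1" using dd unfolding abf by (simp add: algebra_simps)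
    hence vy: "v * y - x * x = 1" using \<delta> by simp
    have xx: "x * x = v * y - 1" unfolding vy[symmetric] by simp
    hence xx': "x * (x * t) = v * (y * t) - t" for t
      by (simp add: mult.assoc[symmetric] left_diff_distrib)
    \<comment> \<open>For \<open>w = -1\<close> the first block of \<open>M\<close> is \<delta>
      times a symmetric matrix of determinant 1, since \<open>det4 M\<close> is a square. The upper
      block of \<open>W1\<close> is a skew map for it, of square -1. The lower block is a quarter
      turn, also of square -1 and skew for the alternating block, so \<open>W1\<close> and
      \<open>W2\<close> have scalar squares.\<close>
    define W1 W2 where "W1 = M4 x y 0 0 (-v) (-x) 0 0 0 0 0 (-1) 0 0 1 0"
      and "W2 = M4 x y 0 0 (-v) (-x) 0 0 0 0 0 1 0 0 (-1) 0"
    have M': "M = M4 (\<delta> * v) (\<delta> * x) 0 0 (\<delta> * x) (\<delta> * y) 0 0 0 0 0 n 0 0 (-n) 0"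
      unfolding N e abf ..
    have sq: "W1 * W1 = (-1) *s 1" "W2 * W2 = (-1) *s 1" "W2 * W1 = W1 * W2"
      by (simp_all add: W1_def W2_def M4_simps xx algebra_simps)
    have det: "det4 ((1 *s 1 + W1) * ((-1) *s 1 + W2)) = 4\<^sup>2"
    proof -
      have 1: "det4 (1 *s 1 + W1) = 2 * (1 - x * x + v * y)"
        by (simp add: W1_def M4_simps det4_M4 algebra_simps)
      have 2: "det4 ((-1) *s 1 + W2) = 2 * (1 - x * x + v * y)"
        by (simp add: W2_def M4_simps det4_M4 algebra_simps)
      show ?thesis unfolding det4_mult 1 2 xx by simp
    qed
    have 4: "(4::'a) \<noteq> 0"
    proof -
      have "(4::'a) = 2 * 2" by simp
      thus ?thesis using 2 by (metis mult_eq_0_iff)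
    qed
    have k: "kron_asymmetry M 1 W1 (-1) W2"
      unfolding kron_asymmetry_def M' W1_def W2_def
      by (simp add: M4_simps algebra_simps)
    show ?thesis
      by (rule biquat_decomposable_of_skew[OF 2 M k sq(3) _ _ sq(1,2) det 4])
        (simp_all add: M' W1_def W2_def M4_simps algebra_simps)
  qed
qed

lemma kron_mult:
  "kronL a b c d * kronL a' b' c' d' = kronL (a*a'+b*c') (a*b'+b*d') (c*a'+d*c') (c*b'+d*d')"
  "kronR a b c d * kronR a' b' c' d' = kronR (a*a'+b*c') (a*b'+b*d') (c*a'+d*c') (c*b'+d*d')"
  by (simp_all add: kronL_def kronR_def M4_simps)

lemma det4_kron2: "det4 (kronL a b c d) = (a * d - b * c)\<^sup>2" "det4 (kronR a b c d) = (a * d - b * c)\<^sup>2"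
  by (simp_all add: kronL_def kronR_def det4_M4 power2_eq_square algebra_simps)

lemma kron_scalar:
  assumes "(2::'a::field) \<noteq> 0" "kronL a b c (- a) * kronR a' b' c' (- a') = t *s (1 :: 'a m4)"
  shows "kronL a b c (- a) = 0 \<or> kronR a' b' c' (- a') = 0"
proof -
  have e: "a * a' = t" "- (a * a') = t" "a * b' = 0" "a * c' = 0" "b * a' = 0" "b * b' = 0" "b * c' = 0"
    "c * a' = 0" "c * b' = 0" "c * c' = 0"
    by (insert assms(2), simp (no_asm_use) add: kronL_def kronR_def M4_simps, elim conjE, assumption)+
  have "2 * (a * a') = 0" using e(1,2) by (metis add.right_inverse mult_2)
  hence "a * a' = 0" using assms(1) by simp
  hence "(a = 0 \<and> b = 0 \<and> c = 0) \<or> (a' = 0 \<and> b' = 0 \<and> c' = 0)" using e by auto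
  thus ?thesis by (auto simp: kronL_def kronR_def M4_simps)
qed

text \<open>The columns of the base change are a vector and its image, which form a basis unless the
  vector is an eigenvector. If \<open>(1, 0)\<close>, \<open>(0, 1)\<close> and
  \<open>(1, 1)\<close> were all eigenvectors, the matrix would be scalar, and a traceless scalar
  matrix is 0.\<close>

lemma traceless_companion:
  fixes a b c :: "'a::field"
  assumes 2: "(2::'a) \<noteq> 0" and nz: "(a, b, c) \<noteq> (0, 0, 0)"
  obtains p q r s where "p * s - q * r \<noteq> 0"
    "a * p + b * r = q" "a * q + b * s = (a\<^sup>2 + b * c) * p" "c * p - a * r = s" "c * q - a * s = (a\<^sup>2 + b * c) * r"
proof -
  note T = that
  have *: thesis if h: "x * (c * x - a * y) - (a * x + b * y) * y \<noteq> 0" for x y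
    by (rule T[OF h]) (simp_all add: power2_eq_square algebra_simps)
  show ?thesis
  proof (cases "c = 0")
    case False thus ?thesis using *[of 1 0] by simp
  next
    case True
    show ?thesis
    proof (cases "b = 0")
      case False thus ?thesis using *[of 0 1] by simp
    next
      case b: True
      hence "a \<noteq> 0" using True nz by simp
      hence "- (2 * a) \<noteq> 0" using 2 by simp
      thus ?thesis using *[of 1 1] True b by (simp add: algebra_simps)
    qed
  qed
qed

lemma kron_companion:
  fixes a b c :: "'a::field"
  assumes 2: "(2::'a) \<noteq> 0" and nz: "(a, b, c) \<noteq> (0, 0, 0)"
  obtains p q r s where "p * s - q * r \<noteq> 0"
    "kronL a b c (- a) * kronL p q r s = kronL p q r s * kronL 0 (a\<^sup>2 + b * c) 1 0"
    "kronR a b c (- a) * kronR p q r s = kronR p q r s * kronR 0 (a\<^sup>2 + b * c) 1 0"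
proof -
  obtain p q r s where "p * s - q * r \<noteq> 0" and
    e: "a * p + b * r = q" "a * q + b * s = (a\<^sup>2 + b * c) * p" "c * p - a * r = s" "c * q - a * s = (a\<^sup>2 + b * c) * r"
    by (rule traceless_companion[OF 2 nz])
  moreover have "kronL a b c (- a) * kronL p q r s = kronL p q r s * kronL 0 (a\<^sup>2 + b * c) 1 0"
    "kronR a b c (- a) * kronR p q r s = kronR p q r s * kronR 0 (a\<^sup>2 + b * c) 1 0"
    unfolding kron_mult using e by (simp_all add: mult.commute)
  ultimately show ?thesis using that by blast
qed

text \<open>The relation makes \<open>W\<close> skew. An invertible \<open>W\<close> can be used for
  both factors, with constants 0 and \<open>k\<close>; for \<open>W = 0\<close> the form is
  alternating; otherwise \<open>W\<close> is nilpotent and is brought to companion form.\<close>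

lemma biquat_of_antisymmetric:
  fixes M :: "'a::field m4"
  assumes 2: "(2::'a) \<noteq> 0" and M: "det4 M = m\<^sup>2" "m \<noteq> 0" and k: "k \<noteq> 0" "k\<^sup>2 \<noteq> a\<^sup>2 + b * c"
    and W: "W = kronR a b c (- a)" and eq: "tr4 M * (k *s 1 - W) = - (M * (k *s 1 + W))"
  shows "biquat_decomposable M"
proof -
  have sk: "tr4 W * M = - (M * W)" by (rule cayley_skew[OF 2 k(1), of "-1"]) (use eq in simp_all)
  have sq: "W * W = (a\<^sup>2 + b * c) *s 1" unfolding W by (rule kron_facts)
  show ?thesis
  proof (cases "a\<^sup>2 + b * c = 0")
    case False
    have "det4 (0 *s 1 + W) = (a\<^sup>2 + b * c)\<^sup>2"
      using det4_kron(2)[of 0 a b c] unfolding W by (simp add: power2_eq_square algebra_simps)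
    hence d: "det4 ((0 *s 1 + W) * (k *s 1 + W)) = ((a\<^sup>2 + b * c) * (k\<^sup>2 - (a\<^sup>2 + b * c)))\<^sup>2"
      unfolding det4_mult unfolding W det4_kron by (simp add: power_mult_distrib)
    have "tr4 M * (0 *s 1 - W) * (k *s 1 - W) = - (tr4 M * (k *s 1 - W) * W)" by (simp add: algebra_simps)
    also have "\<dots> = M * (0 *s 1 + W) * (k *s 1 + W)" unfolding eq by (simp add: algebra_simps)
    finally have ka: "kron_asymmetry M 0 W k W" by (simp add: kron_asymmetry_def)
    show ?thesis
      by (rule biquat_decomposable_of_skew[OF 2 M ka refl sk sk sq sq d]) (use False k in simp)
  next
    case True
    show ?thesis
    proof (cases "(a, b, c) = (0, 0, 0)")
      case z: True
      hence "W = 0" using W by (simp add: kron_facts)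
      hence "k *s tr4 M = k *s (- M)" using eq by simp
      hence "tr4 M = - M" using smul_cancel[OF k(1)] by blast
      thus ?thesis using biquat_of_alternating[OF 2] M by simp
    next
      case nz: False
      obtain p q r s where "p * s - q * r \<noteq> 0" and e: "W * kronR p q r s = kronR p q r s * kronR 0 0 1 0"
        using kron_companion[OF 2 nz] True unfolding W by metis
      define P where "P = kronR p q r s"
      have P: "det4 P \<noteq> 0" using \<open>p * s - q * r \<noteq> 0\<close> by (simp add: P_def det4_kron2)
      have "P * (k *s 1 - kronR 0 0 1 0) = (k *s 1 - W) * P" "P * (k *s 1 + kronR 0 0 1 0) = (k *s 1 + W) * P"
        using e by (simp_all add: P_def algebra_simps)
      hence eqP: "tr4 (tr4 P * M * P) * (k *s 1 - kronR 0 0 1 0) = - (tr4 P * M * P * (k *s 1 + kronR 0 0 1 0))"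
        using arg_cong[OF eq, of "\<lambda>X. tr4 P * X * P"] by (simp add: mult.assoc)
      have "biquat_decomposable (tr4 P * M * P)"
        by (rule biquat_of_nilpotent[OF 2 _ _ k(1) refl eqP, of "m * det4 P"])
          (use M P in \<open>simp_all add: power_mult_distrib power2_eq_square\<close>)
      thus ?thesis by (rule biquat_decomposable_congr[OF P])
    qed
  qed
qed

text \<open>The permutation matrix \<open>P\<close> exchanges the two tensor factors.\<close>

lemma biquat_of_antisymmetric':
  fixes M :: "'a::field m4"
  assumes 2: "(2::'a) \<noteq> 0" and M: "det4 M = m\<^sup>2" "m \<noteq> 0" and k: "k \<noteq> 0" "k\<^sup>2 \<noteq> a\<^sup>2 + b * c"
    and W: "W = kronL a b c (- a)" and eq: "tr4 M * (k *s 1 - W) = - (M * (k *s 1 + W))"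
  shows "biquat_decomposable M"
proof -
  define P :: "'a m4" where "P = M4 1 0 0 0  0 0 1 0  0 1 0 0  0 0 0 1"
  have P: "det4 P = -1" "tr4 P = P" by (simp_all add: P_def det4_M4)
  have "W * P = P * kronR a b c (- a)" by (simp add: W P_def kronL_def kronR_def M4_simps)
  hence "P * (k *s 1 - kronR a b c (- a)) = (k *s 1 - W) * P" "P * (k *s 1 + kronR a b c (- a)) = (k *s 1 + W) * P"
    by (simp_all add: algebra_simps)
  hence "tr4 (tr4 P * M * P) * (k *s 1 - kronR a b c (- a)) = - (tr4 P * M * P * (k *s 1 + kronR a b c (- a)))"
    using arg_cong[OF eq, of "\<lambda>X. tr4 P * X * P"] by (simp add: mult.assoc)
  hence "biquat_decomposable (tr4 P * M * P)"
    by (rule biquat_of_antisymmetric[OF 2 _ M(2) k refl, rotated]) (use M P in simp)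
  thus ?thesis by (rule biquat_decomposable_congr[rotated]) (simp add: P)
qed

text \<open>After rescaling, \<open>U = w *s W2\<close> has the same square \<open>w\<close> as
  \<open>W1\<close>, so \<open>W1 U\<close> has the eigenvalues \<open>w\<close> and
  \<open>- w\<close>. In companion coordinates the columns of \<open>Q\<close> are
  \<open>U + W1\<close>, \<open>w + W1 U\<close>, \<open>W1 - U\<close> and \<open>w - W1 U\<close>;
  they span the two eigenspaces, on which \<open>U\<close> is \<open>W1\<close> and
  \<open>- W1\<close>.\<close>

lemma biquat_of_reciprocal:
  fixes M :: "'a::field m4"
  assumes 2: "(2::'a) \<noteq> 0" and M: "det4 M = m\<^sup>2" "m \<noteq> 0"
    and W1: "W1 = kronL a b c (- a)" and W2: "W2 = kronR a' b' c' (- a')"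
    and k: "kron_asymmetry M 1 W1 1 W2" and w1: "a\<^sup>2 + b * c \<noteq> 1"
    and w: "(a\<^sup>2 + b * c) * (a'\<^sup>2 + b' * c') = 1"
  shows "biquat_decomposable M"
proof -
  define w where "w = a\<^sup>2 + b * c"
  have w0: "w \<noteq> 0" using w unfolding w_def by auto
  define U where "U = kronR (w * a') (w * b') (w * c') (- (w * a'))"
  have U: "U = w *s W2" by (simp add: U_def W2 kron_smul)
  have Uw: "(w * a')\<^sup>2 + (w * b') * (w * c') = w"
  proof -
    have "(w * a')\<^sup>2 + (w * b') * (w * c') = w * (w * (a'\<^sup>2 + b' * c'))"
      by (simp add: power2_eq_square algebra_simps)
    thus ?thesis using w unfolding w_def[symmetric] by simp
  qed
  have kU: "kron_asymmetry M 1 W1 w U"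
  proof -
    have e: "w *s 1 - U = w *s (1 *s 1 - W2)" "w *s 1 + U = w *s (1 *s 1 + W2)"
      by (simp_all add: U smul_distrib)
    show ?thesis using k unfolding kron_asymmetry_def e by simp
  qed
  have "(a, b, c) \<noteq> (0, 0, 0)" using w0 by (auto simp: w_def)
  from kron_companion[OF 2 this] obtain p q r s where n1: "p * s - q * r \<noteq> 0" and
    e1: "W1 * kronL p q r s = kronL p q r s * kronL 0 w 1 0"
    unfolding W1 w_def by metis
  have "(w * a', w * b', w * c') \<noteq> (0, 0, 0)" using w w0 by auto
  from kron_companion[OF 2 this] obtain p' q' r' s' where n2: "p' * s' - q' * r' \<noteq> 0" and
    e2: "U * kronR p' q' r' s' = kronR p' q' r' s' * kronR 0 ((w * a')\<^sup>2 + (w * b') * (w * c')) 1 0"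
    unfolding U_def by metis
  note e2 = e2[unfolded Uw]
  define P where "P = kronL p q r s * kronR p' q' r' s'"
  have cm: "kronR a1 b1 c1 d1 * (kronL a2 b2 c2 d2 * X) = kronL a2 b2 c2 d2 * (kronR a1 b1 c1 d1 * X)"
    for a1 b1 c1 d1 a2 b2 c2 d2 and X :: "'a m4"
    by (simp add: mult.assoc[symmetric] kron_facts)
  define Q where "Q = M4 0 w 0 w  1 0 (-1) 0  1 0 1 0  0 1 0 (-1)"
  define D1 D2 where "D1 = M4 0 w 0 0  1 0 0 0  0 0 0 w  0 0 1 0"
    and "D2 = M4 0 w 0 0  1 0 0 0  0 0 0 (-w)  0 0 (-1) 0"
  have "W1 * P = P * kronL 0 w 1 0"
    unfolding P_def by (simp add: mult.assoc[symmetric] e1) (simp add: mult.assoc kron_facts)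
  moreover have "kronL 0 w 1 0 * Q = Q * D1"
    by (simp add: kronL_def Q_def D1_def M4_simps)
  ultimately have 1: "W1 * (P * Q) = P * Q * D1" by (metis mult.assoc)
  have "U * P = P * kronR 0 w 1 0"
    unfolding P_def U_def mult.assoc cm e2[unfolded U_def] ..
  moreover have "kronR 0 w 1 0 * Q = Q * D2"
    by (simp add: kronR_def Q_def D2_def M4_simps)
  ultimately have UPQ: "U * (P * Q) = P * Q * D2" by (metis mult.assoc)
  have "det4 Q = (2 * w) * 2" by (simp add: Q_def det4_M4 algebra_simps)
  hence "det4 Q \<noteq> 0" using 2 w0 by (metis mult_eq_0_iff)
  moreover have "det4 P \<noteq> 0" using n1 n2 by (simp add: P_def det4_kron2)
  ultimately have PQ: "det4 (P * Q) \<noteq> 0" by simp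
  have "kron_asymmetry (tr4 (P * Q) * M * (P * Q)) 1 D1 w D2" by (rule kron_asymmetry_congr[OF kU 1 UPQ])
  moreover have "det4 (tr4 (P * Q) * M * (P * Q)) = (m * det4 (P * Q))\<^sup>2"
    unfolding det4_mult det4_transpose M by (simp add: power2_eq_square algebra_simps)
  moreover have "m * det4 (P * Q) \<noteq> 0" using M PQ by simp
  ultimately have "biquat_decomposable (tr4 (P * Q) * M * (P * Q))"
    using biquat_of_blocks[OF 2 _ _ w0 _ D1_def D2_def] w1 unfolding w_def[symmetric] by blast
  thus ?thesis by (rule biquat_decomposable_congr[OF PQ])
qed

text \<open>The generic case: \<open>(1 - w\<^sub>2) W\<^sub>1 + (1 - w\<^sub>1) W\<^sub>2\<close> is a Cayley transform of the asymmetry, hence skew,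
  and \<open>W\<^sub>1\<close>, \<open>W\<^sub>2\<close> are polynomials in it.\<close>

lemma biquat_of_generic:
  fixes M :: "'a::field m4"
  assumes 2: "(2::'a) \<noteq> 0" and M: "det4 M = m\<^sup>2" "m \<noteq> 0"
    and k: "kron_asymmetry M 1 W1 1 W2" and c: "W2 * W1 = W1 * W2"
    and sq: "W1 * W1 = w1 *s 1" "W2 * W2 = w2 *s 1"
    and d: "det4 ((1 *s 1 + W1) * (1 *s 1 + W2)) = \<delta>\<^sup>2" "\<delta> \<noteq> 0"
    and w: "w1 \<noteq> 1" "w2 \<noteq> 1" "w1 \<noteq> w2" "w1 * w2 \<noteq> 1"
  shows "biquat_decomposable M"
proof -
  define T where "T = W1 * W2"
  define X where "X = (1 - w2) *s W1 + (1 - w1) *s W2"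
  have c': "W2 * (W1 * Y) = W1 * (W2 * Y)" for Y using c by (simp add: mult.assoc[symmetric])
  have sq': "W1 * (W1 * Y) = w1 *s Y" "W2 * (W2 * Y) = w2 *s Y" for Y
    using sq by (simp_all add: mult.assoc[symmetric])
  note rules = mult.assoc c c' sq sq' distrib_left distrib_right left_diff_distrib right_diff_distrib smul_distrib
  \<comment> \<open>The factor \<open>1 - T\<close> clears the denominator \<open>1 + T\<close> of
    the Cayley transform, because \<open>(1 + T) (1 - T) = 1 - w1 w2\<close>.\<close>
  have e: "(1 *s 1 - W1) * (1 *s 1 - W2) * (1 - T) = (1 - w1 * w2) *s 1 - X"
    "(1 *s 1 + W1) * (1 *s 1 + W2) * (1 - T) = (1 - w1 * w2) *s 1 + X"
    by (simp_all add: T_def X_def rules mult.commute)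
  have "tr4 M * ((1 - w1 * w2) *s 1 - X) = 1 *s (M * ((1 - w1 * w2) *s 1 + X))"
    using k unfolding kron_asymmetry_def e[symmetric] by (simp add: mult.assoc[symmetric])
  hence skX: "tr4 X * M = - (M * X)"
    using cayley_skew[OF 2, of "1 - w1 * w2" 1 M X] w(4) by simp
  have skXX: "tr4 (X * X) * M = M * (X * X)"
  proof -
    have "tr4 (X * X) * M = tr4 X * (tr4 X * M)" by (simp add: mult.assoc)
    also have "\<dots> = tr4 X * (- (M * X))" by (rule arg_cong[OF skX])
    also have "\<dots> = - (tr4 X * M * X)" by (simp only: mult.assoc minus_mult_right)
    also have "\<dots> = M * (X * X)" unfolding skX by (simp only: mult.assoc minus_mult_left[symmetric] minus_minus)
    finally show ?thesis .
  qed
  define u where "u = (1 - w2)\<^sup>2 * w1 + (1 - w1)\<^sup>2 * w2"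
  define v where "v = 2 * ((1 - w1) * (1 - w2))"
  have XX: "X * X = u *s 1 + v *s T"
  proof -
    have "X * X = ((1 - w2) * (1 - w2) * w1) *s 1 + ((1 - w1) * (1 - w1) * w2) *s 1
       + (((1 - w1) * (1 - w2)) *s T + ((1 - w1) * (1 - w2)) *s T)"
      unfolding X_def T_def distrib_left distrib_right smul_simps sq c by (simp add: mult_ac smul_distrib(1) add_ac)
    also have "((1 - w1) * (1 - w2)) *s T + ((1 - w1) * (1 - w2)) *s T = v *s T"
      by (simp only: smul_distrib(2)[symmetric] v_def mult_2)
    finally show ?thesis by (simp add: u_def power2_eq_square smul_distrib(2))
  qed
  have v: "v \<noteq> 0" using 2 w by (simp add: v_def)
  have "tr4 (v *s T) * M = M * (v *s T)"
    using skXX unfolding XX by (simp add: distrib_left distrib_right)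
  hence "v *s (tr4 T * M) = v *s (M * T)" by simp
  hence skT: "tr4 T * M = M * T" using smul_cancel[OF v] by blast
  have XT: "X * T = ((1 - w1) * w2) *s W1 + ((1 - w2) * w1) *s W2" and TX: "T * X = X * T"
    by (simp_all add: X_def T_def rules mult_ac add.commute)
  have skXT: "tr4 (X * T) * M = - (M * (X * T))"
  proof -
    have "tr4 (X * T) * M = tr4 T * (tr4 X * M)" by (simp add: mult.assoc)
    also have "\<dots> = - (tr4 T * M * X)" unfolding skX by (simp add: mult.assoc)
    finally show ?thesis unfolding skT by (simp add: mult.assoc TX)
  qed
  have lin: "tr4 (x *s X + y *s (X * T)) * M = - (M * (x *s X + y *s (X * T)))" for x y
  proof -
    have "tr4 (x *s X + y *s (X * T)) * M = x *s (tr4 X * M) + y *s (tr4 (X * T) * M)"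
      by (simp add: distrib_right)
    thus ?thesis unfolding skX skXT by (simp add: distrib_left)
  qed
  \<comment> \<open>The determinant of the system that expresses \<open>X\<close> and
    \<open>X * T\<close> by \<open>W1\<close> and \<open>W2\<close>; it factors as
    \<open>(w1 - w2) (1 - w1 w2)\<close>.\<close>
  define D where "D = (1 - w2) * ((1 - w2) * w1) - (1 - w1) * ((1 - w1) * w2)"
  have "D = (w1 - w2) * (1 - w1 * w2)" by (simp add: D_def algebra_simps)
  hence D: "D \<noteq> 0" using w by simp
  have s: "((1 - w2) * w1) *s X + (- (1 - w1)) *s (X * T) = D *s W1"
    "(- ((1 - w1) * w2)) *s X + (1 - w2) *s (X * T) = D *s W2"
    unfolding XT unfolding X_def D_def by (simp_all add: smul_distrib mult_ac algebra_simps)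
  have sc: "tr4 W * M = - (M * W)" if "tr4 (D *s W) * M = - (M * (D *s W))" for W
  proof -
    have "D *s (tr4 W * M) = D *s (- (M * W))" using that by simp
    thus ?thesis using smul_cancel[OF D] by blast
  qed
  have sk: "tr4 W1 * M = - (M * W1)" "tr4 W2 * M = - (M * W2)"
    by (rule sc, unfold s[symmetric], rule lin)+
  show ?thesis by (rule biquat_decomposable_of_skew[OF 2 M k c sk sq d])
qed

text \<open>Only \<open>W\<^sub>1 + W\<^sub>2\<close> is controlled by the asymmetry; its two components in the quaternion factors of
  the symmetric form \<open>S\<close> can replace \<open>W\<^sub>1\<close> and \<open>W\<^sub>2\<close>.\<close>

lemma biquat_of_equal:
  fixes M :: "'a::field m4"
  assumes 2: "(2::'a) \<noteq> 0" and M: "det4 M = m\<^sup>2" "m \<noteq> 0"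
    and k: "kron_asymmetry M 1 W1 1 W2" and c: "W2 * W1 = W1 * W2"
    and sq: "W1 * W1 = w *s 1" "W2 * W2 = w *s 1"
    and d: "det4 ((1 *s 1 + W1) * (1 *s 1 + W2)) = \<delta>\<^sup>2" "\<delta> \<noteq> 0"
    and w: "w \<noteq> 1" "w \<noteq> -1" and ns: "\<And>t. W1 * W2 \<noteq> t *s 1"
  shows "biquat_decomposable M"
proof -
  define T where "T = W1 * W2"
  define D where "D = W1 + W2"
  have c': "W2 * (W1 * Y) = W1 * (W2 * Y)" for Y using c by (simp add: mult.assoc[symmetric])
  have sq': "W1 * (W1 * Y) = w *s Y" "W2 * (W2 * Y) = w *s Y" for Y
    using sq by (simp_all add: mult.assoc[symmetric])
  note rules = mult.assoc c c' sq sq' distrib_left distrib_right left_diff_distrib right_diff_distrib smul_distrib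
  have e: "(1 *s 1 - W1) * (1 *s 1 - W2) * (1 - T) = (1 - w) *s ((1 + w) *s 1 - D)"
    "(1 *s 1 + W1) * (1 *s 1 + W2) * (1 - T) = (1 - w) *s ((1 + w) *s 1 + D)"
    by (simp_all add: T_def D_def rules algebra_simps)
  have "tr4 M * ((1 - w) *s ((1 + w) *s 1 - D)) = M * ((1 - w) *s ((1 + w) *s 1 + D))"
    using k unfolding kron_asymmetry_def e[symmetric] by (simp add: mult.assoc[symmetric])
  hence "(1 - w) *s (tr4 M * ((1 + w) *s 1 - D)) = (1 - w) *s (1 *s (M * ((1 + w) *s 1 + D)))" by simp
  hence "tr4 M * ((1 + w) *s 1 - D) = 1 *s (M * ((1 + w) *s 1 + D))"
    using smul_cancel[of "1 - w"] w(1) by (metis eq_iff_diff_eq_0)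
  moreover have "1 + w \<noteq> 0" using w(2) by (metis add.commute eq_neg_iff_add_eq_0)
  ultimately have skD: "tr4 D * M = - (M * D)" using cayley_skew[OF 2, of "1 + w" 1 M D] by simp
  have DD: "D * D = (2 * w) *s 1 + 2 *s T"
  proof -
    have "D * D = W1 * W1 + W1 * W2 + (W2 * W1 + W2 * W2)"
      unfolding D_def by (simp only: distrib_left distrib_right ac_simps)
    also have "\<dots> = (w *s 1 + w *s 1) + (T + T)" unfolding sq c T_def by (simp only: ac_simps)
    also have "T + T = 2 *s T" by (simp only: smul_distrib(2)[of 1 1 T, unfolded one_add_one smul_simps(4)])
    finally show ?thesis by (simp only: mult_2 smul_distrib(2))
  qed
  have DT: "D * T = w *s D" by (simp add: D_def T_def rules add.commute)
  have skDD: "tr4 (D * D) * M = M * (D * D)"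
  proof -
    have "tr4 (D * D) * M = tr4 D * (tr4 D * M)" by (simp add: mult.assoc)
    also have "\<dots> = tr4 D * (- (M * D))" by (rule arg_cong[OF skD])
    also have "\<dots> = - (tr4 D * M * D)" by (simp only: mult.assoc minus_mult_right)
    also have "\<dots> = M * (D * D)" unfolding skD by (simp only: mult.assoc minus_mult_left[symmetric] minus_minus)
    finally show ?thesis .
  qed
  have "2 *s (tr4 T * M) = 2 *s (M * T)"
    using skDD unfolding DD by (simp add: distrib_left distrib_right)
  hence skT: "tr4 T * M = M * T" using smul_cancel[OF 2] by blast
  \<comment> \<open>\<open>1 + D + T\<close> is \<open>(1 + W1) (1 + W2)\<close>. Symmetry of
    \<open>S\<close> follows from \<open>D\<close> being skew and \<open>T\<close> self-adjoint,
    without skewness of \<open>W1\<close> and \<open>W2\<close> separately.\<close>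
  define S where "S = M * (1 + D + T)"
  have S': "S = M * (1 *s 1 + W1) * (1 *s 1 + W2)" by (simp add: S_def D_def T_def algebra_simps)
  have symS: "tr4 S = S"
  proof -
    have "tr4 S = tr4 M + tr4 D * tr4 M + tr4 T * tr4 M" by (simp add: S_def distrib_right)
    also have "tr4 D * tr4 M = - (tr4 M * D)" using arg_cong[OF skD, of tr4] by (simp add: minus_equation_iff)
    also have "tr4 T * tr4 M = tr4 M * T" using arg_cong[OF skT, of tr4] by simp
    also have "tr4 M + - (tr4 M * D) + tr4 M * T = tr4 M * (1 *s 1 - W1) * (1 *s 1 - W2)"
      by (simp add: D_def T_def algebra_simps)
    also have "\<dots> = S" unfolding S' using k by (simp add: kron_asymmetry_def)
    finally show ?thesis .
  qed
  have "det4 S = (m * \<delta>)\<^sup>2" unfolding S' using M d by (simp add: mult.assoc power_mult_distrib)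
  moreover have "m * \<delta> \<noteq> 0" using M d by simp
  ultimately obtain \<alpha>1 \<beta>1 i1 j1 \<alpha>2 \<beta>2 i2 j2 where SB: "skew_biquat \<alpha>1 \<beta>1 i1 j1 \<alpha>2 \<beta>2 i2 j2 S"
    and span: "\<forall>D. tr4 D * S = - (S * D) \<longrightarrow>
      (\<exists>u1 u2 u3 v1 v2 v3. D = quat i1 j1 0 u1 u2 u3 + quat i2 j2 0 v1 v2 v3)"
    by (rule symmetric_biquat[OF 2 symS])
  interpret skew_biquat \<alpha>1 \<beta>1 i1 j1 \<alpha>2 \<beta>2 i2 j2 S by (rule SB)
  have "(1 + D + T) * D = D * (1 + D + T)" by (simp add: D_def T_def rules algebra_simps)
  hence "tr4 D * S = - (S * D)" unfolding S_def by (simp add: mult.assoc[symmetric] skD) (simp add: mult.assoc)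
  then obtain u1 u2 u3 v1 v2 v3 where Dq: "D = quat i1 j1 0 u1 u2 u3 + quat i2 j2 0 v1 v2 v3"
    using span by blast
  define d1 d2 where "d1 = quat i1 j1 0 u1 u2 u3" and "d2 = quat i2 j2 0 v1 v2 v3"
  obtain n1 n2 where n: "d1 * d1 = n1 *s 1" "d2 * d2 = n2 *s 1"
    unfolding d1_def d2_def using pure_square by blast
  have cd: "d2 * d1 = d1 * d2" unfolding d1_def d2_def using quat_commute(3)[OF B] by simp
  have cd': "d2 * (d1 * Y) = d1 * (d2 * Y)" for Y using cd by (simp add: mult.assoc[symmetric])
  have n': "d1 * (d1 * Y) = n1 *s Y" "d2 * (d2 * Y) = n2 *s Y" for Y
    using n by (simp_all add: mult.assoc[symmetric])
  have Dd: "D = d1 + d2" unfolding Dq d1_def d2_def ..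
  have DD': "D * D = (n1 + n2) *s 1 + 2 *s (d1 * d2)"
  proof -
    have "D * D = (n1 *s 1 + n2 *s 1) + (d1 * d2 + d1 * d2)" by (simp add: Dd distrib_left distrib_right n cd algebra_simps)
    also have "d1 * d2 + d1 * d2 = 2 *s (d1 * d2)" using smul_distrib(2)[of 1 1 "d1 * d2"] by simp
    finally show ?thesis by (simp add: smul_distrib)
  qed
  have nsD: "D * D \<noteq> t *s 1" for t
  proof
    assume "D * D = t *s 1"
    hence "2 *s T = (t - 2 * w) *s 1" unfolding DD by (simp add: smul_distrib eq_diff_eq add.commute)
    hence "(1/2) *s 2 *s T = (1/2) *s (t - 2 * w) *s 1" by simp
    thus False using ns[of "(t - 2 * w) / 2"] 2 by (simp add: T_def)
  qed
  have u: "(u1, u2, u3) \<noteq> (0, 0, 0)"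
  proof
    assume "(u1, u2, u3) = (0, 0, 0)"
    hence "d1 = 0" by (simp add: d1_def quat_def)
    thus False using nsD[of n2] n(2) by (simp add: Dd)
  qed
  have v: "(v1, v2, v3) \<noteq> (0, 0, 0)"
  proof
    assume "(v1, v2, v3) = (0, 0, 0)"
    hence "d2 = 0" by (simp add: d2_def quat_def)
    thus False using nsD[of n1] n(1) by (simp add: Dd)
  qed
  \<comment> \<open>The cube of \<open>D\<close> is computed once through \<open>T\<close> and once
    through \<open>d1\<close>, \<open>d2\<close>. Comparison in the basis of sixteen gives
    \<open>n1 + 3 n2 = 3 n1 + n2 = 4 w\<close>, hence \<open>n1 + n2 = 2 w\<close>, and the two
    expressions for \<open>D * D\<close> then yield \<open>T = d1 * d2\<close>.\<close>
  have "D * (D * D) = (2 * w) *s D + 2 *s (D * T)" unfolding DD by (simp add: distrib_left)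
  hence 1: "D * (D * D) = (4 * w) *s D" unfolding DT by (simp add: smul_distrib(2)[symmetric])
  have "D * (D * D) = (n1 + n2) *s D + 2 *s (D * (d1 * d2))" unfolding DD' by (simp add: distrib_left)
  also have "D * (d1 * d2) = n1 *s d2 + n2 *s d1" by (simp add: Dd distrib_right n' cd cd' n)
  finally have "(n1 + n2) *s D + 2 *s (n1 *s d2 + n2 *s d1) = (4 * w) *s D" using 1 by simp
  hence "(n1 + n2) *s (d1 + d2) + 2 *s (n1 *s d2 + n2 *s d1) - (4 * w) *s (d1 + d2) = 0"
    unfolding Dd by simp
  moreover have "(n1 + n2) *s (d1 + d2) + 2 *s (n1 *s d2 + n2 *s d1) - (4 * w) *s (d1 + d2)
      = (n1 + 3 * n2 - 4 * w) *s d1 + (3 * n1 + n2 - 4 * w) *s d2"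
    by (cases d1; cases d2; simp add: M4_simps algebra_simps)
  ultimately have "(n1 + 3 * n2 - 4 * w) *s d1 + (3 * n1 + n2 - 4 * w) *s d2 = 0" by simp
  hence "quat i2 j2 0 ((3 * n1 + n2 - 4 * w) * v1) ((3 * n1 + n2 - 4 * w) * v2) ((3 * n1 + n2 - 4 * w) * v3)
     + quat i2 j2 ((n1 + 3 * n2 - 4 * w) * u1) 0 0 0 * i1 + quat i2 j2 ((n1 + 3 * n2 - 4 * w) * u2) 0 0 0 * j1
     + quat i2 j2 ((n1 + 3 * n2 - 4 * w) * u3) 0 0 0 * (i1 * j1) = 0"
    unfolding d1_def d2_def quat_def smul_distrib(1) by (simp add: add_ac)
  from biquat_indep[OF two B this] have "n1 + 3 * n2 - 4 * w = 0" "3 * n1 + n2 - 4 * w = 0" using u v by auto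
  hence "n1 + n2 = 2 * w"
  proof -
    assume a: "n1 + 3 * n2 - 4 * w = 0" "3 * n1 + n2 - 4 * w = 0"
    have "2 * (2 * (n1 + n2 - 2 * w)) = (n1 + 3 * n2 - 4 * w) + (3 * n1 + n2 - 4 * w)" by (simp add: algebra_simps)
    hence "n1 + n2 - 2 * w = 0" using a 2 by (metis add_0 mult_eq_0_iff)
    thus ?thesis by simp
  qed
  hence "(2 * w) *s 1 + 2 *s T = (2 * w) *s 1 + 2 *s (d1 * d2)" using DD DD' by metis
  hence "2 *s T = 2 *s (d1 * d2)" by (rule add_left_imp_eq)
  hence "T = d1 * d2" using smul_cancel[OF 2] by blast
  hence "S = M * quat i1 j1 1 u1 u2 u3 * quat i2 j2 1 v1 v2 v3"
    unfolding S_def Dd by (simp add: d1_def d2_def quat_def algebra_simps)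
  thus ?thesis by (rule biquat_decomposableI)
qed

text \<open>If some \<open>ki\<close> is 0, nondegeneracy of the tensor form makes \<open>Wi\<close>
  invertible, and it can be cancelled at the cost of a sign. If some \<open>Wi\<close> is 0, the
  other one is skew by a Cayley transform. In all other cases division by \<open>k1\<close> and
  \<open>k2\<close> reduces to constants 1, where the reciprocal, the equal and the generic case
  remain.\<close>

theorem kron_imp_biquat:
  fixes M :: "'a::field m4"
  assumes 2: "(2::'a) \<noteq> 0" and M: "det4 M = m\<^sup>2" "m \<noteq> 0" and D: "kron_decomposable M"
  shows "biquat_decomposable M"
proof -
  obtain P k1 k2 a b c a' b' c' where P: "det4 P \<noteq> 0" and k: "k1\<^sup>2 \<noteq> a\<^sup>2 + b * c" "k2\<^sup>2 \<noteq> a'\<^sup>2 + b' * c'"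
    and kaP: "kron_asymmetry (tr4 P * M * P) k1 (kronL a b c (- a)) k2 (kronR a' b' c' (- a'))"
    using D unfolding kron_decomposable_def by blast
  define N where "N = tr4 P * M * P"
  define W1 W2 where "W1 = kronL a b c (- a)" and "W2 = kronR a' b' c' (- a')"
  define w1 w2 where "w1 = a\<^sup>2 + b * c" and "w2 = a'\<^sup>2 + b' * c'"
  note ka = kaP[folded N_def W1_def W2_def]
  define n where "n = m * det4 P"
  have N: "det4 N = n\<^sup>2" "n \<noteq> 0"
    unfolding N_def det4_mult det4_transpose n_def M using M P by (simp_all add: power2_eq_square algebra_simps)
  have cm: "W2 * W1 = W1 * W2" unfolding W1_def W2_def by (rule kron_facts)
  have sq: "W1 * W1 = w1 *s 1" "W2 * W2 = w2 *s 1" unfolding W1_def W2_def w1_def w2_def by (rule kron_facts)+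
  have ka': "tr4 N * ((k1 *s 1 - W1) * (k2 *s 1 - W2)) = N * ((k1 *s 1 + W1) * (k2 *s 1 + W2))"
    using ka by (simp add: kron_asymmetry_def mult.assoc)
  have sym: ?thesis if "tr4 N = N"
    using biquat_of_symmetric[OF 2 N that] biquat_decomposable_congr[OF P] by (simp add: N_def)
  have canc: "X = Y" if "X * W = Y * W" "W * W = z *s 1" "z \<noteq> 0" for X Y W :: "'a m4" and z
  proof -
    have "X * (W * W) = Y * (W * W)" using that(1) by (simp add: mult.assoc[symmetric])
    thus ?thesis unfolding that(2) using smul_cancel[OF that(3)] by simp
  qed
  have anti: ?thesis if "tr4 N * (k2 *s 1 - W2) = - (N * (k2 *s 1 + W2))" "k2 \<noteq> 0"
    using biquat_of_antisymmetric[OF 2 N that(2) k(2) W2_def that(1)] biquat_decomposable_congr[OF P] by (simp add: N_def)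
  have anti': ?thesis if "tr4 N * (k1 *s 1 - W1) = - (N * (k1 *s 1 + W1))" "k1 \<noteq> 0"
    using biquat_of_antisymmetric'[OF 2 N that(2) k(1) W1_def that(1)] biquat_decomposable_congr[OF P] by (simp add: N_def)
  have single: ?thesis
    if eq: "tr4 N * (k *s 1 - W) = N * (k *s 1 + W)" and "k \<noteq> 0" and s: "W * W = z *s 1"
      and d: "det4 (k *s 1 + W) = (k\<^sup>2 - z)\<^sup>2" and "k\<^sup>2 \<noteq> z" for k W z
  proof -
    have sk: "tr4 W * N = - (N * W)" by (rule cayley_skew[OF 2 that(2), of 1]) (use eq in simp_all)
    have "biquat_decomposable N"
      by (rule biquat_decomposable_of_skew[OF 2 N, of 1 0 k W 0 z "k\<^sup>2 - z"])
        (use eq sk s d that(5) in \<open>simp_all add: kron_asymmetry_def\<close>)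
    thus ?thesis using biquat_decomposable_congr[OF P] by (simp add: N_def)
  qed
  have dets: "det4 (x *s 1 + W1) = (x\<^sup>2 - w1)\<^sup>2" "det4 (x *s 1 + W2) = (x\<^sup>2 - w2)\<^sup>2" for x
    unfolding W1_def W2_def w1_def w2_def by (rule det4_kron)+
  consider (00) "k1 = 0" "k2 = 0" | (01) "k1 = 0" "k2 \<noteq> 0" | (10) "k1 \<noteq> 0" "k2 = 0"
    | (L) "k1 \<noteq> 0" "k2 \<noteq> 0" "W1 = 0" | (R) "k1 \<noteq> 0" "k2 \<noteq> 0" "W2 = 0"
    | (11) "k1 \<noteq> 0" "k2 \<noteq> 0" "W1 \<noteq> 0" "W2 \<noteq> 0" by blast
  thus ?thesis
  proof cases
    case 00
    have nz: "w1 \<noteq> 0" "w2 \<noteq> 0" using k 00 by (simp_all add: w1_def w2_def)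
    have "tr4 N * W1 * W2 = N * W1 * W2" using ka' 00 by (simp add: mult.assoc)
    hence "tr4 N * W1 = N * W1" by (rule canc[OF _ sq(2) nz(2)])
    hence "tr4 N = N" by (rule canc[OF _ sq(1) nz(1)])
    thus ?thesis by (rule sym)
  next
    case 01
    have nz: "w1 \<noteq> 0" using k 01 by (simp add: w1_def)
    have "tr4 N * (k2 *s 1 - W2) * W1 = - (N * (k2 *s 1 + W2)) * W1"
      using ka' 01(1) cm by (simp add: algebra_simps)
    hence "tr4 N * (k2 *s 1 - W2) = - (N * (k2 *s 1 + W2))" by (rule canc[OF _ sq(1) nz])
    thus ?thesis using anti 01 by blast
  next
    case 10
    have nz: "w2 \<noteq> 0" using k 10 by (simp add: w2_def)
    have "tr4 N * (k1 *s 1 - W1) * W2 = - (N * (k1 *s 1 + W1)) * W2"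
      using ka' 10(2) by (simp add: algebra_simps)
    hence "tr4 N * (k1 *s 1 - W1) = - (N * (k1 *s 1 + W1))" by (rule canc[OF _ sq(2) nz])
    thus ?thesis using anti' 10 by blast
  next
    case L
    have "k1 *s (tr4 N * (k2 *s 1 - W2)) = k1 *s (N * (k2 *s 1 + W2))" using ka' L(3) by simp
    hence "tr4 N * (k2 *s 1 - W2) = N * (k2 *s 1 + W2)" using smul_cancel[OF L(1)] by blast
    thus ?thesis by (rule single[OF _ L(2) sq(2) dets(2)]) (use k in \<open>simp add: w2_def\<close>)
  next
    case R
    have "k2 *s (tr4 N * (k1 *s 1 - W1)) = k2 *s (N * (k1 *s 1 + W1))" using ka' R(3) by simp
    hence "tr4 N * (k1 *s 1 - W1) = N * (k1 *s 1 + W1)" using smul_cancel[OF R(2)] by blast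
    thus ?thesis by (rule single[OF _ R(1) sq(1) dets(1)]) (use k in \<open>simp add: w1_def\<close>)
  next
    case 11
    define V1 V2 where "V1 = kronL (a / k1) (b / k1) (c / k1) (- (a / k1))"
      and "V2 = kronR (a' / k2) (b' / k2) (c' / k2) (- (a' / k2))"
    define v1 v2 where "v1 = (a / k1)\<^sup>2 + (b / k1) * (c / k1)" and "v2 = (a' / k2)\<^sup>2 + (b' / k2) * (c' / k2)"
    have WV: "W1 = k1 *s V1" "W2 = k2 *s V2"
      using 11 by (simp_all add: W1_def W2_def V1_def V2_def kron_smul)
    have v: "v1 = w1 / k1\<^sup>2" "v2 = w2 / k2\<^sup>2"
      by (simp_all add: v1_def v2_def w1_def w2_def power2_eq_square add_divide_distrib)
    have v1: "v1 \<noteq> 1" "v2 \<noteq> 1" using k 11 unfolding v by (auto simp: w1_def w2_def)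
    have cV: "V2 * V1 = V1 * V2" unfolding V1_def V2_def by (rule kron_facts)
    have sV: "V1 * V1 = v1 *s 1" "V2 * V2 = v2 *s 1" unfolding V1_def V2_def v1_def v2_def by (rule kron_facts)+
    have kV: "kron_asymmetry N 1 V1 1 V2"
    proof -
      have e: "k1 *s 1 - W1 = k1 *s (1 *s 1 - V1)" "k1 *s 1 + W1 = k1 *s (1 *s 1 + V1)"
        "k2 *s 1 - W2 = k2 *s (1 *s 1 - V2)" "k2 *s 1 + W2 = k2 *s (1 *s 1 + V2)"
        unfolding WV by (simp_all add: smul_distrib)
      have "(k1 * k2) *s (tr4 N * ((1 *s 1 - V1) * (1 *s 1 - V2))) = (k1 * k2) *s (N * ((1 *s 1 + V1) * (1 *s 1 + V2)))"
        using ka' unfolding e by (simp add: mult.commute)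
      moreover have "k1 * k2 \<noteq> 0" using 11 by simp
      ultimately show ?thesis unfolding kron_asymmetry_def mult.assoc using smul_cancel by blast
    qed
    have dV: "det4 ((1 *s 1 + V1) * (1 *s 1 + V2)) = ((1 - v1) * (1 - v2))\<^sup>2" "(1 - v1) * (1 - v2) \<noteq> 0"
      unfolding det4_mult unfolding V1_def V2_def det4_kron v1_def[symmetric] v2_def[symmetric] using v1
      by (simp_all add: power_mult_distrib)
    have ns: "V1 * V2 \<noteq> t *s 1" for t
      using kron_scalar[OF 2, of "a / k1" "b / k1" "c / k1" "a' / k2" "b' / k2" "c' / k2" t] 11
      unfolding V1_def[symmetric] V2_def[symmetric] WV by auto
    have "biquat_decomposable N"
    proof (cases "v1 * v2 = 1")
      case True
      show ?thesis by (rule biquat_of_reciprocal[OF 2 N V1_def V2_def kV v1(1)[unfolded v1_def] True[unfolded v1_def v2_def]])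
    next
      case v12: False
      show ?thesis
      proof (cases "v1 = v2")
        case False
        show ?thesis by (rule biquat_of_generic[OF 2 N kV cV sV dV v1 False v12])
      next
        case True
        have "v1 \<noteq> -1" using v12 True by auto
        thus ?thesis using biquat_of_equal[OF 2 N kV cV sV(1) sV(2)[folded True] dV v1(1) _ ns] by blast
      qed
    qed
    thus ?thesis using biquat_decomposable_congr[OF P] by (simp add: N_def)
  qed
qed

section \<open>Coordinates on a bilinear space of dimension four\<close>

lemma scalar_space_simps [simp]:
  "carrier scalar_space = UNIV" "x \<oplus>\<^bsub>scalar_space\<^esub> y = x + y" "c \<odot>\<^bsub>scalar_space\<^esub> x = c * x"
  "\<zero>\<^bsub>scalar_space\<^esub> = 0"
  by (simp_all add: scalar_space_def)

lemma scalar_space_vs: "vectorspace class_ring (scalar_space :: ('a::field, 'a) module)"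
proof -
  interpret R: field "class_ring :: 'a ring" by (rule class_field)
  have "abelian_group (scalar_space :: ('a, 'a) module)"
    by (rule abelian_groupI) (auto simp: algebra_simps intro: exI[of _ "- _"])
  then interpret A: abelian_group "scalar_space :: ('a, 'a) module" .
  show ?thesis
    by unfold_locales (auto simp: class_ring_simps algebra_simps)
qed

lemma bilinear_form_iff_map: "bilinear_form V b \<longleftrightarrow> bilinear_map V V scalar_space b"
  unfolding bilinear_form_def bilinear_map_def by (simp; blast)

definition vmul :: "'a::field m4 \<Rightarrow> 'a vec \<Rightarrow> 'a vec" (infixr "*x" 75) where
  "X *x v = mat_of X *\<^sub>v v"

lemma vmul_closed [simp]: "X *x v \<in> carrier_vec 4"
  unfolding vmul_def by (rule carrier_vecI) simp

lemma smult_mat_vec4: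
  fixes A :: "'a::field mat"
  assumes "A \<in> carrier_mat 4 4" "v \<in> carrier_vec 4"
  shows "(c \<cdot>\<^sub>m A) *\<^sub>v v = c \<cdot>\<^sub>v (A *\<^sub>v v)"
  using assms by (intro eq_vecI) (auto simp: smult_scalar_prod_distrib[of _ 4])

lemma dim_vmul [simp]: "dim_vec (X *x v) = 4" using carrier_vecD[OF vmul_closed] .

lemma vmul_simps:
  assumes "v \<in> carrier_vec 4"
  shows "(X * Y) *x v = X *x Y *x v" "1 *x v = v" "(X + Y) *x v = X *x v + Y *x v"
    "(c *s X) *x v = c \<cdot>\<^sub>v (X *x v)" "X *x (c \<cdot>\<^sub>v v) = c \<cdot>\<^sub>v (X *x v)"
    "w \<in> carrier_vec 4 \<Longrightarrow> X *x (v + w) = X *x v + X *x w"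
    "w \<in> carrier_vec 4 \<Longrightarrow> (tr4 X *x w) \<bullet> v = w \<bullet> (X *x v)"
  unfolding vmul_def mat_of_mult mat_of_one mat_of_add mat_of_smul mat_of_transpose
  using assms mat_of_carrier(1)[of X] mat_of_carrier(1)[of Y]
  by (auto simp: assoc_mult_mat_vec[of _ 4 4 _ 4] add_mult_distrib_mat_vec[of _ 4 4]
      mult_mat_vec[of _ 4 4] mult_add_distrib_mat_vec[of _ 4 4] smult_mat_vec4
      transpose_vec_mult_scalar[of _ 4 4])

lemma unit_vmul_unit:
  assumes "i < 4" "j < 4"
  shows "unit_vec 4 i \<bullet> (X *x unit_vec 4 j) = mat_of X $$ (i, j)" "(X *x unit_vec 4 j) $ i = mat_of X $$ (i, j)"
proof -
  have "mat_of X *\<^sub>v unit_vec 4 j = col (mat_of X) j"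
    using assms mat_of_carrier(1)[of X] by (intro eq_vecI) auto
  thus "(X *x unit_vec 4 j) $ i = mat_of X $$ (i, j)"
    using assms mat_of_carrier(1)[of X] by (auto simp: vmul_def)
  thus "unit_vec 4 i \<bullet> (X *x unit_vec 4 j) = mat_of X $$ (i, j)"
    using assms scalar_prod_left_unit[OF vmul_closed, of i X "unit_vec 4 j"] by simp
qed

lemma vmul_form_inj:
  assumes "\<And>x y. x \<in> carrier_vec 4 \<Longrightarrow> y \<in> carrier_vec 4 \<Longrightarrow> x \<bullet> (X *x y) = x \<bullet> (Y *x y)"
  shows "X = Y"
proof (rule mat_of_inj, rule eq_matI)
  fix i j assume "i < dim_row (mat_of Y)" "j < dim_col (mat_of Y)"
  hence ij: "i < 4" "j < 4" using mat_of_carrier(1)[of Y] by auto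
  show "mat_of X $$ (i, j) = mat_of Y $$ (i, j)"
    using assms[of "unit_vec 4 i" "unit_vec 4 j"] ij by (simp add: unit_vmul_unit)
qed (use mat_of_carrier(1)[of X] mat_of_carrier(1)[of Y] in auto)

lemma vmul_inj:
  assumes "\<And>y. y \<in> carrier_vec 4 \<Longrightarrow> X *x y = Y *x y"
  shows "X = Y"
  by (rule vmul_form_inj) (simp add: assms)

lemma vmul_hom: "vmul X \<in> LinearCombinations.module_hom class_ring (coord_space 4) (coord_space 4)"
  by (rule module_homI) (simp_all add: coord_space_simps vmul_simps)

lemma coord_hom_vmul:
  assumes "f \<in> LinearCombinations.module_hom class_ring (coord_space 4) (coord_space 4 :: ('a::field, 'a vec) module)"
  obtains X where "\<And>x. x \<in> carrier_vec 4 \<Longrightarrow> f x = X *x x"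
proof -
  define X where "X = of_fun4 (\<lambda>i j. f (unit_vec 4 j) $ i)"
  have "f x = X *x x" if x: "x \<in> carrier_vec 4" for x
  proof (rule coord_space_hom_eqI[OF coord_space_vs assms vmul_hom _ x])
    fix j :: nat assume j: "j < 4"
    have "f (unit_vec 4 j) \<in> carrier_vec 4"
      using module_homD(1)[OF assms, unfolded coord_space_simps] by simp
    thus "f (unit_vec 4 j) = X *x unit_vec 4 j"
      using j vmul_closed[of X "unit_vec 4 j"]
      by (intro eq_vecI) (auto simp: unit_vmul_unit X_def mat_of_of_fun4)
  qed
  thus thesis using that by blast
qed

definition form_on :: "('b \<Rightarrow> 'b \<Rightarrow> 'a) \<Rightarrow> ('a::field vec \<Rightarrow> 'b) \<Rightarrow> 'a m4" where
  "form_on b \<phi> = of_fun4 (\<lambda>i j. b (\<phi> (unit_vec 4 i)) (\<phi> (unit_vec 4 j)))"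

lemma vmul_form_bilinear: "bilinear_map (coord_space 4) (coord_space 4) scalar_space (\<lambda>x y. x \<bullet> (X *x y))"
  unfolding bilinear_map_def coord_space_simps scalar_space_simps
  by (auto simp: vmul_simps add_scalar_prod_distrib[of _ 4] scalar_prod_add_distrib[of _ 4])

locale coord4 =
  fixes V :: "('a::field, 'v) module" and \<phi> :: "'a vec \<Rightarrow> 'v"
  assumes vs: "vectorspace class_ring V" and \<phi>: "\<phi> \<in> linear_isos (coord_space 4) V"
begin

abbreviation "\<psi> \<equiv> inv_into (carrier_vec 4) \<phi>"

lemmas F = vs_facts[OF vs]
lemmas P = linear_isosD[OF \<phi>, unfolded coord_space_simps]
lemmas \<psi>_iso = linear_isos_inv_into[OF coord_space_vs \<phi>, unfolded coord_space_simps]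
lemmas Q = linear_isosD[OF \<psi>_iso, unfolded coord_space_simps]

lemma \<phi>\<psi> [simp]: "x \<in> carrier V \<Longrightarrow> \<phi> (\<psi> x) = x"
  using P(2) by (simp add: bij_betw_def f_inv_into_f)

lemma \<psi>\<phi> [simp]: "v \<in> carrier_vec 4 \<Longrightarrow> \<psi> (\<phi> v) = v"
  using P(6) by (simp add: inv_into_f_f)

definition E :: "'a m4 \<Rightarrow> 'v \<Rightarrow> 'v" where
  "E X = (\<lambda>x\<in>carrier V. \<phi> (X *x \<psi> x))"

lemma E_closed: "E X \<in> carrier (endo_alg V)"
proof -
  have "E X \<in> LinearCombinations.module_hom class_ring V V"
    by (rule module_homI) (simp_all add: E_def P Q F vmul_simps)
  thus ?thesis by (simp add: endo_alg_def E_def)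
qed

lemma E_\<phi>: "v \<in> carrier_vec 4 \<Longrightarrow> E X (\<phi> v) = \<phi> (X *x v)"
  by (simp add: E_def P)

lemma E_inj: "E X = E Y \<Longrightarrow> X = Y"
proof (rule vmul_inj)
  fix v :: "'a vec" assume e: "E X = E Y" and v: "v \<in> carrier_vec 4"
  have "\<phi> (X *x v) = \<phi> (Y *x v)" using E_\<phi>[OF v, of X] E_\<phi>[OF v, of Y] e by simp
  thus "X *x v = Y *x v" using P(6) by (simp add: inj_on_def)
qed

lemma E_surj:
  assumes "f \<in> carrier (endo_alg V)"
  obtains X where "f = E X"
proof -
  from assms have f: "f \<in> LinearCombinations.module_hom class_ring V V" "f \<in> extensional (carrier V)"
    by (auto simp: endo_alg_def)
  have "(\<lambda>v. \<psi> (f (\<phi> v))) \<in> LinearCombinations.module_hom class_ring (coord_space 4) (coord_space 4)"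
    by (rule module_homI) (simp_all add: coord_space_simps P Q module_homD[OF f(1)])
  then obtain X where X: "\<And>x. x \<in> carrier_vec 4 \<Longrightarrow> \<psi> (f (\<phi> x)) = X *x x"
    using coord_hom_vmul by blast
  have "f = E X"
  proof (rule extensionalityI[OF f(2)])
    show "E X \<in> extensional (carrier V)" by (simp add: E_def)
    fix x assume x: "x \<in> carrier V"
    have "\<phi> (\<psi> (f (\<phi> (\<psi> x)))) = \<phi> (X *x \<psi> x)" using X[of "\<psi> x"] Q(3)[OF x] by simp
    thus "f x = E X x" using x by (simp add: E_def module_homD[OF f(1)])
  qed
  thus thesis using that by blast
qed

text \<open>Reduces the definite descriptions in \<open>adjoint_anti\<close> and
  \<open>asymmetry\<close> to solving a matrix equation for \<open>Y\<close>.\<close>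

lemma the_E:
  assumes "\<And>Y. P (E Y) \<longleftrightarrow> Y = Z"
  shows "(THE g. g \<in> carrier (endo_alg V) \<and> P g) = E Z"
proof (rule the_equality)
  show "E Z \<in> carrier (endo_alg V) \<and> P (E Z)" using assms[of Z] E_closed by simp
  fix g assume g: "g \<in> carrier (endo_alg V) \<and> P g"
  then obtain Y where "g = E Y" using E_surj by blast
  thus "g = E Z" using g assms[of Y] by simp
qed

lemma E_ops:
  "E X \<otimes>\<^bsub>endo_alg V\<^esub> E Y = E (X * Y)" "\<one>\<^bsub>endo_alg V\<^esub> = E 1"
  "E X \<oplus>\<^bsub>endo_alg V\<^esub> E Y = E (X + Y)" "c \<odot>\<^bsub>endo_alg V\<^esub> E X = E (c *s X)"
  by (auto simp: endo_alg_def E_def compose_def P Q vmul_simps restrict_def fun_eq_iff)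

context
  fixes b :: "'v \<Rightarrow> 'v \<Rightarrow> 'a" assumes b: "bilinear_form V b"
begin

lemma form_on_eq:
  assumes x: "x \<in> carrier_vec 4" and y: "y \<in> carrier_vec 4"
  shows "b (\<phi> x) (\<phi> y) = x \<bullet> (form_on b \<phi> *x y)"
proof (rule coord_bilinear_eqI[OF scalar_space_vs _ vmul_form_bilinear _ x y])
  show "bilinear_map (coord_space 4) (coord_space 4) scalar_space (\<lambda>x y. b (\<phi> x) (\<phi> y))"
    by (rule bilinear_map_comp_left[OF b[unfolded bilinear_form_iff_map] linear_isosD(1)[OF \<phi>] linear_isosD(1)[OF \<phi>]])
qed (simp add: unit_vmul_unit form_on_def mat_of_of_fun4)

lemma adjoint_matrix_iff:
  "(\<forall>x\<in>carrier V. \<forall>y\<in>carrier V. b (E X x) y = b x (E Y y)) \<longleftrightarrow> tr4 X * form_on b \<phi> = form_on b \<phi> * Y"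
proof -
  have "(\<forall>x\<in>carrier V. \<forall>y\<in>carrier V. b (E X x) y = b x (E Y y)) \<longleftrightarrow>
    (\<forall>x\<in>carrier_vec 4. \<forall>y\<in>carrier_vec 4. b (E X (\<phi> x)) (\<phi> y) = b (\<phi> x) (E Y (\<phi> y)))"
    unfolding P(7)[symmetric] by simp
  also have "\<dots> \<longleftrightarrow> (\<forall>x\<in>carrier_vec 4. \<forall>y\<in>carrier_vec 4.
      x \<bullet> ((tr4 X * form_on b \<phi>) *x y) = x \<bullet> ((form_on b \<phi> * Y) *x y))"
    by (simp add: E_\<phi> form_on_eq vmul_simps(1) vmul_simps(7)[of _ _ "tr4 _", symmetric])
  also have "\<dots> \<longleftrightarrow> tr4 X * form_on b \<phi> = form_on b \<phi> * Y" using vmul_form_inj by metis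
  finally show ?thesis .
qed

lemma asymmetry_matrix_iff:
  "(\<forall>x\<in>carrier V. \<forall>y\<in>carrier V. b x y = b y (E Y x)) \<longleftrightarrow> tr4 (form_on b \<phi>) = form_on b \<phi> * Y"
proof -
  have t: "x \<bullet> (X *x y) = y \<bullet> (tr4 X *x x)" if "x \<in> carrier_vec 4" "y \<in> carrier_vec 4" for x y and X :: "'a m4"
    using vmul_simps(7)[OF that(2,1), of X] comm_scalar_prod[OF that(2) vmul_closed] by simp
  have "(\<forall>x\<in>carrier V. \<forall>y\<in>carrier V. b x y = b y (E Y x)) \<longleftrightarrow>
    (\<forall>x\<in>carrier_vec 4. \<forall>y\<in>carrier_vec 4. b (\<phi> x) (\<phi> y) = b (\<phi> y) (E Y (\<phi> x)))"
    unfolding P(7)[symmetric] by simp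
  also have "\<dots> \<longleftrightarrow> (\<forall>x\<in>carrier_vec 4. \<forall>y\<in>carrier_vec 4.
      y \<bullet> (tr4 (form_on b \<phi>) *x x) = y \<bullet> ((form_on b \<phi> * Y) *x x))"
    by (intro ball_cong refl) (simp only: E_\<phi> form_on_eq vmul_simps(1) t[of _ _ "form_on b \<phi>"] vmul_closed)
  also have "\<dots> \<longleftrightarrow> tr4 (form_on b \<phi>) = form_on b \<phi> * Y" using vmul_form_inj by metis
  finally show ?thesis .
qed

lemma adjoint_anti_matrix:
  assumes "Mi * form_on b \<phi> = 1"
  shows "adjoint_anti V b (E X) = E (Mi * tr4 X * form_on b \<phi>)"
proof -
  have "form_on b \<phi> * Mi = 1" using right_inverse4(2)[OF assms] .
  hence "tr4 X * form_on b \<phi> = form_on b \<phi> * Y \<longleftrightarrow> Y = Mi * tr4 X * form_on b \<phi>" for Y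
    using assms by (metis mult.assoc mult_1)
  thus ?thesis unfolding adjoint_anti_def by (intro the_E) (simp only: adjoint_matrix_iff)
qed

lemma asymmetry_matrix:
  assumes "Mi * form_on b \<phi> = 1"
  shows "asymmetry V b = E (Mi * tr4 (form_on b \<phi>))"
proof -
  have "form_on b \<phi> * Mi = 1" using right_inverse4(2)[OF assms] .
  hence "tr4 (form_on b \<phi>) = form_on b \<phi> * Y \<longleftrightarrow> Y = Mi * tr4 (form_on b \<phi>)" for Y
    using assms by (metis mult.assoc mult_1)
  thus ?thesis unfolding asymmetry_def by (intro the_E) (simp only: asymmetry_matrix_iff)
qed

lemma nondegenerate_iff: "nondegenerate V b \<longleftrightarrow> det4 (form_on b \<phi>) \<noteq> 0"
proof
  have z: "\<phi> (0\<^sub>v 4) = \<zero>\<^bsub>V\<^esub>" using module_hom_zero[OF coord_space_vs vs P(1)] by (simp add: coord_space_simps)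
  show "det4 (form_on b \<phi>) \<noteq> 0" if nd: "nondegenerate V b"
  proof
    assume "det4 (form_on b \<phi>) = 0"
    then obtain v where v: "v \<in> carrier_vec 4" "v \<noteq> 0\<^sub>v 4" "form_on b \<phi> *x v = 0\<^sub>v 4"
      using det_0_iff_vec_prod_zero[OF mat_of_carrier(1), of "form_on b \<phi>"] by (auto simp: det4_def vmul_def)
    have "b x (\<phi> v) = 0" if "x \<in> carrier V" for x
      using form_on_eq[OF Q(3)[OF that] v(1)] that v(3) Q(3)[OF that] by simp
    hence "\<phi> v = \<phi> (0\<^sub>v 4)" using nd v(1) P(3) z by (auto simp: nondegenerate_def)
    thus False using P(6) v by (auto simp: inj_on_def)
  qed
  show "nondegenerate V b" if d: "det4 (form_on b \<phi>) \<noteq> 0"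
  proof -
    obtain Mi where Mi: "form_on b \<phi> * Mi = 1" "Mi * form_on b \<phi> = 1" using det4_inverse[OF d] .
    have 0: "v = 0\<^sub>v 4" if v: "v \<in> carrier_vec 4" and "\<And>w. w \<in> carrier_vec 4 \<Longrightarrow> w \<bullet> v = 0" for v :: "'a vec"
    proof (rule eq_vecI)
      fix i assume "i < dim_vec (0\<^sub>v 4 :: 'a vec)"
      thus "v $ i = (0\<^sub>v 4 :: 'a vec) $ i"
        using that(2)[of "unit_vec 4 i"] scalar_prod_left_unit[OF v, of i] by simp
    qed (use v in auto)
    have z': "X *x 0\<^sub>v 4 = 0\<^sub>v 4" for X :: "'a m4"
      by (rule eq_vecI) (auto simp: vmul_def scalar_prod_def)
    have "x = \<zero>\<^bsub>V\<^esub>" if x: "x \<in> carrier V" and "\<forall>y\<in>carrier V. b x y = 0" for x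
    proof -
      have "y \<bullet> (tr4 (form_on b \<phi>) *x \<psi> x) = 0" if y: "y \<in> carrier_vec 4" for y
        using \<open>\<forall>y\<in>carrier V. b x y = 0\<close> form_on_eq[OF Q(3)[OF x] y] x P(3)[OF y]
          vmul_simps(7)[OF y Q(3)[OF x]] comm_scalar_prod[OF y vmul_closed] by simp
      hence "tr4 (form_on b \<phi>) *x \<psi> x = 0\<^sub>v 4" by (intro 0) auto
      hence "(tr4 Mi * tr4 (form_on b \<phi>)) *x \<psi> x = 0\<^sub>v 4" by (simp add: vmul_simps Q(3)[OF x] z')
      moreover have "tr4 Mi * tr4 (form_on b \<phi>) = 1" using Mi(1) by (metis tr4_simps(1,7))
      ultimately have "\<psi> x = 0\<^sub>v 4" by (simp add: vmul_simps Q(3)[OF x])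
      thus ?thesis using z x by (metis \<phi>\<psi>)
    qed
    moreover have "y = \<zero>\<^bsub>V\<^esub>" if y: "y \<in> carrier V" and "\<forall>x\<in>carrier V. b x y = 0" for y
    proof -
      have "x \<bullet> (form_on b \<phi> *x \<psi> y) = 0" if x: "x \<in> carrier_vec 4" for x
        using \<open>\<forall>x\<in>carrier V. b x y = 0\<close> form_on_eq[OF x Q(3)[OF y]] y P(3)[OF x] by simp
      hence "form_on b \<phi> *x \<psi> y = 0\<^sub>v 4" by (intro 0) auto
      hence "(Mi * form_on b \<phi>) *x \<psi> y = 0\<^sub>v 4" by (simp add: vmul_simps Q(3)[OF y] z')
      hence "\<psi> y = 0\<^sub>v 4" by (simp add: Mi vmul_simps Q(3)[OF y])
      thus ?thesis using z y by (metis \<phi>\<psi>)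
    qed
    ultimately show ?thesis unfolding nondegenerate_def by blast
  qed
qed

end

end

section \<open>Change of basis and the determinant class\<close>

context coord4
begin

lemma change_coordinates:
  assumes g: "g \<in> linear_isos (coord_space 4) V"
  obtains P where "det4 P \<noteq> 0" "\<And>v. v \<in> carrier_vec 4 \<Longrightarrow> g v = \<phi> (P *x v)"
    "\<And>b. bilinear_form V b \<Longrightarrow> form_on b g = tr4 P * form_on b \<phi> * P"
proof -
  interpret g: coord4 V g by (rule coord4.intro[OF vs g])
  have "(\<lambda>v. \<psi> (g v)) \<in> LinearCombinations.module_hom class_ring (coord_space 4) (coord_space 4)"
    by (rule module_homI) (simp_all add: coord_space_simps g.P(3-5) Q(3-5))
  then obtain P where P: "\<And>v. v \<in> carrier_vec 4 \<Longrightarrow> \<psi> (g v) = P *x v" using coord_hom_vmul by blast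
  note P' = linear_isosD(3-5)[OF \<phi>, unfolded coord_space_simps]
  have "(\<lambda>v. g.\<psi> (\<phi> v)) \<in> LinearCombinations.module_hom class_ring (coord_space 4) (coord_space 4)"
    by (rule module_homI) (simp_all add: coord_space_simps P' g.Q(3-5))
  then obtain R where R: "\<And>v. v \<in> carrier_vec 4 \<Longrightarrow> g.\<psi> (\<phi> v) = R *x v" using coord_hom_vmul by blast
  have gP: "g v = \<phi> (P *x v)" if "v \<in> carrier_vec 4" for v
    using P[OF that] \<phi>\<psi>[OF g.P(3)[OF that]] by simp
  have "P * R = 1"
  proof (rule vmul_inj)
    fix v :: "'a vec" assume v: "v \<in> carrier_vec 4"
    have pv: "\<phi> v \<in> carrier V" using linear_isosD(3)[OF \<phi>] v by (simp add: coord_space_simps)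
    have "P *x R *x v = \<psi> (g (g.\<psi> (\<phi> v)))" using P[OF vmul_closed, of R v] R[OF v] by simp
    also have "\<dots> = v" using v pv by simp
    finally show "(P * R) *x v = 1 *x v" using v by (simp add: vmul_simps)
  qed
  hence d: "det4 P \<noteq> 0" by (rule right_inverse4)
  have "form_on b g = tr4 P * form_on b \<phi> * P" if b: "bilinear_form V b" for b
  proof (rule vmul_form_inj)
    fix x y :: "'a vec" assume xy: "x \<in> carrier_vec 4" "y \<in> carrier_vec 4"
    have "x \<bullet> (form_on b g *x y) = b (\<phi> (P *x x)) (\<phi> (P *x y))"
      using g.form_on_eq[OF b xy] gP xy by simp
    also have "\<dots> = (tr4 (tr4 P) *x x) \<bullet> (form_on b \<phi> *x P *x y)" by (simp add: form_on_eq[OF b])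
    also have "\<dots> = x \<bullet> ((tr4 P * form_on b \<phi> * P) *x y)"
      unfolding vmul_simps(7)[OF vmul_closed xy(1)] by (simp add: vmul_simps xy)
    finally show "x \<bullet> (form_on b g *x y) = x \<bullet> ((tr4 P * form_on b \<phi> * P) *x y)" .
  qed
  thus thesis using that d gP by blast
qed

end

lemma squares_coset:
  fixes d :: "'a::field"
  shows "nonzero_squares #>\<^bsub>units_of class_ring\<^esub> d = {c\<^sup>2 * d | c. c \<noteq> 0}"
  unfolding r_coset_def nonzero_squares_def units_of_mult by (auto simp: class_ring_simps)

lemma squares_coset_square:
  fixes d p :: "'a::field"
  assumes "p \<noteq> 0"
  shows "nonzero_squares #>\<^bsub>units_of class_ring\<^esub> (p\<^sup>2 * d) = nonzero_squares #>\<^bsub>units_of class_ring\<^esub> d"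
  unfolding squares_coset
proof safe
  fix c :: 'a assume "c \<noteq> 0"
  thus "\<exists>ca. c\<^sup>2 * (p\<^sup>2 * d) = ca\<^sup>2 * d \<and> ca \<noteq> 0"
    using assms by (intro exI[of _ "c * p"]) (simp add: power_mult_distrib mult_ac)
  show "\<exists>ca. c\<^sup>2 * d = ca\<^sup>2 * (p\<^sup>2 * d) \<and> ca \<noteq> 0"
    using assms \<open>c \<noteq> 0\<close> by (intro exI[of _ "c / p"]) (simp add: power_divide)
qed

context coord4
begin

text \<open>Gram matrices for two bases are congruent, so their determinants differ by the square of
  \<open>det4 P\<close>; the coset described by \<open>det_class\<close> is therefore
  unique.\<close>

lemma det_class_eq:
  assumes b: "bilinear_form V b"
  shows "det_class V b = nonzero_squares #>\<^bsub>units_of class_ring\<^esub> det4 (form_on b \<phi>)"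
  unfolding det_class_def
proof (rule the_equality)
  let ?vs = "map \<phi> (unit_vecs 4)"
  have "gram_matrix b ?vs = mat_of (form_on b \<phi>)"
    unfolding gram_matrix_def form_on_def mat_of_of_fun4
    by (rule eq_matI) (auto simp: unit_vecs_def)
  thus "\<exists>vs. distinct vs \<and> vectorspace.basis class_ring V (set vs) \<and>
    nonzero_squares #>\<^bsub>units_of class_ring\<^esub> det4 (form_on b \<phi>)
      = nonzero_squares #>\<^bsub>units_of class_ring\<^esub> det (gram_matrix b vs)"
    using coord_iso_basis[OF vs \<phi>] by (intro exI[of _ ?vs]) (simp add: det4_def)
next
  fix C assume "\<exists>vs. distinct vs \<and> vectorspace.basis class_ring V (set vs) \<and>
    C = nonzero_squares #>\<^bsub>units_of class_ring\<^esub> det (gram_matrix b vs)"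
  then obtain us where us: "distinct us" "vectorspace.basis class_ring V (set us)"
    "C = nonzero_squares #>\<^bsub>units_of class_ring\<^esub> det (gram_matrix b us)" by blast
  note g = basis_map_iso[OF vs us(1,2)]
  have l: "length us = 4" using coord_iso_dim(2)[OF vs g] coord_iso_dim(2)[OF vs \<phi>] by simp
  let ?g = "basis_map V ((!) us) 4"
  interpret V: vectorspace class_ring V by (rule vs)
  have "us ! i \<in> carrier V" if "i < 4" for i
    using us(2) that l by (auto simp: V.basis_def)
  hence u: "?g (unit_vec 4 i) = us ! i" if "i < 4" for i
    using basis_map_unit[OF vs _ that, of "(!) us"] by simp
  have "gram_matrix b us = mat_of (form_on b ?g)"
    unfolding gram_matrix_def form_on_def mat_of_of_fun4 by (rule eq_matI) (auto simp: l u)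
  hence C: "C = nonzero_squares #>\<^bsub>units_of class_ring\<^esub> det4 (form_on b ?g)" using us(3) by (simp add: det4_def)
  obtain P where P: "det4 P \<noteq> 0" "form_on b ?g = tr4 P * form_on b \<phi> * P"
    using change_coordinates[OF g[unfolded l]] b by metis
  have "det4 (form_on b ?g) = (det4 P)\<^sup>2 * det4 (form_on b \<phi>)"
    unfolding P(2) by (simp add: power2_eq_square)
  thus "C = nonzero_squares #>\<^bsub>units_of class_ring\<^esub> det4 (form_on b \<phi>)"
    unfolding C by (simp add: squares_coset_square[OF P(1)])
qed

lemma det_class_trivial_iff:
  assumes b: "bilinear_form V b" and nd: "nondegenerate V b"
  shows "det_class V b = \<one>\<^bsub>square_class_group\<^esub> \<longleftrightarrow> (\<exists>d. det4 (form_on b \<phi>) = d\<^sup>2)"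
proof -
  let ?d = "det4 (form_on b \<phi>)"
  have nz: "?d \<noteq> 0" using nondegenerate_iff[OF b] nd by simp
  have one: "\<one>\<^bsub>square_class_group\<^esub> = (nonzero_squares :: 'a set)"
    by (simp add: square_class_group_def FactGroup_def)
  show ?thesis unfolding det_class_eq[OF b] one
  proof
    assume "nonzero_squares #>\<^bsub>units_of class_ring\<^esub> ?d = nonzero_squares"
    moreover have "?d \<in> nonzero_squares #>\<^bsub>units_of class_ring\<^esub> ?d"
      unfolding squares_coset by (auto intro: exI[of _ 1])
    ultimately show "\<exists>d. ?d = d\<^sup>2" by (auto simp: nonzero_squares_def)
  next
    assume "\<exists>d. ?d = d\<^sup>2"
    then obtain d where d: "?d = d\<^sup>2 * 1" by auto
    hence "d \<noteq> 0" using nz by auto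
    show "nonzero_squares #>\<^bsub>units_of class_ring\<^esub> ?d = nonzero_squares"
      unfolding d squares_coset_square[OF \<open>d \<noteq> 0\<close>] by (simp only: squares_coset) (simp add: nonzero_squares_def)
  qed
qed

end

section \<open>The matrix algebra, its anti-automorphisms and tensor forms in coordinates\<close>

definition m4_alg :: "('a::field, 'a m4) module" where
  "m4_alg = \<lparr>carrier = UNIV, mult = (*), one = 1, zero = 0, add = (+), smult = (*s)\<rparr>"

lemma m4_alg_simps [simp]:
  "carrier m4_alg = UNIV" "X \<otimes>\<^bsub>m4_alg\<^esub> Y = X * Y" "\<one>\<^bsub>m4_alg\<^esub> = 1" "\<zero>\<^bsub>m4_alg\<^esub> = 0"
  "X \<oplus>\<^bsub>m4_alg\<^esub> Y = X + Y" "c \<odot>\<^bsub>m4_alg\<^esub> X = c *s X"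
  by (simp_all add: m4_alg_def)

lemma m4_alg_ring: "ring (m4_alg :: ('a::field, 'a m4) module)"
proof (rule ringI)
  show "abelian_group (m4_alg :: ('a, 'a m4) module)"
    by (rule abelian_groupI) (auto simp: add.assoc add.commute intro: exI[of _ "- _"])
  show "monoid (m4_alg :: ('a, 'a m4) module)"
    by (rule monoidI) (auto simp: mult.assoc)
qed (auto simp: distrib_left distrib_right)

lemma m4_alg_vs: "vectorspace class_ring (m4_alg :: ('a::field, 'a m4) module)"
proof -
  interpret R: field "class_ring :: 'a ring" by (rule class_field)
  interpret A: ring "m4_alg :: ('a, 'a m4) module" by (rule m4_alg_ring)
  show ?thesis
    by unfold_locales (auto simp: class_ring_simps smul_distrib)
qed

lemma isomorphic_with_anti_sym:
  fixes A :: "('a::field, 'b) module" and B :: "('a, 'c) module"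
  assumes A: "vectorspace class_ring A" "ring A" and \<sigma>: "\<And>x. x \<in> carrier A \<Longrightarrow> \<sigma> x \<in> carrier A"
    and iso: "isomorphic_with_anti A \<sigma> B \<tau>"
  shows "isomorphic_with_anti B \<tau> A \<sigma>"
proof -
  obtain h where h: "h \<in> ring_iso A B" "h \<in> linear_isos A B" "\<forall>x\<in>carrier A. h (\<sigma> x) = \<tau> (h x)"
    using iso by (auto simp: isomorphic_with_anti_def)
  let ?g = "inv_into (carrier A) h"
  note H = linear_isosD[OF h(2)]
  have "?g (\<tau> y) = \<sigma> (?g y)" if y: "y \<in> carrier B" for y
  proof -
    have gy: "?g y \<in> carrier A" "h (?g y) = y" using H(2) y by (auto simp: bij_betw_def inv_into_into f_inv_into_f)
    have "?g (h (\<sigma> (?g y))) = \<sigma> (?g y)" using H(6) \<sigma>[OF gy(1)] by (rule inv_into_f_f)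
    thus ?thesis using h(3) gy by simp
  qed
  thus ?thesis unfolding isomorphic_with_anti_def
    using ring_iso_set_sym[OF A(2) h(1)] linear_isos_inv_into[OF A(1) h(2)] by blast
qed

lemma isomorphic_with_anti_trans:
  fixes A :: "('a::field, 'b) module" and B :: "('a, 'c) module" and C :: "('a, 'd) module"
  assumes "isomorphic_with_anti A \<sigma> B \<tau>" "isomorphic_with_anti B \<tau> C \<rho>"
  shows "isomorphic_with_anti A \<sigma> C \<rho>"
proof -
  obtain h where h: "h \<in> ring_iso A B" "h \<in> linear_isos A B" "\<forall>x\<in>carrier A. h (\<sigma> x) = \<tau> (h x)"
    using assms(1) by (auto simp: isomorphic_with_anti_def)
  obtain k where k: "k \<in> ring_iso B C" "k \<in> linear_isos B C" "\<forall>x\<in>carrier B. k (\<tau> x) = \<rho> (k x)"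
    using assms(2) by (auto simp: isomorphic_with_anti_def)
  have "k \<circ> h \<in> linear_isos A C" using linear_isos_comp[OF h(2) k(2)] by (simp add: comp_def)
  moreover have "\<forall>x\<in>carrier A. (k \<circ> h) (\<sigma> x) = \<rho> ((k \<circ> h) x)"
    using h(3) k(3) linear_isosD(3)[OF h(2)] by simp
  ultimately show ?thesis unfolding isomorphic_with_anti_def
    using ring_iso_set_trans[OF h(1) k(1)] by blast
qed

lemma decomposable_alg_cong:
  fixes A :: "('a::field, 'b) module" and B :: "('a, 'c) module"
  assumes "isomorphic_with_anti A \<sigma> B \<tau>" "isomorphic_with_anti B \<tau> A \<sigma>"
  shows "decomposable_alg A \<sigma> \<longleftrightarrow> decomposable_alg B \<tau>"
proof -
  have "isomorphic_with_anti A \<sigma> C \<rho> \<longleftrightarrow> isomorphic_with_anti B \<tau> C \<rho>"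
    for C :: "('a, ('a vec \<times> 'a vec \<Rightarrow>\<^sub>0 'a) set) module" and \<rho>
    using isomorphic_with_anti_trans[OF assms(1)] isomorphic_with_anti_trans[OF assms(2)] by blast
  thus ?thesis unfolding decomposable_alg_def by simp
qed

lemma (in coord4) decomposable_alg_matrix:
  assumes b: "bilinear_form V b" and Mi: "Mi * form_on b \<phi> = 1"
  shows "decomposable_alg (endo_alg V) (adjoint_anti V b)
    \<longleftrightarrow> decomposable_alg m4_alg (\<lambda>X. Mi * tr4 X * form_on b \<phi>)"
proof -
  let ?s = "\<lambda>X. Mi * tr4 X * form_on b \<phi>"
  have bij: "bij_betw E (carrier m4_alg) (carrier (endo_alg V))"
    unfolding bij_betw_def using E_inj E_closed by (auto simp: inj_on_def elim: E_surj)
  have "E \<in> ring_iso m4_alg (endo_alg V)"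
    unfolding ring_iso_def using bij by (auto intro!: ring_hom_memI simp: E_ops E_closed)
  moreover have "E \<in> LinearCombinations.module_hom class_ring m4_alg (endo_alg V)"
    by (rule module_homI) (simp_all add: E_ops E_closed)
  hence "E \<in> linear_isos m4_alg (endo_alg V)" using bij by (simp add: linear_isos_def)
  ultimately have 1: "isomorphic_with_anti m4_alg ?s (endo_alg V) (adjoint_anti V b)"
    unfolding isomorphic_with_anti_def using adjoint_anti_matrix[OF b Mi] by auto
  have 2: "isomorphic_with_anti (endo_alg V) (adjoint_anti V b) m4_alg ?s"
    by (rule isomorphic_with_anti_sym[OF m4_alg_vs m4_alg_ring _ 1]) simp
  show ?thesis by (rule decomposable_alg_cong[OF 2 1])
qed

text \<open>Both \<open>tensor_form\<close> and the product of \<open>tensor_alg\<close> are nested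
  lifts of this shape. The inner lift is taken separately for each \<open>(x, y)\<close>, so its
  bilinearity in \<open>(x, y)\<close> has to be proved by induction over \<open>X'\<close>, from
  pure tensors to sums.\<close>

lemma (in tensor_pair) tensor_lift2:
  fixes U :: "('a, 'd) module"
  assumes U: "vectorspace class_ring U"
    and r: "\<And>x y. x \<in> carrier V \<Longrightarrow> y \<in> carrier W \<Longrightarrow> bilinear_map V W U (\<Gamma> x y)"
    and l: "\<And>x' y'. x' \<in> carrier V \<Longrightarrow> y' \<in> carrier W \<Longrightarrow> bilinear_map V W U (\<lambda>x y. \<Gamma> x y x' y')"
  shows "bilinear_map T T U (\<lambda>X X'. tensor_lift V W U (\<lambda>x y. tensor_lift V W U (\<Gamma> x y) X') X)"
    and "\<And>x y x' y'. x \<in> carrier V \<Longrightarrow> y \<in> carrier W \<Longrightarrow> x' \<in> carrier V \<Longrightarrow> y' \<in> carrier W \<Longrightarrow>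
      tensor_lift V W U (\<lambda>x y. tensor_lift V W U (\<Gamma> x y) (pt x' y')) (pt x y) = \<Gamma> x y x' y'"
proof -
  note F = vs_facts[OF U]
  interpret U: abelian_group U by (rule F(1))
  let ?G = "\<lambda>X' x y. tensor_lift V W U (\<Gamma> x y) X'"
  have G: "?G (pt x' y') x y = \<Gamma> x y x' y'"
    if "x \<in> carrier V" "y \<in> carrier W" "x' \<in> carrier V" "y' \<in> carrier W" for x y x' y'
    using tensor_lift_pt[OF U r[OF that(1,2)] that(3,4)] .
  note H = module_homD[OF tensor_lift_hom[OF U r]]
  have bil: "bilinear_map V W U (?G X')" if "X' \<in> carrier T" for X'
    using that
  proof (induction rule: tensor_induct)
    case (pure c x' y')
    note B = bilinear_mapD[OF l[OF pure]]
    note pc = pt_closed[OF pure]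
    have "?G (c \<odot>\<^bsub>T\<^esub> pt x' y') x y = c \<odot>\<^bsub>U\<^esub> \<Gamma> x y x' y'" if "x \<in> carrier V" "y \<in> carrier W" for x y
      using H(3)[OF that pc] G[OF that pure] by simp
    thus ?case unfolding bilinear_map_def
      by (simp add: B F(5,6,8) V(3,5) W(3,5) mult.commute)
  next
    case (add X Y)
    note B = bilinear_mapD[OF add(3)] and C = bilinear_mapD[OF add(4)]
    have "?G (X \<oplus>\<^bsub>T\<^esub> Y) x y = ?G X x y \<oplus>\<^bsub>U\<^esub> ?G Y x y" if "x \<in> carrier V" "y \<in> carrier W" for x y
      using H(2)[OF that add(1,2)] .
    thus ?case unfolding bilinear_map_def
      by (simp add: B C F(3,5,6) V(3,5) W(3,5) U.a_ac)
  qed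
  note L = module_homD[OF tensor_lift_hom[OF U bil]]
  show "tensor_lift V W U (?G (pt x' y')) (pt x y) = \<Gamma> x y x' y'"
    if "x \<in> carrier V" "y \<in> carrier W" "x' \<in> carrier V" "y' \<in> carrier W" for x y x' y'
    using tensor_lift_pt[OF U bil[OF pt_closed[OF that(3,4)]] that(1,2)] G[OF that] by simp
  show "bilinear_map T T U (\<lambda>X X'. tensor_lift V W U (?G X') X)"
    unfolding bilinear_map_def
  proof (intro ballI conjI allI)
    fix X Y c assume X: "X \<in> carrier T" and Y: "Y \<in> carrier T"
    note S = vs_facts[OF tensor_vs]
    have R: "(\<lambda>X'. tensor_lift V W U (?G X') X) \<in> LinearCombinations.module_hom class_ring T U" using X
    proof (induction rule: tensor_induct)
      case (pure c x y)
      have e: "tensor_lift V W U (?G X') (c \<odot>\<^bsub>T\<^esub> pt x y) = c \<odot>\<^bsub>U\<^esub> ?G X' x y" if "X' \<in> carrier T" for X'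
        using L(3)[OF that pt_closed[OF pure]] tensor_lift_pt[OF U bil[OF that] pure] by simp
      show ?case
        by (rule module_homI) (simp_all add: e S(3,5) H[OF pure] F(5,6,8) mult.commute)
    next
      case (add X Y)
      show ?case
        by (rule module_homI) (simp_all add: L[OF _ add(1)] L(1,2) add(1,2) module_homD[OF add(3)] module_homD[OF add(4)] F(3,5,6) S(3,5) U.a_ac)
    qed
    show "tensor_lift V W U (?G Y) X \<in> carrier U"
      "tensor_lift V W U (?G Y) (c \<odot>\<^bsub>T\<^esub> X) = c \<odot>\<^bsub>U\<^esub> tensor_lift V W U (?G Y) X"
      "tensor_lift V W U (?G (c \<odot>\<^bsub>T\<^esub> Y)) X = c \<odot>\<^bsub>U\<^esub> tensor_lift V W U (?G Y) X"
      using L[OF Y X] module_homD[OF R Y] by auto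
    fix Z assume "Z \<in> carrier T"
    thus "tensor_lift V W U (?G Y) (X \<oplus>\<^bsub>T\<^esub> Z) = tensor_lift V W U (?G Y) X \<oplus>\<^bsub>U\<^esub> tensor_lift V W U (?G Y) Z"
      "tensor_lift V W U (?G (Y \<oplus>\<^bsub>T\<^esub> Z)) X = tensor_lift V W U (?G Y) X \<oplus>\<^bsub>U\<^esub> tensor_lift V W U (?G Z) X"
      using L[OF Y X] module_homD[OF R Y] by auto
  qed
qed

lemma (in tensor_pair) tensor_form_bilinear:
  assumes f: "bilinear_form V f" and g: "bilinear_form W g"
  shows "bilinear_form T (tensor_form V f W g)"
    and "x \<in> carrier V \<Longrightarrow> y \<in> carrier W \<Longrightarrow> x' \<in> carrier V \<Longrightarrow> y' \<in> carrier W \<Longrightarrow>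
      tensor_form V f W g (pt x y) (pt x' y') = f x x' * g y y'"
proof -
  note f' = f[unfolded bilinear_form_iff_map] and g' = g[unfolded bilinear_form_iff_map]
  note B = bilinear_mapD[OF f'] bilinear_mapD[OF g']
  have "bilinear_map V W scalar_space (\<lambda>x' y'. f x x' * g y y')" if "x \<in> carrier V" "y \<in> carrier W" for x y
    unfolding bilinear_map_def using that by (simp add: B[simplified] algebra_simps)
  moreover have "bilinear_map V W scalar_space (\<lambda>x y. f x x' * g y y')" if "x' \<in> carrier V" "y' \<in> carrier W" for x' y'
    unfolding bilinear_map_def using that by (simp add: B[simplified] algebra_simps)
  ultimately show "bilinear_form T (tensor_form V f W g)"
    "x \<in> carrier V \<Longrightarrow> y \<in> carrier W \<Longrightarrow> x' \<in> carrier V \<Longrightarrow> y' \<in> carrier W \<Longrightarrow>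
      tensor_form V f W g (pt x y) (pt x' y') = f x x' * g y y'"
    unfolding bilinear_form_iff_map tensor_form_def
    using tensor_lift2[OF scalar_space_vs, of "\<lambda>x y x' y'. f x x' * g y y'"] by blast+
qed

lemma (in tensor_pair) kron_form_on:
  assumes \<phi>1: "\<phi>1 \<in> linear_isos (coord_space 2) V" and \<phi>2: "\<phi>2 \<in> linear_isos (coord_space 2) W"
    and \<kappa>: "\<And>x y. x \<in> carrier_vec 2 \<Longrightarrow> y \<in> carrier_vec 2 \<Longrightarrow> \<kappa> (kron_vec 2 2 x y) = pt (\<phi>1 x) (\<phi>2 y)"
    and f: "bilinear_form V f" and g: "bilinear_form W g"
  defines "F \<equiv> \<lambda>i j. f (\<phi>1 (unit_vec 2 i)) (\<phi>1 (unit_vec 2 j))"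
    and "G \<equiv> \<lambda>i j. g (\<phi>2 (unit_vec 2 i)) (\<phi>2 (unit_vec 2 j))"
  shows "form_on (tensor_form V f W g) \<kappa> = kronL (F 0 0) (F 0 1) (F 1 0) (F 1 1) * kronR (G 0 0) (G 0 1) (G 1 0) (G 1 1)"
proof -
  note P1 = linear_isosD(3)[OF \<phi>1, unfolded coord_space_simps] and P2 = linear_isosD(3)[OF \<phi>2, unfolded coord_space_simps]
  have k: "\<kappa> (unit_vec 4 i) = pt (\<phi>1 (unit_vec 2 (i div 2))) (\<phi>2 (unit_vec 2 (i mod 2)))" if "i < 4" for i
    using \<kappa>[of "unit_vec 2 (i div 2)" "unit_vec 2 (i mod 2)"] kron_vec_unit[of "i div 2" 2 "i mod 2" 2, where 'a = 'a] that
    by (simp add: less_mult_imp_div_less)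
  have "tensor_form V f W g (\<kappa> (unit_vec 4 i)) (\<kappa> (unit_vec 4 j)) = F (i div 2) (j div 2) * G (i mod 2) (j mod 2)"
    if "i < 4" "j < 4" for i j
    unfolding k[OF that(1)] k[OF that(2)] F_def G_def by (rule tensor_form_bilinear(2)[OF f g]) (simp_all add: P1 P2)
  thus ?thesis unfolding form_on_def of_fun4_def by (simp add: kronL_def kronR_def M4_simps)
qed

text \<open>In each factor the off-diagonal entries \<open>a + k\<close> and \<open>a - k\<close>
  separate the alternating part \<open>k\<close> from the symmetric part; when 2 is invertible,
  every matrix of size two has this shape. \<open>J\<close> is the Kronecker square of the
  alternating matrix.\<close>

lemma kron_cayley:
  fixes a b c k a' b' c' k' :: "'a::field"
  defines "K \<equiv> kronL (- c) (a + k) (a - k) b * kronR (- c') (a' + k') (a' - k') b'"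
    and "J \<equiv> kronL 0 1 (-1) 0 * kronR 0 1 (-1) (0 :: 'a)"
    and "W1 \<equiv> kronL a b c (- a)" and "W2 \<equiv> kronR a' b' c' (- a')"
  shows "K = J * ((k *s 1 - W1) * (k' *s 1 - W2))" "tr4 K = J * ((k *s 1 + W1) * (k' *s 1 + W2))"
    and "det4 K = ((k\<^sup>2 - (a\<^sup>2 + b * c)) * (k'\<^sup>2 - (a'\<^sup>2 + b' * c')))\<^sup>2"
proof -
  have 1: "k *s 1 - W1 = kronL (k - a) (- b) (- c) (k + a)" "k *s 1 + W1 = kronL (k + a) b c (k - a)"
    "k' *s 1 - W2 = kronR (k' - a') (- b') (- c') (k' + a')" "k' *s 1 + W2 = kronR (k' + a') b' c' (k' - a')"
    by (simp_all add: W1_def W2_def kronL_def kronR_def M4_simps)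
  have 2: "kronL p q r s * kronR p' q' r' s' * (kronL t u v w * kronR t' u' v' w')
      = kronL p q r s * kronL t u v w * (kronR p' q' r' s' * kronR t' u' v' w')"
    for p q r s p' q' r' s' t u v w t' u' v' w' :: 'a
    using kron_facts(3)[of p' q' r' s' t u v w] by (metis mult.assoc)
  show "K = J * ((k *s 1 - W1) * (k' *s 1 - W2))"
    unfolding 1 J_def K_def 2 kron_mult by (simp add: add.commute)
  show "tr4 K = J * ((k *s 1 + W1) * (k' *s 1 + W2))"
    unfolding 1 J_def 2 kron_mult unfolding K_def by (simp add: kronL_def kronR_def M4_simps algebra_simps)
  show "det4 K = ((k\<^sup>2 - (a\<^sup>2 + b * c)) * (k'\<^sup>2 - (a'\<^sup>2 + b' * c')))\<^sup>2"
    unfolding K_def det4_mult det4_kron2 power_mult_distrib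
    by (simp add: power2_eq_square algebra_simps)
qed

text \<open>With \<open>K = J A\<close> and \<open>tr4 K = J B\<close>, the matrix
  \<open>Ki J\<close> is the inverse of \<open>A\<close>. As \<open>A\<close> and \<open>B\<close>
  commute, the asymmetry \<open>Ki J B\<close> of \<open>K\<close> equals \<open>B (Ki J)\<close>,
  which is the asymmetry that \<open>tr4 M * A = M * B\<close> prescribes for
  \<open>M\<close>.\<close>

lemma kron_asymmetry_iff:
  fixes a :: "'a::field"
  assumes K: "K = kronL (- c) (a + k) (a - k) b * kronR (- c') (a' + k') (a' - k') b'"
    and Ki: "Ki * K = 1" and Mi: "Mi * M = 1"
  shows "kron_asymmetry M k (kronL a b c (- a)) k' (kronR a' b' c' (- a')) \<longleftrightarrow> Mi * tr4 M = Ki * tr4 K"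
proof -
  define J where "J = kronL 0 1 (-1) 0 * kronR 0 1 (-1) (0 :: 'a)"
  define A where "A = (k *s 1 - kronL a b c (- a)) * (k' *s 1 - kronR a' b' c' (- a'))"
  define B where "B = (k *s 1 + kronL a b c (- a)) * (k' *s 1 + kronR a' b' c' (- a'))"
  have KA: "K = J * A" "tr4 K = J * B" unfolding K J_def A_def B_def by (rule kron_cayley)+
  have 1: "Ki * J * A = 1" using Ki by (simp add: KA mult.assoc)
  hence 2: "A * (Ki * J) = 1" by (rule right_inverse4)
  have M2: "M * Mi = 1" using right_inverse4(2)[OF Mi] .
  have "A * B = B * A"
    unfolding A_def B_def by (simp add: algebra_simps kron_facts(3)) (simp add: kronL_def kronR_def M4_simps algebra_simps)
  have c: "Ki * J * B = B * (Ki * J)"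
  proof -
    have "Ki * J * (A * B) * (Ki * J) = Ki * J * (B * A) * (Ki * J)" unfolding \<open>A * B = B * A\<close> ..
    hence "Ki * J * A * B * (Ki * J) = Ki * J * B * (A * (Ki * J))" by (simp only: mult.assoc)
    thus ?thesis unfolding 1 2 by simp
  qed
  have "tr4 M * A = M * B \<longleftrightarrow> tr4 M = M * B * (Ki * J)"
  proof
    assume "tr4 M * A = M * B"
    hence "tr4 M * (A * (Ki * J)) = M * B * (Ki * J)" by (simp only: mult.assoc[symmetric])
    thus "tr4 M = M * B * (Ki * J)" unfolding 2 by simp
  next
    assume "tr4 M = M * B * (Ki * J)"
    hence "tr4 M * A = M * B * (Ki * J * A)" by (simp only: mult.assoc)
    thus "tr4 M * A = M * B" unfolding 1 by simp
  qed
  also have "\<dots> \<longleftrightarrow> Mi * tr4 M = B * (Ki * J)"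
  proof
    assume "tr4 M = M * B * (Ki * J)"
    hence "Mi * tr4 M = Mi * M * (B * (Ki * J))" by (simp only: mult.assoc)
    thus "Mi * tr4 M = B * (Ki * J)" unfolding Mi by simp
  next
    assume "Mi * tr4 M = B * (Ki * J)"
    hence "M * Mi * tr4 M = M * B * (Ki * J)" by (simp only: mult.assoc)
    thus "tr4 M = M * B * (Ki * J)" unfolding M2 by simp
  qed
  finally show ?thesis
    unfolding kron_asymmetry_def KA(2) using c by (simp add: A_def B_def mult.assoc)
qed

lemma vmul_iso: 
  assumes "det4 P \<noteq> 0"
  shows "vmul P \<in> linear_isos (coord_space 4) (coord_space 4)"
proof -
  obtain R where R: "P * R = 1" "R * P = 1" using det4_inverse[OF assms] .
  show ?thesis
    by (rule linear_isosI[OF vmul_hom, of "vmul R"])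
      (simp_all add: coord_space_simps vmul_simps(1)[symmetric] R vmul_simps(2))
qed

lemma id_iso: "(\<lambda>x. x) \<in> linear_isos V V"
  by (rule linear_isosI[of _ _ _ "\<lambda>x. x"], rule module_homI) auto

lemma coord_space_fin_dim: "vectorspace.fin_dim class_ring (coord_space n)" "vectorspace.dim class_ring (coord_space n) = n"
  by (rule coord_iso_dim[OF coord_space_vs id_iso])+

lemma kron_space_decomposable:
  fixes a :: "'a::field"
  assumes K: "K = kronL a b c d * kronR a' b' c' d'"
  shows "decomposable_space (coord_space 4) (\<lambda>x y. x \<bullet> (K *x y))"
proof -
  let ?V = "coord_space 2 :: ('a, 'a vec) module"
  define f where "f a b c d x y = a * (x $ 0 * y $ 0) + b * (x $ 0 * y $ 1) + c * (x $ 1 * y $ 0) + d * (x $ 1 * y $ 1)"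
    for a b c d :: 'a and x y :: "'a vec"
  have f: "bilinear_form ?V (f a b c d)" for a b c d
    unfolding bilinear_form_def coord_space_simps f_def by (auto simp: algebra_simps)
  interpret tensor_pair ?V ?V by (rule tensor_pair.intro; rule coord_space_vs)
  obtain \<kappa> where \<kappa>: "\<kappa> \<in> linear_isos (coord_space (2 * 2)) T"
    "\<And>x y. x \<in> carrier_vec 2 \<Longrightarrow> y \<in> carrier_vec 2 \<Longrightarrow> \<kappa> (kron_vec 2 2 x y) = pt x y"
    using tensor_coord_iso[OF id_iso id_iso] by blast
  have \<kappa>4: "\<kappa> \<in> linear_isos (coord_space 4) T" using \<kappa>(1) by simp
  interpret c: coord4 T \<kappa> by (rule coord4.intro[OF tensor_vs \<kappa>4])
  let ?b = "tensor_form ?V (f a b c d) ?V (f a' b' c' d')"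
  have "form_on ?b \<kappa> = K"
    by (rule trans[OF kron_form_on[OF id_iso id_iso \<kappa>(2) f f]]) (simp_all add: K f_def)
  hence "x \<bullet> (K *x y) = ?b (\<kappa> x) (\<kappa> y)" if "x \<in> carrier_vec 4" "y \<in> carrier_vec 4" for x y
    using c.form_on_eq[OF tensor_form_bilinear(1)[OF f f] that] by simp
  hence "isometric (coord_space 4) (\<lambda>x y. x \<bullet> (K *x y)) T ?b"
    unfolding isometric_def using \<kappa>4 by (auto simp: coord_space_simps)
  moreover have "bilinear_space ?V (f a b c d)" for a b c d
    unfolding bilinear_space_def using f coord_space_vs coord_space_fin_dim by blast
  ultimately show ?thesis unfolding decomposable_space_def
    using coord_space_fin_dim(2)[of 2] by (metis order_refl)
qed

lemma coord4_standard: "coord4 (coord_space 4 :: ('a::field, 'a vec) module) (\<lambda>x. x)"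
  by (rule coord4.intro[OF coord_space_vs id_iso])

text \<open>The witness is the coordinate space with Gram matrix \<open>K\<close>. As the two
  asymmetries have equal matrices, \<phi> itself conjugates one into the other.\<close>

lemma (in coord4) has_decomposable_asymmetryI:
  assumes b: "bilinear_form V b" and Mi: "Mi * form_on b \<phi> = 1"
    and K: "K = kronL k11 k12 k21 k22 * kronR l11 l12 l21 l22" and Ki: "Ki * K = 1"
    and a: "Mi * tr4 (form_on b \<phi>) = Ki * tr4 K"
  shows "has_decomposable_asymmetry V b"
proof -
  let ?V = "coord_space 4 :: ('a, 'a vec) module" and ?b = "\<lambda>x y. x \<bullet> (K *x y)"
  interpret s: coord4 ?V "\<lambda>x. x" by (rule coord4_standard)
  have b0: "bilinear_form ?V ?b" unfolding bilinear_form_iff_map by (rule vmul_form_bilinear)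
  have K0: "form_on ?b (\<lambda>x. x) = K" by (rule vmul_form_inj) (simp add: s.form_on_eq[OF b0, symmetric])
  have nd: "nondegenerate ?V ?b"
    unfolding s.nondegenerate_iff[OF b0] K0 using right_inverse4(1)[OF right_inverse4(2)[OF Ki]] .
  have "asymmetry V b y = \<phi> (asymmetry ?V ?b (inv_into (carrier ?V) \<phi> y))" if y: "y \<in> carrier V" for y
    using y Q(3)[OF y] s.\<psi>\<phi>[OF Q(3)[OF y]]
    by (simp add: asymmetry_matrix[OF b Mi] s.asymmetry_matrix[OF b0, unfolded K0, OF Ki] a E_def s.E_def coord_space_simps)
  thus ?thesis unfolding has_decomposable_asymmetry_def bilinear_space_def
    using nd b0 kron_space_decomposable[OF K] coord_space_vs coord_space_fin_dim(1) \<phi> by blast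
qed

text \<open>A Kronecker basis of the decomposable space, carried over by the conjugating isomorphism
  \<open>f\<close>, is a basis \<theta> of \<open>V\<close> in which both asymmetries have the same
  matrix. Both tensor factors have dimension two, since \<open>4 = m * n\<close> with
  \<open>m\<close>, \<open>n\<close> at least 2.\<close>

lemma (in coord4) has_decomposable_asymmetryD:
  assumes b: "bilinear_form V b" and nd: "nondegenerate V b" and h: "has_decomposable_asymmetry V b"
  obtains \<theta> Mi K Ki k11 k12 k21 k22 l11 l12 l21 l22 where "\<theta> \<in> linear_isos (coord_space 4) V" "Mi * form_on b \<theta> = 1"
    "K = kronL k11 k12 k21 k22 * kronR l11 l12 l21 l22" "Ki * K = 1"
    "Mi * tr4 (form_on b \<theta>) = Ki * tr4 K"
proof -
  obtain U :: "('a, 'a vec) module" and c f where U: "vectorspace class_ring U" and c: "bilinear_form U c" "nondegenerate U c" and dec: "decomposable_space U c"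
    and f: "f \<in> linear_isos U V" and a: "\<And>y. y \<in> carrier V \<Longrightarrow> asymmetry V b y = f (asymmetry U c (inv_into (carrier U) f y))"
    using h unfolding has_decomposable_asymmetry_def bilinear_space_def by blast
  obtain V1 V2 :: "('a, 'a vec) module" and f1 f2 g where
    V1: "vectorspace class_ring V1" "vectorspace.fin_dim class_ring V1" "bilinear_form V1 f1"
    and V2: "vectorspace class_ring V2" "vectorspace.fin_dim class_ring V2" "bilinear_form V2 f2"
    and d: "vectorspace.dim class_ring V1 \<ge> 2" "vectorspace.dim class_ring V2 \<ge> 2"
    and g: "g \<in> linear_isos U (tensor_space V1 V2)"
    and iso: "\<And>x y. x \<in> carrier U \<Longrightarrow> y \<in> carrier U \<Longrightarrow> c x y = tensor_form V1 f1 V2 f2 (g x) (g y)"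
    using dec unfolding decomposable_space_def bilinear_space_def isometric_def by blast
  interpret tp: tensor_pair V1 V2 by (rule tensor_pair.intro[OF V1(1) V2(1)])
  have "(\<lambda>v. g (inv_into (carrier U) f (\<phi> v))) \<in> linear_isos (coord_space 4) (tensor_space V1 V2)"
    by (rule linear_isos_comp[OF linear_isos_comp[OF \<phi> linear_isos_inv_into[OF U f]] g])
  hence "vectorspace.dim class_ring V1 * vectorspace.dim class_ring V2 = 4"
    using coord_iso_dim(2)[OF tp.tensor_vs] tp.tensor_dim(2)[OF V1(2) V2(2)] by simp
  moreover have "m = 2 \<and> n = 2" if "m * n = 4" "m \<ge> 2" "n \<ge> 2" for m n :: nat
  proof -
    have "m * 2 \<le> 4" "2 * n \<le> 4" using mult_le_mono2[OF that(3), of m] mult_le_mono1[OF that(2), of n] that(1) by simp_all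
    thus ?thesis using that(2,3) by simp
  qed
  ultimately have d2: "vectorspace.dim class_ring V1 = 2" "vectorspace.dim class_ring V2 = 2" using d by blast+
  obtain \<phi>1 \<phi>2 where p: "\<phi>1 \<in> linear_isos (coord_space 2) V1" "\<phi>2 \<in> linear_isos (coord_space 2) V2"
    using ex_coord_iso[OF V1(1,2)] ex_coord_iso[OF V2(1,2)] d2 by auto
  obtain \<kappa> where \<kappa>: "\<kappa> \<in> linear_isos (coord_space (2 * 2)) (tensor_space V1 V2)"
    "\<And>x y. x \<in> carrier_vec 2 \<Longrightarrow> y \<in> carrier_vec 2 \<Longrightarrow> \<kappa> (kron_vec 2 2 x y) = pure_tensor V1 V2 (\<phi>1 x) (\<phi>2 y)"
    using tp.tensor_coord_iso[OF p] by blast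
  have \<kappa>4: "\<kappa> \<in> linear_isos (coord_space 4) (tensor_space V1 V2)" using \<kappa>(1) by simp
  define \<eta> where "\<eta> = (\<lambda>v. inv_into (carrier U) g (\<kappa> v))"
  have \<eta>: "\<eta> \<in> linear_isos (coord_space 4) U"
    unfolding \<eta>_def by (rule linear_isos_comp[OF \<kappa>4 linear_isos_inv_into[OF U g]])
  have g\<eta>: "g (\<eta> v) = \<kappa> v" if "v \<in> carrier_vec 4" for v
    using linear_isosD(3)[OF \<kappa>4, of v] that linear_isosD(2)[OF g] by (simp add: coord_space_simps \<eta>_def bij_betw_def f_inv_into_f)
  interpret u: coord4 U \<eta> by (rule coord4.intro[OF U \<eta>])
  have "form_on c \<eta> = form_on (tensor_form V1 f1 V2 f2) \<kappa>"
    by (simp add: form_on_def iso u.P g\<eta> of_fun4_def)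
  note K = trans[OF this tp.kron_form_on[OF p \<kappa>(2) V1(3) V2(3)]]
  obtain Ki where Ki: "Ki * form_on c \<eta> = 1" using det4_inverse u.nondegenerate_iff[OF c(1)] c(2) by metis
  define \<theta> where "\<theta> = (\<lambda>v. f (\<eta> v))"
  have \<theta>: "\<theta> \<in> linear_isos (coord_space 4) V" unfolding \<theta>_def by (rule linear_isos_comp[OF \<eta> f])
  interpret t: coord4 V \<theta> by (rule coord4.intro[OF vs \<theta>])
  obtain Mi where Mi: "Mi * form_on b \<theta> = 1" using det4_inverse t.nondegenerate_iff[OF b] nd by metis
  have "Mi * tr4 (form_on b \<theta>) = Ki * tr4 (form_on c \<eta>)"
  proof (rule vmul_inj)
    fix v :: "'a vec" assume v: "v \<in> carrier_vec 4"
    have \<eta>v: "\<eta> v \<in> carrier U" using u.P(3)[OF v] .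
    have tv: "\<theta> v \<in> carrier V" using t.P(3)[OF v] .
    have "inv_into (carrier U) f (\<theta> v) = \<eta> v" unfolding \<theta>_def using linear_isosD(6)[OF f] \<eta>v by (rule inv_into_f_f)
    hence "asymmetry V b (\<theta> v) = f (asymmetry U c (\<eta> v))" using a[OF tv] by simp
    hence "\<theta> ((Mi * tr4 (form_on b \<theta>)) *x v) = \<theta> ((Ki * tr4 (form_on c \<eta>)) *x v)"
      unfolding t.asymmetry_matrix[OF b Mi] u.asymmetry_matrix[OF c(1) Ki] t.E_\<phi>[OF v] u.E_\<phi>[OF v] by (simp add: \<theta>_def)
    thus "(Mi * tr4 (form_on b \<theta>)) *x v = (Ki * tr4 (form_on c \<eta>)) *x v"
      using t.P(6) by (simp add: inj_on_def)
  qed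
  thus thesis using that[OF \<theta> Mi K Ki] by blast
qed

lemma (in coord4) has_decomposable_asymmetry_iff:
  assumes 2: "(2::'a) \<noteq> 0" and b: "bilinear_form V b" and nd: "nondegenerate V b"
  shows "has_decomposable_asymmetry V b \<longleftrightarrow> kron_decomposable (form_on b \<phi>)"
proof
  assume "has_decomposable_asymmetry V b"
  then obtain \<theta> Mi K Ki k11 k12 k21 k22 l11 l12 l21 l22 where \<theta>: "\<theta> \<in> linear_isos (coord_space 4) V" and Mi: "Mi * form_on b \<theta> = 1"
    and K: "K = kronL k11 k12 k21 k22 * kronR l11 l12 l21 l22" and Ki: "Ki * K = 1"
    and a: "Mi * tr4 (form_on b \<theta>) = Ki * tr4 K"
    by (rule has_decomposable_asymmetryD[OF b nd])
  have s: "x = (x + y) / 2 + (x - y) / 2" "y = (x + y) / 2 - (x - y) / 2" for x y :: 'a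
    using 2 mult_eq_0_iff[of "2::'a" 2] by (simp_all add: field_simps)
  define k a k' a' where "k = (k12 - k21) / 2" "a = (k12 + k21) / 2" "k' = (l12 - l21) / 2" "a' = (l12 + l21) / 2"
  have e: "k12 = a + k" "k21 = a - k" "l12 = a' + k'" "l21 = a' - k'"
    unfolding k_a_k'_a'_def by (rule s)+
  have K': "K = kronL (- (- k11)) (a + k) (a - k) k22 * kronR (- (- l11)) (a' + k') (a' - k') l22"
    unfolding K e by simp
  obtain P where P: "det4 P \<noteq> 0" "form_on b \<theta> = tr4 P * form_on b \<phi> * P"
    using change_coordinates[OF \<theta>] b by metis
  have "kron_asymmetry (form_on b \<theta>) k (kronL a k22 (- k11) (- a)) k' (kronR a' l22 (- l11) (- a'))"
    using kron_asymmetry_iff[OF K' Ki Mi] a by simp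
  moreover have "det4 K \<noteq> 0" using right_inverse4(1)[OF right_inverse4(2)[OF Ki]] .
  hence "k\<^sup>2 \<noteq> a\<^sup>2 + k22 * (- k11)" "k'\<^sup>2 \<noteq> a'\<^sup>2 + l22 * (- l11)"
    unfolding K' kron_cayley(3) by auto
  ultimately show "kron_decomposable (form_on b \<phi>)" unfolding kron_decomposable_def P(2) using P(1) by blast
next
  assume "kron_decomposable (form_on b \<phi>)"
  then obtain P k k' a b1 c a' b' c' where P: "det4 P \<noteq> 0" and nz: "k\<^sup>2 \<noteq> a\<^sup>2 + b1 * c" "k'\<^sup>2 \<noteq> a'\<^sup>2 + b' * c'"
    and ka: "kron_asymmetry (tr4 P * form_on b \<phi> * P) k (kronL a b1 c (- a)) k' (kronR a' b' c' (- a'))"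
    unfolding kron_decomposable_def by blast
  have \<theta>: "(\<lambda>v. \<phi> (P *x v)) \<in> linear_isos (coord_space 4) V" by (rule linear_isos_comp[OF vmul_iso[OF P] \<phi>])
  interpret t: coord4 V "\<lambda>v. \<phi> (P *x v)" by (rule coord4.intro[OF vs \<theta>])
  obtain R where R: "\<And>v. v \<in> carrier_vec 4 \<Longrightarrow> \<phi> (P *x v) = \<phi> (R *x v)"
    "form_on b (\<lambda>v. \<phi> (P *x v)) = tr4 R * form_on b \<phi> * R" using change_coordinates[OF \<theta>] b by metis
  have "P = R" by (rule vmul_inj) (use R(1) linear_isosD(6)[OF \<phi>] in \<open>simp add: inj_on_def coord_space_simps\<close>)
  note M = R(2)[folded \<open>P = R\<close>]
  define K where "K = kronL (- c) (a + k) (a - k) b1 * kronR (- c') (a' + k') (a' - k') b'"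
  have "det4 K \<noteq> 0" unfolding K_def kron_cayley(3) using nz by simp
  then obtain Ki where Ki: "Ki * K = 1" using det4_inverse by metis
  obtain Mi where Mi: "Mi * form_on b (\<lambda>v. \<phi> (P *x v)) = 1" using det4_inverse t.nondegenerate_iff[OF b] nd by metis
  show "has_decomposable_asymmetry V b"
    using t.has_decomposable_asymmetryI[OF b Mi K_def Ki] kron_asymmetry_iff[OF K_def Ki Mi] ka[folded M] by simp
qed

section \<open>Four-dimensional subalgebras of the matrix algebra\<close>

lemma coord_inj_iso:
  fixes f :: "'a::field vec \<Rightarrow> 'a vec"
  assumes f: "f \<in> LinearCombinations.module_hom class_ring (coord_space 4) (coord_space 4)"
    and inj: "inj_on f (carrier_vec 4)"
  shows "f \<in> linear_isos (coord_space 4) (coord_space 4)"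
proof -
  obtain X where X: "\<And>x. x \<in> carrier_vec 4 \<Longrightarrow> f x = X *x x" using coord_hom_vmul[OF f] by blast
  have z: "X *x 0\<^sub>v 4 = 0\<^sub>v 4" by (rule eq_vecI) (auto simp: vmul_def scalar_prod_def)
  have "det4 X \<noteq> 0"
  proof
    assume "det4 X = 0"
    then obtain v where v: "v \<in> carrier_vec 4" "v \<noteq> 0\<^sub>v 4" "X *x v = 0\<^sub>v 4"
      using det_0_iff_vec_prod_zero[OF mat_of_carrier(1), of X] by (auto simp: det4_def vmul_def)
    hence "f v = f (0\<^sub>v 4)" using X[OF v(1)] X[of "0\<^sub>v 4"] z by simp
    thus False using inj v(1,2) by (simp add: inj_on_def)
  qed
  from linear_isosD(2)[OF vmul_iso[OF this]] have "bij_betw (vmul X) (carrier_vec 4) (carrier_vec 4)"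
    unfolding coord_space_simps .
  hence "bij_betw f (carrier_vec 4) (carrier_vec 4)" by (simp add: X cong: bij_betw_cong)
  thus ?thesis using f by (simp add: linear_isos_def coord_space_simps)
qed

text \<open>A four-dimensional subalgebra of the matrix algebra together with coordinates. Its
  elements are represented by coordinate vectors because \<open>decomposable_alg\<close> quantifies
  over algebras with elements of type \<open>'a vec\<close>.\<close>

locale subalg4 =
  fixes q :: "'a::field vec \<Rightarrow> 'a m4"
  assumes hom: "q \<in> LinearCombinations.module_hom class_ring (coord_space 4) m4_alg"
    and inj: "inj_on q (carrier_vec 4)"
    and one_mem: "1 \<in> q ` carrier_vec 4"
    and mult_mem: "\<And>X Y. X \<in> q ` carrier_vec 4 \<Longrightarrow> Y \<in> q ` carrier_vec 4 \<Longrightarrow> X * Y \<in> q ` carrier_vec 4"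
begin

abbreviation "C \<equiv> carrier_vec 4 :: 'a vec set"
abbreviation "qi \<equiv> inv_into C q"

definition A :: "('a, 'a vec) module" where
  "A = \<lparr>carrier = C, mult = (\<lambda>x y. qi (q x * q y)), one = qi 1, zero = 0\<^sub>v 4, add = (+), smult = (\<cdot>\<^sub>v)\<rparr>"

lemma A_simps [simp]:
  "carrier A = C" "x \<otimes>\<^bsub>A\<^esub> y = qi (q x * q y)" "\<one>\<^bsub>A\<^esub> = qi 1" "\<zero>\<^bsub>A\<^esub> = 0\<^sub>v 4" "x \<oplus>\<^bsub>A\<^esub> y = x + y" "c \<odot>\<^bsub>A\<^esub> x = c \<cdot>\<^sub>v x"
  by (simp_all add: A_def)

lemma q_qi [simp]: "X \<in> q ` C \<Longrightarrow> q (qi X) = X" "X \<in> q ` C \<Longrightarrow> qi X \<in> C"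
  by (rule f_inv_into_f, assumption) (rule inv_into_into)

lemma qi_q [simp]: "x \<in> C \<Longrightarrow> qi (q x) = x"
  by (rule inv_into_f_f[OF inj])

lemma q_mem [simp]: "x \<in> C \<Longrightarrow> q x \<in> q ` C" by simp

lemma q_lin: "x \<in> C \<Longrightarrow> y \<in> C \<Longrightarrow> q (x + y) = q x + q y" "x \<in> C \<Longrightarrow> q (c \<cdot>\<^sub>v x) = c *s q x"
  using module_homD[OF hom, unfolded coord_space_simps m4_alg_simps] by auto

lemma q_zero: "q (0\<^sub>v 4) = 0"
  using module_hom_zero[OF coord_space_vs m4_alg_vs hom] by (simp add: coord_space_simps)

lemma add_mem: "X \<in> q ` C \<Longrightarrow> Y \<in> q ` C \<Longrightarrow> X + Y \<in> q ` C"
  by (auto simp: q_lin(1)[symmetric])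

lemma smul_mem: "X \<in> q ` C \<Longrightarrow> c *s X \<in> q ` C"
  by (auto simp: q_lin(2)[symmetric])

lemma q_eqI: "x \<in> C \<Longrightarrow> y \<in> C \<Longrightarrow> q x = q y \<Longrightarrow> x = y"
  using inj by (rule inj_onD)

lemma coord_iso: "(\<lambda>x. x) \<in> linear_isos (coord_space 4) A"
  by (rule linear_isosI[of _ _ _ "\<lambda>x. x"], rule module_homI) (auto simp: coord_space_simps)

lemma vs: "vectorspace class_ring A"
  by (rule linear_isos_vectorspace[OF coord_space_vs coord_iso]) (simp add: coord_space_simps)

lemma fin_dim: "vectorspace.fin_dim class_ring A" "vectorspace.dim class_ring A = 4"
  using coord_iso_dim[OF vs coord_iso] by auto

lemma degree: "alg_degree A = 2"
  unfolding alg_degree_def fin_dim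
proof (rule the_equality)
  fix n :: nat assume "n\<^sup>2 = 4"
  hence "n\<^sup>2 = 2\<^sup>2" by simp
  thus "n = 2" by (rule power2_eq_imp_eq) auto
qed simp

lemma algebra: "fin_dim_algebra A"
proof -
  have m: "monoid A"
    by (rule monoidI) (simp_all add: one_mem mult_mem mult.assoc)
  have "ring A"
  proof (rule ringI[OF vs_abelian_group[OF vs] m])
    fix x y z assume "x \<in> carrier A" "y \<in> carrier A" "z \<in> carrier A"
    thus "(x \<oplus>\<^bsub>A\<^esub> y) \<otimes>\<^bsub>A\<^esub> z = x \<otimes>\<^bsub>A\<^esub> z \<oplus>\<^bsub>A\<^esub> y \<otimes>\<^bsub>A\<^esub> z" "z \<otimes>\<^bsub>A\<^esub> (x \<oplus>\<^bsub>A\<^esub> y) = z \<otimes>\<^bsub>A\<^esub> x \<oplus>\<^bsub>A\<^esub> z \<otimes>\<^bsub>A\<^esub> y"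
      by (auto intro!: q_eqI simp: q_lin mult_mem add_mem distrib_left distrib_right)
  qed
  moreover have "qi (q (c \<cdot>\<^sub>v x) * q y) = c \<cdot>\<^sub>v qi (q x * q y)" "qi (q x * q (c \<cdot>\<^sub>v y)) = c \<cdot>\<^sub>v qi (q x * q y)"
    if "x \<in> C" "y \<in> C" for x y c
    using that by (auto intro!: q_eqI simp: q_lin mult_mem smul_mem)
  ultimately show ?thesis unfolding fin_dim_algebra_def using vs fin_dim(1) by simp
qed

lemma central_simpleI:
  assumes center: "\<And>X. X \<in> q ` C \<Longrightarrow> (\<And>Y. Y \<in> q ` C \<Longrightarrow> X * Y = Y * X) \<Longrightarrow> \<exists>c. X = c *s 1"
    and simple: "\<And>I X. I \<subseteq> q ` C \<Longrightarrow> (\<And>X Y. X \<in> I \<Longrightarrow> Y \<in> I \<Longrightarrow> X + Y \<in> I)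
      \<Longrightarrow> (\<And>X Y. X \<in> I \<Longrightarrow> Y \<in> q ` C \<Longrightarrow> X * Y \<in> I \<and> Y * X \<in> I) \<Longrightarrow> X \<in> I \<Longrightarrow> X \<noteq> 0 \<Longrightarrow> 1 \<in> I"
  shows "central_simple A"
  unfolding central_simple_def
proof (intro conjI allI impI algebra)
  show "{z \<in> carrier A. \<forall>x\<in>carrier A. z \<otimes>\<^bsub>A\<^esub> x = x \<otimes>\<^bsub>A\<^esub> z} = {c \<odot>\<^bsub>A\<^esub> \<one>\<^bsub>A\<^esub> | c. True}"
  proof (intro Set.set_eqI iffI)
    fix z assume z: "z \<in> {z \<in> carrier A. \<forall>x\<in>carrier A. z \<otimes>\<^bsub>A\<^esub> x = x \<otimes>\<^bsub>A\<^esub> z}"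
    hence zC: "z \<in> C" by simp
    have "q z * Y = Y * q z" if Y: "Y \<in> q ` C" for Y
    proof -
      have "qi (q z * q (qi Y)) = qi (q (qi Y) * q z)" using z q_qi(2)[OF Y] by simp
      hence "q (qi (q z * q (qi Y))) = q (qi (q (qi Y) * q z))" by simp
      thus ?thesis using zC Y by (simp add: mult_mem)
    qed
    then obtain c where "q z = c *s 1" using center[of "q z"] zC by auto
    hence "z = c \<cdot>\<^sub>v qi 1" using zC one_mem by (intro q_eqI) (auto simp: q_lin)
    thus "z \<in> {c \<odot>\<^bsub>A\<^esub> \<one>\<^bsub>A\<^esub> | c. True}" by auto
  next
    fix z assume "z \<in> {c \<odot>\<^bsub>A\<^esub> \<one>\<^bsub>A\<^esub> | c. True}"
    then obtain c where "z = c \<cdot>\<^sub>v qi 1" by auto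
    thus "z \<in> {z \<in> carrier A. \<forall>x\<in>carrier A. z \<otimes>\<^bsub>A\<^esub> x = x \<otimes>\<^bsub>A\<^esub> z}" using one_mem by (simp add: q_lin)
  qed
  show "\<one>\<^bsub>A\<^esub> \<noteq> \<zero>\<^bsub>A\<^esub>" using q_qi(1)[OF one_mem] q_zero by auto
  fix I assume "ideal I A"
  then interpret I: ideal I A .
  have IC: "I \<subseteq> C" using I.a_subset by simp
  show "I = {\<zero>\<^bsub>A\<^esub>} \<or> I = carrier A"
  proof (cases "I = {\<zero>\<^bsub>A\<^esub>}")
    case False
    then obtain x where x: "x \<in> I" "x \<noteq> 0\<^sub>v 4" using additive_subgroup.zero_closed[OF I.additive_subgroup_axioms] by auto
    have "1 \<in> q ` I"
    proof (rule simple[of "q ` I" "q x"])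
      show "q ` I \<subseteq> q ` C" using IC by blast
      show "X + Y \<in> q ` I" if XY: "X \<in> q ` I" "Y \<in> q ` I" for X Y
      proof -
        obtain u v where u: "u \<in> I" "X = q u" and v: "v \<in> I" "Y = q v" using XY by blast
        have "u \<in> C" "v \<in> C" using u(1) v(1) IC by blast+
        hence "X + Y = q (u + v)" unfolding u(2) v(2) by (rule q_lin(1)[symmetric])
        thus ?thesis using additive_subgroup.a_closed[OF I.additive_subgroup_axioms u(1) v(1)] by simp
      qed
      show "X * Y \<in> q ` I \<and> Y * X \<in> q ` I" if XY: "X \<in> q ` I" "Y \<in> q ` C" for X Y
      proof -
        obtain u v where u: "u \<in> I" "X = q u" and v: "v \<in> C" "Y = q v" using XY by blast
        have uC: "u \<in> C" using u IC by blast
        have "X * Y = q (qi (q u * q v))" "Y * X = q (qi (q v * q u))" unfolding u(2) v(2)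
          by (rule sym, rule q_qi(1), rule mult_mem; rule q_mem; rule uC v(1))+
        thus ?thesis using I.I_r_closed[OF u(1), of v] I.I_l_closed[OF u(1), of v] v by simp
      qed
      show "q x \<noteq> 0" using x IC q_zero q_eqI[of x "0\<^sub>v 4"] by auto
    qed (use x in simp)
    then obtain u where u: "u \<in> I" "q u = 1" by auto
    have "y \<in> I" if y: "y \<in> C" for y
      using I.I_l_closed[OF u(1), of y] y u(2) by simp
    thus ?thesis using IC by auto
  qed simp
qed

text \<open>Left multiplication by \<open>s\<close> is injective on the subalgebra, hence surjective
  by finite dimension; the inverse of \<open>s\<close> therefore lies in the subalgebra.\<close>

lemma left_regular_unit:
  assumes s: "s \<in> q ` C" "det4 s \<noteq> 0"
  obtains t where "t \<in> q ` C" "s * t = 1" "t * s = 1"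
proof -
  obtain r where r: "r * s = 1" using det4_inverse[OF s(2)] by metis
  let ?f = "\<lambda>x. qi (s * q x)"
  have "?f \<in> LinearCombinations.module_hom class_ring (coord_space 4) (coord_space 4)"
    by (rule module_homI) (auto intro!: q_eqI simp: coord_space_simps q_lin mult_mem add_mem smul_mem s distrib_left)
  moreover have "inj_on ?f C"
  proof (rule inj_onI)
    fix x y assume xy: "x \<in> C" "y \<in> C" "?f x = ?f y"
    have "q (?f x) = s * q x" "q (?f y) = s * q y" using xy(1,2) s(1) by (auto intro!: q_qi(1) mult_mem)
    hence "s * q x = s * q y" using xy(3) by metis
    hence "r * s * q x = r * s * q y" by (simp only: mult.assoc)
    thus "x = y" using r q_eqI xy by simp
  qed
  ultimately have "?f ` C = C" using linear_isosD(7)[OF coord_inj_iso, of ?f] by (simp only: coord_space_simps)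
  hence "qi 1 \<in> ?f ` C" using q_qi(2)[OF one_mem] by (simp only:)
  then obtain x where x: "x \<in> C" "?f x = qi 1" by (elim imageE) simp
  have "q (?f x) = s * q x" by (rule q_qi(1)[OF mult_mem[OF s(1) q_mem[OF x(1)]]])
  hence "s * q x = 1" unfolding x(2) q_qi(1)[OF one_mem] by (rule sym)
  thus thesis using that[OF q_mem[OF x(1)] _ right_inverse4(2)] by blast
qed

lemma anti_automorphismI:
  assumes lin: "\<And>X Y. \<sigma> (X + Y) = \<sigma> X + \<sigma> Y" "\<And>c X. \<sigma> (c *s X) = c *s \<sigma> X"
    and anti: "\<And>X Y. \<sigma> (X * Y) = \<sigma> Y * \<sigma> X" and one: "\<sigma> 1 = 1" and inj\<sigma>: "\<And>X Y. \<sigma> X = \<sigma> Y \<Longrightarrow> X = Y"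
    and st: "\<And>X. X \<in> q ` C \<Longrightarrow> \<sigma> X \<in> q ` C"
  shows "anti_automorphism A (\<lambda>x. qi (\<sigma> (q x)))"
proof -
  let ?f = "\<lambda>x. qi (\<sigma> (q x))"
  have "?f \<in> LinearCombinations.module_hom class_ring (coord_space 4) (coord_space 4)"
    by (rule module_homI) (auto intro!: q_eqI simp: coord_space_simps q_lin lin add_mem smul_mem st)
  moreover have "inj_on ?f C"
  proof (rule inj_onI)
    fix x y assume xy: "x \<in> C" "y \<in> C" "?f x = ?f y"
    have "q (?f x) = \<sigma> (q x)" "q (?f y) = \<sigma> (q y)" using xy(1,2) by (auto intro!: q_qi(1) st)
    hence "\<sigma> (q x) = \<sigma> (q y)" using xy(3) by metis
    thus "x = y" using inj\<sigma> q_eqI xy by blast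
  qed
  ultimately have b: "?f \<in> linear_isos (coord_space 4) (coord_space 4)" by (rule coord_inj_iso)
  have "?f \<in> linear_isos A A"
    using linear_isosD(2,4,5)[OF b] linear_isosD(3)[OF b]
    unfolding linear_isos_def by (auto intro!: module_homI simp: coord_space_simps)
  thus ?thesis unfolding anti_automorphism_def
    by (auto intro!: q_eqI simp: one one_mem anti st mult_mem)
qed

end

section \<open>Tensor products of algebras and of anti-automorphisms\<close>

locale tensor_algs = tensor_pair A1 A2 for A1 :: "('a::field, 'b) module" and A2 :: "('a, 'c) module" +
  assumes alg1: "fin_dim_algebra A1" and alg2: "fin_dim_algebra A2"
begin

abbreviation "TA \<equiv> tensor_alg A1 A2"

lemma TA_simps [simp]:
  "carrier TA = carrier T" "X \<oplus>\<^bsub>TA\<^esub> Y = X \<oplus>\<^bsub>T\<^esub> Y" "c \<odot>\<^bsub>TA\<^esub> X = c \<odot>\<^bsub>T\<^esub> X" "\<zero>\<^bsub>TA\<^esub> = \<zero>\<^bsub>T\<^esub>"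
  "\<one>\<^bsub>TA\<^esub> = pt \<one>\<^bsub>A1\<^esub> \<one>\<^bsub>A2\<^esub>"
  by (simp_all add: tensor_alg_def)

lemma mult_bilinear:
  assumes "fin_dim_algebra A"
  shows "x \<in> carrier A \<Longrightarrow> y \<in> carrier A \<Longrightarrow> x \<otimes>\<^bsub>A\<^esub> y \<in> carrier A" "bilinear_map A A A (\<lambda>x y. x \<otimes>\<^bsub>A\<^esub> y)"
    "\<one>\<^bsub>A\<^esub> \<in> carrier A" "x \<in> carrier A \<Longrightarrow> \<one>\<^bsub>A\<^esub> \<otimes>\<^bsub>A\<^esub> x = x" "x \<in> carrier A \<Longrightarrow> x \<otimes>\<^bsub>A\<^esub> \<one>\<^bsub>A\<^esub> = x"
proof -
  interpret R: ring A using assms by (simp add: fin_dim_algebra_def)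
  show "x \<in> carrier A \<Longrightarrow> y \<in> carrier A \<Longrightarrow> x \<otimes>\<^bsub>A\<^esub> y \<in> carrier A"
    "\<one>\<^bsub>A\<^esub> \<in> carrier A" "x \<in> carrier A \<Longrightarrow> \<one>\<^bsub>A\<^esub> \<otimes>\<^bsub>A\<^esub> x = x" "x \<in> carrier A \<Longrightarrow> x \<otimes>\<^bsub>A\<^esub> \<one>\<^bsub>A\<^esub> = x"
    by simp_all
  show "bilinear_map A A A (\<lambda>x y. x \<otimes>\<^bsub>A\<^esub> y)"
    using assms unfolding bilinear_map_def fin_dim_algebra_def by (auto simp: R.l_distr R.r_distr)
qed

lemma TA_mult:
  "bilinear_map T T T (\<lambda>X Y. X \<otimes>\<^bsub>TA\<^esub> Y)"
  "a \<in> carrier A1 \<Longrightarrow> b \<in> carrier A2 \<Longrightarrow> a' \<in> carrier A1 \<Longrightarrow> b' \<in> carrier A2 \<Longrightarrow>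
    pt a b \<otimes>\<^bsub>TA\<^esub> pt a' b' = pt (a \<otimes>\<^bsub>A1\<^esub> a') (b \<otimes>\<^bsub>A2\<^esub> b')"
proof -
  have r: "bilinear_map A1 A2 T (\<lambda>a' b'. pt (a \<otimes>\<^bsub>A1\<^esub> a') (b \<otimes>\<^bsub>A2\<^esub> b'))" if "a \<in> carrier A1" "b \<in> carrier A2" for a b
    by (rule bilinear_map_comp_left[OF pt_bilinear bilinear_map_hom_right[OF mult_bilinear(2)[OF alg1] that(1)]
          bilinear_map_hom_right[OF mult_bilinear(2)[OF alg2] that(2)]])
  have l: "bilinear_map A1 A2 T (\<lambda>a b. pt (a \<otimes>\<^bsub>A1\<^esub> a') (b \<otimes>\<^bsub>A2\<^esub> b'))" if "a' \<in> carrier A1" "b' \<in> carrier A2" for a' b'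
    by (rule bilinear_map_comp_left[OF pt_bilinear bilinear_map_hom_left[OF mult_bilinear(2)[OF alg1] that(1)]
          bilinear_map_hom_left[OF mult_bilinear(2)[OF alg2] that(2)]])
  note L = tensor_lift2[OF tensor_vs, of "\<lambda>a b a' b'. pt (a \<otimes>\<^bsub>A1\<^esub> a') (b \<otimes>\<^bsub>A2\<^esub> b')", OF r l]
  have m: "(\<lambda>X Y. X \<otimes>\<^bsub>TA\<^esub> Y) = (\<lambda>X Y. tensor_lift A1 A2 T (\<lambda>a b. tensor_lift A1 A2 T (\<lambda>a' b'. pt (a \<otimes>\<^bsub>A1\<^esub> a') (b \<otimes>\<^bsub>A2\<^esub> b')) Y) X)"
    by (simp add: tensor_alg_def)
  show "bilinear_map T T T (\<lambda>X Y. X \<otimes>\<^bsub>TA\<^esub> Y)" unfolding m by (rule L(1))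
  show "pt a b \<otimes>\<^bsub>TA\<^esub> pt a' b' = pt (a \<otimes>\<^bsub>A1\<^esub> a') (b \<otimes>\<^bsub>A2\<^esub> b')"
    if "a \<in> carrier A1" "b \<in> carrier A2" "a' \<in> carrier A1" "b' \<in> carrier A2"
    using L(2)[OF _ _ _ _ that] fun_cong[OF fun_cong[OF m, of "pt a b"], of "pt a' b'"] by simp
qed

lemma tensor_map_facts:
  assumes "\<sigma> \<in> LinearCombinations.module_hom class_ring A1 A1" "\<tau> \<in> LinearCombinations.module_hom class_ring A2 A2"
  shows "tensor_map A1 \<sigma> A2 \<tau> \<in> LinearCombinations.module_hom class_ring T T"
    "a \<in> carrier A1 \<Longrightarrow> b \<in> carrier A2 \<Longrightarrow> tensor_map A1 \<sigma> A2 \<tau> (pt a b) = pt (\<sigma> a) (\<tau> b)"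
  unfolding tensor_map_def
  using tensor_lift_hom[OF tensor_vs] tensor_lift_pt[OF tensor_vs] bilinear_map_comp_left[OF pt_bilinear assms] by blast+

end

text \<open>Multiplication of commuting images induces the homomorphism \<open>H\<close> on the
  tensor product. Every tensor is a sum of four terms \<open>ei \<otimes> yi\<close>, so
  \<open>inj\<close> and \<open>surj\<close>, which speak of the images of such sums, make
  \<open>H\<close> bijective. The required isomorphism is its inverse.\<close>

lemma (in tensor_algs) isomorphic_with_antiI:
  fixes q1 :: "'b \<Rightarrow> 'a m4" and q2 :: "'c \<Rightarrow> 'a m4"
  assumes h1: "q1 \<in> LinearCombinations.module_hom class_ring A1 m4_alg"
    and h2: "q2 \<in> LinearCombinations.module_hom class_ring A2 m4_alg"
    and m1: "\<And>x y. x \<in> carrier A1 \<Longrightarrow> y \<in> carrier A1 \<Longrightarrow> q1 (x \<otimes>\<^bsub>A1\<^esub> y) = q1 x * q1 y"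
    and m2: "\<And>x y. x \<in> carrier A2 \<Longrightarrow> y \<in> carrier A2 \<Longrightarrow> q2 (x \<otimes>\<^bsub>A2\<^esub> y) = q2 x * q2 y"
    and one: "q1 \<one>\<^bsub>A1\<^esub> = 1" "q2 \<one>\<^bsub>A2\<^esub> = 1"
    and comm: "\<And>x y. x \<in> carrier A1 \<Longrightarrow> y \<in> carrier A2 \<Longrightarrow> q2 y * q1 x = q1 x * q2 y"
    and e: "e0 \<in> carrier A1" "e1 \<in> carrier A1" "e2 \<in> carrier A1" "e3 \<in> carrier A1"
    and gen: "\<And>x. x \<in> carrier A1 \<Longrightarrow> \<exists>c0 c1 c2 c3. x = c0 \<odot>\<^bsub>A1\<^esub> e0 \<oplus>\<^bsub>A1\<^esub> (c1 \<odot>\<^bsub>A1\<^esub> e1 \<oplus>\<^bsub>A1\<^esub> (c2 \<odot>\<^bsub>A1\<^esub> e2 \<oplus>\<^bsub>A1\<^esub> c3 \<odot>\<^bsub>A1\<^esub> e3))"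
    and inj: "\<And>y0 y1 y2 y3 z0 z1 z2 z3. {y0, y1, y2, y3, z0, z1, z2, z3} \<subseteq> carrier A2 \<Longrightarrow>
      q1 e0 * q2 y0 + (q1 e1 * q2 y1 + (q1 e2 * q2 y2 + q1 e3 * q2 y3)) =
      q1 e0 * q2 z0 + (q1 e1 * q2 z1 + (q1 e2 * q2 z2 + q1 e3 * q2 z3)) \<Longrightarrow> y0 = z0 \<and> y1 = z1 \<and> y2 = z2 \<and> y3 = z3"
    and surj: "\<And>X. \<exists>y0 y1 y2 y3. {y0, y1, y2, y3} \<subseteq> carrier A2 \<and>
      X = q1 e0 * q2 y0 + (q1 e1 * q2 y1 + (q1 e2 * q2 y2 + q1 e3 * q2 y3))"
    and \<sigma>1: "\<sigma>1 \<in> LinearCombinations.module_hom class_ring A1 A1" "\<And>x. x \<in> carrier A1 \<Longrightarrow> q1 (\<sigma>1 x) = \<sigma> (q1 x)"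
    and \<sigma>2: "\<sigma>2 \<in> LinearCombinations.module_hom class_ring A2 A2" "\<And>x. x \<in> carrier A2 \<Longrightarrow> q2 (\<sigma>2 x) = \<sigma> (q2 x)"
    and lin: "\<And>X Y. \<sigma> (X + Y) = \<sigma> X + \<sigma> Y" "\<And>c X. \<sigma> (c *s X) = c *s \<sigma> X"
    and anti: "\<And>X Y. \<sigma> (X * Y) = \<sigma> Y * \<sigma> X"
  shows "isomorphic_with_anti m4_alg \<sigma> TA (tensor_map A1 \<sigma>1 A2 \<sigma>2)"
proof -
  interpret AT: abelian_group T by (rule vs_abelian_group[OF tensor_vs])
  note S = vs_facts[OF tensor_vs]
  note D1 = module_homD[OF h1, unfolded m4_alg_simps] and D2 = module_homD[OF h2, unfolded m4_alg_simps]
  have bil: "bilinear_map A1 A2 m4_alg (\<lambda>x y. q1 x * q2 y)"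
    unfolding bilinear_map_def by (simp add: D1 D2 distrib_left distrib_right)
  define H where "H = tensor_lift A1 A2 m4_alg (\<lambda>x y. q1 x * q2 y)"
  have H: "H \<in> LinearCombinations.module_hom class_ring T m4_alg" unfolding H_def by (rule tensor_lift_hom[OF m4_alg_vs bil])
  have Hpt: "H (pt x y) = q1 x * q2 y" if "x \<in> carrier A1" "y \<in> carrier A2" for x y
    unfolding H_def by (rule tensor_lift_pt[OF m4_alg_vs bil that])
  note HD = module_homD[OF H, unfolded m4_alg_simps]
  let ?n = "\<lambda>y0 y1 y2 y3. pt e0 y0 \<oplus>\<^bsub>T\<^esub> (pt e1 y1 \<oplus>\<^bsub>T\<^esub> (pt e2 y2 \<oplus>\<^bsub>T\<^esub> pt e3 y3))"
  note PB = bilinear_mapD[OF pt_bilinear]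
  have nf: "\<exists>y0 y1 y2 y3. {y0, y1, y2, y3} \<subseteq> carrier A2 \<and> X = ?n y0 y1 y2 y3" if "X \<in> carrier T" for X
    using that
  proof (induction rule: tensor_induct)
    case (pure c x y)
    obtain c0 c1 c2 c3 where x: "x = c0 \<odot>\<^bsub>A1\<^esub> e0 \<oplus>\<^bsub>A1\<^esub> (c1 \<odot>\<^bsub>A1\<^esub> e1 \<oplus>\<^bsub>A1\<^esub> (c2 \<odot>\<^bsub>A1\<^esub> e2 \<oplus>\<^bsub>A1\<^esub> c3 \<odot>\<^bsub>A1\<^esub> e3))"
      using gen[OF pure(1)] by blast
    have cy: "c \<odot>\<^bsub>A2\<^esub> y \<in> carrier A2" using pure(2) by (rule W(5))
    have "c \<odot>\<^bsub>T\<^esub> pt x y = pt x (c \<odot>\<^bsub>A2\<^esub> y)" using PB(5)[OF pure] by simp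
    also have "\<dots> = ?n (c0 \<odot>\<^bsub>A2\<^esub> (c \<odot>\<^bsub>A2\<^esub> y)) (c1 \<odot>\<^bsub>A2\<^esub> (c \<odot>\<^bsub>A2\<^esub> y)) (c2 \<odot>\<^bsub>A2\<^esub> (c \<odot>\<^bsub>A2\<^esub> y)) (c3 \<odot>\<^bsub>A2\<^esub> (c \<odot>\<^bsub>A2\<^esub> y))"
      unfolding x using cy e by (simp only: PB(2,4,5) V(3,5))
    finally show ?case using W(5)[OF cy] by blast
  next
    case (add X Y)
    obtain y0 y1 y2 y3 where y: "{y0, y1, y2, y3} \<subseteq> carrier A2" "X = ?n y0 y1 y2 y3" using add(3) by blast
    obtain z0 z1 z2 z3 where z: "{z0, z1, z2, z3} \<subseteq> carrier A2" "Y = ?n z0 z1 z2 z3" using add(4) by blast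
    have "X \<oplus>\<^bsub>T\<^esub> Y = ?n (y0 \<oplus>\<^bsub>A2\<^esub> z0) (y1 \<oplus>\<^bsub>A2\<^esub> z1) (y2 \<oplus>\<^bsub>A2\<^esub> z2) (y3 \<oplus>\<^bsub>A2\<^esub> z3)"
      unfolding y(2) z(2) using y(1) z(1) e by (simp add: PB(1,3) AT.a_ac)
    moreover have "{y0 \<oplus>\<^bsub>A2\<^esub> z0, y1 \<oplus>\<^bsub>A2\<^esub> z1, y2 \<oplus>\<^bsub>A2\<^esub> z2, y3 \<oplus>\<^bsub>A2\<^esub> z3} \<subseteq> carrier A2"
      using y(1) z(1) by (simp add: W(3))
    ultimately show ?case by blast
  qed
  have ncl: "?n y0 y1 y2 y3 \<in> carrier T" "H (?n y0 y1 y2 y3) = q1 e0 * q2 y0 + (q1 e1 * q2 y1 + (q1 e2 * q2 y2 + q1 e3 * q2 y3))"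
    if "{y0, y1, y2, y3} \<subseteq> carrier A2" for y0 y1 y2 y3
    using that e by (simp_all add: PB(1) HD(2) Hpt)
  have injH: "inj_on H (carrier T)"
  proof (rule inj_onI)
    fix X Y assume XY: "X \<in> carrier T" "Y \<in> carrier T" "H X = H Y"
    obtain y0 y1 y2 y3 where y: "{y0, y1, y2, y3} \<subseteq> carrier A2" "X = ?n y0 y1 y2 y3" using nf[OF XY(1)] by blast
    obtain z0 z1 z2 z3 where z: "{z0, z1, z2, z3} \<subseteq> carrier A2" "Y = ?n z0 z1 z2 z3" using nf[OF XY(2)] by blast
    have "y0 = z0 \<and> y1 = z1 \<and> y2 = z2 \<and> y3 = z3"
      by (rule inj) (use y(1) z(1) XY(3)[unfolded y(2) z(2) ncl(2)[OF y(1)] ncl(2)[OF z(1)]] in auto)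
    thus "X = Y" using y(2) z(2) by simp
  qed
  have surjH: "\<exists>X\<in>carrier T. Z = H X" for Z
    using surj[of Z] ncl by metis
  have bijH: "bij_betw H (carrier T) UNIV" unfolding bij_betw_def using injH surjH by auto
  have Hiso: "H \<in> linear_isos T m4_alg" unfolding linear_isos_def using H bijH by simp
  note MB = bilinear_mapD[OF TA_mult(1)]
  have Hmult: "H (X \<otimes>\<^bsub>TA\<^esub> Y) = H X * H Y" if "X \<in> carrier T" "Y \<in> carrier T" for X Y
    using that(1)
  proof (induction rule: tensor_induct)
    case (pure c a b)
    note ab = pt_closed[OF pure]
    have "H (pt a b \<otimes>\<^bsub>TA\<^esub> Y) = H (pt a b) * H Y" using that(2)
    proof (induction rule: tensor_induct)
      case (pure d a' b')
      have c': "q2 b * (q1 a' * q2 b') = q1 a' * (q2 b * q2 b')"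
        using comm[OF pure(1) \<open>b \<in> carrier A2\<close>] by (simp only: mult.assoc[symmetric])
      have "H (pt a b \<otimes>\<^bsub>TA\<^esub> pt a' b') = H (pt a b) * H (pt a' b')"
        using \<open>a \<in> carrier A1\<close> \<open>b \<in> carrier A2\<close> pure
        by (simp add: TA_mult(2) Hpt mult_bilinear(1)[OF alg1] mult_bilinear(1)[OF alg2] m1 m2 c' mult.assoc)
      thus ?case using MB[OF ab pt_closed[OF pure]] pt_closed[OF pure] by (simp add: HD)
    next
      case (add Y Z)
      thus ?case using MB[OF ab] by (simp add: HD distrib_left)
    qed
    thus ?case using MB[OF ab that(2)] ab by (simp add: HD)
  next
    case (add X Z)
    thus ?case using MB[OF add(1) that(2)] MB[OF add(2) that(2)] by (simp add: HD distrib_right)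
  qed
  note TM = tensor_map_facts[OF \<sigma>1(1) \<sigma>2(1)]
  note TD = module_homD[OF TM(1)]
  have H\<sigma>: "H (tensor_map A1 \<sigma>1 A2 \<sigma>2 X) = \<sigma> (H X)" if "X \<in> carrier T" for X
    using that
  proof (induction rule: tensor_induct)
    case (pure c a b)
    have "H (tensor_map A1 \<sigma>1 A2 \<sigma>2 (pt a b)) = \<sigma> (H (pt a b))"
      using pure by (simp add: TM(2) Hpt \<sigma>1(2) \<sigma>2(2) module_homD(1)[OF \<sigma>1(1)] module_homD(1)[OF \<sigma>2(1)] anti[symmetric] comm)
    thus ?case using pt_closed[OF pure] by (simp add: TD HD lin)
  next
    case (add X Y)
    thus ?case by (simp add: TD HD lin)
  qed
  let ?G = "inv_into (carrier T) H"
  have G: "?G X \<in> carrier T" "H (?G X) = X" for X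
    using bijH by (auto simp: bij_betw_def inv_into_into f_inv_into_f)
  have GI: "?G Z = X" if "X \<in> carrier T" "H X = Z" for X Z using inv_into_f_f[OF injH that(1)] that(2) by simp
  have Giso: "?G \<in> linear_isos m4_alg T" by (rule linear_isos_inv_into[OF tensor_vs Hiso])
  have "?G \<in> linear_isos m4_alg TA" using linear_isosD[OF Giso]
    unfolding linear_isos_def by (auto intro!: module_homI)
  moreover have "?G \<in> ring_iso m4_alg TA"
    unfolding ring_iso_def
  proof (intro CollectI conjI ring_hom_memI)
    show "bij_betw ?G (carrier m4_alg) (carrier TA)" using linear_isosD(2)[OF Giso] by simp
    fix X Y
    show "?G X \<in> carrier TA" using G by simp
    show "?G (X \<otimes>\<^bsub>m4_alg\<^esub> Y) = ?G X \<otimes>\<^bsub>TA\<^esub> ?G Y"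
      by (rule GI) (simp_all add: Hmult G MB(1))
    show "?G (X \<oplus>\<^bsub>m4_alg\<^esub> Y) = ?G X \<oplus>\<^bsub>TA\<^esub> ?G Y"
      by (rule GI) (simp_all add: HD G S(3))
  next
    show "?G \<one>\<^bsub>m4_alg\<^esub> = \<one>\<^bsub>TA\<^esub>"
      by (rule GI) (simp_all add: Hpt PB(1) one mult_bilinear(3)[OF alg1] mult_bilinear(3)[OF alg2])
  qed
  moreover have "?G (\<sigma> X) = tensor_map A1 \<sigma>1 A2 \<sigma>2 (?G X)" for X
    by (rule GI) (simp_all add: TD G H\<sigma>)
  ultimately show ?thesis unfolding isomorphic_with_anti_def by blast
qed

section \<open>Quaternion algebras as central simple subalgebras of the matrix algebra\<close>

lemma quat_arith:
  "quat i j x0 x1 x2 x3 + quat i j y0 y1 y2 y3 = quat i j (x0 + y0) (x1 + y1) (x2 + y2) (x3 + y3)"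
  "c *s quat i j x0 x1 x2 x3 = quat i j (c * x0) (c * x1) (c * x2) (c * x3)"
  "quat i j x0 x1 x2 x3 - quat i j y0 y1 y2 y3 = quat i j (x0 - y0) (x1 - y1) (x2 - y2) (x3 - y3)"
  "quat i j 1 0 0 0 = 1" "quat i j 0 1 0 0 = i" "quat i j 0 0 1 0 = j"
  by (simp_all add: quat_def smul_distrib)

lemma quat_mult:
  assumes "quat_gens \<alpha> \<beta> i j"
  shows "quat i j x0 x1 x2 x3 * quat i j y0 y1 y2 y3 = quat i j
    (x0 * y0 + \<alpha> * x1 * y1 + \<beta> * x2 * y2 - \<alpha> * \<beta> * x3 * y3) (x0 * y1 + x1 * y0 - \<beta> * x2 * y3 + \<beta> * x3 * y2)
    (x0 * y2 + x2 * y0 + \<alpha> * x1 * y3 - \<alpha> * x3 * y1) (x0 * y3 + x3 * y0 + x1 * y2 - x2 * y1)"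
proof -
  note g = quat_gensD[OF assms]
  have k: "i * j * i = (- \<alpha>) *s j" "i * j * j = \<beta> *s i" "i * j * (i * j) = (- (\<alpha> * \<beta>)) *s 1" "i * (i * j) = \<alpha> *s j"
    "j * (i * j) = (- \<beta>) *s i"
    using g by (simp_all add: mult.assoc)
  have "quat i j x0 x1 x2 x3 * quat i j y0 y1 y2 y3 =
    (x0 * y0) *s 1 + (x0 * y1) *s i + (x0 * y2) *s j + (x0 * y3) *s (i * j) +
    ((x1 * y0) *s i + (x1 * y1) *s (i * i) + (x1 * y2) *s (i * j) + (x1 * y3) *s (i * (i * j))) +
    ((x2 * y0) *s j + (x2 * y1) *s (j * i) + (x2 * y2) *s (j * j) + (x2 * y3) *s (j * (i * j))) +
    ((x3 * y0) *s (i * j) + (x3 * y1) *s (i * j * i) + (x3 * y2) *s (i * j * j) + (x3 * y3) *s (i * j * (i * j)))"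
    unfolding quat_def
    by (simp add: distrib_left distrib_right smul_distrib(1) mult.assoc add_ac mult.commute mult.left_commute)
  also have "\<dots> = quat i j
    (x0 * y0 + \<alpha> * x1 * y1 + \<beta> * x2 * y2 - \<alpha> * \<beta> * x3 * y3) (x0 * y1 + x1 * y0 - \<beta> * x2 * y3 + \<beta> * x3 * y2)
    (x0 * y2 + x2 * y0 + \<alpha> * x1 * y3 - \<alpha> * x3 * y1) (x0 * y3 + x3 * y0 + x1 * y2 - x2 * y1)"
    unfolding quat_def k g(3,4,5) smul_simps smul_distrib
    by (simp add: ac_simps smul_distrib)
  finally show ?thesis .
qed

definition quat_vec :: "'a::field m4 \<Rightarrow> 'a m4 \<Rightarrow> 'a vec \<Rightarrow> 'a m4" where
  "quat_vec i j x = quat i j (x $ 0) (x $ 1) (x $ 2) (x $ 3)"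

lemma quat_vec_image: "X \<in> quat_vec i j ` carrier_vec 4 \<longleftrightarrow> (\<exists>x0 x1 x2 x3. X = quat i j x0 x1 x2 x3)"
proof
  assume "\<exists>x0 x1 x2 x3. X = quat i j x0 x1 x2 x3"
  then obtain x0 x1 x2 x3 where "X = quat i j x0 x1 x2 x3" by blast
  thus "X \<in> quat_vec i j ` carrier_vec 4"
    by (intro image_eqI[of _ _ "vec 4 (\<lambda>k. [x0, x1, x2, x3] ! k)"]) (simp_all add: quat_vec_def)
qed (auto simp: quat_vec_def)

lemma quat_vec_image_obtain:
  assumes "X \<in> quat_vec i j ` carrier_vec 4"
  obtains x0 x1 x2 x3 where "X = quat i j x0 x1 x2 x3"
  using assms unfolding quat_vec_image by blast

locale quat_sub =
  fixes \<alpha> \<beta> :: "'a::field" and i j :: "'a m4"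
  assumes two: "(2::'a) \<noteq> 0" and gens: "quat_gens \<alpha> \<beta> i j"
begin

lemma subalg: "subalg4 (quat_vec i j)"
proof
  show "quat_vec i j \<in> LinearCombinations.module_hom class_ring (coord_space 4) m4_alg"
    by (rule module_homI) (auto simp: coord_space_simps quat_vec_def quat_arith)
  show "inj_on (quat_vec i j) (carrier_vec 4)"
  proof (rule inj_onI)
    fix x y :: "'a vec" assume xy: "x \<in> carrier_vec 4" "y \<in> carrier_vec 4" "quat_vec i j x = quat_vec i j y"
    hence "quat i j (x $ 0 - y $ 0) (x $ 1 - y $ 1) (x $ 2 - y $ 2) (x $ 3 - y $ 3) = 0"
      by (simp add: quat_vec_def quat_arith(3)[symmetric])
    from quat_eq_0[OF two gens this] xy show "x = y"
      by (intro eq_vecI) (auto dest!: less_4_cases)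
  qed
  show "1 \<in> quat_vec i j ` carrier_vec 4" unfolding quat_vec_image by (metis quat_arith(4))
  fix X Y assume "X \<in> quat_vec i j ` carrier_vec 4" "Y \<in> quat_vec i j ` carrier_vec 4"
  thus "X * Y \<in> quat_vec i j ` carrier_vec 4" unfolding quat_vec_image
    by (elim exE) (simp only: quat_mult[OF gens], blast)
qed

sublocale subalg4 "quat_vec i j" by (rule subalg)

lemma gens_mem: "i \<in> quat_vec i j ` carrier_vec 4" "j \<in> quat_vec i j ` carrier_vec 4"
  unfolding quat_vec_image using quat_arith(5,6) by metis+

lemma four: "(4::'a) \<noteq> 0"
proof -
  have "(4::'a) = 2 * 2" by simp
  thus ?thesis using two by (metis mult_eq_0_iff)
qed

text \<open>Commutators with \<open>i\<close> and \<open>j\<close> annihilate all non-scalar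
  coefficients of a central element. In an ideal, passing from \<open>Y\<close> to
  \<open>Z = \<alpha> Y + i Y i\<close> and on to \<open>\<beta> Z + j Z j\<close> leaves the scalar
  \<open>4 \<alpha> \<beta> x0\<close>; multiplying \<open>X\<close> by \<open>i\<close>,
  \<open>j\<close> or \<open>i * j\<close> beforehand moves any nonzero coefficient into the scalar
  place.\<close>

lemma csa: "central_simple A"
proof (rule central_simpleI)
  fix X assume X: "X \<in> quat_vec i j ` carrier_vec 4" and c: "\<And>Y. Y \<in> quat_vec i j ` carrier_vec 4 \<Longrightarrow> X * Y = Y * X"
  obtain x0 x1 x2 x3 where x: "X = quat i j x0 x1 x2 x3" using quat_vec_image_obtain[OF X] .
  note g = quat_gensD(1,2)[OF gens]
  have "X * i - i * X = 0" "X * j - j * X = 0" using c gens_mem by simp_all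
  moreover have "X * i - i * X = quat i j 0 0 (- (2 * \<alpha> * x3)) (- (2 * x2))"
    using quat_mult[OF gens, of x0 x1 x2 x3 0 1 0 0] quat_mult[OF gens, of 0 1 0 0 x0 x1 x2 x3]
    by (simp add: x quat_arith mult.assoc)
  moreover have "X * j - j * X = quat i j 0 (2 * \<beta> * x3) 0 (2 * x1)"
    using quat_mult[OF gens, of x0 x1 x2 x3 0 0 1 0] quat_mult[OF gens, of 0 0 1 0 x0 x1 x2 x3]
    by (simp add: x quat_arith mult.assoc)
  ultimately have "quat i j 0 0 (- (2 * \<alpha> * x3)) (- (2 * x2)) = 0" "quat i j 0 (2 * \<beta> * x3) 0 (2 * x1) = 0"
    by (simp_all only:)
  from quat_eq_0[OF two gens this(1)] quat_eq_0[OF two gens this(2)]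
  have "2 * \<alpha> * x3 = 0" "2 * x2 = 0" "2 * x1 = 0" by simp_all
  hence "x3 = 0" "x2 = 0" "x1 = 0" using two g by simp_all
  thus "\<exists>c. X = c *s 1" by (intro exI[of _ x0]) (simp add: x quat_def)
next
  fix I X assume IC: "I \<subseteq> quat_vec i j ` carrier_vec 4" and add: "\<And>X Y. X \<in> I \<Longrightarrow> Y \<in> I \<Longrightarrow> X + Y \<in> I"
    and mul: "\<And>X Y. X \<in> I \<Longrightarrow> Y \<in> quat_vec i j ` carrier_vec 4 \<Longrightarrow> X * Y \<in> I \<and> Y * X \<in> I"
    and X: "X \<in> I" "X \<noteq> 0"
  note g = quat_gensD(1,2)[OF gens]
  have sc: "c *s Y \<in> I" if "Y \<in> I" for c Y
    using mul[OF that, of "c *s 1"] smul_mem[OF one_mem] by simp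
  have r: "x0 = 0 \<or> 1 \<in> I" if Y: "quat i j x0 x1 x2 x3 \<in> I" (is "?Y \<in> I") for x0 x1 x2 x3
  proof -
    have iYi: "i * ?Y * i = quat i j (\<alpha> * x0) (\<alpha> * x1) (- (\<alpha> * x2)) (- (\<alpha> * x3))"
      using quat_mult[OF gens, of 0 1 0 0 x0 x1 x2 x3]
        quat_mult[OF gens, of "\<alpha> * x1" x0 "\<alpha> * x3" x2 0 1 0 0] by (simp add: quat_arith)
    have Z: "\<alpha> *s ?Y + i * ?Y * i \<in> I" (is "?Z \<in> I")
      by (rule add[OF sc[OF Y] conjunct1[OF mul[OF conjunct2[OF mul[OF Y gens_mem(1)]] gens_mem(1)]]])
    have Z': "?Z = quat i j (2 * \<alpha> * x0) (2 * \<alpha> * x1) 0 0" unfolding iYi by (simp add: quat_arith mult.assoc)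
    have "j * ?Z * j = quat i j (2 * \<alpha> * \<beta> * x0) (- (2 * \<alpha> * \<beta> * x1)) 0 0"
      unfolding Z' using quat_mult[OF gens, of 0 0 1 0 "2 * \<alpha> * x0" "2 * \<alpha> * x1" 0 0]
        quat_mult[OF gens, of 0 0 "2 * \<alpha> * x0" "- (2 * \<alpha> * x1)" 0 0 1 0] by (simp add: quat_arith mult_ac)
    hence "\<beta> *s ?Z + j * ?Z * j = (4 * \<alpha> * \<beta> * x0) *s 1"
      unfolding Z' by (simp add: quat_arith) (simp add: quat_def mult_ac)
    moreover have "\<beta> *s ?Z + j * ?Z * j \<in> I"
      by (rule add[OF sc[OF Z] conjunct1[OF mul[OF conjunct2[OF mul[OF Z gens_mem(2)]] gens_mem(2)]]])
    ultimately have "(4 * \<alpha> * \<beta> * x0) *s 1 \<in> I" by simp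
    note mem = sc[OF this, of "inverse (4 * \<alpha> * \<beta> * x0)", unfolded smul_simps(3)]
    show ?thesis
    proof (cases "x0 = 0")
      case False
      hence "4 * \<alpha> * \<beta> * x0 \<noteq> 0" using g four by simp
      from mem[unfolded left_inverse[OF this] smul_simps(4)] show ?thesis ..
    qed simp
  qed
  obtain x0 x1 x2 x3 where x: "X = quat i j x0 x1 x2 x3" by (rule quat_vec_image_obtain[OF subsetD[OF IC X(1)]])
  have m: "X * i \<in> I" "X * j \<in> I" using mul[OF X(1) gens_mem(1)] mul[OF X(1) gens_mem(2)] by blast+
  have m': "X * i * j \<in> I" using mul[OF m(1) gens_mem(2)] by blast
  have xi: "X * i = quat i j (\<alpha> * x1) x0 (- (\<alpha> * x3)) (- x2)"
    using quat_mult[OF gens, of x0 x1 x2 x3 0 1 0 0] by (simp add: x quat_arith)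
  have xj: "X * j = quat i j (\<beta> * x2) (\<beta> * x3) x0 x1"
    using quat_mult[OF gens, of x0 x1 x2 x3 0 0 1 0] by (simp add: x quat_arith)
  have xij: "quat i j (\<alpha> * x1) x0 (- (\<alpha> * x3)) (- x2) * j = quat i j (- (\<beta> * \<alpha> * x3)) (- (\<beta> * x2)) (\<alpha> * x1) x0"
    using quat_mult[OF gens, of "\<alpha> * x1" x0 "- (\<alpha> * x3)" "- x2" 0 0 1 0] by (simp add: quat_arith mult_ac)
  have "x0 = 0 \<or> 1 \<in> I" "\<alpha> * x1 = 0 \<or> 1 \<in> I" "\<beta> * x2 = 0 \<or> 1 \<in> I" "- (\<beta> * \<alpha> * x3) = 0 \<or> 1 \<in> I"
    using r[OF X(1)[unfolded x]] r[OF m(1)[unfolded xi]] r[OF m(2)[unfolded xj]] r[OF m'[unfolded xi xij]] by blast+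
  moreover have "\<not> (x0 = 0 \<and> x1 = 0 \<and> x2 = 0 \<and> x3 = 0)" using X(2) by (auto simp: x quat_def)
  ultimately show "1 \<in> I" using g by auto
qed

end

text \<open>Writing \<open>M = S (s\<^sub>1 s\<^sub>2)\<^sup>-\<^sup>1\<close>, the adjoint involution of \<open>S\<close> is \<open>e \<mapsto> - e\<close> on the generators, hence
  that of \<open>M\<close> is \<open>e \<mapsto> - s e s\<^sup>-\<^sup>1\<close> with \<open>s\<close> the factor of \<open>s\<^sub>1 s\<^sub>2\<close> in the same quaternion algebra.\<close>

lemma biquat_imp_decomposable_alg:
  fixes M :: "'a::field m4"
  assumes 2: "(2::'a) \<noteq> 0" and Mi: "Mi * M = 1" and D: "biquat_decomposable M"
  shows "decomposable_alg m4_alg (\<lambda>X. Mi * tr4 X * M)"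
proof -
  obtain \<alpha>1 \<beta>1 i1 j1 \<alpha>2 \<beta>2 i2 j2 x0 x1 x2 x3 y0 y1 y2 y3 where
    B: "biquat \<alpha>1 \<beta>1 i1 j1 \<alpha>2 \<beta>2 i2 j2"
    and d: "det4 (quat i1 j1 x0 x1 x2 x3 * quat i2 j2 y0 y1 y2 y3) \<noteq> 0"
    and sk: "\<And>e. e \<in> {i1, j1, i2, j2} \<Longrightarrow> tr4 e * (M * quat i1 j1 x0 x1 x2 x3 * quat i2 j2 y0 y1 y2 y3) =
        - (M * quat i1 j1 x0 x1 x2 x3 * quat i2 j2 y0 y1 y2 y3 * e)"
    using D unfolding biquat_decomposable_def by blast
  let ?\<sigma> = "\<lambda>X. Mi * tr4 X * M"
  have g: "quat_gens \<alpha>1 \<beta>1 i1 j1" "quat_gens \<alpha>2 \<beta>2 i2 j2" using B unfolding biquat_def by blast+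
  interpret Q1: quat_sub \<alpha>1 \<beta>1 i1 j1 by (rule quat_sub.intro[OF 2 g(1)])
  interpret Q2: quat_sub \<alpha>2 \<beta>2 i2 j2 by (rule quat_sub.intro[OF 2 g(2)])
  define s1 where "s1 = quat i1 j1 x0 x1 x2 x3"
  define s2 where "s2 = quat i2 j2 y0 y1 y2 y3"
  let ?B1 = "quat_vec i1 j1 ` carrier_vec 4" and ?B2 = "quat_vec i2 j2 ` carrier_vec 4"
  have s: "s1 \<in> ?B1" "s2 \<in> ?B2" unfolding quat_vec_image s1_def s2_def by blast+
  have "det4 s1 \<noteq> 0" "det4 s2 \<noteq> 0" using d by (simp_all add: s1_def s2_def)
  then obtain t1 t2 where t: "t1 \<in> ?B1" "s1 * t1 = 1" "t1 * s1 = 1" "t2 \<in> ?B2" "s2 * t2 = 1" "t2 * s2 = 1"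
    using Q1.left_regular_unit[OF s(1)] Q2.left_regular_unit[OF s(2)] by metis
  have comm: "X * Y = Y * X" if "X \<in> ?B1" "Y \<in> ?B2" for X Y
    using that quat_commute(3)[OF B] unfolding quat_vec_image by blast
  have MMi: "M * Mi = 1" using right_inverse4(2)[OF Mi] .
  have \<sigma>e: "?\<sigma> e = - (s1 * s2 * e * t2 * t1)" if "e \<in> {i1, j1, i2, j2}" for e
  proof -
    have "?\<sigma> e = Mi * (tr4 e * (M * s1 * s2)) * t2 * t1"
      by (simp only: mult.assoc) (simp only: mult.assoc[of s2 t2 t1, symmetric] t mult_1 mult_1_right)
    also have "\<dots> = - ((Mi * M) * s1 * s2 * e * t2 * t1)"
      using sk[OF that, folded s1_def s2_def] by (simp add: mult.assoc)
    finally show ?thesis using Mi by simp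
  qed
  have \<sigma>1: "?\<sigma> e = (- 1) *s (s1 * e * t1)" if e: "e \<in> {i1, j1}" for e
  proof -
    have "e \<in> ?B1" using e Q1.gens_mem by auto
    have "s2 * e * t2 = e * (s2 * t2)" by (simp only: mult.assoc[symmetric] comm[OF \<open>e \<in> ?B1\<close> s(2)])
    hence "s2 * e * t2 = e" using t(5) by simp
    moreover have "s1 * s2 * e * t2 * t1 = s1 * (s2 * e * t2) * t1" by (simp only: mult.assoc)
    ultimately have "s1 * s2 * e * t2 * t1 = s1 * e * t1" by simp
    thus ?thesis using \<sigma>e[of e] e by auto
  qed
  have \<sigma>2: "?\<sigma> e = (- 1) *s (s2 * e * t2)" if e: "e \<in> {i2, j2}" for e
  proof -
    have "e \<in> ?B2" using e Q2.gens_mem by auto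
    hence "s2 * e * t2 \<in> ?B2" using s t by (intro Q2.mult_mem)
    from comm[OF s(1) this] have "s1 * (s2 * e * t2) * t1 = s2 * e * t2 * (s1 * t1)" by (simp only: mult.assoc[symmetric])
    hence "s1 * (s2 * e * t2) * t1 = s2 * e * t2" using t(2) by simp
    thus ?thesis using \<sigma>e[of e] e by (simp add: mult.assoc)
  qed
  have lin: "?\<sigma> (X + Y) = ?\<sigma> X + ?\<sigma> Y" "?\<sigma> (c *s X) = c *s ?\<sigma> X" "?\<sigma> 1 = 1" for X Y c
    by (simp_all add: distrib_left distrib_right Mi)
  have anti: "?\<sigma> (X * Y) = ?\<sigma> Y * ?\<sigma> X" for X Y
  proof -
    have "?\<sigma> Y * ?\<sigma> X = Mi * tr4 Y * (M * Mi) * tr4 X * M" by (simp only: mult.assoc)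
    thus ?thesis using MMi by (simp add: mult.assoc)
  qed
  have inj: "X = Y" if "?\<sigma> X = ?\<sigma> Y" for X Y
  proof -
    have "M * ?\<sigma> X * Mi = M * ?\<sigma> Y * Mi" using that by simp
    hence "(M * Mi) * tr4 X * (M * Mi) = (M * Mi) * tr4 Y * (M * Mi)" by (simp only: mult.assoc)
    hence "tr4 (tr4 X) = tr4 (tr4 Y)" using MMi by simp
    thus ?thesis by simp
  qed
  have st1: "?\<sigma> X \<in> ?B1" if X: "X \<in> ?B1" for X
  proof -
    obtain a b c d where x: "X = quat i1 j1 a b c d" using quat_vec_image_obtain[OF X] .
    have ij: "?\<sigma> i1 \<in> ?B1" "?\<sigma> j1 \<in> ?B1"
      by (subst \<sigma>1, simp, intro Q1.smul_mem Q1.mult_mem s t Q1.gens_mem)+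
    have "?\<sigma> X = a *s 1 + b *s ?\<sigma> i1 + c *s ?\<sigma> j1 + d *s (?\<sigma> j1 * ?\<sigma> i1)"
      unfolding x quat_def lin anti ..
    moreover have "a *s 1 + b *s U + c *s V + d *s (V * U) \<in> ?B1" if "U \<in> ?B1" "V \<in> ?B1" for U V
      using that by (intro Q1.add_mem Q1.smul_mem Q1.mult_mem Q1.one_mem)
    ultimately show ?thesis using ij by (simp only:)
  qed
  have st2: "?\<sigma> X \<in> ?B2" if X: "X \<in> ?B2" for X
  proof -
    obtain a b c d where x: "X = quat i2 j2 a b c d" using quat_vec_image_obtain[OF X] .
    have ij: "?\<sigma> i2 \<in> ?B2" "?\<sigma> j2 \<in> ?B2"
      by (subst \<sigma>2, simp, intro Q2.smul_mem Q2.mult_mem s t Q2.gens_mem)+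
    have "?\<sigma> X = a *s 1 + b *s ?\<sigma> i2 + c *s ?\<sigma> j2 + d *s (?\<sigma> j2 * ?\<sigma> i2)"
      unfolding x quat_def lin anti ..
    moreover have "a *s 1 + b *s U + c *s V + d *s (V * U) \<in> ?B2" if "U \<in> ?B2" "V \<in> ?B2" for U V
      using that by (intro Q2.add_mem Q2.smul_mem Q2.mult_mem Q2.one_mem)
    ultimately show ?thesis using ij by (simp only:)
  qed
  interpret T: tensor_algs Q1.A Q2.A
    by (intro tensor_algs.intro tensor_pair.intro tensor_algs_axioms.intro Q1.vs Q2.vs Q1.algebra Q2.algebra)
  let ?s1 = "\<lambda>x. Q1.qi (?\<sigma> (quat_vec i1 j1 x))" and ?s2 = "\<lambda>x. Q2.qi (?\<sigma> (quat_vec i2 j2 x))"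
  have a1: "anti_automorphism Q1.A ?s1" by (rule Q1.anti_automorphismI[OF lin(1,2) anti lin(3) inj st1])
  have a2: "anti_automorphism Q2.A ?s2" by (rule Q2.anti_automorphismI[OF lin(1,2) anti lin(3) inj st2])
  define u where "u k = (unit_vec 4 k :: 'a vec)" for k
  have q1u: "quat_vec i1 j1 (u 0) = 1" "quat_vec i1 j1 (u 1) = i1" "quat_vec i1 j1 (u 2) = j1" "quat_vec i1 j1 (u 3) = i1 * j1"
    by (simp_all add: quat_vec_def u_def quat_def)
  have B': "X * i1 = i1 * X" "X * j1 = j1 * X" "X * (i1 * j1) = i1 * j1 * X" if "X \<in> ?B2" for X
    using comm[OF _ that] Q1.gens_mem Q1.mult_mem by metis+
  \<comment> \<open>The basis of the first algebra is \<open>1, i1, j1, i1 * j1\<close>; injectivity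
    and surjectivity on normal forms are the independence and the spanning property of the sixteen
    products.\<close>
  have iso: "isomorphic_with_anti m4_alg ?\<sigma> (tensor_alg Q1.A Q2.A) (tensor_map Q1.A ?s1 Q2.A ?s2)"
  proof (rule T.isomorphic_with_antiI[where ?q1.0 = "quat_vec i1 j1" and ?q2.0 = "quat_vec i2 j2"
        and ?e0.0 = "u 0" and ?e1.0 = "u 1" and ?e2.0 = "u 2" and ?e3.0 = "u 3"])
    show "quat_vec i1 j1 \<in> LinearCombinations.module_hom class_ring Q1.A m4_alg"
      by (rule module_homI) (simp_all add: Q1.q_lin)
    show "quat_vec i2 j2 \<in> LinearCombinations.module_hom class_ring Q2.A m4_alg"
      by (rule module_homI) (simp_all add: Q2.q_lin)
    fix x assume x: "x \<in> carrier Q1.A"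
    have "x = (x $ 0) \<cdot>\<^sub>v u 0 + ((x $ 1) \<cdot>\<^sub>v u 1 + ((x $ 2) \<cdot>\<^sub>v u 2 + (x $ 3) \<cdot>\<^sub>v u 3))"
      using x by (intro eq_vecI) (auto simp: u_def dest!: less_4_cases)
    thus "\<exists>c0 c1 c2 c3. x = c0 \<odot>\<^bsub>Q1.A\<^esub> u 0 \<oplus>\<^bsub>Q1.A\<^esub> (c1 \<odot>\<^bsub>Q1.A\<^esub> u 1 \<oplus>\<^bsub>Q1.A\<^esub> (c2 \<odot>\<^bsub>Q1.A\<^esub> u 2 \<oplus>\<^bsub>Q1.A\<^esub> c3 \<odot>\<^bsub>Q1.A\<^esub> u 3))"
      unfolding Q1.A_simps by blast
  next
    fix y0 y1 y2 y3 z0 z1 z2 z3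
    assume c: "{y0, y1, y2, y3, z0, z1, z2, z3} \<subseteq> carrier Q2.A"
      and e: "quat_vec i1 j1 (u 0) * quat_vec i2 j2 y0 + (quat_vec i1 j1 (u 1) * quat_vec i2 j2 y1 +
        (quat_vec i1 j1 (u 2) * quat_vec i2 j2 y2 + quat_vec i1 j1 (u 3) * quat_vec i2 j2 y3)) =
        quat_vec i1 j1 (u 0) * quat_vec i2 j2 z0 + (quat_vec i1 j1 (u 1) * quat_vec i2 j2 z1 +
        (quat_vec i1 j1 (u 2) * quat_vec i2 j2 z2 + quat_vec i1 j1 (u 3) * quat_vec i2 j2 z3))"
    have mem: "quat_vec i2 j2 w \<in> ?B2" if "w \<in> {y0, y1, y2, y3, z0, z1, z2, z3}" for w using c that by auto
    define D where "D y z = quat_vec i2 j2 y - quat_vec i2 j2 z" for y z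
    have D: "D y z = quat i2 j2 (y $ 0 - z $ 0) (y $ 1 - z $ 1) (y $ 2 - z $ 2) (y $ 3 - z $ 3)" for y z
      by (simp add: D_def quat_vec_def quat_arith)
    have "D y0 z0 + D y1 z1 * i1 + D y2 z2 * j1 + D y3 z3 * (i1 * j1) = 0"
      using e unfolding q1u mult_1 B'(1-3)[OF mem, symmetric, simplified] D_def
      by (simp add: left_diff_distrib B'[OF mem] algebra_simps)
    from biquat_indep[OF 2 B this[unfolded D]] c show "y0 = z0 \<and> y1 = z1 \<and> y2 = z2 \<and> y3 = z3"
      by (auto intro!: eq_vecI dest!: less_4_cases)
  next
    fix X :: "'a m4"
    obtain a0 a1 a2 a3 b0 b1 b2 b3 c0 c1 c2 c3 d0 d1 d2 d3 where
      X: "X = quat i2 j2 a0 a1 a2 a3 + quat i2 j2 b0 b1 b2 b3 * i1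
       + quat i2 j2 c0 c1 c2 c3 * j1 + quat i2 j2 d0 d1 d2 d3 * (i1 * j1)" using biquat_span[OF 2 B] by blast
    have qv: "\<exists>y\<in>carrier_vec 4. quat i2 j2 a b c d = quat_vec i2 j2 y" for a b c d
    proof -
      have "quat i2 j2 a b c d \<in> ?B2" unfolding quat_vec_image by blast
      thus ?thesis by (elim imageE) (rule bexI)
    qed
    obtain y0 where y0: "y0 \<in> carrier_vec 4" "quat i2 j2 a0 a1 a2 a3 = quat_vec i2 j2 y0" by (rule bexE[OF qv])
    obtain y1 where y1: "y1 \<in> carrier_vec 4" "quat i2 j2 b0 b1 b2 b3 = quat_vec i2 j2 y1" by (rule bexE[OF qv])
    obtain y2 where y2: "y2 \<in> carrier_vec 4" "quat i2 j2 c0 c1 c2 c3 = quat_vec i2 j2 y2" by (rule bexE[OF qv])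
    obtain y3 where y3: "y3 \<in> carrier_vec 4" "quat i2 j2 d0 d1 d2 d3 = quat_vec i2 j2 y3" by (rule bexE[OF qv])
    note y = y0(1) y1(1) y2(1) y3(1) y0(2) y1(2) y2(2) y3(2)
    have "X = quat_vec i1 j1 (u 0) * quat_vec i2 j2 y0 + (quat_vec i1 j1 (u 1) * quat_vec i2 j2 y1 +
        (quat_vec i1 j1 (u 2) * quat_vec i2 j2 y2 + quat_vec i1 j1 (u 3) * quat_vec i2 j2 y3))"
      unfolding X y(5-8) q1u by (simp add: B'[OF Q2.q_mem[OF y(2)]] B'[OF Q2.q_mem[OF y(3)]] B'[OF Q2.q_mem[OF y(4)]] add.assoc)
    thus "\<exists>y0 y1 y2 y3. {y0, y1, y2, y3} \<subseteq> carrier Q2.A \<and>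
      X = quat_vec i1 j1 (u 0) * quat_vec i2 j2 y0 + (quat_vec i1 j1 (u 1) * quat_vec i2 j2 y1 +
        (quat_vec i1 j1 (u 2) * quat_vec i2 j2 y2 + quat_vec i1 j1 (u 3) * quat_vec i2 j2 y3))"
      using y(1-4) by (intro exI[of _ y0] exI[of _ y1] exI[of _ y2] exI[of _ y3]) simp
  next
    show "?s1 \<in> LinearCombinations.module_hom class_ring Q1.A Q1.A" "?s2 \<in> LinearCombinations.module_hom class_ring Q2.A Q2.A"
      using a1 a2 linear_isosD(1) unfolding anti_automorphism_def by blast+
    show "quat_vec i2 j2 y * quat_vec i1 j1 x = quat_vec i1 j1 x * quat_vec i2 j2 y"
      if "x \<in> carrier Q1.A" "y \<in> carrier Q2.A" for x y
      by (rule comm[symmetric, OF Q1.q_mem Q2.q_mem]) (use that in simp_all)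
  qed (use lin anti st1 st2 Q1.mult_mem Q2.mult_mem Q1.one_mem Q2.one_mem in \<open>simp_all add: u_def\<close>)
  show ?thesis unfolding decomposable_alg_def
    using Q1.csa Q2.csa a1 a2 Q1.degree Q2.degree iso by (metis order_refl)
qed

section \<open>Central simple algebras of dimension four\<close>

locale csa4 = subalg4 q for q :: "'a::field vec \<Rightarrow> 'a m4" +
  assumes two: "(2::'a) \<noteq> 0"
    and center: "\<And>X. X \<in> q ` carrier_vec 4 \<Longrightarrow> (\<And>Y. Y \<in> q ` carrier_vec 4 \<Longrightarrow> X * Y = Y * X) \<Longrightarrow> \<exists>c. X = c *s 1"
    and simple: "\<And>I X. I \<subseteq> q ` carrier_vec 4 \<Longrightarrow> (\<And>X Y. X \<in> I \<Longrightarrow> Y \<in> I \<Longrightarrow> X + Y \<in> I)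
      \<Longrightarrow> (\<And>X Y. X \<in> I \<Longrightarrow> Y \<in> q ` carrier_vec 4 \<Longrightarrow> X * Y \<in> I \<and> Y * X \<in> I) \<Longrightarrow> X \<in> I \<Longrightarrow> X \<noteq> 0 \<Longrightarrow> 1 \<in> I"
begin

abbreviation "B \<equiv> q ` C"

lemma minus_mem: "X \<in> B \<Longrightarrow> - X \<in> B" "X \<in> B \<Longrightarrow> Y \<in> B \<Longrightarrow> X - Y \<in> B"
proof -
  show n: "- X \<in> B" if "X \<in> B" for X using smul_mem[OF that, of "- 1"] by simp
  show "X \<in> B \<Longrightarrow> Y \<in> B \<Longrightarrow> X - Y \<in> B" using add_mem[OF _ n, of X Y] by simp
qed

text \<open>Sending coordinates to the coordinates of the corresponding combination of
  \<open>e0\<close>, ..., \<open>e3\<close> is an injective linear map of the coordinate space to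
  itself, hence onto.\<close>

lemma independent_spans:
  assumes e: "e0 \<in> B" "e1 \<in> B" "e2 \<in> B" "e3 \<in> B"
    and ind: "\<And>c0 c1 c2 c3. c0 *s e0 + c1 *s e1 + c2 *s e2 + c3 *s e3 = 0 \<Longrightarrow> c0 = 0 \<and> c1 = 0 \<and> c2 = 0 \<and> c3 = 0"
    and Y: "Y \<in> B"
  obtains c0 c1 c2 c3 where "Y = c0 *s e0 + c1 *s e1 + c2 *s e2 + c3 *s e3"
proof -
  let ?l = "\<lambda>x. (x $ 0) *s e0 + (x $ 1) *s e1 + (x $ 2) *s e2 + (x $ 3) *s e3"
  have mem: "?l x \<in> B" for x using e by (intro add_mem smul_mem)
  have "(\<lambda>x. qi (?l x)) \<in> LinearCombinations.module_hom class_ring (coord_space 4) (coord_space 4)"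
  proof (rule module_homI, unfold coord_space_simps)
    fix x y :: "'a vec" and c assume x: "x \<in> C"
    show "qi (?l x) \<in> C" using q_qi(2)[OF mem] .
    have "?l (c \<cdot>\<^sub>v x) = c *s ?l x" using x by (simp add: smul_distrib)
    hence "q (qi (?l (c \<cdot>\<^sub>v x))) = q (c \<cdot>\<^sub>v qi (?l x))" unfolding q_qi(1)[OF mem] q_lin(2)[OF q_qi(2)[OF mem]] .
    thus "qi (?l (c \<cdot>\<^sub>v x)) = c \<cdot>\<^sub>v qi (?l x)" by (rule q_eqI[OF q_qi(2)[OF mem] smult_carrier_vec[THEN iffD2, OF q_qi(2)[OF mem]]])
    assume y: "y \<in> C"
    have "?l (x + y) = ?l x + ?l y" using x y by (simp add: smul_distrib)
    hence "q (qi (?l (x + y))) = q (qi (?l x) + qi (?l y))" unfolding q_qi(1)[OF mem] q_lin(1)[OF q_qi(2)[OF mem] q_qi(2)[OF mem]] .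
    thus "qi (?l (x + y)) = qi (?l x) + qi (?l y)" by (rule q_eqI[OF q_qi(2)[OF mem] add_carrier_vec[OF q_qi(2)[OF mem] q_qi(2)[OF mem]]])
  qed
  moreover have "inj_on (\<lambda>x. qi (?l x)) C"
  proof (rule inj_onI)
    fix x y assume xy: "x \<in> C" "y \<in> C" "qi (?l x) = qi (?l y)"
    have "?l x = ?l y" using arg_cong[OF xy(3), of q] unfolding q_qi(1)[OF mem] .
    hence "?l x - ?l y = 0" by simp
    moreover have "?l x - ?l y = (x $ 0 - y $ 0) *s e0 + (x $ 1 - y $ 1) *s e1 + (x $ 2 - y $ 2) *s e2 + (x $ 3 - y $ 3) *s e3"
      by (simp only: smul_distrib) (simp only: diff_conv_add_uminus minus_add_distrib ac_simps)
    ultimately have "x $ 0 - y $ 0 = 0 \<and> x $ 1 - y $ 1 = 0 \<and> x $ 2 - y $ 2 = 0 \<and> x $ 3 - y $ 3 = 0" using ind by metis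
    thus "x = y" using xy by (intro eq_vecI) (auto dest!: less_4_cases)
  qed
  ultimately have "(\<lambda>x. qi (?l x)) ` C = C"
    using linear_isosD(7)[OF coord_inj_iso, of "\<lambda>x. qi (?l x)"] by (simp only: coord_space_simps)
  hence "qi Y \<in> (\<lambda>x. qi (?l x)) ` C" using q_qi(2)[OF Y] by (simp only:)
  then obtain x where "qi Y = qi (?l x)" by blast
  hence "Y = ?l x" using q_qi(1)[OF Y] q_qi(1)[OF mem, of x] by metis
  thus thesis using that by blast
qed

text \<open>The elements \<open>X\<close> with \<open>X B u = 0\<close> form a two-sided ideal. It
  contains \<open>v\<close>, hence 1 by simplicity.\<close>

lemma prime:
  assumes "v \<in> B" "v \<noteq> 0" "\<And>Y. Y \<in> B \<Longrightarrow> v * Y * u = 0"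
  shows "u = 0"
proof -
  have "1 \<in> {X \<in> B. \<forall>Y\<in>B. X * Y * u = 0}"
  proof (rule simple[of _ v])
    fix X Y assume X: "X \<in> {X \<in> B. \<forall>Y\<in>B. X * Y * u = 0}"
    { assume "Y \<in> {X \<in> B. \<forall>Y\<in>B. X * Y * u = 0}"
      thus "X + Y \<in> {X \<in> B. \<forall>Y\<in>B. X * Y * u = 0}" using X add_mem by (simp add: distrib_right) }
    assume Y: "Y \<in> B"
    have "X * Y * Z * u = 0" if "Z \<in> B" for Z
    proof -
      have "X * (Y * Z) * u = 0" using X mult_mem[OF Y that] by blast
      thus ?thesis by (simp only: mult.assoc)
    qed
    thus "X * Y \<in> {X \<in> B. \<forall>Y\<in>B. X * Y * u = 0} \<and> Y * X \<in> {X \<in> B. \<forall>Y\<in>B. X * Y * u = 0}"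
      using X Y mult_mem by (simp add: mult.assoc)
  qed (use assms in auto)
  hence "1 * 1 * u = 0" using one_mem by blast
  thus ?thesis by simp
qed

lemma quat_span:
  assumes g: "quat_gens \<alpha> \<beta> i j" and m: "i \<in> B" "j \<in> B" and Y: "Y \<in> B"
  obtains c0 c1 c2 c3 where "Y = quat i j c0 c1 c2 c3"
  using independent_spans[OF one_mem m mult_mem[OF m] _ Y]
    quat_eq_0[OF two g] unfolding quat_def by blast

text \<open>Were \<open>1, x, x\<^sup>2, y\<close> a basis with \<open>x y \<noteq> y x\<close>, then \<open>(x - d) y\<close> would commute with \<open>x\<close> for some scalar \<open>d\<close>.
  So \<open>x\<close> is quadratic.\<close>

lemma division_quat_gens:
  assumes dom: "\<And>u v. u \<in> B \<Longrightarrow> v \<in> B \<Longrightarrow> u * v = 0 \<Longrightarrow> u = 0 \<or> v = 0"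
  obtains \<alpha> \<beta> i j where "quat_gens \<alpha> \<beta> i j" "i \<in> B" "j \<in> B"
proof -
  have quadratic: "\<exists>p r. x * x = p *s x + r *s 1" if x: "x \<in> B" and y: "y \<in> B" "x * y \<noteq> y * x" for x y
  proof (rule ccontr)
    assume nq: "\<nexists>p r. x * x = p *s x + r *s 1"
    have xn: "x - \<gamma> *s 1 \<noteq> 0" for \<gamma> using y(2) by auto
    have ind: "c0 = 0 \<and> c1 = 0 \<and> c2 = 0 \<and> c3 = 0" if e: "c0 *s 1 + c1 *s x + c2 *s (x * x) + c3 *s y = 0" for c0 c1 c2 c3
    proof -
      have "x * (c0 *s 1 + c1 *s x + c2 *s (x * x) + c3 *s y) - (c0 *s 1 + c1 *s x + c2 *s (x * x) + c3 *s y) * x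
         = c3 *s (x * y - y * x)" by (simp add: distrib_left distrib_right smul_distrib mult.assoc)
      hence c3: "c3 = 0" using e y(2) by simp
      have "c2 = 0"
      proof (rule ccontr)
        assume "c2 \<noteq> 0"
        have "c2 *s (x * x) = (- c1) *s x + (- c0) *s 1" using e c3 by (simp add: add_eq_0_iff)
        hence "(1 / c2) *s c2 *s (x * x) = (- c1 / c2) *s x + (- c0 / c2) *s 1" by (simp only: smul_distrib) simp
        hence "x * x = (- c1 / c2) *s x + (- c0 / c2) *s 1" using \<open>c2 \<noteq> 0\<close> by simp
        thus False using nq by blast
      qed
      moreover have "c1 = 0"
      proof (rule ccontr)
        assume "c1 \<noteq> 0"
        have "c1 *s x = (- c0) *s 1" using e c3 \<open>c2 = 0\<close> by (simp add: add_eq_0_iff)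
        hence "(1 / c1) *s c1 *s x = (- c0 / c1) *s 1" by simp
        hence "x = (- c0 / c1) *s 1" using \<open>c1 \<noteq> 0\<close> by simp
        thus False using xn[of "- c0 / c1"] by simp
      qed
      ultimately show ?thesis using e c3 by (simp add: M4_simps)
    qed
    obtain a b c d where xy: "x * y = a *s 1 + b *s x + c *s (x * x) + d *s y"
      using independent_spans[OF one_mem x mult_mem[OF x x] y(1) ind mult_mem[OF x y(1)]] by blast
    have "(x - d *s 1) * y = a *s 1 + b *s x + c *s (x * x)" using xy by (simp add: left_diff_distrib)
    moreover have "x * (a *s 1 + b *s x + c *s (x * x)) = (a *s 1 + b *s x + c *s (x * x)) * x"
      by (simp add: distrib_left distrib_right mult.assoc)
    ultimately have "x * ((x - d *s 1) * y) = (x - d *s 1) * y * x" by simp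
    hence "(x - d *s 1) * (x * y - y * x) = 0" by (simp add: left_diff_distrib right_diff_distrib mult.assoc)
    thus False using dom[of "x - d *s 1" "x * y - y * x"] xn[of d] y(2) x y(1) minus_mem mult_mem smul_mem one_mem by auto
  qed
  \<comment> \<open>Otherwise every element would be central, hence scalar, and the algebra would
    have dimension one.\<close>
  have "\<exists>x\<in>B. \<exists>y\<in>B. x * y \<noteq> y * x"
  proof (rule ccontr)
    assume "\<not> (\<exists>x\<in>B. \<exists>y\<in>B. x * y \<noteq> y * x)"
    hence c: "\<exists>c. X = c *s 1" if "X \<in> B" for X using center[OF that] that by blast
    let ?u = "\<lambda>k. q (unit_vec 4 k)"
    obtain a b where ab: "?u 0 = a *s 1" "?u 1 = b *s 1" using c[OF q_mem] by (metis unit_vec_carrier)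
    have "q (b \<cdot>\<^sub>v unit_vec 4 0) = q (a \<cdot>\<^sub>v unit_vec 4 1)" by (simp add: q_lin ab[simplified] mult.commute)
    hence "b \<cdot>\<^sub>v unit_vec 4 0 = a \<cdot>\<^sub>v unit_vec 4 1" by (rule q_eqI[rotated 2]) auto
    hence "(b \<cdot>\<^sub>v unit_vec 4 0) $ 1 = (a \<cdot>\<^sub>v unit_vec 4 1) $ 1" by simp
    hence "a = 0" by simp
    hence "q (unit_vec 4 0) = q (0\<^sub>v 4)" using ab(1) q_zero by simp
    hence "unit_vec 4 0 = (0\<^sub>v 4 :: 'a vec)" by (rule q_eqI[rotated 2]) auto
    hence "(unit_vec 4 0 :: 'a vec) $ 0 = 0\<^sub>v 4 $ 0" by simp
    thus False by simp
  qed
  then obtain x y where xy: "x \<in> B" "y \<in> B" "x * y \<noteq> y * x" by blast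
  obtain p r where pr: "x * x = p *s x + r *s 1" using quadratic[OF xy] by blast
  \<comment> \<open>Completing the square makes \<open>i * i\<close> a scalar.\<close>
  define i where "i = x - (p / 2) *s 1"
  have iB: "i \<in> B" unfolding i_def by (intro minus_mem(2) smul_mem one_mem xy(1))
  define \<alpha> where "\<alpha> = r + (p / 2) * (p / 2)"
  have "(p / 2) *s x + (p / 2) *s x = p *s x" using two by (simp add: smul_distrib(2)[symmetric])
  hence ii: "i * i = \<alpha> *s 1"
    by (simp add: i_def \<alpha>_def left_diff_distrib right_diff_distrib smul_distrib pr) (simp add: algebra_simps)
  have iy: "i * y \<noteq> y * i" using xy(3) by (simp add: i_def left_diff_distrib right_diff_distrib)
  hence i0: "i \<noteq> 0" by auto
  have a0: "\<alpha> \<noteq> 0" using dom[OF iB iB] ii i0 by auto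
  \<comment> \<open>A commutator with \<open>i\<close> anticommutes with \<open>i\<close>, because
    \<open>i * i\<close> is scalar.\<close>
  define j where "j = i * y - y * i"
  have jB: "j \<in> B" unfolding j_def by (intro minus_mem(2) mult_mem iB xy(2))
  have j0: "j \<noteq> 0" using iy by (simp add: j_def)
  have iiX: "i * (i * X) = \<alpha> *s X" for X using ii by (simp add: mult.assoc[symmetric])
  have ji: "j * i = - (i * j)" by (simp add: j_def left_diff_distrib right_diff_distrib mult.assoc ii iiX)
  have ij0: "i * j \<noteq> 0" using dom[OF iB jB] i0 j0 by blast
  have "j * i \<noteq> i * j"
  proof
    assume "j * i = i * j"
    hence "i * j + i * j = 0" using ji by (metis add.right_inverse)
    thus False using two_cancel[OF two] ij0 by blast
  qed
  then obtain p' \<beta> where jj: "j * j = p' *s j + \<beta> *s 1" using quadratic[OF jB iB] by blast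
  \<comment> \<open>\<open>j * j\<close> commutes with \<open>i\<close> whereas \<open>j\<close>
    anticommutes with it, so the linear term \<open>p'\<close> of the quadratic equation
    vanishes.\<close>
  have "i * (j * j) = j * j * i"
  proof -
    have "j * j * i = j * (j * i)" by (simp only: mult.assoc)
    also have "\<dots> = j * (- (i * j))" by (rule arg_cong[OF ji])
    also have "\<dots> = - ((j * i) * j)" by (simp only: mult_minus_right mult.assoc)
    also have "\<dots> = i * (j * j)" unfolding ji by (simp only: minus_mult_left[symmetric] minus_minus mult.assoc)
    finally show ?thesis by (rule sym)
  qed
  hence "p' *s (i * j) = p' *s (j * i)" unfolding jj by (simp add: distrib_left distrib_right)
  hence "p' *s (i * j) + p' *s (i * j) = 0" unfolding ji by (metis add.right_inverse smul_simps(7))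
  hence "p' *s (i * j) = 0" using two_cancel[OF two] by blast
  hence "p' = 0" using ij0 by simp
  hence jj: "j * j = \<beta> *s 1" using jj by simp
  hence "\<beta> \<noteq> 0" using dom[OF jB jB] j0 by auto
  hence "quat_gens \<alpha> \<beta> i j" unfolding quat_gens_def using a0 ii jj ji by blast
  thus thesis using that iB jB by blast
qed

text \<open>A zero divisor gives a nilpotent \<open>z\<close>, and \<open>z B z\<close> is a line because right multiplication by \<open>z\<close> maps
  \<open>z B \<noteq> B\<close> onto it with kernel containing it. This yields matrix units \<open>n\<close>, \<open>m\<^sub>1\<close>.\<close>

lemma split_quat_gens:
  assumes u: "u \<in> B" "v \<in> B" "u * v = 0" "u \<noteq> 0" "v \<noteq> 0"
  obtains \<alpha> \<beta> i j where "quat_gens \<alpha> \<beta> i j" "i \<in> B" "j \<in> B"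
proof -
  obtain w where w: "w \<in> B" "v * w * u \<noteq> 0" using prime[OF u(2,5)] u(4) by blast
  define z where "z = v * w * u"
  have z: "z \<in> B" "z \<noteq> 0" unfolding z_def using w u mult_mem by auto
  have "z * z = v * w * (u * v) * w * u" by (simp only: z_def mult.assoc)
  hence zz: "z * z = 0" using u(3) by simp
  have zzX: "z * (z * X) = 0" for X using zz by (simp add: mult.assoc[symmetric])
  obtain w0 where w0: "w0 \<in> B" "z * w0 * z \<noteq> 0" using prime[OF z] z(2) by blast
  define n where "n = z * w0 * z"
  have n: "n \<in> B" "n \<noteq> 0" unfolding n_def using w0 z mult_mem by auto
  have nz: "n * z = 0" "z * n = 0" by (simp_all add: n_def mult.assoc zz zzX)
  have nn: "n * n = 0" unfolding n_def using zz by (metis (no_types) mult.assoc mult_zero_left mult_zero_right)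
  \<comment> \<open>If \<open>z t z\<close> were not a multiple of \<open>n\<close>, the elements
    \<open>z w0\<close>, \<open>z t\<close>, \<open>n\<close>, \<open>z t z\<close> would be
    independent and hence span \<open>B\<close>. All of them are killed by left multiplication with
    \<open>z\<close>, and 1 is not.\<close>
  have line: "\<exists>c. z * t * z = c *s n" if t: "t \<in> B" for t
  proof (rule ccontr)
    assume nc: "\<nexists>c. z * t * z = c *s n"
    have key: "a = 0 \<and> b = 0" if e: "a *s n + b *s (z * t * z) = 0" for a b
    proof -
      have "b = 0"
      proof (rule ccontr)
        assume "b \<noteq> 0"
        have "b *s (z * t * z) = (- a) *s n" using e by (simp add: add_eq_0_iff)
        hence "(1 / b) *s b *s (z * t * z) = (- a / b) *s n" by simp
        hence "z * t * z = (- a / b) *s n" using \<open>b \<noteq> 0\<close> by simp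
        thus False using nc by blast
      qed
      thus ?thesis using e n(2) by simp
    qed
    have ind: "c0 = 0 \<and> c1 = 0 \<and> c2 = 0 \<and> c3 = 0"
      if e: "c0 *s (z * w0) + c1 *s (z * t) + c2 *s n + c3 *s (z * t * z) = 0" for c0 c1 c2 c3
    proof -
      have "(c0 *s (z * w0) + c1 *s (z * t) + c2 *s n + c3 *s (z * t * z)) * z = c0 *s n + c1 *s (z * t * z)"
        by (simp add: distrib_right nz n_def[symmetric] mult.assoc zz) (simp add: n_def mult.assoc)
      hence 01: "c0 = 0 \<and> c1 = 0" using e key by simp
      hence "c2 *s n + c3 *s (z * t * z) = 0" using e by simp
      thus ?thesis using key 01 by blast
    qed
    have mem: "z * w0 \<in> B" "z * t \<in> B" "z * t * z \<in> B" using z w0 t mult_mem by auto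
    obtain c0 c1 c2 c3 where "1 = c0 *s (z * w0) + c1 *s (z * t) + c2 *s n + c3 *s (z * t * z)"
      using independent_spans[OF mem(1,2) n(1) mem(3) ind one_mem] by blast
    hence "z * 1 = z * (c0 *s (z * w0) + c1 *s (z * t) + c2 *s n + c3 *s (z * t * z))" by simp
    also have "\<dots> = 0" by (simp add: distrib_left nz zzX mult.assoc)
    finally show False using z(2) by simp
  qed
  obtain w1 where w1: "w1 \<in> B" "n * w1 * n \<noteq> 0" using prime[OF n] n(2) by blast
  have nline: "\<exists>c. n * t * n = c *s n" if t: "t \<in> B" for t
    using line[of "w0 * z * t * z * w0"] t z w0 mult_mem by (simp add: n_def mult.assoc)
  obtain d where d: "n * w1 * n = d *s n" using nline[OF w1(1)] by blast
  hence d0: "d \<noteq> 0" using w1(2) by auto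
  \<comment> \<open>\<open>m0\<close> is scaled to satisfy \<open>n m0 n = n\<close>;
    \<open>m = m0 n m0\<close> satisfies \<open>m n m = m\<close> in addition; subtracting
    \<open>c *s (n * m)\<close> makes it nilpotent and preserves both identities.\<close>
  define m0 where "m0 = (1 / d) *s w1"
  have m0: "m0 \<in> B" "n * m0 * n = n" unfolding m0_def using w1 smul_mem d d0 by simp_all
  define m where "m = m0 * n * m0"
  have nX: "n * (n * X) = 0" "n * (m0 * (n * X)) = n * X" for X using nn m0(2) by (metis mult.assoc mult_zero_left)+
  have m: "m \<in> B" "n * m * n = n" "m * n * m = m"
    unfolding m_def using m0 n mult_mem by (auto simp: mult.assoc nX m0(2)[unfolded mult.assoc])
  obtain c where c: "n * (m0 * m0) * n = c *s n" using nline[OF mult_mem[OF m0(1) m0(1)]] by blast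
  have mm: "m * m = c *s m"
  proof -
    have "m * m = m0 * (n * (m0 * m0) * n) * m0" by (simp only: m_def mult.assoc)
    thus ?thesis unfolding c by (simp add: m_def mult.assoc)
  qed
  define m1 where "m1 = m - c *s (n * m)"
  have m1: "m1 \<in> B" unfolding m1_def by (intro minus_mem(2) smul_mem mult_mem m(1) n(1))
  have mnn: "n * m * n = n" "m * n * m = m" by (rule m(2), rule m(3))
  have mX: "n * (m * (n * X)) = n * X" "m * (n * (m * X)) = m * X" "m * (m * X) = c *s (m * X)" for X
    by (simp_all only: mult.assoc[symmetric] m(2,3) mm smul_simps(1))
  note mr = mX nX(1) nn mm m(2,3)[unfolded mult.assoc]
  have n1: "n * (m1 * n) = n" by (simp add: m1_def left_diff_distrib right_diff_distrib mult.assoc mr)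
  have m11: "m1 * m1 = 0" by (simp add: m1_def left_diff_distrib right_diff_distrib mult.assoc mr smul_distrib)
  have mn1: "m1 * (n * m1) = m1" by (simp add: m1_def left_diff_distrib right_diff_distrib mult.assoc mr smul_distrib)
  have X1: "n * (m1 * (n * X)) = n * X" "m1 * (n * (m1 * X)) = m1 * X" "m1 * (m1 * X) = 0" for X
    by (simp_all only: mult.assoc[symmetric] n1[unfolded mult.assoc[symmetric]] mn1[unfolded mult.assoc[symmetric]] m11 mult_zero_left)
  note r1 = X1 nX(1) nn m11 n1 mn1
  have m10: "m1 \<noteq> 0" using n1 n(2) by auto
  \<comment> \<open>\<open>?e\<close>, \<open>?f\<close>, \<open>n\<close>, \<open>m1\<close>
    multiply like the four matrix units of size two. They are independent, and expanding 1 in them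
    shows that the idempotents \<open>?e\<close> and \<open>?f\<close> add up to 1.\<close>
  let ?e = "n * m1" and ?f = "m1 * n"
  have prod: "?e * (a *s ?e + b *s ?f + c *s n + d *s m1) = a *s ?e + c *s n"
    "?f * (a *s ?e + b *s ?f + c *s n + d *s m1) = b *s ?f + d *s m1"
    "(a *s ?e + c *s n) * n = a *s n" "(b *s ?f + d *s m1) * m1 = b *s m1" for a b c d
    by (simp_all add: distrib_left distrib_right mult.assoc r1)
  have ind: "a = 0 \<and> b = 0 \<and> c = 0 \<and> d = 0" if e: "a *s ?e + b *s ?f + c *s n + d *s m1 = 0" for a b c d
  proof -
    have 1: "a *s ?e + c *s n = 0" "b *s ?f + d *s m1 = 0" using prod(1,2)[of a b c d] e by simp_all
    hence "a = 0" "b = 0" using prod(3)[of a c] prod(4)[of b d] n(2) m10 by simp_all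
    thus ?thesis using 1 n(2) m10 by simp
  qed
  have mem: "?e \<in> B" "?f \<in> B" by (intro mult_mem n(1) m1)+
  obtain a b c d where one: "1 = a *s ?e + b *s ?f + c *s n + d *s m1"
    using independent_spans[OF mem n(1) m1 ind one_mem] by blast
  have ef: "?e = a *s ?e + c *s n" "?f = b *s ?f + d *s m1" using prod(1,2)[of a b c d] unfolding one[symmetric] by simp_all
  have "n = a *s n" using arg_cong[OF ef(1), of "\<lambda>X. X * n"] unfolding prod(3) by (simp add: mult.assoc r1)
  hence "1 *s n = a *s n" by simp
  hence "a = 1" by (metis n(2) smul_distrib(4) smul_eq_0_iff eq_iff_diff_eq_0)
  moreover have "m1 = b *s m1" using arg_cong[OF ef(2), of "\<lambda>X. X * m1"] unfolding prod(4) by (simp add: mult.assoc r1)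
  hence "1 *s m1 = b *s m1" by simp
  hence "b = 1" by (metis m10 smul_distrib(4) smul_eq_0_iff eq_iff_diff_eq_0)
  ultimately have ab: "a = 1" "b = 1" by blast+
  have "c *s n = 0" "d *s m1 = 0" using ef unfolding ab smul_simps(4) by (metis add_left_cancel add.right_neutral)+
  hence sum: "?e + ?f = 1" using one unfolding ab smul_simps(4) by (simp only: add.right_neutral)
  \<comment> \<open>In terms of matrix units, \<open>?e - ?f\<close> is the diagonal matrix
    \<open>(1, -1)\<close> and \<open>n + m1\<close> the swap: anticommuting elements of square
    1.\<close>
  have "(?e - ?f) * (?e - ?f) = ?e + ?f" "(n + m1) * (n + m1) = ?e + ?f"
    "(n + m1) * (?e - ?f) = m1 - n" "(?e - ?f) * (n + m1) = n - m1"
    by (simp_all add: distrib_left distrib_right left_diff_distrib right_diff_distrib mult.assoc r1)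
  hence "quat_gens 1 1 (?e - ?f) (n + m1)" unfolding quat_gens_def sum by simp
  thus thesis by (rule that[OF _ minus_mem(2)[OF mem] add_mem[OF n(1) m1]])
qed

lemma ex_quat_gens:
  obtains \<alpha> \<beta> i j where "quat_gens \<alpha> \<beta> i j" "i \<in> B" "j \<in> B"
  using division_quat_gens split_quat_gens by blast

text \<open>The intertwiner is \<open>\<Sum> e' y e\<^sup>-\<^sup>1\<close> over the basis \<open>1, i, j, ij\<close>, multiplied by \<open>\<alpha> \<beta>\<close>.\<close>

lemma skolem_noether:
  assumes g: "quat_gens \<alpha> \<beta> i j" "i \<in> B" "j \<in> B" and g': "quat_gens \<alpha> \<beta> i' j'" "i' \<in> B" "j' \<in> B"
  obtains s where "s \<in> B" "det4 s \<noteq> 0" "i' * s = s * i" "j' * s = s * j"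
proof -
  note G = quat_gensD[OF g(1)] and G' = quat_gensD[OF g'(1)]
  define T where "T y = (\<alpha> * \<beta>) *s y + \<beta> *s (i' * y * i) + \<alpha> *s (j' * y * j) - i' * j' * y * i * j" for y
  have TB: "T y \<in> B" if "y \<in> B" for y
    unfolding T_def using that g g' by (intro minus_mem add_mem smul_mem mult_mem)
  have jij: "j * (i * X) = - (i * (j * X))" for X using G(8) .
  have Ti: "i' * T y = T y * i" "j' * T y = T y * j" for y
    unfolding T_def by (simp_all add: distrib_left distrib_right left_diff_distrib right_diff_distrib mult.assoc G G' mult_ac add_ac)
  have "\<exists>y\<in>B. T y \<noteq> 0"
  proof (rule ccontr)
    assume "\<not> (\<exists>y\<in>B. T y \<noteq> 0)"
    hence T0: "T y = 0" if "y \<in> B" for y using that by blast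
    \<comment> \<open>If \<open>T\<close> vanished on \<open>B\<close>, this identity would give
      \<open>y i = - i' y\<close> for all \<open>y\<close>. Then \<open>y = 1\<close> yields
      \<open>i' = - i\<close>, and \<open>y = j\<close> makes \<open>i\<close> and \<open>j\<close>
      commute.\<close>
    have sum: "T (y * i) + T y * i = (\<alpha> * \<beta>) *s (y * i + i' * y) + (\<alpha> * \<beta>) *s (y * i + i' * y)" for y
      unfolding T_def by (simp add: distrib_left distrib_right left_diff_distrib right_diff_distrib mult.assoc G G' smul_distrib mult_ac add_ac)
    have yi: "y * i + i' * y = 0" if "y \<in> B" for y
    proof -
      have "(\<alpha> * \<beta>) *s (y * i + i' * y) + (\<alpha> * \<beta>) *s (y * i + i' * y) = 0"
        unfolding sum[symmetric] T0[OF that] T0[OF mult_mem[OF that g(2)]] by simp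
      hence "(\<alpha> * \<beta>) *s (y * i + i' * y) = 0" by (rule two_cancel[OF two])
      thus ?thesis using G(1,2) by simp
    qed
    have i': "i' = - i" using yi[OF one_mem] by (simp add: eq_neg_iff_add_eq_0 add.commute)
    have "i * j = j * i" using yi[OF g(3)] unfolding i' by simp
    hence "i * j + i * j = 0" using G(5) by (metis add.right_inverse)
    hence "i * j = 0" using two_cancel[OF two] by blast
    hence "i * (i * j) * j = 0" by simp
    thus False using G by simp
  qed
  then obtain y where y: "y \<in> B" "T y \<noteq> 0" by blast
  let ?s = "T y"
  \<comment> \<open>The intertwining property turns \<open>B ?s\<close> into a two-sided ideal; by
    simplicity it contains 1, so \<open>?s\<close> is invertible.\<close>
  have "1 \<in> (\<lambda>X. X * ?s) ` B"
  proof (rule simple[of _ ?s])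
    show "(\<lambda>X. X * ?s) ` B \<subseteq> B" using TB[OF y(1)] mult_mem by blast
    show "?s \<in> (\<lambda>X. X * ?s) ` B" using one_mem by (intro image_eqI[of _ _ 1]) simp_all
    fix U V assume "U \<in> (\<lambda>X. X * ?s) ` B"
    then obtain X where X: "X \<in> B" "U = X * ?s" by blast
    { assume "V \<in> (\<lambda>X. X * ?s) ` B"
      then obtain Y where "Y \<in> B" "V = Y * ?s" by blast
      thus "U + V \<in> (\<lambda>X. X * ?s) ` B" using X add_mem by (intro image_eqI[of _ _ "X + Y"]) (simp_all add: distrib_right) }
    assume V: "V \<in> B"
    obtain c0 c1 c2 c3 where v: "V = quat i j c0 c1 c2 c3" using quat_span[OF g V] .
    let ?V = "quat i' j' c0 c1 c2 c3"
    have sij: "?s * (i * j) = i' * j' * ?s"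
      using Ti[of y] by (metis mult.assoc)
    have "?s * V = ?V * ?s" unfolding v quat_def by (simp add: distrib_left distrib_right Ti sij)
    moreover have "?V \<in> B" unfolding quat_def using g' one_mem by (intro add_mem smul_mem mult_mem)
    ultimately show "U * V \<in> (\<lambda>X. X * ?s) ` B \<and> V * U \<in> (\<lambda>X. X * ?s) ` B"
      using X V mult_mem by (auto simp: mult.assoc[symmetric] intro!: image_eqI[of _ _ "X * ?V"]) (simp_all add: mult.assoc)
  qed (use y add_mem in auto)
  then obtain X where "X * ?s = 1" by auto
  hence "det4 ?s \<noteq> 0" by (metis right_inverse4)
  thus thesis using that TB[OF y(1)] Ti by blast
qed

end

section \<open>Decompositions of the matrix algebra\<close>

lemma m4_alg_dim: "vectorspace.fin_dim class_ring (m4_alg :: ('a::field, 'a m4) module)"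
  "vectorspace.dim class_ring (m4_alg :: ('a::field, 'a m4) module) = 16"
proof -
  have "(\<lambda>x. of_fun4 (\<lambda>i j. x $ (4 * i + j))) \<in> linear_isos (coord_space 16) (m4_alg :: ('a, 'a m4) module)"
  proof (rule linear_isosI[of _ _ _ "\<lambda>X. vec 16 (\<lambda>k. mat_of X $$ (k div 4, k mod 4))"])
    show "(\<lambda>x. of_fun4 (\<lambda>i j. x $ (4 * i + j))) \<in> LinearCombinations.module_hom class_ring (coord_space 16) m4_alg"
      by (rule module_homI) (simp_all add: coord_space_simps of_fun4_def M4_simps)
    fix x :: "'a vec" assume "x \<in> carrier (coord_space 16)"
    thus "vec 16 (\<lambda>k. mat_of (of_fun4 (\<lambda>i j. x $ (4 * i + j))) $$ (k div 4, k mod 4)) = x"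
      by (intro eq_vecI) (auto simp: coord_space_simps mat_of_of_fun4 less_mult_imp_div_less)
  next
    fix X :: "'a m4"
    have "of_fun4 (\<lambda>i j. vec 16 (\<lambda>k. mat_of X $$ (k div 4, k mod 4)) $ (4 * i + j)) = of_fun4 (\<lambda>i j. mat_of X $$ (i, j))"
      unfolding of_fun4_def by (simp, simp add: numeral_2_eq_2)
    thus "of_fun4 (\<lambda>i j. vec 16 (\<lambda>k. mat_of X $$ (k div 4, k mod 4)) $ (4 * i + j)) = X"
      using of_fun4_mat_of[of X] by (rule trans)
  qed (simp_all add: coord_space_simps)
  from coord_iso_dim[OF m4_alg_vs this]
  show "vectorspace.fin_dim class_ring (m4_alg :: ('a::field, 'a m4) module)"
    "vectorspace.dim class_ring (m4_alg :: ('a::field, 'a m4) module) = 16" .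
qed

section \<open>Central simple algebras represented in the matrix algebra\<close>

locale alg_rep =
  fixes A :: "('a::field, 'b) module" and q :: "'b \<Rightarrow> 'a m4"
  assumes two: "(2::'a) \<noteq> 0" and cs: "central_simple A"
    and hom: "q \<in> LinearCombinations.module_hom class_ring A m4_alg"
    and mult: "\<And>x y. x \<in> carrier A \<Longrightarrow> y \<in> carrier A \<Longrightarrow> q (x \<otimes>\<^bsub>A\<^esub> y) = q x * q y"
    and one: "q \<one>\<^bsub>A\<^esub> = 1"
begin

lemma alg: "fin_dim_algebra A" using cs by (simp add: central_simple_def)

lemma vs: "vectorspace class_ring A" and fd: "vectorspace.fin_dim class_ring A" and ring: "ring A"
  using alg by (simp_all add: fin_dim_algebra_def)

interpretation R: ring A by (rule ring)

lemmas q_lin = module_homD[OF hom, unfolded m4_alg_simps]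

lemma q_zero: "q \<zero>\<^bsub>A\<^esub> = 0"
  using module_hom_zero[OF vs m4_alg_vs hom] by simp

lemma q_minus: "x \<in> carrier A \<Longrightarrow> q (\<ominus>\<^bsub>A\<^esub> x) = - q x"
  using q_lin(2)[of x "\<ominus>\<^bsub>A\<^esub> x"] R.r_neg[of x] q_zero by (simp add: eq_neg_iff_add_eq_0 add.commute)

lemma ideal_preimage:
  assumes 0: "0 \<in> I" and add: "\<And>X Y. X \<in> I \<Longrightarrow> Y \<in> I \<Longrightarrow> X + Y \<in> I"
    and mul: "\<And>X Y. X \<in> I \<Longrightarrow> Y \<in> q ` carrier A \<Longrightarrow> X * Y \<in> I \<and> Y * X \<in> I"
  shows "ideal {a \<in> carrier A. q a \<in> I} A"
proof (rule idealI[OF ring])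
  have neg: "- q x \<in> I" if "x \<in> carrier A" "q x \<in> I" for x
  proof -
    have "- 1 \<in> q ` carrier A" using q_minus[OF R.one_closed] one R.a_inv_closed[OF R.one_closed] by (metis image_eqI)
    from mul[OF that(2) this] show ?thesis by simp
  qed
  show "subgroup {a \<in> carrier A. q a \<in> I} (add_monoid A)"
    by (rule subgroup.intro) (auto simp: q_lin q_zero 0 add neg q_minus a_inv_def[symmetric])
  fix a x assume a: "a \<in> {a \<in> carrier A. q a \<in> I}" and x: "x \<in> carrier A"
  show "x \<otimes>\<^bsub>A\<^esub> a \<in> {a \<in> carrier A. q a \<in> I}" "a \<otimes>\<^bsub>A\<^esub> x \<in> {a \<in> carrier A. q a \<in> I}"
    using mul[of "q a" "q x"] a x by (simp_all add: mult)
qed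

lemma ideal_cases: "ideal I A \<Longrightarrow> I = {\<zero>\<^bsub>A\<^esub>} \<or> I = carrier A"
  using cs by (simp add: central_simple_def)

text \<open>The kernel is an ideal that does not contain 1, hence 0 by simplicity.\<close>

lemma q_inj: "inj_on q (carrier A)"
proof (rule inj_onI)
  fix x y assume xy: "x \<in> carrier A" "y \<in> carrier A" "q x = q y"
  have i: "ideal {a \<in> carrier A. q a \<in> {0}} A" by (rule ideal_preimage) auto
  have "\<one>\<^bsub>A\<^esub> \<notin> {a \<in> carrier A. q a \<in> {0}}" using one by simp
  hence "{a \<in> carrier A. q a \<in> {0}} = {\<zero>\<^bsub>A\<^esub>}" using ideal_cases[OF i] R.one_closed by blast
  moreover have "q (x \<ominus>\<^bsub>A\<^esub> y) = 0" using xy by (simp add: R.minus_eq q_lin q_minus)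
  ultimately have "x \<ominus>\<^bsub>A\<^esub> y = \<zero>\<^bsub>A\<^esub>" using xy(1,2) R.minus_closed by blast
  moreover have "x = (x \<ominus>\<^bsub>A\<^esub> y) \<oplus>\<^bsub>A\<^esub> y" using xy(1,2) by (simp add: R.minus_eq R.a_assoc R.l_neg)
  ultimately show "x = y" using xy(2) by simp
qed

lemma center_scalar:
  assumes "x \<in> carrier A" "\<And>y. y \<in> carrier A \<Longrightarrow> q x * q y = q y * q x"
  shows "\<exists>c. q x = c *s 1"
proof -
  have "x \<otimes>\<^bsub>A\<^esub> y = y \<otimes>\<^bsub>A\<^esub> x" if y: "y \<in> carrier A" for y
    using assms y by (intro inj_onD[OF q_inj]) (simp_all add: mult)
  hence "x \<in> {z \<in> carrier A. \<forall>x\<in>carrier A. z \<otimes>\<^bsub>A\<^esub> x = x \<otimes>\<^bsub>A\<^esub> z}" using assms(1) by blast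
  hence "x \<in> {c \<odot>\<^bsub>A\<^esub> \<one>\<^bsub>A\<^esub> | c. True}" using cs unfolding central_simple_def by blast
  then obtain c where "x = c \<odot>\<^bsub>A\<^esub> \<one>\<^bsub>A\<^esub>" by blast
  thus ?thesis using one by (auto simp: q_lin)
qed

text \<open>In a plane spanned by \<open>E 0\<close> and \<open>E 1\<close>, the unit is a
  combination of the two, which makes them commute; the whole algebra would be its own centre,
  although the centre is a line. This dimension is excluded directly because
  \<open>alg_degree\<close> is unspecified when the dimension is not a square, so that a bound on it
  does not rule out \<open>16 = 2 * 8\<close>.\<close>

lemma dim_not_2: "vectorspace.dim class_ring A \<noteq> 2"
proof
  assume "vectorspace.dim class_ring A = 2"
  then obtain \<phi> where \<phi>: "\<phi> \<in> linear_isos (coord_space 2) A" using ex_coord_iso[OF vs fd] by auto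
  note P = linear_isosD[OF \<phi>, unfolded coord_space_simps]
  define E where "E k = q (\<phi> (unit_vec 2 k))" for k
  have lin: "\<exists>a b. q x = a *s E 0 + b *s E 1" if x: "x \<in> carrier A" for x
  proof -
    obtain v where v: "v \<in> carrier_vec 2" "x = \<phi> v" using P(7) x by blast
    have "v = (v $ 0) \<cdot>\<^sub>v unit_vec 2 0 + (v $ 1) \<cdot>\<^sub>v unit_vec 2 1"
      using v(1) by (intro eq_vecI) (auto simp: less_2_cases_iff)
    hence "q x = q (\<phi> ((v $ 0) \<cdot>\<^sub>v unit_vec 2 0 + (v $ 1) \<cdot>\<^sub>v unit_vec 2 1))" using v(2) by simp
    also have "\<dots> = (v $ 0) *s E 0 + (v $ 1) *s E 1" unfolding E_def by (simp add: P(3-5) q_lin vs_smult_closed[OF vs])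
    finally show ?thesis by blast
  qed
  obtain w0 w1 where w: "1 = w0 *s E 0 + w1 *s E 1" using lin[OF R.one_closed] one by auto
  have "(w0 *s E 0 + w1 *s E 1) * E k = E k * (w0 *s E 0 + w1 *s E 1)" for k unfolding w[symmetric] by simp
  from this[of 0] this[of 1] have "w1 *s (E 1 * E 0) = w1 *s (E 0 * E 1)" "w0 *s (E 0 * E 1) = w0 *s (E 1 * E 0)"
    by (simp_all add: distrib_left distrib_right)
  moreover have "w0 \<noteq> 0 \<or> w1 \<noteq> 0" using w by auto
  ultimately have c: "E 1 * E 0 = E 0 * E 1" using smul_cancel by metis
  have "q x * q y = q y * q x" if xy: "x \<in> carrier A" "y \<in> carrier A" for x y
  proof -
    obtain a b a' b' where "q x = a *s E 0 + b *s E 1" "q y = a' *s E 0 + b' *s E 1" using lin xy by metis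
    thus ?thesis by (simp add: distrib_left distrib_right c[simplified] smul_distrib(1) mult.commute add_ac)
  qed
  hence s: "\<exists>c. q x = c *s 1" if "x \<in> carrier A" for x using center_scalar that by blast
  obtain c0 c1 where c01: "E 0 = c0 *s 1" "E 1 = c1 *s 1" using s P(3) unfolding E_def by (metis unit_vec_carrier)
  have "q (\<phi> (c1 \<cdot>\<^sub>v unit_vec 2 0)) = q (\<phi> (c0 \<cdot>\<^sub>v unit_vec 2 1))"
    using c01 by (simp add: P(3,5) q_lin E_def[symmetric] mult.commute)
  hence "\<phi> (c1 \<cdot>\<^sub>v unit_vec 2 0) = \<phi> (c0 \<cdot>\<^sub>v unit_vec 2 1)" by (rule inj_onD[OF q_inj]) (simp_all add: P(3))
  hence e: "c1 \<cdot>\<^sub>v unit_vec 2 0 = c0 \<cdot>\<^sub>v unit_vec 2 1" by (rule inj_onD[OF P(6)]) simp_all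
  have "c1 = 0" using arg_cong[OF e, of "\<lambda>v. v $ 0"] by simp
  moreover have "c0 = 0" using arg_cong[OF e, of "\<lambda>v. v $ 1"] by simp
  ultimately show False using w c01 by simp
qed

lemma csa4:
  assumes "vectorspace.dim class_ring A = 4"
  obtains Q where "csa4 Q" "Q ` carrier_vec 4 = q ` carrier A"
proof -
  obtain \<phi> where \<phi>: "\<phi> \<in> linear_isos (coord_space 4) A" using ex_coord_iso[OF vs fd] assms by auto
  note P = linear_isosD[OF \<phi>, unfolded coord_space_simps]
  define Q where "Q v = q (\<phi> v)" for v
  have im: "Q ` carrier_vec 4 = q ` carrier A" unfolding Q_def using P(7) by (metis image_image)
  have "csa4 Q"
  proof
    show "Q \<in> LinearCombinations.module_hom class_ring (coord_space 4) m4_alg"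
      by (rule module_homI) (simp_all add: coord_space_simps Q_def P(3-5) q_lin)
    show "inj_on Q (carrier_vec 4)"
      unfolding Q_def using P(3,6) q_inj by (auto simp: inj_on_def)
    show "1 \<in> Q ` carrier_vec 4" unfolding im using one R.one_closed by (metis image_eqI)
    show "X * Y \<in> Q ` carrier_vec 4" if "X \<in> Q ` carrier_vec 4" "Y \<in> Q ` carrier_vec 4" for X Y
      using that unfolding im by (auto simp: mult[symmetric])
    show "\<exists>c. X = c *s 1" if "X \<in> Q ` carrier_vec 4" "\<And>Y. Y \<in> Q ` carrier_vec 4 \<Longrightarrow> X * Y = Y * X" for X
      using that center_scalar unfolding im by auto
    fix I X assume I: "I \<subseteq> Q ` carrier_vec 4" "\<And>X Y. X \<in> I \<Longrightarrow> Y \<in> I \<Longrightarrow> X + Y \<in> I"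
      "\<And>X Y. X \<in> I \<Longrightarrow> Y \<in> Q ` carrier_vec 4 \<Longrightarrow> X * Y \<in> I \<and> Y * X \<in> I" and X: "X \<in> I" "X \<noteq> 0"
    obtain a where a: "a \<in> carrier A" "X = q a" using I(1) X(1) unfolding im by blast
    have "X * q \<zero>\<^bsub>A\<^esub> \<in> I" using I(3)[OF X(1), unfolded im] R.zero_closed by blast
    hence i: "ideal {a \<in> carrier A. q a \<in> I} A"
      using ideal_preimage[of I] I(2) I(3)[unfolded im] by (simp add: q_zero)
    have "a \<in> {a \<in> carrier A. q a \<in> I}" "a \<noteq> \<zero>\<^bsub>A\<^esub>" using a X q_zero by auto
    hence "{a \<in> carrier A. q a \<in> I} = carrier A" using ideal_cases[OF i] by blast
    hence "\<one>\<^bsub>A\<^esub> \<in> {a \<in> carrier A. q a \<in> I}" using R.one_closed by (simp only:)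
    thus "1 \<in> I" using one by simp
  qed (rule two)
  thus thesis using that im by blast
qed

end

lemma degree_dim_not_1:
  assumes "alg_degree A \<ge> 2"
  shows "vectorspace.dim class_ring A \<noteq> 1"
proof
  assume d: "vectorspace.dim class_ring A = 1"
  have "alg_degree A = 1" unfolding alg_degree_def d by (rule the_equality) (auto simp: power2_eq_square)
  thus False using assms by simp
qed

text \<open>The tensor factors become commuting subalgebras of the matrix algebra, stable under the
  anti-automorphism \<open>?\<sigma>\<close>. In each of them Skolem-Noether carries a pair of
  quaternion generators to its image under \<open>- ?\<sigma>\<close>; the intertwiners
  \<open>s1\<close>, \<open>s2\<close> make all four generators skew for
  \<open>M s1 s2\<close>.\<close>

lemma decomposable_alg_imp_biquat:
  fixes M :: "'a::field m4"
  assumes 2: "(2::'a) \<noteq> 0" and Mi: "Mi * M = 1" and D: "decomposable_alg m4_alg (\<lambda>X. Mi * tr4 X * M)"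
  shows "biquat_decomposable M"
proof -
  let ?\<sigma> = "\<lambda>X. Mi * tr4 X * M"
  obtain A1 A2 :: "('a, 'a vec) module" and \<sigma>1 \<sigma>2 h where
    A1: "central_simple A1" "anti_automorphism A1 \<sigma>1" "alg_degree A1 \<ge> 2"
    and A2: "central_simple A2" "anti_automorphism A2 \<sigma>2" "alg_degree A2 \<ge> 2"
    and h: "h \<in> ring_iso m4_alg (tensor_alg A1 A2)" "h \<in> linear_isos m4_alg (tensor_alg A1 A2)"
    and h\<sigma>: "\<And>X. h (?\<sigma> X) = tensor_map A1 \<sigma>1 A2 \<sigma>2 (h X)"
    using D unfolding decomposable_alg_def isomorphic_with_anti_def by auto
  have fa: "fin_dim_algebra A1" "fin_dim_algebra A2" using A1 A2 by (simp_all add: central_simple_def)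
  hence vs: "vectorspace class_ring A1" "vectorspace class_ring A2"
    and fd: "vectorspace.fin_dim class_ring A1" "vectorspace.fin_dim class_ring A2" by (simp_all add: fin_dim_algebra_def)
  interpret T: tensor_algs A1 A2
    by (intro tensor_algs.intro tensor_pair.intro tensor_algs_axioms.intro vs fa)
  note o1 = T.mult_bilinear[OF fa(1)] and o2 = T.mult_bilinear[OF fa(2)]
  note H = linear_isosD[OF h(2), unfolded T.TA_simps m4_alg_simps]
  have hT: "h \<in> linear_isos m4_alg T.T"
    unfolding linear_isos_def using H by (auto intro!: module_homI)
  define g where "g = inv_into UNIV h"
  have g: "g \<in> linear_isos T.T m4_alg" using linear_isos_inv_into[OF m4_alg_vs hT] by (simp add: g_def)
  note G = linear_isosD[OF g, unfolded m4_alg_simps]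
  have hg: "h (g X) = X" if "X \<in> carrier T.T" for X using H(2) that by (simp add: g_def bij_betw_def f_inv_into_f)
  have gh: "g (h X) = X" for X using H(6) by (simp add: g_def)
  have hm: "h (X * Y) = h X \<otimes>\<^bsub>T.TA\<^esub> h Y" "h 1 = T.pt \<one>\<^bsub>A1\<^esub> \<one>\<^bsub>A2\<^esub>" for X Y
    using h(1) ring_hom_mult[of h m4_alg T.TA X Y] ring_hom_one[of h m4_alg T.TA] by (simp_all add: ring_iso_def)
  note mc = bilinear_mapD(1)[OF T.TA_mult(1)]
  have gm: "g (X \<otimes>\<^bsub>T.TA\<^esub> Y) = g X * g Y" if "X \<in> carrier T.T" "Y \<in> carrier T.T" for X Y
    using gh[of "g X * g Y"] hm(1)[of "g X" "g Y"] hg that by simp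
  have pc: "x \<in> carrier A1 \<Longrightarrow> y \<in> carrier A2 \<Longrightarrow> T.pt x y \<in> carrier T.T" for x y by (rule T.pt_closed)
  define q1 where "q1 a = g (T.pt a \<one>\<^bsub>A2\<^esub>)" for a
  define q2 where "q2 b = g (T.pt \<one>\<^bsub>A1\<^esub> b)" for b
  note PB = bilinear_mapD[OF T.pt_bilinear]
  have one: "q1 \<one>\<^bsub>A1\<^esub> = 1" "q2 \<one>\<^bsub>A2\<^esub> = 1" unfolding q1_def q2_def hm(2)[symmetric] gh by simp_all
  interpret R1: alg_rep A1 q1
  proof
    show "q1 \<in> LinearCombinations.module_hom class_ring A1 m4_alg"
      by (rule module_homI) (simp_all add: q1_def PB o2(3) G(4,5) pc)
    show "q1 (x \<otimes>\<^bsub>A1\<^esub> y) = q1 x * q1 y" if "x \<in> carrier A1" "y \<in> carrier A1" for x y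
      unfolding q1_def using that by (simp add: gm[symmetric] pc o2 T.TA_mult(2))
  qed (rule 2 A1 one)+
  interpret R2: alg_rep A2 q2
  proof
    show "q2 \<in> LinearCombinations.module_hom class_ring A2 m4_alg"
      by (rule module_homI) (simp_all add: q2_def PB o1(3) G(4,5) pc)
    show "q2 (x \<otimes>\<^bsub>A2\<^esub> y) = q2 x * q2 y" if "x \<in> carrier A2" "y \<in> carrier A2" for x y
      unfolding q2_def using that by (simp add: gm[symmetric] pc o1 T.TA_mult(2))
  qed (rule 2 A2 one)+
  have "vectorspace.dim class_ring A1 * vectorspace.dim class_ring A2 = 16"
    using linear_isos_dim(2)[OF m4_alg_vs T.tensor_vs hT m4_alg_dim(1)] T.tensor_dim(2)[OF fd] m4_alg_dim(2) by simp
  moreover have "m = 4 \<and> n = 4" if "m * n = 16" "m \<noteq> 1" "n \<noteq> 1" "m \<noteq> 2" "n \<noteq> 2" for m n :: nat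
  proof -
    have "m \<noteq> 0" "n \<noteq> 0" using that(1) by (metis mult_0 mult_0_right zero_neq_numeral)+
    hence "m \<ge> 3" "n \<ge> 3" using that by auto
    hence "m * 3 \<le> 16" using mult_le_mono2[of 3 n m] that(1) by simp
    hence "m = 3 \<or> m = 4 \<or> m = 5" using \<open>m \<ge> 3\<close> by auto
    thus ?thesis using that(1) by (elim disjE; simp; presburger)
  qed
  ultimately have d: "vectorspace.dim class_ring A1 = 4" "vectorspace.dim class_ring A2 = 4"
    using R1.dim_not_2 R2.dim_not_2 degree_dim_not_1[OF A1(3)] degree_dim_not_1[OF A2(3)] by blast+
  obtain Q1 Q2 where Q: "csa4 Q1" "Q1 ` carrier_vec 4 = q1 ` carrier A1" "csa4 Q2" "Q2 ` carrier_vec 4 = q2 ` carrier A2"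
    using R1.csa4[OF d(1)] R2.csa4[OF d(2)] by metis
  interpret C1: csa4 Q1 by (rule Q(1))
  interpret C2: csa4 Q2 by (rule Q(3))
  note S1 = A1(2)[unfolded anti_automorphism_def] and S2 = A2(2)[unfolded anti_automorphism_def]
  have s: "\<sigma>1 x \<in> carrier A1" "\<sigma>2 y \<in> carrier A2" if "x \<in> carrier A1" "y \<in> carrier A2" for x y
    by (rule linear_isosD(3)[OF conjunct1[OF S1] that(1)], rule linear_isosD(3)[OF conjunct1[OF S2] that(2)])
  note TM = T.tensor_map_facts(2)[OF linear_isosD(1)[OF conjunct1[OF S1]] linear_isosD(1)[OF conjunct1[OF S2]]]
  have st1: "?\<sigma> X \<in> Q1 ` carrier_vec 4" if X: "X \<in> Q1 ` carrier_vec 4" for X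
  proof -
    obtain x where x: "x \<in> carrier A1" "X = q1 x" using X unfolding Q(2) by (elim imageE)
    have "h (?\<sigma> X) = T.pt (\<sigma>1 x) \<one>\<^bsub>A2\<^esub>" unfolding h\<sigma> x(2) q1_def hg[OF pc[OF x(1) o2(3)]] TM[OF x(1) o2(3)] using S2 by simp
    hence "?\<sigma> X = q1 (\<sigma>1 x)" unfolding q1_def using gh[of "?\<sigma> X"] by simp
    thus ?thesis unfolding Q(2) by (rule image_eqI[OF _ s(1)[OF x(1) o2(3)]])
  qed
  have st2: "?\<sigma> X \<in> Q2 ` carrier_vec 4" if X: "X \<in> Q2 ` carrier_vec 4" for X
  proof -
    obtain x where x: "x \<in> carrier A2" "X = q2 x" using X unfolding Q(4) by (elim imageE)
    have "h (?\<sigma> X) = T.pt \<one>\<^bsub>A1\<^esub> (\<sigma>2 x)" unfolding h\<sigma> x(2) q2_def hg[OF pc[OF o1(3) x(1)]] TM[OF o1(3) x(1)] using S1 by simp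
    hence "?\<sigma> X = q2 (\<sigma>2 x)" unfolding q2_def using gh[of "?\<sigma> X"] by simp
    thus ?thesis unfolding Q(4) by (rule image_eqI[OF _ s(2)[OF o1(3) x(1)]])
  qed
  have comm: "X * Y = Y * X" if XY: "X \<in> Q1 ` carrier_vec 4" "Y \<in> Q2 ` carrier_vec 4" for X Y
  proof -
    obtain x where x: "x \<in> carrier A1" "X = q1 x" using XY(1) unfolding Q(2) by (elim imageE)
    obtain y where y: "y \<in> carrier A2" "Y = q2 y" using XY(2) unfolding Q(4) by (elim imageE)
    show ?thesis unfolding x(2) y(2) q1_def q2_def
      using x(1) y(1) by (simp add: gm[symmetric] pc o1 o2 T.TA_mult(2))
  qed
  have MMi: "M * Mi = 1" using right_inverse4(2)[OF Mi] .
  have anti: "?\<sigma> (X * Y) = ?\<sigma> Y * ?\<sigma> X" for X Y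
  proof -
    have "?\<sigma> Y * ?\<sigma> X = Mi * tr4 Y * (M * Mi) * tr4 X * M" by (simp only: mult.assoc)
    thus ?thesis using MMi by (simp add: mult.assoc)
  qed
  \<comment> \<open>Reversing the order of a product respects \<open>j i = - i j\<close>, and the
    sign disappears in squares and products.\<close>
  have gens: "quat_gens \<alpha> \<beta> (- ?\<sigma> i) (- ?\<sigma> j)" if q: "quat_gens \<alpha> \<beta> i j" for \<alpha> \<beta> i j
  proof -
    note q' = quat_gensD[OF q]
    have "?\<sigma> i * ?\<sigma> i = \<alpha> *s 1" "?\<sigma> j * ?\<sigma> j = \<beta> *s 1" unfolding anti[symmetric] q'(3,4) by (simp_all add: Mi)
    moreover have "?\<sigma> j * ?\<sigma> i = - (?\<sigma> i * ?\<sigma> j)" unfolding anti[symmetric] q'(5) by simp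
    ultimately show ?thesis unfolding quat_gens_def using q'(1,2) by (simp only: minus_mult_minus) simp
  qed
  obtain \<alpha>1 \<beta>1 i1 j1 where g1: "quat_gens \<alpha>1 \<beta>1 i1 j1" "i1 \<in> C1.B" "j1 \<in> C1.B" by (rule C1.ex_quat_gens)
  obtain \<alpha>2 \<beta>2 i2 j2 where g2: "quat_gens \<alpha>2 \<beta>2 i2 j2" "i2 \<in> C2.B" "j2 \<in> C2.B" by (rule C2.ex_quat_gens)
  obtain s1 where s1: "s1 \<in> C1.B" "det4 s1 \<noteq> 0" "- ?\<sigma> i1 * s1 = s1 * i1" "- ?\<sigma> j1 * s1 = s1 * j1"
    by (rule C1.skolem_noether[OF g1 gens[OF g1(1)] C1.minus_mem(1)[OF st1[OF g1(2)]] C1.minus_mem(1)[OF st1[OF g1(3)]]])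
  obtain s2 where s2: "s2 \<in> C2.B" "det4 s2 \<noteq> 0" "- ?\<sigma> i2 * s2 = s2 * i2" "- ?\<sigma> j2 * s2 = s2 * j2"
    by (rule C2.skolem_noether[OF g2 gens[OF g2(1)] C2.minus_mem(1)[OF st2[OF g2(2)]] C2.minus_mem(1)[OF st2[OF g2(3)]]])
  have B: "biquat \<alpha>1 \<beta>1 i1 j1 \<alpha>2 \<beta>2 i2 j2"
    unfolding biquat_def using g1 g2 comm[OF g1(2) g2(2)] comm[OF g1(2) g2(3)] comm[OF g1(3) g2(2)] comm[OF g1(3) g2(3)] by metis
  have M\<sigma>: "tr4 e * M = M * ?\<sigma> e" for e
  proof -
    have "M * ?\<sigma> e = M * Mi * tr4 e * M" by (simp only: mult.assoc)
    thus ?thesis using MMi by simp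
  qed
  have sk1: "tr4 e * (M * s1 * s2) = - (M * s1 * s2 * e)" if e: "- ?\<sigma> e * s1 = s1 * e" "e \<in> C1.B" for e
  proof -
    have "tr4 e * (M * s1 * s2) = tr4 e * M * s1 * s2" by (simp only: mult.assoc)
    also have "\<dots> = - (M * (- ?\<sigma> e * s1) * s2)" unfolding M\<sigma> by (simp add: mult.assoc)
    also have "\<dots> = - (M * s1 * (e * s2))" unfolding e(1) by (simp only: mult.assoc)
    finally show ?thesis unfolding comm[OF e(2) s2(1)] by (simp only: mult.assoc)
  qed
  have sk2: "tr4 e * (M * s1 * s2) = - (M * s1 * s2 * e)" if e: "- ?\<sigma> e * s2 = s2 * e" "e \<in> C2.B" for e
  proof -
    have "tr4 e * (M * s1 * s2) = tr4 e * M * s1 * s2" by (simp only: mult.assoc)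
    also have "\<dots> = M * (?\<sigma> e * s1) * s2" unfolding M\<sigma> by (simp only: mult.assoc)
    also have "\<dots> = M * (s1 * ?\<sigma> e) * s2" unfolding comm[OF s1(1) st2[OF e(2)]] ..
    also have "\<dots> = - (M * s1 * (- ?\<sigma> e * s2))" by (simp add: mult.assoc)
    finally show ?thesis unfolding e(1) by (simp only: mult.assoc)
  qed
  obtain x0 x1 x2 x3 where x: "s1 = quat i1 j1 x0 x1 x2 x3" by (rule C1.quat_span[OF g1 s1(1)])
  obtain y0 y1 y2 y3 where y: "s2 = quat i2 j2 y0 y1 y2 y3" by (rule C2.quat_span[OF g2 s2(1)])
  have "det4 (s1 * s2) \<noteq> 0" using s1(2) s2(2) by simp
  moreover have "\<forall>e\<in>{i1, j1, i2, j2}. tr4 e * (M * s1 * s2) = - (M * s1 * s2 * e)"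
    using sk1[OF s1(3) g1(2)] sk1[OF s1(4) g1(3)] sk2[OF s2(3) g2(2)] sk2[OF s2(4) g2(3)] by blast
  ultimately show ?thesis unfolding biquat_decomposable_def using B x y by blast
qed

theorem theorem4p12:
  fixes V' :: "('a :: field, 'v) module" and b' :: "'v \<Rightarrow> 'v \<Rightarrow> 'a"
  assumes "CHAR('a) \<noteq> 2"
    and "bilinear_space V' b'"
    and "nondegenerate V' b'"
    and "vectorspace.dim class_ring V' = 4"
  shows "decomposable_alg (endo_alg V') (adjoint_anti V' b') \<longleftrightarrow>
    has_decomposable_asymmetry V' b' \<and> det_class V' b' = \<one>\<^bsub>square_class_group\<^esub>"
proof -
  have 2: "(2::'a) \<noteq> 0"
  proof
    assume "(2::'a) = 0"
    hence "CHAR('a) dvd 2" using of_nat_eq_0_iff_char_dvd[of 2, where 'a = 'a] by simp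
    hence "CHAR('a) = 1" using assms(1) by (metis two_is_prime_nat prime_nat_iff)
    thus False by simp
  qed
  have vs: "vectorspace class_ring V'" and fd: "vectorspace.fin_dim class_ring V'" and b: "bilinear_form V' b'"
    using assms(2) by (simp_all add: bilinear_space_def)
  obtain \<phi> where \<phi>: "\<phi> \<in> linear_isos (coord_space 4) V'" using ex_coord_iso[OF vs fd] assms(4) by auto
  interpret coord4 V' \<phi> by (rule coord4.intro[OF vs \<phi>])
  let ?M = "form_on b' \<phi>"
  have d: "det4 ?M \<noteq> 0" using nondegenerate_iff[OF b] assms(3) by simp
  obtain Mi where Mi: "Mi * ?M = 1" using det4_inverse[OF d] by metis
  have "decomposable_alg (endo_alg V') (adjoint_anti V' b') \<longleftrightarrow> biquat_decomposable ?M"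
    unfolding decomposable_alg_matrix[OF b Mi]
    using decomposable_alg_imp_biquat[OF 2 Mi] biquat_imp_decomposable_alg[OF 2 Mi] by blast
  also have "\<dots> \<longleftrightarrow> kron_decomposable ?M \<and> (\<exists>m. det4 ?M = m\<^sup>2)"
    using biquat_imp_kron[OF 2 d] kron_imp_biquat[OF 2] d by (metis zero_power2)
  finally show ?thesis
    unfolding has_decomposable_asymmetry_iff[OF 2 b assms(3)] det_class_trivial_iff[OF b assms(3)] .
qed

end
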